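(* Let $n\ge2$ and let $F:\mathbb{B}^{n+1}\to\mathbb{B}^{2n+1}$ be a nonlinear proper holomorphic map which is $C^{n+1}$ up to the boundary. Then $F$ is equivalent, up to automorphisms of the unit balls $\mathbb{B}^{n+1}$ and $\mathbb{B}^{2n+1}$, to the Whitney map $$W_n(z^0,z^i)=\big((z^0)^2,\;z^0z^i,\;z^i\big),\qquad 1\le i\le n;$$ that is, $F=\tau\circ W_n\circ\sigma$ for some holomorphic automorphisms $\sigma$ of $\mathbb{B}^{n+1}$ and $\tau$ of $\mathbb{B}^{2n+1}$.
   Context: $\mathbb{B}^{k}\subset\mathbb{C}^{k}$ is the open unit ball; $(z^0,z^i)$, $1\le i\le n$, are the coordinates of $\mathbb{C}^{n+1}$, and $W_n$ takes values in $\mathbb{C}^{1+n+n}=\mathbb{C}^{2n+1}$. A proper holomorphic map between the balls is called linear if it is equivalent, up to automorphisms of the two balls, to the standard linear embedding $z\mapsto(z,0)$ (equivalently, its boundary map is a part of a linear embedding of spheres), and nonlinear otherwise. *)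

theory Defs
  imports "HOL-Analysis.Analysis"
begin

(* C^k is "complex ^ 'm" with CARD('m) = k, with its Euclidean (Hermitian) norm, so that the open
   unit ball is "ball 0 1".  The real derivative has to be linear for the complex scalar
   multiplication *s. *)

definition holomorphic_map_on ::
    "(complex ^ 'a \<Rightarrow> complex ^ 'b) \<Rightarrow> (complex ^ 'a) set \<Rightarrow> bool" where
  "holomorphic_map_on f S \<longleftrightarrow>
     (\<forall>z\<in>S. \<exists>L. Vector_Spaces.linear (*s) (*s) L \<and> (f has_derivative L) (at z within S))"

(* For open S: f is k times continuously differentiable on S in the real sense, and f and all its
   partial derivatives of order at most k extend continuously to the closure of S.  Basis consists
   of the real coordinate directions, i.e. both "axis i 1" and "axis i \<i>" for complex ^ 'm. *)

fun C_up_to_boundary ::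
    "nat \<Rightarrow> 'a::euclidean_space set \<Rightarrow> ('a \<Rightarrow> 'b::real_normed_vector) \<Rightarrow> bool" where
  "C_up_to_boundary 0 S f \<longleftrightarrow>
     (\<exists>g. continuous_on (closure S) g \<and> (\<forall>x\<in>S. g x = f x))"
| "C_up_to_boundary (Suc k) S f \<longleftrightarrow>
     C_up_to_boundary 0 S f \<and> f differentiable_on S \<and>
     (\<forall>b\<in>Basis. C_up_to_boundary k S (\<lambda>x. frechet_derivative f (at x) b))"

definition ball_automorphism :: "(complex ^ 'a \<Rightarrow> complex ^ 'a) \<Rightarrow> bool" where
  "ball_automorphism f \<longleftrightarrow>
     bij_betw f (ball 0 1) (ball 0 1) \<and>
     holomorphic_map_on f (ball 0 1) \<and>
     holomorphic_map_on (inv_into (ball 0 1) f) (ball 0 1)"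

(* Functions are total in HOL, so maps between balls are compared on the ball only. *)

definition ball_equivalent ::
    "(complex ^ 'a \<Rightarrow> complex ^ 'b) \<Rightarrow> (complex ^ 'a \<Rightarrow> complex ^ 'b) \<Rightarrow> bool" where
  "ball_equivalent f g \<longleftrightarrow>
     (\<exists>\<sigma> \<tau>. ball_automorphism \<sigma> \<and> ball_automorphism \<tau> \<and>
        (\<forall>z\<in>ball 0 1. f z = \<tau> (g (\<sigma> z))))"

definition standard_embedding ::
    "complex ^ 'a::finite \<Rightarrow> complex ^ ('a + 'b::finite)" where
  "standard_embedding z = (\<chi> j. case j of Inl i \<Rightarrow> z $ i | Inr i \<Rightarrow> 0)"

definition linear_ball_map :: "(complex ^ 'a::finite \<Rightarrow> complex ^ ('a + 'b::finite)) \<Rightarrow> bool" where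
  "linear_ball_map f \<longleftrightarrow> ball_equivalent f standard_embedding"

(* With n = CARD('n), the coordinate z^0 of C^(n+1) has index None and z^i has index Some i.
   C^(2n+1) is C^(n+1) followed by C^n. *)

definition whitney_map ::
    "complex ^ ('n::finite option) \<Rightarrow> complex ^ ('n option + 'n)" where
  "whitney_map z =
     (\<chi> j. case j of
        Inl None \<Rightarrow> (z $ None)\<^sup>2
      | Inl (Some i) \<Rightarrow> z $ None * z $ Some i
      | Inr i \<Rightarrow> z $ Some i)"

end

theory Submission imports Defs "HOL-Complex_Analysis.Conformal_Mappings" begin

text \<open>Let \<open>F\<close> be the map and \<open>K(z,w) = (1 - \<langle>F(z), F(w)\<rangle>) / (1 - \<langle>z, w\<rangle>)\<close>. The point is that this Hermitian kernel has
  rank at most two. Given that, normalise \<open>F(0) = 0\<close>; then \<open>K(z,w) = 1 + \<epsilon> g(z) cnj (g(w))\<close> with \<open>\<epsilon> \<in> {1, 0, -1}\<close>, where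
  \<open>\<epsilon> = -1\<close> is impossible, \<open>\<epsilon> = 0\<close> says that \<open>F\<close> is an isometry, and for \<open>\<epsilon> = 1\<close> a unitary change of coordinates identifies
  \<open>g\<close> with a linear fractional function and \<open>K\<close> with the kernel of the Whitney map.

  For the rank, expand \<open>|F|\<^sup>2 = 1\<close> along the circles of the sphere that shrink to a boundary point \<open>p\<close> in a tangential
  direction. This shows that the differential is conformal on the complex tangent space at \<open>p\<close>, and, the codimension being
  \<open>n\<close>, that the second fundamental form is \<open>2 \<langle>t, u\<rangle> U(t)\<close> modulo the differential. In particular it is asymptotic on a
  hyperplane, which is a polynomial identity in the jets. By the maximum principle on chords such an identity between
  tangential vectors at the sphere persists at \<open>z\<close> in the ball for vectors orthogonal to \<open>w\<close> whenever \<open>\<langle>z, w\<rangle> = 1\<close>. Hence a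
  functional \<open>X(z,w)\<close> that annihilates the tangential jets is, up to factors, constant for \<open>z\<close> in the hyperplane
  \<open>\<langle>\<cdot>, w\<rangle> = 1\<close>, and \<open>\<langle>F(z') - F(z), X(z,w)\<rangle> / \<langle>z' - z, w\<rangle>\<close> runs through a space of dimension two as \<open>w\<close> varies. For \<open>z = w = p\<close>
  on the sphere it is a multiple of \<open>K(z',p)\<close>, and comparing it with the same quotient for a fixed \<open>z\<close> puts all
  \<open>K(\<cdot>,p)\<close>, for \<open>p\<close> in an open part of the sphere, into one space of dimension two.\<close>

section \<open>Hermitian linear algebra\<close>

text \<open>The map is not known to extend holomorphically across the sphere, so
  \<open>hdot (F z) (F w) = 1\<close> on \<open>hdot z w = 1\<close> cannot be obtained by
  complexifying \<open>|F|^2 = 1\<close>. Only identities that are holomorphic in the jets can be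
  moved inwards, one chord at a time. Hence linear dependence is expressed by determinants and
  minors, and the antiholomorphic value at \<open>w\<close> is replaced by a functional
  \<open>X z w\<close> built from the jets at \<open>z\<close>. Keeping \<open>X z w\<close>
  parallel along a hyperplane means differentiating pairings with second derivatives once more, so
  jets of order three are needed; \<open>n \<ge> 2\<close> supplies them through the smoothness
  \<open>n + 1\<close>, and also supplies a vector orthogonal to two given ones. With
  \<open>CARD('a) = n + 1\<close> and \<open>CARD('b) = 2 n + 1\<close>, the range of the
  differential (dimension \<open>n + 1\<close>) and the second derivative paired with one vector
  \<open>u\<close> and a tangential one (dimension \<open>n\<close>) exactly fill the target at a
  nondegenerate point; the uniqueness of \<open>X z w\<close> rests on this count. Rank two is the
  value to expect: the Whitney map has \<open>K(z,w) = 1 + z^0 cnj (w^0)\<close>.\<close>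

abbreviation lin :: "(complex^'a \<Rightarrow> complex^'b) \<Rightarrow> bool" where
  "lin f \<equiv> Vector_Spaces.linear (*s) (*s) f"

definition hdot :: "complex^'n \<Rightarrow> complex^'n \<Rightarrow> complex" where
  "hdot x y = (\<Sum>i\<in>UNIV. x$i * cnj (y$i))"

lemma hdot_add [simp]: "hdot (x + y) z = hdot x z + hdot y z" "hdot z (x + y) = hdot z x + hdot z y"
  by (simp_all add: hdot_def algebra_simps sum.distrib)

lemma hdot_diff [simp]: "hdot (x - y) z = hdot x z - hdot y z" "hdot z (x - y) = hdot z x - hdot z y"
  by (simp_all add: hdot_def algebra_simps sum_subtractf)

lemma hdot_minus [simp]: "hdot (- x) z = - hdot x z" "hdot z (- x) = - hdot z x"
  by (simp_all add: hdot_def sum_negf)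

lemma hdot_scale [simp]: "hdot (c *s x) z = c * hdot x z" "hdot z (c *s x) = cnj c * hdot z x"
  by (simp_all add: hdot_def sum_distrib_left algebra_simps)

lemma hdot_zero [simp]: "hdot 0 z = 0" "hdot z 0 = 0"
  by (simp_all add: hdot_def)

lemma hdot_sum: "hdot (\<Sum>i\<in>A. f i) z = (\<Sum>i\<in>A. hdot (f i) z)" "hdot z (\<Sum>i\<in>A. f i) = (\<Sum>i\<in>A. hdot z (f i))"
  by (induction A rule: infinite_finite_induct) auto

lemma hdot_axis [simp]: "hdot x (axis i 1) = x $ i" "hdot (axis i 1) x = cnj (x $ i)"
  by (simp_all add: hdot_def axis_def if_distrib[of "\<lambda>a. _ * a"] if_distrib[of cnj] if_distrib[of "\<lambda>a. a * _"] cong: if_cong)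

lemma cnj_hdot: "cnj (hdot x y) = hdot y x"
  by (simp add: hdot_def mult.commute)

lemma hdot_self: "hdot x x = of_real ((norm x)\<^sup>2)"
  by (simp add: hdot_def norm_vec_def L2_set_def complex_norm_square[symmetric] sum_nonneg)

lemma hdot_self_Re: "Re (hdot x x) = (norm x)\<^sup>2"
  by (simp add: hdot_self)

lemma hdot_eq_0_iff [simp]: "hdot x x = 0 \<longleftrightarrow> x = 0"
  by (simp add: hdot_self)

lemma hdot_unit: "norm x = 1 \<Longrightarrow> hdot x x = 1"
  by (simp add: hdot_self)

lemma norm_smult: "norm (c *s x) = cmod c * norm (x :: complex^'n)"
  by (simp add: norm_vec_def norm_mult L2_set_right_distrib)

lemma hdot_0_sym: "hdot x y = 0 \<longleftrightarrow> hdot y x = 0"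
  by (metis cnj_hdot complex_cnj_zero)

lemma inner_eq_hdot: "x \<bullet> y = Re (hdot x y)"
  by (simp add: inner_vec_def hdot_def inner_complex_def)

lemma norm_add_sq: "(norm (x + y))\<^sup>2 = (norm x)\<^sup>2 + (norm y)\<^sup>2 + 2 * Re (hdot x y)"
  by (simp add: power2_norm_eq_inner inner_add inner_commute inner_eq_hdot[symmetric])

lemma norm_diff_sq: "(norm (x - y))\<^sup>2 = (norm x)\<^sup>2 + (norm y)\<^sup>2 - 2 * Re (hdot x y)"
  by (simp add: power2_norm_eq_inner inner_diff inner_commute inner_eq_hdot[symmetric])

lemma cmod_hdot_le: "cmod (hdot x y) \<le> norm x * norm y"
proof -
  \<comment> \<open>A unimodular factor makes the product real, which reduces the estimate to the
    real Cauchy-Schwarz inequality.\<close>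
  obtain c where c: "cmod c = 1" "c * hdot x y = of_real (cmod (hdot x y))"
  proof (cases "hdot x y = 0")
    case False
    let ?c = "of_real (cmod (hdot x y)) / hdot x y"
    have "cmod ?c = 1" "?c * hdot x y = of_real (cmod (hdot x y))" using False by (auto simp: norm_divide)
    then show ?thesis using that by blast
  qed (use that[of 1] in auto)
  have "cmod (hdot x y) = (c *s x) \<bullet> y" by (simp add: inner_eq_hdot c)
  also have "\<dots> \<le> norm (c *s x) * norm y" by (rule norm_cauchy_schwarz)
  finally show ?thesis by (simp add: norm_smult c)
qed

lemma continuous_on_hdot [continuous_intros]:
  "continuous_on S f \<Longrightarrow> continuous_on S g \<Longrightarrow> continuous_on S (\<lambda>x. hdot (f x) (g x))"
  unfolding hdot_def by (intro continuous_intros)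

lemma tendsto_hdot [tendsto_intros]:
  "(f \<longlongrightarrow> a) F \<Longrightarrow> (g \<longlongrightarrow> b) F \<Longrightarrow> ((\<lambda>x. hdot (f x) (g x)) \<longlongrightarrow> hdot a b) F"
  unfolding hdot_def by (intro tendsto_intros)

lemma continuous_on_smult [continuous_intros]:
  fixes g :: "'x::topological_space \<Rightarrow> complex^'n"
  shows "continuous_on S f \<Longrightarrow> continuous_on S g \<Longrightarrow> continuous_on S (\<lambda>x. f x *s g x)"
  unfolding vector_scalar_mult_def by (intro continuous_intros)

lemma tendsto_smult [tendsto_intros]:
  fixes g :: "'x \<Rightarrow> complex^'n"
  shows "(f \<longlongrightarrow> a) F \<Longrightarrow> (g \<longlongrightarrow> b) F \<Longrightarrow> ((\<lambda>x. f x *s g x) \<longlongrightarrow> a *s b) F"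
  unfolding vector_scalar_mult_def by (intro tendsto_intros)

lemma of_real_smult: "of_real r *s x = r *\<^sub>R (x :: complex^'n)"
  unfolding vec_eq_iff vector_smult_component vector_scaleR_component by (simp add: scaleR_conv_of_real)

section \<open>Complex linear maps and dimension counts\<close>

lemma linI:
  assumes "\<And>x y. f (x + y) = f x + f y" "\<And>c x. f (c *s x) = c *s f x"
  shows "lin f"
  using assms by (auto simp: Vector_Spaces.linear_iff vec.vector_space_axioms)

lemma lin_add: "lin f \<Longrightarrow> f (x + y) = f x + f y"
  and lin_scale: "lin f \<Longrightarrow> f (c *s x) = c *s f x"
  and lin_diff: "lin f \<Longrightarrow> f (x - y) = f x - f y"
  and lin_0: "lin f \<Longrightarrow> f 0 = 0"
  and lin_neg: "lin f \<Longrightarrow> f (- x) = - f x"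
  and lin_sum: "lin f \<Longrightarrow> f (\<Sum>i\<in>A. g i) = (\<Sum>i\<in>A. f (g i))"
  by (simp_all add: vec.linear_add vec.linear_scale vec.linear_diff vec.linear_0 vec.linear_neg vec.linear_sum)

lemma vec_expand: "(x::complex^'n) = (\<Sum>i\<in>UNIV. x $ i *s axis i 1)"
  by (rule basis_expansion[symmetric])

lemma lin_expand: "lin f \<Longrightarrow> f x = (\<Sum>i\<in>UNIV. x $ i *s f (axis i 1))"
  by (subst vec_expand[of x]) (simp add: lin_sum lin_scale)

text \<open>Riesz representation in coordinates. Later functionals are found by annihilation
  conditions and must become vectors before they can enter \<open>D4\<close> or be compared.\<close>

lemma functional_hdot:
  assumes "\<And>x y. f (x + y) = f x + f y" "\<And>c x. f (c *s x) = c * f x"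
  shows "\<exists>\<xi>::complex^'n. \<forall>x. f x = hdot x \<xi>"
proof -
  have f0: "f 0 = 0" using assms(2)[of 0 0] by simp
  have s: "f (\<Sum>i\<in>A. g i) = (\<Sum>i\<in>A. f (g i))" for A :: "'n set" and g
    by (induction A rule: infinite_finite_induct) (auto simp: assms f0)
  have "f x = hdot x (\<chi> i. cnj (f (axis i 1)))" for x
    by (subst vec_expand[of x]) (simp add: s assms hdot_def)
  then show ?thesis by blast
qed

lemma hdot_ext: "(\<And>x. hdot x a = hdot x b) \<Longrightarrow> a = b"
  by (metis hdot_eq_0_iff hdot_diff(2) eq_iff_diff_eq_0)

text \<open>Dimension counts are run on index types: too many independent vectors are packed into
  one injective map between coordinate spaces.\<close>

lemma lin_inj_card_le:
  fixes f :: "complex^'c \<Rightarrow> complex^'d"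
  assumes "lin f" "\<And>x. f x = 0 \<Longrightarrow> x = 0"
  shows "CARD('c) \<le> CARD('d)"
proof -
  have i: "inj f" using assms vec.linear_inj_iff_eq_0 by blast
  have "vec.dim (f ` UNIV) = vec.dim (UNIV :: (complex^'c) set)"
    using vec.dim_image_eq[OF assms(1), of UNIV] i by (simp add: inj_on_subset)
  moreover have "vec.dim (f ` UNIV) \<le> vec.dim (UNIV :: (complex^'d) set)"
    by (rule vec.dim_subset) simp
  ultimately show ?thesis by (metis vec_dim_card)
qed

lemma lin_inj_surj:
  fixes f :: "complex^'c \<Rightarrow> complex^'d"
  assumes "lin f" "\<And>x. f x = 0 \<Longrightarrow> x = 0" "CARD('c) = CARD('d)"
  shows "\<exists>x. f x = y"
proof -
  have "inj f" using assms vec.linear_inj_iff_eq_0 by blast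
  then have "surj f" using vec.linear_injective_imp_surjective[OF assms(1)] assms(3) by (metis vec_dim_card)
  then show ?thesis by (metis surj_def)
qed

lemma lin_surj_inj:
  fixes f :: "complex^'c \<Rightarrow> complex^'d"
  assumes "lin f" "surj f" "CARD('c) = CARD('d)" "f x = 0"
  shows "x = 0"
proof -
  have "inj f" using vec.linear_surjective_imp_injective[OF assms(1,2)] assms(3) by (metis vec_dim_card)
  then show ?thesis using assms(1,4) vec.linear_inj_iff_eq_0 by blast
qed

text \<open>Coordinates of a direct sum, indexed by a sum type, so that a pair of vectors can be fed
  to the cardinality lemmas.\<close>

definition fsv :: "complex^('a::finite+'b::finite) \<Rightarrow> complex^'a" where "fsv x = (\<chi> i. x $ Inl i)"
definition snv :: "complex^('a::finite+'b::finite) \<Rightarrow> complex^'b" where "snv x = (\<chi> i. x $ Inr i)"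
definition prv :: "complex^'a \<Rightarrow> complex^'b \<Rightarrow> complex^('a::finite+'b::finite)" where
  "prv x y = (\<chi> j. case j of Inl i \<Rightarrow> x $ i | Inr i \<Rightarrow> y $ i)"

lemma fsv_prv [simp]: "fsv (prv x y) = x" and snv_prv [simp]: "snv (prv x y) = y"
  by (auto simp: vec_eq_iff fsv_def snv_def prv_def split: sum.split)

lemma prv_fsv_snv [simp]: "prv (fsv x) (snv x) = x"
  by (auto simp: vec_eq_iff fsv_def snv_def prv_def split: sum.split)

lemma fsv_lin [simp]: "fsv (x + y) = fsv x + fsv y" "fsv (c *s x) = c *s fsv x"
  and snv_lin [simp]: "snv (x + y) = snv x + snv y" "snv (c *s x) = c *s snv x"
  and prv_eq_0: "x = 0 \<longleftrightarrow> fsv x = 0 \<and> snv x = 0"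
  by (auto simp: vec_eq_iff fsv_def snv_def) (metis sum.exhaust)

lemma sum_UNIV_sum: "(\<Sum>j\<in>(UNIV::('a::finite+'b::finite) set). f j) = (\<Sum>i\<in>UNIV. f (Inl i)) + (\<Sum>i\<in>UNIV. f (Inr i))"
  using sum.Plus[of "UNIV :: 'a set" "UNIV :: 'b set" f] by (simp add: UNIV_Plus_UNIV)

lemma hdot_prv [simp]: "hdot (prv x y) (prv x' y') = hdot x x' + hdot y y'"
  by (simp add: hdot_def sum_UNIV_sum prv_def)

text \<open>Used to polarise identities that are only known on the diagonal.\<close>

lemma coeff_20_eq_0:
  fixes c00 c01 c02 c10 c11 c12 c20 c21 c22 :: complex
  assumes P: "\<And>l. c00 + c01 * cnj l + c02 * (cnj l * cnj l) + c10 * l + c11 * (l * cnj l) + c12 * (l * cnj l * cnj l)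
     + c20 * (l * l) + c21 * (l * l * cnj l) + c22 * (l * l * (cnj l * cnj l)) = 0"
  shows "c20 = 0"
proof -
  have "c00 + c01 + c02 + c10 + c11 + c12 + c20 + c21 + c22 = 0" using P[of 1] by simp
  moreover have "c00 - c01 + c02 - c10 + c11 - c12 + c20 - c21 + c22 = 0" using P[of "-1"] by simp
  moreover have "c00 - c01 * \<i> - c02 + c10 * \<i> + c11 - c12 * \<i> - c20 + c21 * \<i> + c22 = 0"
    using P[of \<i>] by (simp add: algebra_simps)
  moreover have "c00 + c01 * \<i> - c02 - c10 * \<i> + c11 + c12 * \<i> - c20 - c21 * \<i> + c22 = 0"
    using P[of "-\<i>"] by (simp add: algebra_simps)
  ultimately have 1: "4 * (c20 + c02) = 0" by algebra
  \<comment> \<open>At the fourth roots of unity the squares of \<open>l\<close> and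
    \<open>cnj l\<close> coincide, so those four points only control \<open>c20 + c02\<close>. The
    points \<open>1 + \<i>\<close>, \<open>1 - \<i>\<close> and their negatives have squares
    \<open>2 * \<i>\<close> and \<open>- 2 * \<i>\<close>, which separates the two
    coefficients.\<close>
  define p q where "p = 1 + \<i>" and "q = 1 - \<i>"
  have pq: "p * p = 2 * \<i>" "q * q = -2 * \<i>" "p * q = 2" "q * p = 2" "cnj p = q" "cnj q = p"
    by (simp_all add: p_def q_def algebra_simps)
  have a: "c00 + c01 * q + c02 * (q * q) + c10 * p + c11 * (p * q) + c12 * (p * q * q) + c20 * (p * p) + c21 * (p * p * q)
     + c22 * (p * p * (q * q)) = 0" using P[of p] pq by metis
  have b: "c00 - c01 * q + c02 * (q * q) - c10 * p + c11 * (p * q) - c12 * (p * q * q) + c20 * (p * p) - c21 * (p * p * q)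
     + c22 * (p * p * (q * q)) = 0" using P[of "-p"] unfolding complex_cnj_minus pq(5) by (simp only: minus_mult_minus mult_minus_left mult_minus_right minus_minus diff_conv_add_uminus)
  have c: "c00 + c01 * p + c02 * (p * p) + c10 * q + c11 * (q * p) + c12 * (q * p * p) + c20 * (q * q) + c21 * (q * q * p)
     + c22 * (q * q * (p * p)) = 0" using P[of q] pq by metis
  have d: "c00 - c01 * p + c02 * (p * p) - c10 * q + c11 * (q * p) - c12 * (q * p * p) + c20 * (q * q) - c21 * (q * q * p)
     + c22 * (q * q * (p * p)) = 0" using P[of "-q"] unfolding complex_cnj_minus pq(6) by (simp only: minus_mult_minus mult_minus_left mult_minus_right minus_minus diff_conv_add_uminus)
  have "2 * (c20 - c02) * (p * p - q * q) = 0" using a b c d by algebra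
  then have "c20 = c02" by (simp add: pq)
  with 1 show ?thesis by simp
qed

section \<open>Jets of a map between balls\<close>

text \<open>Holomorphy is tested on complex lines only, because every use of it restricts to a chord
  of the ball.\<close>

definition lhol :: "(complex^'a \<Rightarrow> complex) \<Rightarrow> bool" where
  "lhol f \<longleftrightarrow> (\<forall>z d. (\<lambda>t. f (z + t *s d)) holomorphic_on {t. z + t *s d \<in> ball 0 1})"

lemma lholD: "lhol f \<Longrightarrow> (\<lambda>t. f (z + t *s d)) holomorphic_on {t. z + t *s d \<in> ball 0 1}"
  by (simp add: lhol_def)

lemma continuous_on_line: "continuous_on S (\<lambda>t. z + t *s (d :: complex^'n))"
  by (intro continuous_intros)

lemma open_line: "open {t. z + t *s (d :: complex^'n) \<in> ball 0 1}"
  by (rule continuous_open_preimage[OF continuous_on_line[of UNIV], simplified vimage_def, simplified]) auto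

lemma line_shift: "z + t *s d + s *s d = z + (s + t) *s (d::complex^'n)"
  by (simp add: vec_eq_iff algebra_simps)

lemma line_deriv:
  fixes f :: "complex^'a \<Rightarrow> complex"
  assumes "\<And>z. z \<in> ball 0 1 \<Longrightarrow> ((\<lambda>t. f (z + t *s d)) has_field_derivative D z) (at 0)"
    and t: "z + t *s d \<in> ball 0 1"
  shows "((\<lambda>t. f (z + t *s d)) has_field_derivative D (z + t *s d)) (at t)"
proof -
  have "((\<lambda>s. f (z + (s + t) *s d)) has_field_derivative D (z + t *s d)) (at 0)"
    using assms(1)[OF t] unfolding line_shift .
  then have "((\<lambda>s. f (z + s *s d)) has_field_derivative D (z + t *s d)) (at (0 + t))"
    unfolding DERIV_shift .
  then show ?thesis by simp
qed

lemma line_holomorphic: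
  fixes h :: "complex^'a \<Rightarrow> complex"
  assumes "\<And>z. z \<in> ball 0 1 \<Longrightarrow> ((\<lambda>t. h (z + t *s d)) has_field_derivative D z) (at 0)"
  shows "(\<lambda>t. h (z + t *s d)) holomorphic_on {t. z + t *s d \<in> ball 0 1}"
  unfolding holomorphic_on_open[OF open_line] using line_deriv[where D = D, OF assms] by blast

lemma lholI:
  fixes f :: "complex^'a \<Rightarrow> complex"
  assumes "\<And>z d. z \<in> ball 0 1 \<Longrightarrow> \<exists>D. ((\<lambda>t. f (z + t *s d)) has_field_derivative D) (at 0)"
  shows "lhol f"
  unfolding lhol_def
proof (intro allI)
  fix z d
  have "\<exists>D. \<forall>z\<in>ball 0 1. ((\<lambda>t. f (z + t *s d)) has_field_derivative D z) (at 0)" by (rule bchoice) (use assms in blast)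
  then show "(\<lambda>t. f (z + t *s d)) holomorphic_on {t. z + t *s d \<in> ball 0 1}" using line_holomorphic[of f d] by blast
qed

text \<open>The parameters of the chord form a bounded open set whose frontier is mapped to the
  sphere, so the maximum modulus principle applies with the boundary bound 0.\<close>

lemma chord_maximum_principle:
  fixes z d :: "complex^'a"
  assumes hol: "g holomorphic_on {t. z + t *s d \<in> ball 0 1}" and cont: "continuous_on {t. z + t *s d \<in> cball 0 1} g"
    and d: "d \<noteq> 0" and z: "z \<in> ball 0 1" and bd: "\<And>t. norm (z + t *s d) = 1 \<Longrightarrow> g t = 0"
  shows "g 0 = 0"
proof -
  define S where "S = {t. z + t *s d \<in> ball 0 1}"
  have oS: "open S" unfolding S_def by (rule open_line)
  have "closed {t. z + t *s d \<in> cball 0 1}"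
    using continuous_closed_preimage[OF continuous_on_line[of UNIV z d], of "cball 0 1"] by (simp add: vimage_def)
  moreover have "S \<subseteq> {t. z + t *s d \<in> cball 0 1}" by (auto simp: S_def)
  ultimately have clS: "closure S \<subseteq> {t. z + t *s d \<in> cball 0 1}" by (rule closure_minimal[rotated])
  have bS: "bounded S"
    unfolding bounded_iff
  proof (intro exI ballI)
    fix t assume "t \<in> S"
    then have "norm (z + t *s d) < 1" by (simp add: S_def)
    moreover have "norm (t *s d) \<le> norm (z + t *s d) + norm z"
      using norm_triangle_ineq4[of "z + t *s d" z] by simp
    ultimately have "cmod t * norm d \<le> 2" using z by (simp add: norm_smult)
    then show "cmod t \<le> 2 / norm d" using d by (simp add: field_simps)
  qed
  have g0: "cmod (g t) \<le> 0" if "t \<in> frontier S" for t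
  proof -
    have "t \<in> closure S" "t \<notin> S" using that oS by (auto simp: frontier_def interior_open)
    then have "norm (z + t *s d) = 1" using clS by (auto simp: S_def)
    then show ?thesis using bd by simp
  qed
  have hg: "g holomorphic_on interior S" unfolding interior_open[OF oS] unfolding S_def by (rule hol)
  have 0: "0 \<in> S" using z by (simp add: S_def)
  have "cmod (g 0) \<le> 0" by (rule maximum_modulus_frontier[OF hg continuous_on_subset[OF cont clS] bS g0 0])
  then show ?thesis by simp
qed

text \<open>A chord of the ball in the direction of the reflected point \<open>w\<close>, along which a vector orthogonal to
  \<open>w\<close> can be moved affinely so that it becomes tangent to the sphere at both ends of the chord.\<close>

lemma max_principle_tangential:
  fixes \<Phi> :: "complex^'a \<Rightarrow> ('i \<Rightarrow> complex^'a) \<Rightarrow> complex"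
  assumes hol: "\<And>z d v e. (\<lambda>t. \<Phi> (z + t *s d) (\<lambda>i. v i + t *s e i)) holomorphic_on {t. z + t *s d \<in> ball 0 1}"
    and cont: "\<And>z d v e. continuous_on {t. z + t *s d \<in> cball 0 1} (\<lambda>t. \<Phi> (z + t *s d) (\<lambda>i. v i + t *s e i))"
    and bd: "\<And>p v. norm p = 1 \<Longrightarrow> (\<And>i. hdot (v i) p = 0) \<Longrightarrow> \<Phi> p v = 0"
    and z: "z \<in> cball 0 1" and zw: "hdot z w = 1" and vw: "\<And>i. hdot (v i) w = 0"
  shows "\<Phi> z v = 0"
proof -
  have int: "\<Phi> z v = 0" if z: "z \<in> ball 0 1" and zw: "hdot z w = 1" and vw: "\<And>i. hdot (v i) w = 0" for z w v
  proof -
    define d where "d = w - z"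
    define \<delta> where "\<delta> = 1 - (norm z)\<^sup>2"
    have nz: "norm z < 1" using z by simp
    have \<delta>: "\<delta> > 0" unfolding \<delta>_def using nz by (simp add: power_less_one_iff)
    have wz: "hdot w z = 1" using zw cnj_hdot[of z w] by simp
    have dz: "hdot d z = of_real \<delta>" by (simp add: d_def wz \<delta>_def hdot_self)
    have zd: "hdot z d = of_real \<delta>" using cnj_hdot[of d z] dz by simp
    have d0: "d \<noteq> 0" using dz \<delta> by auto
    \<comment> \<open>The slope is forced by tangency. Since \<open>v i\<close> is orthogonal to
      \<open>w\<close>, its product with \<open>d\<close> is minus its product with
      \<open>z\<close>; where \<open>z + t *s d\<close> has norm 1, the identity \<open>eq\<close>
      below makes this slope cancel the product of \<open>v i + t *s e i\<close> with
      \<open>z + t *s d\<close>.\<close>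
    define e where "e = (\<lambda>i. (- (hdot (v i) z) / of_real \<delta>) *s d)"
    define g where "g = (\<lambda>t. \<Phi> (z + t *s d) (\<lambda>i. v i + t *s e i))"
    have g0: "g t = 0" if n1: "norm (z + t *s d) = 1" for t
    proof -
      have e1: "hdot (z + t *s d) (z + t *s d) = 1" by (rule hdot_unit[OF n1])
      have hz: "hdot z z = 1 - of_real \<delta>" by (simp add: \<delta>_def hdot_self)
      have eq: "of_real \<delta> = t * of_real \<delta> + cnj t * of_real \<delta> + t * cnj t * hdot d d"
        using e1 by (simp add: dz zd hz algebra_simps)
      have "hdot (v i + t *s e i) (z + t *s d) = 0" for i
      proof -
        have vd: "hdot (v i) d = - hdot (v i) z" by (simp add: d_def vw)
        have "hdot (v i + t *s e i) (z + t *s d) = hdot (v i) z * (1 - cnj t)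
           + (- (hdot (v i) z) / of_real \<delta>) * (t * of_real \<delta> + t * cnj t * hdot d d)"
          by (simp add: e_def vd dz algebra_simps add_divide_distrib)
        also have "t * of_real \<delta> + t * cnj t * hdot d d = of_real \<delta> * (1 - cnj t)"
          using eq by (simp add: algebra_simps)
        finally show ?thesis using \<delta> by simp
      qed
      then show ?thesis unfolding g_def by (intro bd n1)
    qed
    have "g 0 = 0" by (rule chord_maximum_principle[OF _ _ d0 z g0]) (unfold g_def, rule hol, rule cont)
    then show ?thesis by (simp add: g_def)
  qed
  show ?thesis
  proof (cases "z \<in> ball 0 1")
    case False
    then have n1: "norm z = 1" using z by auto
    have "continuous_on {t. 0 + t *s z \<in> cball 0 1} (\<lambda>t. \<Phi> (0 + t *s z) (\<lambda>i. v i + t *s (\<lambda>_. 0) i))"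
      by (rule cont)
    then have c: "continuous_on {t. cmod t \<le> 1} (\<lambda>t. \<Phi> (t *s z) v)" using n1 by (simp add: norm_smult)
    \<comment> \<open>The pair \<open>r z\<close>, \<open>w / r\<close> satisfies the same two
      relations, so the interior case applies to it before \<open>r\<close> tends to 1.\<close>
    have "\<Phi> (of_real r *s z) v = 0" if r: "r \<in> {0<..<1}" for r :: real
      by (rule int[of _ "(1 / of_real r) *s w"]) (use r n1 zw vw in \<open>auto simp: norm_smult\<close>)
    moreover have "((\<lambda>r::real. \<Phi> (of_real r *s z) v) \<longlongrightarrow> \<Phi> (of_real 1 *s z) v) (at 1 within {0<..<1})"
    proof -
      have "continuous_on {0..1} (\<lambda>r::real. \<Phi> (of_real r *s z) v)"
        by (rule continuous_on_compose2[OF c]) (auto intro!: continuous_intros)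
      then have "((\<lambda>r::real. \<Phi> (of_real r *s z) v) \<longlongrightarrow> \<Phi> (of_real 1 *s z) v) (at 1 within {0..1})"
        unfolding continuous_on_def by (drule_tac x=1 in bspec) simp_all
      then show ?thesis by (rule tendsto_within_subset) auto
    qed
    ultimately have "((\<lambda>r::real. 0::complex) \<longlongrightarrow> \<Phi> (of_real 1 *s z) v) (at 1 within {0<..<1})"
      by (elim Lim_transform_within[OF _ zero_less_one]) auto
    moreover have "at (1::real) within {0<..<1} \<noteq> bot"
      by (simp add: at_within_eq_bot_iff)
    ultimately show ?thesis using tendsto_unique[OF _ _ tendsto_const] by fastforce
  qed (use int zw vw in blast)
qed

text \<open>The map with its partial derivatives up to order three. The derivative relations hold in
  the open ball only; on the sphere these functions are mere continuous limits and nothing may be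
  differentiated there. At top order \<open>h3\<close> keeps just holomorphy on lines, as no fourth
  derivative is recorded.\<close>

locale jets =
  fixes G0 :: "complex^'a \<Rightarrow> complex^'b"
    and G1 :: "'a \<Rightarrow> complex^'a \<Rightarrow> complex^'b"
    and G2 :: "'a \<Rightarrow> 'a \<Rightarrow> complex^'a \<Rightarrow> complex^'b"
    and G3 :: "'a \<Rightarrow> 'a \<Rightarrow> 'a \<Rightarrow> complex^'a \<Rightarrow> complex^'b"
  assumes c0: "continuous_on (cball 0 1) G0"
    and c1: "continuous_on (cball 0 1) (G1 i)"
    and c2: "continuous_on (cball 0 1) (G2 i j)"
    and c3: "continuous_on (cball 0 1) (G3 i j l)"
    and D0: "z \<in> ball 0 1 \<Longrightarrow> ((\<lambda>t. G0 (z + t *s d) $ k) has_field_derivative (\<Sum>i\<in>UNIV. d$i * G1 i z $ k)) (at 0)"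
    and D1: "z \<in> ball 0 1 \<Longrightarrow> ((\<lambda>t. G1 i (z + t *s d) $ k) has_field_derivative (\<Sum>j\<in>UNIV. d$j * G2 i j z $ k)) (at 0)"
    and D2: "z \<in> ball 0 1 \<Longrightarrow> ((\<lambda>t. G2 i j (z + t *s d) $ k) has_field_derivative (\<Sum>l\<in>UNIV. d$l * G3 i j l z $ k)) (at 0)"
    and h3: "lhol (\<lambda>z. G3 i j l z $ k)"
    and s2: "z \<in> ball 0 1 \<Longrightarrow> G2 i j z = G2 j i z"
    and s3: "z \<in> ball 0 1 \<Longrightarrow> G3 i j l z = G3 i l j z"
    and inside: "z \<in> ball 0 1 \<Longrightarrow> norm (G0 z) < 1"
    and bdry: "norm z = 1 \<Longrightarrow> norm (G0 z) = 1"
begin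

section \<open>Derivatives as multilinear forms: symmetry, continuity, holomorphy on lines\<close>

definition J1 :: "complex^'a \<Rightarrow> complex^'a \<Rightarrow> complex^'b" where
  "J1 z v = (\<Sum>i\<in>UNIV. v$i *s G1 i z)"
definition J2 :: "complex^'a \<Rightarrow> complex^'a \<Rightarrow> complex^'a \<Rightarrow> complex^'b" where
  "J2 z v w = (\<Sum>i\<in>UNIV. \<Sum>j\<in>UNIV. (v$i * w$j) *s G2 i j z)"
definition J3 :: "complex^'a \<Rightarrow> complex^'a \<Rightarrow> complex^'a \<Rightarrow> complex^'a \<Rightarrow> complex^'b" where
  "J3 z u v w = (\<Sum>i\<in>UNIV. \<Sum>j\<in>UNIV. \<Sum>l\<in>UNIV. (u$i * v$j * w$l) *s G3 i j l z)"

lemma J1_add [simp]: "J1 z (v + w) = J1 z v + J1 z w" and J1_scale [simp]: "J1 z (c *s v) = c *s J1 z v"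
  by (simp_all add: J1_def vec_eq_iff sum.distrib sum_distrib_left algebra_simps)
lemma lin_J1: "lin (J1 z)" by (rule linI) simp_all
lemma J1_diff [simp]: "J1 z (v - w) = J1 z v - J1 z w" and J1_0 [simp]: "J1 z 0 = 0" and J1_neg [simp]: "J1 z (- v) = - J1 z v"
  by (simp_all add: lin_diff[OF lin_J1] lin_0[OF lin_J1] lin_neg[OF lin_J1])

lemma J2_add [simp]: "J2 z (v + v') w = J2 z v w + J2 z v' w" "J2 z v (w + w') = J2 z v w + J2 z v w'"
  and J2_scale [simp]: "J2 z (c *s v) w = c *s J2 z v w" "J2 z v (c *s w) = c *s J2 z v w"
  by (simp_all add: J2_def vec_eq_iff sum.distrib sum_distrib_left algebra_simps)
lemma lin_J2: "lin (J2 z v)" "lin (\<lambda>v. J2 z v w)" by (rule linI; simp)+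
lemma J2_diff [simp]: "J2 z (v - v') w = J2 z v w - J2 z v' w" "J2 z v (w - w') = J2 z v w - J2 z v w'"
  and J2_0 [simp]: "J2 z 0 w = 0" "J2 z v 0 = 0"
  using lin_diff[OF lin_J2(2)] lin_diff[OF lin_J2(1)] lin_0[OF lin_J2(2)] lin_0[OF lin_J2(1)]
  by blast+

lemma J3_add [simp]: "J3 z (u + u') v w = J3 z u v w + J3 z u' v w" "J3 z u (v + v') w = J3 z u v w + J3 z u v' w"
    "J3 z u v (w + w') = J3 z u v w + J3 z u v w'"
  and J3_scale [simp]: "J3 z (c *s u) v w = c *s J3 z u v w" "J3 z u (c *s v) w = c *s J3 z u v w" "J3 z u v (c *s w) = c *s J3 z u v w"
  by (simp_all add: J3_def vec_eq_iff sum.distrib sum_distrib_left algebra_simps)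

lemma closure_eq_cball:
  fixes f g :: "complex^'a \<Rightarrow> complex^'b"
  assumes "continuous_on (cball 0 1) f" "continuous_on (cball 0 1) g" "\<And>z. z \<in> ball 0 1 \<Longrightarrow> f z = g z" "z \<in> cball 0 1"
  shows "f z = g z"
proof -
  have cl: "closed {x \<in> cball 0 1. f x - g x = 0}"
    by (intro continuous_closed_preimage_constant continuous_intros assms) auto
  have "ball 0 1 \<subseteq> {x \<in> cball 0 1. f x - g x = 0}" using assms(3) by (auto simp del: mem_ball_0 simp: mem_ball_imp_mem_cball)
  then have "closure (ball 0 1) \<subseteq> {x \<in> cball 0 1. f x - g x = 0}" by (rule closure_minimal[OF _ cl])
  then have "z \<in> {x \<in> cball 0 1. f x - g x = 0}" using assms(4) unfolding closure_ball[OF zero_less_one] by (rule subsetD)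
  then show ?thesis by simp
qed

lemma J2_sym: "z \<in> cball 0 1 \<Longrightarrow> J2 z v w = J2 z w v"
proof -
  assume z: "z \<in> cball 0 1"
  have "G2 i j z = G2 j i z" for i j by (rule closure_eq_cball[OF c2 c2 s2 z])
  then have "J2 z v w = (\<Sum>i\<in>UNIV. \<Sum>j\<in>UNIV. (w$j * v$i) *s G2 j i z)"
    by (simp add: J2_def mult.commute)
  also have "\<dots> = J2 z w v" unfolding J2_def by (rule sum.swap)
  finally show ?thesis .
qed

lemma G3_12: "z \<in> ball 0 1 \<Longrightarrow> G3 i j l z = G3 j i l z"
proof -
  assume z: "z \<in> ball 0 1"
  have "G3 i j l z $ k = G3 j i l z $ k" for k
  proof -
    have a: "((\<lambda>t. G2 i j (z + t *s axis l 1) $ k) has_field_derivative G3 i j l z $ k) (at 0)" for i j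
      using D2[OF z, of i j "axis l 1" k] by (simp add: axis_def if_distrib[of "\<lambda>a. a * _"] cong: if_cong)
    have "eventually (\<lambda>t. t \<in> {t. z + t *s axis l 1 \<in> ball 0 1}) (nhds (0::complex))"
      by (rule eventually_nhds_in_open[OF open_line]) (use z in simp)
    then have "eventually (\<lambda>t. G2 i j (z + t *s axis l 1) $ k = G2 j i (z + t *s axis l 1) $ k) (nhds 0)"
      by (rule eventually_mono) (use s2 in auto)
    from DERIV_cong_ev[THEN iffD1, OF refl this refl a] show ?thesis using a[of j i] by (rule DERIV_unique)
  qed
  then show ?thesis by (simp add: vec_eq_iff)
qed

lemma J3_sym: assumes z: "z \<in> cball 0 1" shows "J3 z u v w = J3 z u w v" "J3 z u v w = J3 z v u w"
proof -
  have "G3 i j l z = G3 i l j z" for i j l by (rule closure_eq_cball[OF c3 c3 s3 z])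
  then have "J3 z u v w = (\<Sum>i\<in>UNIV. \<Sum>j\<in>UNIV. \<Sum>l\<in>UNIV. (u$i * w$l * v$j) *s G3 i l j z)"
    by (simp add: J3_def mult_ac)
  also have "\<dots> = J3 z u w v" unfolding J3_def by (intro sum.cong refl sum.swap)
  finally show "J3 z u v w = J3 z u w v" .
  have "G3 i j l z = G3 j i l z" for i j l by (rule closure_eq_cball[OF c3 c3 G3_12 z])
  then have "J3 z u v w = (\<Sum>i\<in>UNIV. \<Sum>j\<in>UNIV. \<Sum>l\<in>UNIV. (v$j * u$i * w$l) *s G3 j i l z)"
    by (simp add: J3_def mult_ac)
  also have "\<dots> = J3 z v u w" unfolding J3_def by (rule sum.swap)
  finally show "J3 z u v w = J3 z v u w" .
qed

lemma contJ [continuous_intros]: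
  assumes "continuous_on S z" "\<And>x. x \<in> S \<Longrightarrow> z x \<in> cball 0 1"
  shows "continuous_on S (\<lambda>x. G0 (z x))"
    and "continuous_on S u \<Longrightarrow> continuous_on S (\<lambda>x. J1 (z x) (u x))"
    and "continuous_on S u \<Longrightarrow> continuous_on S v \<Longrightarrow> continuous_on S (\<lambda>x. J2 (z x) (u x) (v x))"
    and "continuous_on S u \<Longrightarrow> continuous_on S v \<Longrightarrow> continuous_on S w \<Longrightarrow> continuous_on S (\<lambda>x. J3 (z x) (u x) (v x) (w x))"
proof -
  have "z ` S \<subseteq> cball 0 1" using assms(2) by blast
  note c = continuous_on_compose2[OF _ assms(1) this]
  show "continuous_on S (\<lambda>x. G0 (z x))" by (rule c[OF c0])
  show "continuous_on S u \<Longrightarrow> continuous_on S (\<lambda>x. J1 (z x) (u x))"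
    unfolding J1_def by (intro continuous_intros c[OF c1])
  show "continuous_on S u \<Longrightarrow> continuous_on S v \<Longrightarrow> continuous_on S (\<lambda>x. J2 (z x) (u x) (v x))"
    unfolding J2_def by (intro continuous_intros c[OF c2])
  show "continuous_on S u \<Longrightarrow> continuous_on S v \<Longrightarrow> continuous_on S w \<Longrightarrow> continuous_on S (\<lambda>x. J3 (z x) (u x) (v x) (w x))"
    unfolding J3_def by (intro continuous_intros c[OF c3])
qed

lemma lholG: "lhol (\<lambda>z. G0 z $ k)" "lhol (\<lambda>z. G1 i z $ k)" "lhol (\<lambda>z. G2 i j z $ k)"
  by (rule lholI, blast intro: D0 D1 D2)+

lemma holJ [holomorphic_intros]:
  shows "(\<lambda>t. G0 (z + t *s d) $ k) holomorphic_on {t. z + t *s d \<in> ball 0 1}"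
    and "(\<lambda>t. J1 (z + t *s d) (u + t *s u') $ k) holomorphic_on {t. z + t *s d \<in> ball 0 1}"
    and "(\<lambda>t. J2 (z + t *s d) (u + t *s u') (v + t *s v') $ k) holomorphic_on {t. z + t *s d \<in> ball 0 1}"
    and "(\<lambda>t. J3 (z + t *s d) (u + t *s u') (v + t *s v') (w + t *s w') $ k) holomorphic_on {t. z + t *s d \<in> ball 0 1}"
  unfolding J1_def J2_def J3_def sum_component vector_smult_component vector_add_component
  by (intro holomorphic_intros lholD lholG h3)+

lemma derJ:
  assumes t: "z + t *s d \<in> ball 0 1"
  shows "((\<lambda>t. G0 (z + t *s d) $ k) has_field_derivative J1 (z + t *s d) d $ k) (at t)"
    and "((\<lambda>t. J1 (z + t *s d) v $ k) has_field_derivative J2 (z + t *s d) v d $ k) (at t)"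
    and "((\<lambda>t. J2 (z + t *s d) v w $ k) has_field_derivative J3 (z + t *s d) v w d $ k) (at t)"
proof -
  show "((\<lambda>t. G0 (z + t *s d) $ k) has_field_derivative J1 (z + t *s d) d $ k) (at t)"
    using line_deriv[of "\<lambda>z. G0 z $ k", OF D0 t] by (simp add: J1_def sum_component)
  note 1 = line_deriv[of "\<lambda>z. G1 _ z $ k", OF D1 t]
  show "((\<lambda>t. J1 (z + t *s d) v $ k) has_field_derivative J2 (z + t *s d) v d $ k) (at t)"
    unfolding J1_def J2_def sum_component vector_smult_component mult.assoc sum_distrib_left[symmetric]
    by (intro DERIV_sum DERIV_cmult 1)
  note 2 = line_deriv[of "\<lambda>z. G2 _ _ z $ k", OF D2 t]
  show "((\<lambda>t. J2 (z + t *s d) v w $ k) has_field_derivative J3 (z + t *s d) v w d $ k) (at t)"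
    unfolding J3_def J2_def sum_component vector_smult_component mult.assoc sum_distrib_left[symmetric]
    by (intro DERIV_sum DERIV_cmult 2)
qed

end

section \<open>Boundary identities on tangential circles\<close>

lemma has_integral_cnjI: "(f has_integral I) A \<Longrightarrow> ((\<lambda>x. cnj (f x)) has_integral cnj I) A"
  using has_integral_linear[OF _ bounded_linear_cnj] by (auto simp: o_def)

text \<open>Cauchy's formula at the centre; in the parameter of \<open>circlepath\<close> the factor
  \<open>2 pi i\<close> cancels against the velocity.\<close>

lemma circle_mean:
  assumes "g holomorphic_on ball 0 r" "continuous_on (cball 0 r) g" "0 < r"
  shows "((\<lambda>x. g (circlepath 0 r x)) has_integral g 0) {0..1}"
proof -
  have "((\<lambda>u. g u / (u - 0)) has_contour_integral (2 * of_real pi * \<i> * g 0)) (circlepath 0 r)"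
    by (rule Cauchy_integral_circlepath) (use assms in auto)
  then have "((\<lambda>x. g (circlepath 0 r x) / circlepath 0 r x * vector_derivative (circlepath 0 r) (at x within {0..1}))
      has_integral (2 * of_real pi * \<i> * g 0)) {0..1}"
    by (simp add: has_contour_integral_def)
  then have "((\<lambda>x. 2 * of_real pi * \<i> * g (circlepath 0 r x)) has_integral (2 * of_real pi * \<i> * g 0)) {0..1}"
  proof (rule has_integral_eq[rotated])
    fix x :: real assume x: "x \<in> {0..1}"
    have e: "circlepath 0 r x = of_real r * exp (2 * of_real pi * \<i> * of_real x)" by (simp add: circlepath)
    have "vector_derivative (circlepath 0 r) (at x within {0..1}) = 2 * of_real pi * \<i> * circlepath 0 r x"
      using vector_derivative_circlepath01[of x 0 r] x unfolding e by simp
    moreover have "circlepath 0 r x \<noteq> 0" using assms(3) unfolding e by simp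
    ultimately show "g (circlepath 0 r x) / circlepath 0 r x * vector_derivative (circlepath 0 r) (at x within {0..1}) =
      2 * of_real pi * \<i> * g (circlepath 0 r x)" by simp
  qed
  then have "((\<lambda>x. (1 / (2 * of_real pi * \<i>)) * (2 * of_real pi * \<i> * g (circlepath 0 r x))) has_integral
     (1 / (2 * of_real pi * \<i>)) * (2 * of_real pi * \<i> * g 0)) {0..1}"
    by (rule has_integral_mult_right)
  then show ?thesis by simp
qed

lemma circlepath_norm: "0 < r \<Longrightarrow> cmod (circlepath 0 r x) = r"
  by (simp add: circlepath norm_mult)

lemma circlepath_cnj: "0 < r \<Longrightarrow> circlepath 0 r x * cnj (circlepath 0 r x) = of_real (r\<^sup>2)"
  by (simp add: complex_norm_square[symmetric] circlepath_norm del: of_real_power)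

text \<open>Dividing by \<open>z ^ j\<close> leaves a removable singularity with value
  \<open>L\<close>, which the mean value property reads off. On the circle the division is undone by
  the conjugate power, at the price of \<open>r ^ (2*j)\<close>.\<close>

lemma circle_coeff:
  assumes h: "g holomorphic_on ball 0 r" "continuous_on (cball 0 r) g" "0 < r"
    and L: "((\<lambda>z. g z / z ^ j) \<longlongrightarrow> L) (at 0)"
  shows "((\<lambda>x. cnj (circlepath 0 r x) ^ j * g (circlepath 0 r x)) has_integral of_real (r ^ (2*j)) * L) {0..1}"
proof -
  define h where "h z = (if z = 0 then L else g z / z ^ j)" for z
  have c: "continuous_on (cball 0 r) h"
    unfolding continuous_on_eq_continuous_within
  proof
    fix z :: complex assume z: "z \<in> cball 0 r"
    show "continuous (at z within cball 0 r) h"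
    proof (cases "z = 0")
      case True
      have "(h \<longlongrightarrow> L) (at 0)" using L by (rule Lim_transform_eventually) (auto simp: h_def eventually_at_filter)
      then have "(h \<longlongrightarrow> h 0) (at 0)" by (simp add: h_def)
      then have "isCont h 0" by (simp add: isCont_def)
      then show ?thesis using True continuous_at_imp_continuous_at_within by blast
    next
      case False
      have "continuous (at z within cball 0 r) (\<lambda>z. g z / z ^ j)"
        using assms(2) z False by (intro continuous_intros) (auto simp: continuous_on_eq_continuous_within)
      then have "((\<lambda>z. g z / z ^ j) \<longlongrightarrow> g z / z ^ j) (at z within cball 0 r)"
        by (simp add: continuous_within)
      moreover have "eventually (\<lambda>w. g w / w ^ j = h w) (at z within cball 0 r)"
        using eventually_neq_at_within[of 0 z "cball 0 r"] by (rule eventually_mono) (simp add: h_def)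
      ultimately have "(h \<longlongrightarrow> g z / z ^ j) (at z within cball 0 r)" by (rule Lim_transform_eventually)
      then show ?thesis using False by (simp add: continuous_within h_def)
    qed
  qed
  have hh: "h holomorphic_on ball 0 r - {0}"
    by (rule holomorphic_transform[of "\<lambda>z. g z / z ^ j"])
       (auto simp: h_def intro!: holomorphic_intros holomorphic_on_subset[OF h(1)])
  have "continuous_on (ball 0 r) h" by (rule continuous_on_subset[OF c]) auto
  then have "h holomorphic_on ball 0 r" by (rule no_isolated_singularity[OF _ hh]) simp_all
  from has_integral_mult_right[OF circle_mean[OF this c h(3)], of "of_real (r ^ (2*j))"]
  have "((\<lambda>x. of_real (r ^ (2*j)) * h (circlepath 0 r x)) has_integral of_real (r ^ (2*j)) * L) {0..1}"
    by (simp add: h_def)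
  moreover have "of_real (r ^ (2*j)) * h (circlepath 0 r x) = cnj (circlepath 0 r x) ^ j * g (circlepath 0 r x)" for x
  proof -
    have n: "circlepath 0 r x \<noteq> 0" using circlepath_norm[OF h(3), of x] h(3) by auto
    have "of_real (r ^ (2*j)) = (circlepath 0 r x * cnj (circlepath 0 r x)) ^ j"
      by (simp add: circlepath_cnj[OF h(3)] power_mult)
    then show ?thesis using n by (simp add: h_def power_mult_distrib)
  qed
  ultimately show ?thesis by simp
qed

lemma circle_monomial:
  assumes "0 < r"
  shows "((\<lambda>x. circlepath 0 r x ^ a * cnj (circlepath 0 r x) ^ j) has_integral of_real (if a = j then r ^ (2*a) else 0)) {0..1}"
proof -
  have 1: "((\<lambda>x. circlepath 0 r x ^ (j + k) * cnj (circlepath 0 r x) ^ j) has_integral of_real (if k = 0 then r ^ (2*j) else 0)) {0..1}" for k j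
  proof -
    have "((\<lambda>x. cnj (circlepath 0 r x) ^ j * circlepath 0 r x ^ (j + k)) has_integral of_real (r ^ (2*j)) * (if k = 0 then 1 else 0)) {0..1}"
    proof (rule circle_coeff[OF _ _ assms])
      have "((\<lambda>z::complex. z ^ k) \<longlongrightarrow> 0 ^ k) (at 0)" by (intro tendsto_intros)
      then have "((\<lambda>z::complex. z ^ k) \<longlongrightarrow> (if k = 0 then 1 else 0)) (at 0)" by (simp add: power_0_left)
      then show "((\<lambda>z::complex. z ^ (j + k) / z ^ j) \<longlongrightarrow> (if k = 0 then 1 else 0)) (at 0)"
        by (rule Lim_transform_eventually) (auto simp: eventually_at_filter power_add)
    qed (intro holomorphic_intros continuous_intros)+
    then show ?thesis by (simp add: mult.commute if_distrib cong: if_cong)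
  qed
  show ?thesis
  proof (cases "j \<le> a")
    case True
    then obtain k where k: "a = j + k" using le_Suc_ex by blast
    show ?thesis unfolding k using 1[of j k] by (cases "k = 0") auto
  next
    case False
    then obtain k where k: "j = a + k" "k \<noteq> 0" by (metis add.right_neutral less_imp_le_nat linorder_not_le le_Suc_ex less_irrefl)
    have "((\<lambda>x. circlepath 0 r x ^ (a + k) * cnj (circlepath 0 r x) ^ a) has_integral 0) {0..1}"
      using 1[of a k] k(2) by simp
    then have "((\<lambda>x. cnj (circlepath 0 r x ^ (a + k) * cnj (circlepath 0 r x) ^ a)) has_integral cnj 0) {0..1}"
      by (rule has_integral_cnjI)
    then show ?thesis unfolding k(1) using k(2) by (simp add: mult.commute)
  qed
qed

text \<open>The Fourier mode \<open>k\<close> of a squared norm on the circle of radius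
  \<open>r\<close>. The polynomial part is computed by orthogonality of monomials. The cubic
  remainder enters through \<open>\<Psi> b\<close>, its coefficient of order \<open>b + k\<close>
  paired with \<open>F b\<close>, which vanishes up to order two; the conjugate mixed terms drop
  out, and the term quadratic in the remainder is only estimated.\<close>

lemma circle_modes:
  fixes E :: "complex \<Rightarrow> complex^'b" and F :: "nat \<Rightarrow> complex^'b"
  assumes r: "0 < r"
    and hol: "\<And>v. (\<lambda>z. hdot (E z) v) holomorphic_on ball 0 r"
    and cont: "continuous_on (cball 0 r) E"
    and bnd: "\<And>z. z \<in> ball 0 r \<Longrightarrow> norm (E z) \<le> C * cmod z ^ 3"
    and one: "\<And>z. cmod z = r \<Longrightarrow> norm (F 0 + z *s F 1 + z\<^sup>2 *s F 2 + E z) = 1"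
  obtains \<Psi> m where
    "of_real (if k = 0 then 1 else 0) = (\<Sum>a\<le>2. \<Sum>b\<le>2. hdot (F a) (F b) * of_real (if a = b + k then r ^ (2*a) else 0))
       + (\<Sum>b\<le>2. \<Psi> b) + m"
    "cmod m \<le> C\<^sup>2 * r ^ (6 + k)"
    "\<And>b. b + k \<le> 2 \<Longrightarrow> \<Psi> b = 0"
    "\<And>b. cmod (\<Psi> b) \<le> norm (F b) * C * r ^ (3 + b + k)"
    "\<And>b L. ((\<lambda>z. hdot (E z) (F b) / z ^ (b + k)) \<longlongrightarrow> L) (at 0) \<Longrightarrow> \<Psi> b = of_real (r ^ (2 * (b + k))) * L"
proof -
  let ?e = "circlepath 0 r"
  have C0: "0 \<le> C"
  proof -
    have "norm (E (of_real (r/2))) \<le> C * cmod (of_real (r/2)) ^ 3" by (rule bnd) (use r in simp)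
    then have "0 \<le> C * (r/2) ^ 3" using r by (simp del: power_divide) (meson norm_ge_zero order_trans)
    moreover have "0 < (r/2) ^ 3" using r by simp
    ultimately show ?thesis by (metis mult_neg_pos not_le)
  qed
  have bE: "norm (E z) \<le> C * r ^ 3" if "z \<in> cball 0 r" for z
  proof -
    have "z \<in> closure (ball 0 r)" using that r by simp
    then show ?thesis
    proof (rule continuous_on_closure_norm_le[rotated 2])
      show "continuous_on (closure (ball 0 r)) E" using cont r by simp
      show "\<forall>y\<in>ball 0 r. norm (E y) \<le> C * r ^ 3"
      proof
        fix y assume y: "y \<in> ball (0::complex) r"
        have "C * cmod y ^ 3 \<le> C * r ^ 3" using y C0 by (intro mult_left_mono power_mono) auto
        then show "norm (E y) \<le> C * r ^ 3" using bnd[OF y] by linarith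
      qed
    qed
  qed
  have eb: "?e x \<in> cball 0 r" for x using circlepath_norm[OF r, of x] by simp
  have ce: "continuous_on {0..1} ?e" by (metis path_circlepath path_def)
  have cEe: "continuous_on {0..1} (\<lambda>x. E (?e x))"
    by (rule continuous_on_compose2[OF cont ce]) (use eb in auto)
  have cE: "continuous_on (cball 0 r) (\<lambda>z. hdot (E z) v)" for v by (intro continuous_intros cont)
  define \<Psi> where "\<Psi> b = integral {0..1} (\<lambda>x. cnj (?e x) ^ (b + k) * hdot (E (?e x)) (F b))" for b
  define m where "m = integral {0..1} (\<lambda>x. cnj (?e x) ^ k * hdot (E (?e x)) (E (?e x)))"
  have I\<Psi>: "((\<lambda>x. cnj (?e x) ^ (b + k) * hdot (E (?e x)) (F b)) has_integral \<Psi> b) {0..1}" for b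
    unfolding \<Psi>_def by (intro integrable_integral integrable_continuous_interval continuous_intros cEe ce)
  have Im: "((\<lambda>x. cnj (?e x) ^ k * hdot (E (?e x)) (E (?e x))) has_integral m) {0..1}"
    unfolding m_def by (intro integrable_integral integrable_continuous_interval continuous_intros cEe ce)
  have lim0: "((\<lambda>z. hdot (E z) v / z ^ j) \<longlongrightarrow> 0) (at 0)" if "j \<le> 2" for j v
  proof (rule Lim_null_comparison)
    show "((\<lambda>z::complex. C * norm v * cmod z ^ (3 - j)) \<longlongrightarrow> 0) (at 0)"
      using that by (auto intro!: tendsto_eq_intros simp: power_0_left)
    have "norm (hdot (E z) v / z ^ j) \<le> C * norm v * cmod z ^ (3 - j)" if z: "z \<in> ball 0 r" "z \<noteq> 0" for z
    proof -
      have "cmod (hdot (E z) v) \<le> C * cmod z ^ 3 * norm v"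
        using cmod_hdot_le[of "E z" v] bnd[OF z(1)] by (meson mult_right_mono norm_ge_zero order_trans)
      also have "cmod z ^ 3 = cmod z ^ (3 - j) * cmod z ^ j" using \<open>j \<le> 2\<close> by (simp flip: power_add)
      finally show ?thesis using z by (simp add: norm_divide norm_power field_simps)
    qed
    then show "\<forall>\<^sub>F z in at 0. norm (hdot (E z) v / z ^ j) \<le> C * norm v * cmod z ^ (3 - j)"
      unfolding eventually_at using r by (intro exI[of _ r]) auto
  qed
  have L: "\<Psi> b = of_real (r ^ (2 * (b + k))) * L" if "((\<lambda>z. hdot (E z) (F b) / z ^ (b + k)) \<longlongrightarrow> L) (at 0)" for b L
    using circle_coeff[OF hol cE r that] I\<Psi>[of b] has_integral_unique by blast
  \<comment> \<open>After conjugation this is the coefficient of order \<open>a \<le> 2\<close> of a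
    function that vanishes to order at least three.\<close>
  have conj0: "((\<lambda>x. ?e x ^ a * cnj (?e x) ^ k * hdot (F a) (E (?e x))) has_integral 0) {0..1}" if "a \<le> 2" for a
  proof -
    have "((\<lambda>z. z ^ k * hdot (E z) (F a) / z ^ a) \<longlongrightarrow> 0 ^ k * 0) (at 0)"
      using tendsto_mult[OF _ lim0[OF that, of "F a"], of "\<lambda>z. z ^ k" "0 ^ k"] by (simp add: tendsto_intros)
    from circle_coeff[OF _ _ r this] have "((\<lambda>x. cnj (?e x) ^ a * (?e x ^ k * hdot (E (?e x)) (F a))) has_integral 0) {0..1}"
      by (simp add: holomorphic_intros hol continuous_intros cont)
    then have "((\<lambda>x. cnj (cnj (?e x) ^ a * (?e x ^ k * hdot (E (?e x)) (F a)))) has_integral cnj 0) {0..1}"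
      by (rule has_integral_cnjI)
    then show ?thesis by (simp add: cnj_hdot mult_ac)
  qed
  have tot: "((\<lambda>x. (\<Sum>a\<le>2. \<Sum>b\<le>2. hdot (F a) (F b) * (?e x ^ a * cnj (?e x) ^ (b + k)))
      + (\<Sum>b\<le>2. cnj (?e x) ^ (b + k) * hdot (E (?e x)) (F b))
      + (\<Sum>a\<le>2. ?e x ^ a * cnj (?e x) ^ k * hdot (F a) (E (?e x)))
      + cnj (?e x) ^ k * hdot (E (?e x)) (E (?e x))) has_integral
     (\<Sum>a\<le>2. \<Sum>b\<le>2. hdot (F a) (F b) * of_real (if a = b + k then r ^ (2*a) else 0)) + (\<Sum>b\<le>2. \<Psi> b) + (\<Sum>a\<le>(2::nat). 0) + m) {0..1}"
    by (intro has_integral_add has_integral_sum has_integral_mult_right circle_monomial r I\<Psi> Im conj0) auto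
  have "cnj (?e x) ^ k = (\<Sum>a\<le>2. \<Sum>b\<le>2. hdot (F a) (F b) * (?e x ^ a * cnj (?e x) ^ (b + k)))
      + (\<Sum>b\<le>2. cnj (?e x) ^ (b + k) * hdot (E (?e x)) (F b))
      + (\<Sum>a\<le>2. ?e x ^ a * cnj (?e x) ^ k * hdot (F a) (E (?e x)))
      + cnj (?e x) ^ k * hdot (E (?e x)) (E (?e x))" (is "_ = ?R") for x
  proof -
    define f where "f = F 0 + ?e x *s F 1 + (?e x)\<^sup>2 *s F 2 + E (?e x)"
    have "hdot f f = 1" unfolding f_def by (intro hdot_unit one circlepath_norm r)
    moreover have "?R = cnj (?e x) ^ k * hdot f f"
      by (simp add: f_def numeral_2_eq_2 atMost_Suc power_add algebra_simps)
    ultimately show ?thesis by simp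
  qed
  then have "((\<lambda>x. cnj (?e x) ^ k) has_integral
     (\<Sum>a\<le>2. \<Sum>b\<le>2. hdot (F a) (F b) * of_real (if a = b + k then r ^ (2*a) else 0)) + (\<Sum>b\<le>2. \<Psi> b) + m) {0..1}"
    using tot by simp
  moreover have "((\<lambda>x. cnj (?e x) ^ k) has_integral of_real (if k = 0 then 1 else 0)) {0..1}"
    using circle_monomial[OF r, of 0 k] by (cases "k = 0") auto
  ultimately have 1: "of_real (if k = 0 then 1 else 0) = (\<Sum>a\<le>2. \<Sum>b\<le>2. hdot (F a) (F b) * of_real (if a = b + k then r ^ (2*a) else 0))
       + (\<Sum>b\<le>2. \<Psi> b) + m"
    by (rule has_integral_unique[rotated])
  have 2: "cmod m \<le> C\<^sup>2 * r ^ (6 + k)"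
  proof -
    have "norm m \<le> (C\<^sup>2 * r ^ (6 + k)) * Sigma_Algebra.measure lborel (cbox (0::real) 1)"
    proof (rule has_integral_bound)
      show "((\<lambda>x. cnj (?e x) ^ k * hdot (E (?e x)) (E (?e x))) has_integral m) (cbox 0 1)" using Im by simp
      fix x :: real
      have "cmod (hdot (E (?e x)) (E (?e x))) \<le> (C * r ^ 3) * (C * r ^ 3)"
        using cmod_hdot_le[of "E (?e x)" "E (?e x)"] bE[OF eb[of x]] by (meson mult_mono norm_ge_zero order_trans)
      then have "r ^ k * cmod (hdot (E (?e x)) (E (?e x))) \<le> r ^ k * ((C * r ^ 3) * (C * r ^ 3))"
        using r by (intro mult_left_mono) auto
      then show "norm (cnj (?e x) ^ k * hdot (E (?e x)) (E (?e x))) \<le> C\<^sup>2 * r ^ (6 + k)"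
        by (simp add: norm_mult norm_power circlepath_norm[OF r] power2_eq_square power_add algebra_simps eval_nat_numeral)
    qed (use C0 r in auto)
    then show ?thesis by simp
  qed
  have 4: "cmod (\<Psi> b) \<le> norm (F b) * C * r ^ (3 + b + k)" for b
  proof -
    have "norm (\<Psi> b) \<le> (norm (F b) * C * r ^ (3 + b + k)) * Sigma_Algebra.measure lborel (cbox (0::real) 1)"
    proof (rule has_integral_bound)
      show "((\<lambda>x. cnj (?e x) ^ (b + k) * hdot (E (?e x)) (F b)) has_integral \<Psi> b) (cbox 0 1)" using I\<Psi> by simp
      fix x :: real
      have "cmod (hdot (E (?e x)) (F b)) \<le> (C * r ^ 3) * norm (F b)"
        using cmod_hdot_le[of "E (?e x)" "F b"] bE[OF eb[of x]] by (meson mult_right_mono norm_ge_zero order_trans)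
      then have "r ^ (b + k) * cmod (hdot (E (?e x)) (F b)) \<le> r ^ (b + k) * ((C * r ^ 3) * norm (F b))"
        using r by (intro mult_left_mono) auto
      then show "norm (cnj (?e x) ^ (b + k) * hdot (E (?e x)) (F b)) \<le> norm (F b) * C * r ^ (3 + b + k)"
        by (simp add: norm_mult norm_power circlepath_norm[OF r] power_add algebra_simps)
    qed (use C0 r in auto)
    then show ?thesis by simp
  qed
  have 3: "\<Psi> b = 0" if "b + k \<le> 2" for b using L[OF lim0[OF that]] by simp
  show ?thesis by (rule that[OF 1 2 3 4 L])
qed

text \<open>Subtracting the model term \<open>a z^3 / 6\<close> before applying Taylor's theorem
  makes the error depend on the oscillation \<open>f3 - a\<close>. With \<open>a = 0\<close> this
  bounds the remainder, with \<open>a = f3 0\<close> it identifies its cubic coefficient.\<close>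

lemma taylor3:
  fixes f0 f1 f2 f3 :: "complex \<Rightarrow> complex"
  assumes d: "\<And>x. x \<in> ball 0 \<rho> \<Longrightarrow> (f0 has_field_derivative f1 x) (at x)"
      "\<And>x. x \<in> ball 0 \<rho> \<Longrightarrow> (f1 has_field_derivative f2 x) (at x)"
      "\<And>x. x \<in> ball 0 \<rho> \<Longrightarrow> (f2 has_field_derivative f3 x) (at x)"
    and B: "\<And>x. x \<in> ball 0 \<rho> \<Longrightarrow> cmod (f3 x - a) \<le> B"
    and z: "z \<in> ball 0 \<rho>"
  shows "cmod (f0 z - (f0 0 + f1 0 * z + f2 0 * z\<^sup>2 / 2) - a * z ^ 3 / 6) \<le> B * cmod z ^ 3 / 2"
proof -
  define g where "g i x = (if i = 0 then f0 x - a * x ^ 3 / 6 else if i = 1 then f1 x - a * x ^ 2 / 2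
      else if i = 2 then f2 x - a * x else f3 x - a)" for i :: nat and x
  have "\<rho> > 0" using z by (metis ball_eq_empty empty_iff not_le)
  have "cmod (g 0 z - (\<Sum>i\<le>2. g i 0 * (z - 0) ^ i / fact i)) \<le> B * cmod (z - 0) ^ Suc 2 / fact 2"
  proof (rule complex_Taylor[of "ball 0 \<rho>"])
    fix i x assume x: "x \<in> ball (0::complex) \<rho>" and i: "i \<le> (2::nat)"
    have "((\<lambda>x. f0 x - a * x ^ 3 / 6) has_field_derivative f1 x - a * x ^ 2 / 2) (at x)"
      by (rule derivative_eq_intros d x refl | simp)+
    moreover have "((\<lambda>x. f1 x - a * x ^ 2 / 2) has_field_derivative f2 x - a * x) (at x)"
      by (rule derivative_eq_intros d x refl | simp)+
    moreover have "((\<lambda>x. f2 x - a * x) has_field_derivative f3 x - a) (at x)"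
      by (rule derivative_eq_intros d x refl | simp)+
    moreover have "i = 0 \<or> i = 1 \<or> i = 2" using i by auto
    ultimately have "(g i has_field_derivative g (Suc i) x) (at x)" unfolding g_def by auto
    then show "(g i has_field_derivative g (Suc i) x) (at x within ball 0 \<rho>)" by (rule has_field_derivative_at_within)
  next
    fix x assume "x \<in> ball (0::complex) \<rho>"
    then show "cmod (g (Suc 2) x) \<le> B" using B by (simp add: g_def)
  qed (use z \<open>\<rho> > 0\<close> in auto)
  moreover have "g 0 z - (\<Sum>i\<le>2. g i 0 * (z - 0) ^ i / fact i) = f0 z - (f0 0 + f1 0 * z + f2 0 * z\<^sup>2 / 2) - a * z ^ 3 / 6"
    by (simp add: g_def numeral_2_eq_2 atMost_Suc algebra_simps)
  ultimately show ?thesis by (simp add: numeral_3_eq_3)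
qed

lemma norm_le_card: "(\<And>k. cmod (x $ k) \<le> b) \<Longrightarrow> norm (x :: complex^'n) \<le> real CARD('n) * b"
proof -
  assume a: "\<And>k. cmod (x $ k) \<le> b"
  have "norm x \<le> (\<Sum>k\<in>UNIV. cmod (x $ k))" unfolding norm_vec_def by (rule L2_set_le_sum) auto
  also have "\<dots> \<le> (\<Sum>k\<in>(UNIV::'n set). b)" by (rule sum_mono) (rule a)
  finally show ?thesis by simp
qed

context jets begin

lemma jet_bound:
  obtains B where "B \<ge> 0"
    "\<And>z u v w. z \<in> cball 0 1 \<Longrightarrow> norm u \<le> 1 \<Longrightarrow> norm v \<le> 1 \<Longrightarrow> norm w \<le> 1 \<Longrightarrow>
       norm (J1 z u) \<le> B \<and> norm (J2 z u v) \<le> B \<and> norm (J3 z u v w) \<le> B"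
proof -
  let ?S = "cball (0::complex^'a) 1 \<times> cball (0::complex^'a) 1 \<times> cball (0::complex^'a) 1 \<times> cball (0::complex^'a) 1"
  have c: "compact ?S" by (intro compact_Times compact_cball)
  have "continuous_on ?S (\<lambda>x. (J1 (fst x) (fst (snd x)), J2 (fst x) (fst (snd x)) (fst (snd (snd x))),
      J3 (fst x) (fst (snd x)) (fst (snd (snd x))) (snd (snd (snd x)))))" (is "continuous_on _ ?f")
    by (intro continuous_intros) auto
  then have "bounded (?f ` ?S)" using c compact_continuous_image compact_imp_bounded by blast
  then obtain B where "\<forall>y\<in>?f ` ?S. norm y \<le> B" unfolding bounded_iff by blast
  then have B: "\<And>x. x \<in> ?S \<Longrightarrow> norm (?f x) \<le> B" by blast
  show ?thesis
  proof (rule that[of "\<bar>B\<bar>"])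
    fix z u v w :: "complex^'a" assume "z \<in> cball 0 1" "norm u \<le> 1" "norm v \<le> 1" "norm w \<le> 1"
    then have b: "norm (J1 z u, J2 z u v, J3 z u v w) \<le> B" using B[of "(z,u,v,w)"] by simp
    have "norm (J1 z u) \<le> B" using norm_fst_le[of "J1 z u" "(J2 z u v, J3 z u v w)"] b by simp
    moreover have b2: "norm (J2 z u v, J3 z u v w) \<le> B" using norm_snd_le[of "(J2 z u v, J3 z u v w)" "J1 z u"] b by simp
    moreover have "norm (J2 z u v) \<le> B" using norm_fst_le[of "J2 z u v" "J3 z u v w"] b2 by simp
    moreover have "norm (J3 z u v w) \<le> B" using norm_snd_le[of "J3 z u v w" "J2 z u v"] b2 by simp
    ultimately show "norm (J1 z u) \<le> \<bar>B\<bar> \<and> norm (J2 z u v) \<le> \<bar>B\<bar> \<and> norm (J3 z u v w) \<le> \<bar>B\<bar>" by auto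
  qed simp
qed

text \<open>For \<open>c = sqrt (1 - s) p\<close> and \<open>t\<close> tangential at \<open>p\<close> the circle \<open>c + \<zeta> t\<close>, \<open>|\<zeta>|\<^sup>2 = s\<close>, lies on the sphere. The bounds come
  from the Fourier modes \<open>0, 1, 2, 3\<close> of \<open>|F|\<^sup>2 = 1\<close> along this circle.\<close>

definition circle_bound :: "real \<Rightarrow> complex^'a \<Rightarrow> complex^'a \<Rightarrow> real \<Rightarrow> bool" where
  "circle_bound C c t s \<longleftrightarrow>
      \<bar>1 - (norm (G0 c))\<^sup>2 - s * (norm (J1 c t))\<^sup>2 - s\<^sup>2 * (norm (J2 c t t))\<^sup>2 / 4\<bar> \<le> C * s ^ 3 \<and>
      cmod (hdot (J1 c t) (G0 c) + of_real s / 2 * hdot (J2 c t t) (J1 c t)) \<le> C * s\<^sup>2 \<and>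
      cmod (hdot (J2 c t t) (G0 c)) \<le> C * s \<and>
      cmod (hdot (J3 c t t t) (G0 c)) \<le> C * sqrt s"

lemma circle_est:
  obtains C where
    "\<And>p t s. norm p = 1 \<Longrightarrow> norm t = 1 \<Longrightarrow> hdot t p = 0 \<Longrightarrow> 0 < s \<Longrightarrow> s < 1 \<Longrightarrow> circle_bound C (of_real (sqrt (1 - s)) *s p) t s"
proof -
  obtain B where B0: "B \<ge> 0" and B: "\<And>z u v w. z \<in> cball 0 1 \<Longrightarrow> norm u \<le> 1 \<Longrightarrow> norm v \<le> 1 \<Longrightarrow> norm w \<le> 1 \<Longrightarrow>
       norm (J1 z u) \<le> B \<and> norm (J2 z u v) \<le> B \<and> norm (J3 z u v w) \<le> B" by (rule jet_bound) blast
  define C where "C = real CARD('b) * (B / 2)"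
  have C0: "C \<ge> 0" using B0 by (simp add: C_def)
  \<comment> \<open>Large enough for all four modes; the worst one, mode 3, needs
    \<open>12 B C + 6 C^2\<close>.\<close>
  define K where "K = 6 * (2 * B * C + C\<^sup>2)"
  show ?thesis
  proof (rule that[of K])
    fix p t :: "complex^'a" and s :: real
    assume p: "norm p = 1" and t: "norm t = 1" and tp: "hdot t p = 0" and s: "0 < s" "s < 1"
    define c where c: "c = of_real (sqrt (1 - s)) *s p"
    define r where "r = sqrt s"
    have r: "0 < r" "r < 1" "r\<^sup>2 = s" using s by (auto simp: r_def)
    have nc: "(norm (c + \<zeta> *s t))\<^sup>2 = 1 - s + (cmod \<zeta>)\<^sup>2" for \<zeta>
    proof -
      have "hdot p t = 0" using tp hdot_0_sym[of t p] by blast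
      then show ?thesis using s p t by (simp add: norm_add_sq norm_smult c power_mult_distrib)
    qed
    have inb: "c + \<zeta> *s t \<in> ball 0 1 \<longleftrightarrow> cmod \<zeta> < r" and inc: "c + \<zeta> *s t \<in> cball 0 1 \<longleftrightarrow> cmod \<zeta> \<le> r" for \<zeta>
    proof -
      have "norm (c + \<zeta> *s t) < 1 \<longleftrightarrow> (norm (c + \<zeta> *s t))\<^sup>2 < 1" by (simp add: power_less_one_iff)
      also have "\<dots> \<longleftrightarrow> (cmod \<zeta>)\<^sup>2 < r\<^sup>2" by (simp add: nc r)
      also have "\<dots> \<longleftrightarrow> cmod \<zeta> < r" using r by (smt (verit) norm_ge_zero power2_less_imp_less power_strict_mono pos2)
      finally show "c + \<zeta> *s t \<in> ball 0 1 \<longleftrightarrow> cmod \<zeta> < r" by simp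
      have "norm (c + \<zeta> *s t) \<le> 1 \<longleftrightarrow> (norm (c + \<zeta> *s t))\<^sup>2 \<le> 1" by (simp add: power_le_one_iff)
      also have "\<dots> \<longleftrightarrow> (cmod \<zeta>)\<^sup>2 \<le> r\<^sup>2" by (simp add: nc r)
      also have "\<dots> \<longleftrightarrow> cmod \<zeta> \<le> r" using r by (smt (verit) norm_ge_zero power2_le_imp_le power_mono)
      finally show "c + \<zeta> *s t \<in> cball 0 1 \<longleftrightarrow> cmod \<zeta> \<le> r" by simp
    qed
    have cc: "c \<in> ball 0 1" "c \<in> cball 0 1" using inb[of 0] r by auto
    define F where "F n = (if n = 0 then G0 c else if n = 1 then J1 c t else (1/2) *s J2 c t t)" for n :: nat
    define E where "E \<zeta> = G0 (c + \<zeta> *s t) - (F 0 + \<zeta> *s F 1 + \<zeta>\<^sup>2 *s F 2)" for \<zeta>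
    have tay: "norm (E \<zeta> - (\<zeta> ^ 3) *s a) \<le> real CARD('b) * (b / 2 * cmod \<zeta> ^ 3)"
      if "\<rho> \<le> r" "\<zeta> \<in> ball 0 \<rho>" "\<And>x k. x \<in> ball 0 \<rho> \<Longrightarrow> cmod (J3 (c + x *s t) t t t $ k - 6 * a $ k) \<le> b" for \<rho> a b \<zeta>
    proof (rule norm_le_card)
      fix k
      have "cmod (G0 (c + \<zeta> *s t) $ k - (G0 (c + 0 *s t) $ k + J1 (c + 0 *s t) t $ k * \<zeta> + J2 (c + 0 *s t) t t $ k * \<zeta>\<^sup>2 / 2) - 6 * a $ k * \<zeta> ^ 3 / 6)
         \<le> b * cmod \<zeta> ^ 3 / 2"
      proof (rule taylor3[of \<rho>])
        fix x :: complex assume "x \<in> ball 0 \<rho>"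
        then have "c + x *s t \<in> ball 0 1" using that(1) inb by auto
        then show "((\<lambda>x. G0 (c + x *s t) $ k) has_field_derivative J1 (c + x *s t) t $ k) (at x)"
          "((\<lambda>x. J1 (c + x *s t) t $ k) has_field_derivative J2 (c + x *s t) t t $ k) (at x)"
          "((\<lambda>x. J2 (c + x *s t) t t $ k) has_field_derivative J3 (c + x *s t) t t t $ k) (at x)"
          by (rule derJ)+
      qed (use that in auto)
      then show "cmod ((E \<zeta> - (\<zeta> ^ 3) *s a) $ k) \<le> b / 2 * cmod \<zeta> ^ 3"
        by (simp add: E_def F_def algebra_simps)
    qed
    have bnd: "norm (E \<zeta>) \<le> C * cmod \<zeta> ^ 3" if "\<zeta> \<in> ball 0 r" for \<zeta>
    proof -
      have "norm (E \<zeta> - (\<zeta> ^ 3) *s 0) \<le> real CARD('b) * (B / 2 * cmod \<zeta> ^ 3)"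
      proof (rule tay[OF order_refl that])
        fix x k assume "x \<in> ball (0::complex) r"
        then have "c + x *s t \<in> cball 0 1" using inc[of x] by simp
        then have "norm (J3 (c + x *s t) t t t) \<le> B" using B t by simp
        then show "cmod (J3 (c + x *s t) t t t $ k - 6 * 0 $ k) \<le> B" using Finite_Cartesian_Product.norm_nth_le order_trans by (metis diff_zero mult_zero_right zero_index)
      qed
      then show ?thesis by (simp add: C_def)
    qed
    \<comment> \<open>In mode 3 the vector \<open>F 0\<close> meets the cubic coefficient of the
      remainder, so this coefficient is needed exactly and not just as a bound.\<close>
    have lim3: "((\<lambda>\<zeta>. hdot (E \<zeta>) (F 0) / \<zeta> ^ 3) \<longlongrightarrow> hdot ((1/6) *s J3 c t t t) (F 0)) (at 0)"
    proof -
      define a where "a = (1/6) *s J3 c t t t"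
      have ne: "((\<lambda>\<zeta>. (1 / \<zeta> ^ 3) *s (E \<zeta> - (\<zeta> ^ 3) *s a)) \<longlongrightarrow> 0) (at 0)"
      proof (rule tendstoI)
        fix e :: real assume e: "e > 0"
        define b where "b = e / real CARD('b)"
        have b: "b > 0" using e by (simp add: b_def)
        have "continuous_on (cball 0 r) (\<lambda>x. J3 (c + x *s t) t t t)"
          by (intro continuous_intros) (use inc in auto)
        then have "isCont (\<lambda>x. J3 (c + x *s t) t t t) 0"
          using r(1) by (intro continuous_on_interior[of "cball 0 r"]) auto
        then obtain d where d: "d > 0" "\<And>x. dist x 0 < d \<Longrightarrow> dist (J3 (c + x *s t) t t t) (J3 (c + 0 *s t) t t t) < b"
          unfolding continuous_at_eps_delta using b by blast
        define \<rho> where "\<rho> = min d r"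
        have "dist ((1 / \<zeta> ^ 3) *s (E \<zeta> - (\<zeta> ^ 3) *s a)) 0 < e" if z: "\<zeta> \<noteq> 0" "dist \<zeta> 0 < \<rho>" for \<zeta>
        proof -
          have "norm (E \<zeta> - (\<zeta> ^ 3) *s a) \<le> real CARD('b) * (b / 2 * cmod \<zeta> ^ 3)"
          proof (rule tay[of \<rho>])
            fix x k assume "x \<in> ball (0::complex) \<rho>"
            then have "norm (J3 (c + x *s t) t t t - J3 c t t t) < b" using d(2)[of x] by (simp add: \<rho>_def dist_norm)
            then have "cmod ((J3 (c + x *s t) t t t - J3 c t t t) $ k) \<le> b"
              using Finite_Cartesian_Product.norm_nth_le[of "J3 (c + x *s t) t t t - J3 c t t t" k] by linarith
            then show "cmod (J3 (c + x *s t) t t t $ k - 6 * a $ k) \<le> b" by (simp add: a_def)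
          qed (use z in \<open>auto simp: \<rho>_def\<close>)
          then have "norm (E \<zeta> - (\<zeta> ^ 3) *s a) \<le> e / 2 * cmod \<zeta> ^ 3" by (simp add: b_def)
          then have "norm ((1 / \<zeta> ^ 3) *s (E \<zeta> - (\<zeta> ^ 3) *s a)) \<le> e / 2"
            using z unfolding norm_smult norm_divide norm_power by (simp add: field_simps)
          then have "norm ((1 / \<zeta> ^ 3) *s (E \<zeta> - (\<zeta> ^ 3) *s a)) < e" using e by linarith
          then show ?thesis by (simp only: dist_norm diff_0_right)
        qed
        then show "\<forall>\<^sub>F \<zeta> in at 0. dist ((1 / \<zeta> ^ 3) *s (E \<zeta> - (\<zeta> ^ 3) *s a)) 0 < e"
          unfolding eventually_at using d(1) r(1) by (intro exI[of _ \<rho>]) (auto simp: \<rho>_def)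
      qed
      have "((\<lambda>\<zeta>. hdot ((1 / \<zeta> ^ 3) *s (E \<zeta> - (\<zeta> ^ 3) *s a)) (F 0) + hdot a (F 0)) \<longlongrightarrow> hdot 0 (F 0) + hdot a (F 0)) (at 0)"
        by (intro tendsto_intros ne)
      then have "((\<lambda>\<zeta>. hdot ((1 / \<zeta> ^ 3) *s (E \<zeta> - (\<zeta> ^ 3) *s a)) (F 0) + hdot a (F 0)) \<longlongrightarrow> hdot a (F 0)) (at 0)"
        by simp
      then show ?thesis unfolding a_def[symmetric]
        by (rule Lim_transform_eventually) (auto simp: eventually_at_filter field_simps)
    qed
    have hol: "(\<lambda>z. hdot (E z) v) holomorphic_on ball 0 r" for v
    proof -
      have "(\<lambda>z. G0 (c + z *s t) $ k) holomorphic_on ball 0 r" for k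
        by (rule holomorphic_on_subset[OF holJ(1)]) (unfold subset_iff mem_Collect_eq inb, simp)
      then show ?thesis unfolding E_def hdot_def vector_minus_component vector_add_component vector_smult_component
        by (intro holomorphic_on_sum holomorphic_on_mult holomorphic_on_diff holomorphic_on_add holomorphic_on_const holomorphic_on_power holomorphic_on_ident)
    qed
    have cont: "continuous_on (cball 0 r) E"
      unfolding E_def by (intro continuous_intros) (use inc in auto)
    have one: "norm (F 0 + z *s F 1 + z\<^sup>2 *s F 2 + E z) = 1" if "cmod z = r" for z
    proof -
      have "(norm (c + z *s t))\<^sup>2 = 1" using nc[of z] that r by simp
      then have "norm (c + z *s t) = 1" by (simp add: power2_eq_1_iff) (smt (verit) norm_ge_zero)
      then show ?thesis using bdry by (simp add: E_def)
    qed
    define Q where "Q k \<Psi> m \<longleftrightarrow> complex_of_real (if k = 0 then 1 else 0) =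
         (\<Sum>a\<le>2. \<Sum>b\<le>2. hdot (F a) (F b) * of_real (if a = b + k then r ^ (2*a) else 0)) + (\<Sum>b\<le>2. \<Psi> b) + m
       \<and> cmod m \<le> C\<^sup>2 * r ^ (6 + k) \<and> (\<forall>b. b + k \<le> 2 \<longrightarrow> \<Psi> b = 0) \<and> (\<forall>b. cmod (\<Psi> b) \<le> norm (F b) * C * r ^ (3 + b + k))
       \<and> (\<forall>b L. ((\<lambda>z. hdot (E z) (F b) / z ^ (b + k)) \<longlongrightarrow> L) (at 0) \<longrightarrow> \<Psi> b = of_real (r ^ (2 * (b + k))) * L)" for k \<Psi> m
    have modes: "\<exists>\<Psi> m. Q k \<Psi> m" for k
      unfolding Q_def by (rule circle_modes[OF r(1) hol cont bnd one, of k]) blast+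
    have F1: "norm (F 1) \<le> B" using B[of c t t t] cc t by (simp add: F_def)
    have F2: "norm (F 2) \<le> B" using B[of c t t t] cc t B0 by (simp add: F_def norm_smult)
    have CB: "0 \<le> B * C" using B0 C0 by simp
    have rp: "r ^ n \<le> r ^ m" if "m \<le> n" for m n using r that by (intro power_decreasing) auto
    have cm: "cmod (a * of_real (r ^ n)) = cmod a * r ^ n" for a n
      using r(1) by (simp add: norm_mult norm_power)
    have QP: "cmod (\<Psi> b) \<le> norm (F b) * C * r ^ n" if "Q k \<Psi> m" "n = 3 + b + k" for k \<Psi> m b n
      using that unfolding Q_def by blast
    have QL: "\<Psi> b = of_real (r ^ (2 * (b + k))) * L" if "Q k \<Psi> m" "((\<lambda>z. hdot (E z) (F b) / z ^ (b + k)) \<longlongrightarrow> L) (at 0)" for k \<Psi> m b L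
      using that unfolding Q_def by blast
    have FS: "F (Suc 0) = J1 c t" by (simp add: F_def)
    have sum2: "(\<Sum>a\<le>2. h a) = h 0 + h 1 + h (2::nat)" for h :: "nat \<Rightarrow> complex"
      by (simp add: numeral_2_eq_2 atMost_Suc)
    have nF: "(norm (F 0))\<^sup>2 = (norm (G0 c))\<^sup>2" "(norm (F 1))\<^sup>2 = (norm (J1 c t))\<^sup>2" "(norm (F 2))\<^sup>2 = (norm (J2 c t t))\<^sup>2 / 4"
      by (simp_all add: F_def norm_smult power_divide)
    have b1: "cmod x * r ^ i \<le> K * r ^ j" if "cmod x * r ^ i \<le> a * (B * C) * r ^ l + a' * C\<^sup>2 * r ^ l'" "j \<le> l" "j \<le> l'" "a \<le> 6" "a' \<le> 6"
        "0 \<le> a" "0 \<le> a'" for x :: complex and i j l l' a a'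
    proof -
      have "a * (B * C) * r ^ l \<le> 6 * (B * C) * r ^ j" using that B0 C0 rp[of j l] r by (intro mult_mono mult_right_mono) auto
      moreover have "a' * C\<^sup>2 * r ^ l' \<le> 6 * C\<^sup>2 * r ^ j" using that rp[of j l'] r by (intro mult_mono mult_right_mono) auto
      moreover have "6 * (B * C) * r ^ j \<le> 12 * (B * C) * r ^ j" using B0 C0 r by (intro mult_right_mono) auto
      ultimately show ?thesis using that(1) by (simp add: K_def algebra_simps)
    qed
    have e0: "\<bar>1 - (norm (G0 c))\<^sup>2 - s * (norm (J1 c t))\<^sup>2 - s\<^sup>2 * (norm (J2 c t t))\<^sup>2 / 4\<bar> \<le> K * s ^ 3"
    proof -
      obtain \<Psi> m where "Q 0 \<Psi> m" using modes by blast
      then have q: "1 = hdot (F 0) (F 0) + hdot (F 1) (F 1) * of_real (r ^ 2) + hdot (F 2) (F 2) * of_real (r ^ 4) + m"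
        and m: "cmod m \<le> C\<^sup>2 * r ^ 6"
        by (auto simp: Q_def sum2)
      have "r ^ 4 = s\<^sup>2" using r(3) by (metis power_mult numeral_Bit0 mult_2_right)
      moreover have "r ^ 6 = s ^ 3" using r(3) by (metis power_mult num_double numeral_times_numeral)
      moreover have "1 = Re (hdot (F 0) (F 0) + hdot (F 1) (F 1) * of_real (r ^ 2) + hdot (F 2) (F 2) * of_real (r ^ 4) + m)"
        using q by (metis one_complex.simps(1))
      ultimately have "1 - (norm (G0 c))\<^sup>2 - s * (norm (J1 c t))\<^sup>2 - s\<^sup>2 * (norm (J2 c t t))\<^sup>2 / 4 = Re m"
        by (simp add: hdot_self_Re nF(1,3) FS r(3) algebra_simps del: of_real_power)
      moreover have "\<bar>Re m\<bar> \<le> C\<^sup>2 * s ^ 3" using m \<open>r ^ 6 = s ^ 3\<close> abs_Re_le_cmod[of m] by simp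
      moreover have "C\<^sup>2 * s ^ 3 \<le> K * s ^ 3" using s CB by (intro mult_right_mono) (auto simp: K_def)
      ultimately show ?thesis by linarith
    qed
    have e1: "cmod (hdot (J1 c t) (G0 c) + of_real s / 2 * hdot (J2 c t t) (J1 c t)) \<le> K * s\<^sup>2"
    proof -
      obtain \<Psi> m where Qk: "Q 1 \<Psi> m" using modes by blast
      have p: "cmod (\<Psi> 2) \<le> norm (F 2) * C * r ^ 6" by (rule QP[OF Qk], simp)+
      from Qk have q: "0 = hdot (F 1) (F 0) * of_real (r ^ 2) + hdot (F 2) (F 1) * of_real (r ^ 4) + \<Psi> 2 + m"
        and m: "cmod m \<le> C\<^sup>2 * r ^ 7"
        by (auto simp: Q_def sum2)
      have x: "(hdot (F 1) (F 0) + of_real s * hdot (F 2) (F 1)) * of_real (r ^ 2) = - \<Psi> 2 - m"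
        using q unfolding r(3)[symmetric] of_real_power by algebra
      have "cmod (hdot (F 1) (F 0) + of_real s * hdot (F 2) (F 1)) * r ^ 2 = cmod (\<Psi> 2 + m)"
        using arg_cong[OF x, of cmod] norm_minus_cancel[of "\<Psi> 2 + m"] unfolding cm by simp
      also have "\<dots> \<le> 1 * (B * C) * r ^ 6 + 1 * C\<^sup>2 * r ^ 7"
      proof -
        have "norm (F 2) * C * r ^ 6 \<le> B * C * r ^ 6" using F2 C0 r by (intro mult_right_mono) auto
        then show ?thesis using norm_triangle_ineq[of "\<Psi> 2" m] m p by simp
      qed
      finally have "cmod (hdot (F 1) (F 0) + of_real s * hdot (F 2) (F 1)) * r ^ 2 \<le> K * r ^ 6" by (rule b1) auto
      also have "K * r ^ 6 = (K * s\<^sup>2) * r ^ 2" by (simp add: r(3)[symmetric] eval_nat_numeral)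
      finally have "cmod (hdot (F 1) (F 0) + of_real s * hdot (F 2) (F 1)) \<le> K * s\<^sup>2"
        by (rule mult_right_le_imp_le) (rule zero_less_power[OF r(1)])
      then show ?thesis by (simp add: F_def)
    qed
    have e2: "cmod (hdot (J2 c t t) (G0 c)) \<le> K * s"
    proof -
      obtain \<Psi> m where Qk: "Q 2 \<Psi> m" using modes by blast
      have p: "cmod (\<Psi> 1) \<le> norm (F 1) * C * r ^ 6" "cmod (\<Psi> 2) \<le> norm (F 2) * C * r ^ 7" by (rule QP[OF Qk], simp)+
      from Qk have q: "0 = hdot (F 2) (F 0) * of_real (r ^ 4) + \<Psi> 1 + \<Psi> 2 + m"
        and m: "cmod m \<le> C\<^sup>2 * r ^ 8"
        by (auto simp: Q_def sum2 add.assoc)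
      have x: "(2 * hdot (F 2) (F 0)) * of_real (r ^ 4) = - 2 * (\<Psi> 1 + \<Psi> 2 + m)"
        using q by algebra
      have "cmod (2 * hdot (F 2) (F 0)) * r ^ 4 = 2 * cmod (\<Psi> 1 + \<Psi> 2 + m)"
        using arg_cong[OF x, of cmod] using r(1) by (simp add: norm_mult norm_power del: mult_minus_left distrib_left_numeral mult_minus1 minus_add_distrib)
      also have "\<dots> \<le> 4 * (B * C) * r ^ 6 + 2 * C\<^sup>2 * r ^ 8"
      proof -
        have "norm (F 1) * C * r ^ 6 \<le> B * C * r ^ 6" using F1 C0 r by (intro mult_right_mono) auto
        moreover have "norm (F 2) * C * r ^ 7 \<le> B * C * r ^ 6" using F2 C0 B0 r rp[of 6 7] by (intro mult_mono mult_right_mono) auto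
        ultimately show ?thesis using norm_triangle_ineq[of "\<Psi> 1 + \<Psi> 2" m] norm_triangle_ineq[of "\<Psi> 1" "\<Psi> 2"] m p by simp
      qed
      finally have "cmod (2 * hdot (F 2) (F 0)) * r ^ 4 \<le> K * r ^ 6" by (rule b1) auto
      also have "K * r ^ 6 = (K * s) * r ^ 4" by (simp add: r(3)[symmetric] eval_nat_numeral)
      finally have "cmod (2 * hdot (F 2) (F 0)) \<le> K * s"
        by (rule mult_right_le_imp_le) (rule zero_less_power[OF r(1)])
      then show ?thesis by (simp add: F_def)
    qed
    \<comment> \<open>The wanted product sits in \<open>\<Psi> 0\<close> with the factor
      \<open>r^6\<close>, while the other terms are of order \<open>r^7\<close>; this leaves only a
      bound by \<open>sqrt s\<close>.\<close>
    have e3: "cmod (hdot (J3 c t t t) (G0 c)) \<le> K * sqrt s"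
    proof -
      obtain \<Psi> m where Qk: "Q 3 \<Psi> m" using modes by blast
      have p: "cmod (\<Psi> 1) \<le> norm (F 1) * C * r ^ 7" "cmod (\<Psi> 2) \<le> norm (F 2) * C * r ^ 8" by (rule QP[OF Qk], simp)+
      from Qk have q: "0 = \<Psi> 0 + \<Psi> 1 + \<Psi> 2 + m"
        and m: "cmod m \<le> C\<^sup>2 * r ^ 9"
        by (auto simp: Q_def sum2)
      have "\<Psi> 0 = of_real (r ^ 6) * hdot ((1/6) *s J3 c t t t) (F 0)" using QL[OF Qk, of 0] lim3 by simp
      then have "6 * \<Psi> 0 = hdot (J3 c t t t) (F 0) * of_real (r ^ 6)" by (simp add: mult.commute)
      then have x: "hdot (J3 c t t t) (F 0) * of_real (r ^ 6) = - 6 * (\<Psi> 1 + \<Psi> 2 + m)"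
        using q by algebra
      have "cmod (hdot (J3 c t t t) (F 0)) * r ^ 6 = 6 * cmod (\<Psi> 1 + \<Psi> 2 + m)"
        using arg_cong[OF x, of cmod] using r(1) by (simp add: norm_mult norm_power del: mult_minus_left distrib_left_numeral mult_minus1 minus_add_distrib)
      also have "\<dots> \<le> 12 * (B * C) * r ^ 7 + 6 * C\<^sup>2 * r ^ 9"
      proof -
        have "norm (F 1) * C * r ^ 7 \<le> B * C * r ^ 7" using F1 C0 r by (intro mult_right_mono) auto
        moreover have "norm (F 2) * C * r ^ 8 \<le> B * C * r ^ 7" using F2 C0 B0 r rp[of 7 8] by (intro mult_mono mult_right_mono) auto
        ultimately show ?thesis using norm_triangle_ineq[of "\<Psi> 1 + \<Psi> 2" m] norm_triangle_ineq[of "\<Psi> 1" "\<Psi> 2"] m p by simp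
      qed
      also have "\<dots> \<le> 12 * (B * C) * r ^ 7 + 6 * C\<^sup>2 * r ^ 7" using rp[of 7 9] by (intro add_left_mono mult_left_mono) auto
      also have "\<dots> = (K * r) * r ^ 6" by (simp add: K_def algebra_simps eval_nat_numeral)
      finally have "cmod (hdot (J3 c t t t) (F 0)) \<le> K * r"
        by (rule mult_right_le_imp_le) (rule zero_less_power[OF r(1)])
      then show ?thesis by (simp add: F_def r_def)
    qed
    show "circle_bound K (of_real (sqrt (1 - s)) *s p) t s" unfolding circle_bound_def c[symmetric]
      using e0 e1 e2 e3 by blast
  qed
qed

end

text \<open>Simplification rewrites \<open>x + x\<close> on vectors as a componentwise product with
  a numeral, which has to be taken out of the Hermitian product.\<close>

lemma hdot_numeral [simp]: "hdot (numeral n * x) y = numeral n * hdot x y" "hdot y (numeral n * x) = numeral n * hdot y x"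
proof -
  have "numeral n * x = numeral n *s x" by (simp add: vec_eq_iff)
  then show "hdot (numeral n * x) y = numeral n * hdot x y" "hdot y (numeral n * x) = numeral n * hdot y x" by simp_all
qed

text \<open>For \<open>p = 0\<close> the quotient is 0 by convention and the projection is the
  identity, so the rules below hold without a case distinction.\<close>

definition prj :: "complex^'a \<Rightarrow> complex^'a \<Rightarrow> complex^'a" where
  "prj p v = v - (hdot v p / hdot p p) *s p"

lemma hdot_prj [simp]: "hdot (prj p v) p = 0"
  by (cases "p = 0") (simp_all add: prj_def)

lemma prj_id: "hdot v p = 0 \<Longrightarrow> prj p v = v"
  by (simp add: prj_def)

lemma prj_add: "prj p (v + w) = prj p v + prj p w" and prj_scale: "prj p (c *s v) = c *s prj p v"
  by (simp_all add: prj_def vec_eq_iff algebra_simps add_divide_distrib)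

lemma prj_decomp: "v = (hdot v p / hdot p p) *s p + prj p v"
  by (simp add: prj_def)

text \<open>For \<open>l\<close> a small positive multiple of \<open>\<beta>\<close> the left side
  is of first order and the right side of second order.\<close>

lemma quadratic_form_no_linear_part:
  fixes \<beta> :: complex and A B :: real
  assumes "\<And>l::complex. 2 * Re (cnj l * \<beta>) \<le> (cmod l)\<^sup>2 * A"
  shows "\<beta> = 0"
proof (rule ccontr)
  assume b: "\<beta> \<noteq> 0"
  define e where "e = 1 / (\<bar>A\<bar> + 1)"
  have e: "e > 0" "e * \<bar>A\<bar> < 1" by (simp_all add: e_def field_simps)
  have "2 * Re (cnj (of_real e * \<beta>) * \<beta>) \<le> (cmod (of_real e * \<beta>))\<^sup>2 * A" by (rule assms)
  moreover have "cnj \<beta> * \<beta> = of_real ((cmod \<beta>)\<^sup>2)" by (metis complex_norm_square mult.commute)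
  ultimately have "2 * (e * (cmod \<beta>)\<^sup>2) \<le> e\<^sup>2 * (cmod \<beta>)\<^sup>2 * A"
    using e by (simp add: norm_mult power_mult_distrib mult.assoc)
  also have "\<dots> \<le> e\<^sup>2 * (cmod \<beta>)\<^sup>2 * \<bar>A\<bar>" by (intro mult_left_mono) auto
  also have "\<dots> = (e * (cmod \<beta>)\<^sup>2) * (e * \<bar>A\<bar>)" by (simp add: power2_eq_square)
  also have "\<dots> \<le> (e * (cmod \<beta>)\<^sup>2) * 1" using e b by (intro mult_left_mono) auto
  finally show False using e b by simp
qed

lemma Lim_at_right_0: "(f \<longlongrightarrow> (l::complex)) (at_right (0::real)) \<Longrightarrow> Lim (at_right 0) f = l"
  by (rule tendsto_Lim) auto

context jets begin

section \<open>Limits of the circle estimates at the sphere\<close>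

lemma radial_tendsto:
  assumes "norm p = 1"
  shows "((\<lambda>s. G0 (of_real (sqrt (1 - s)) *s p)) \<longlongrightarrow> G0 p) (at_right (0::real))"
    and "((\<lambda>s. J1 (of_real (sqrt (1 - s)) *s p) u) \<longlongrightarrow> J1 p u) (at_right (0::real))"
    and "((\<lambda>s. J2 (of_real (sqrt (1 - s)) *s p) u v) \<longlongrightarrow> J2 p u v) (at_right (0::real))"
    and "((\<lambda>s. J3 (of_real (sqrt (1 - s)) *s p) u v w) \<longlongrightarrow> J3 p u v w) (at_right (0::real))"
proof -
  have b: "of_real (sqrt (1 - s)) *s p \<in> cball 0 1" if "s \<in> {0..1}" for s :: real
    using that assms by (simp add: norm_smult)
  have c: "continuous_on {0..1} (\<lambda>s::real. of_real (sqrt (1 - s)) *s p)"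
    by (intro continuous_intros)
  note t = continuous_on_Icc_at_rightD[OF _ zero_less_one]
  show "((\<lambda>s. G0 (of_real (sqrt (1 - s)) *s p)) \<longlongrightarrow> G0 p) (at_right (0::real))"
    using t[OF contJ(1)[OF c b]] by simp
  show "((\<lambda>s. J1 (of_real (sqrt (1 - s)) *s p) u) \<longlongrightarrow> J1 p u) (at_right (0::real))"
    using t[OF contJ(2)[OF c b continuous_on_const]] by simp
  show "((\<lambda>s. J2 (of_real (sqrt (1 - s)) *s p) u v) \<longlongrightarrow> J2 p u v) (at_right (0::real))"
    using t[OF contJ(3)[OF c b continuous_on_const continuous_on_const]] by simp
  show "((\<lambda>s. J3 (of_real (sqrt (1 - s)) *s p) u v w) \<longlongrightarrow> J3 p u v w) (at_right (0::real))"
    using t[OF contJ(4)[OF c b continuous_on_const continuous_on_const continuous_on_const]] by simp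
qed

lemma ev01: "\<forall>\<^sub>F s in at_right (0::real). 0 < s \<and> s < 1"
  unfolding eventually_at_right_field by (intro exI[of _ 1]) auto

lemma unit_scale:
  fixes t :: "complex^'a"
  assumes "hdot t p = 0" "t \<noteq> 0"
  obtains t' where "norm t' = 1" "hdot t' p = 0" "t = of_real (norm t) *s t'"
proof
  show "norm ((1 / of_real (norm t)) *s t) = 1" using assms by (simp add: norm_smult norm_divide)
qed (use assms in auto)

text \<open>The bounds for modes 1, 2 and 3 are positive powers of \<open>s\<close>, and the extra
  term of mode 1 carries a factor \<open>s\<close>; so the products vanish as the circle shrinks to
  \<open>p\<close>.\<close>

lemma tangential_1:
  assumes p: "norm p = 1" and t: "hdot t p = 0"
  shows "hdot (J1 p t) (G0 p) = 0"
    and "hdot (J2 p t t) (G0 p) = 0"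
    and "hdot (J3 p t t t) (G0 p) = 0"
proof -
  obtain C where C: "\<And>p t s. norm p = 1 \<Longrightarrow> norm t = 1 \<Longrightarrow> hdot t p = 0 \<Longrightarrow> 0 < s \<Longrightarrow> s < 1 \<Longrightarrow>
      circle_bound C (of_real (sqrt (1 - s)) *s p) t s"
    by (rule circle_est) blast
  have u: "hdot (J1 p t) (G0 p) = 0 \<and> hdot (J2 p t t) (G0 p) = 0 \<and> hdot (J3 p t t t) (G0 p) = 0"
    if t: "hdot t p = 0" "norm t = 1" for t
  proof (intro conjI)
    define c where "c s = of_real (sqrt (1 - s)) *s p" for s
    note L = radial_tendsto[OF p, folded c_def]
    have z: "((\<lambda>s. x s) \<longlongrightarrow> 0) (at_right (0::real))"
      if "\<forall>\<^sub>F s in at_right 0. cmod (x s) \<le> C * g s" "(g \<longlongrightarrow> 0) (at_right 0)" for x g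
      by (rule Lim_null_comparison[OF that(1)]) (use tendsto_mult[OF tendsto_const[of C] that(2)] in simp)
    have g1: "((\<lambda>s. s\<^sup>2) \<longlongrightarrow> 0) (at_right (0::real))" "((\<lambda>s. s) \<longlongrightarrow> 0) (at_right (0::real))" "((\<lambda>s. sqrt s) \<longlongrightarrow> 0) (at_right (0::real))"
      by (auto intro!: tendsto_eq_intros)
    have "((\<lambda>s. hdot (J1 (c s) t) (G0 (c s)) + of_real s / 2 * hdot (J2 (c s) t t) (J1 (c s) t)) \<longlongrightarrow> 0) (at_right (0::real))"
      by (rule z[OF _ g1(1)], rule eventually_mono[OF ev01]) (use C[OF p t(2,1), unfolded circle_bound_def] in \<open>auto simp: c_def\<close>)
    moreover have "((\<lambda>s. hdot (J1 (c s) t) (G0 (c s)) + of_real s / 2 * hdot (J2 (c s) t t) (J1 (c s) t)) \<longlongrightarrow>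
        hdot (J1 p t) (G0 p) + of_real 0 / 2 * hdot (J2 p t t) (J1 p t)) (at_right (0::real))"
      by (intro tendsto_intros L) auto
    ultimately show "hdot (J1 p t) (G0 p) = 0" using tendsto_unique[OF trivial_limit_at_right_real] by fastforce
    have "((\<lambda>s. hdot (J2 (c s) t t) (G0 (c s))) \<longlongrightarrow> 0) (at_right (0::real))"
      by (rule z[OF _ g1(2)], rule eventually_mono[OF ev01]) (use C[OF p t(2,1), unfolded circle_bound_def] in \<open>auto simp: c_def\<close>)
    moreover have "((\<lambda>s. hdot (J2 (c s) t t) (G0 (c s))) \<longlongrightarrow> hdot (J2 p t t) (G0 p)) (at_right (0::real))"
      by (intro tendsto_intros L)
    ultimately show "hdot (J2 p t t) (G0 p) = 0" using tendsto_unique[OF trivial_limit_at_right_real] by blast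
    have "((\<lambda>s. hdot (J3 (c s) t t t) (G0 (c s))) \<longlongrightarrow> 0) (at_right (0::real))"
      by (rule z[OF _ g1(3)], rule eventually_mono[OF ev01]) (use C[OF p t(2,1), unfolded circle_bound_def] in \<open>auto simp: c_def\<close>)
    moreover have "((\<lambda>s. hdot (J3 (c s) t t t) (G0 (c s))) \<longlongrightarrow> hdot (J3 p t t t) (G0 p)) (at_right (0::real))"
      by (intro tendsto_intros L)
    ultimately show "hdot (J3 p t t t) (G0 p) = 0" using tendsto_unique[OF trivial_limit_at_right_real] by blast
  qed
  have "hdot (J1 p t) (G0 p) = 0 \<and> hdot (J2 p t t) (G0 p) = 0 \<and> hdot (J3 p t t t) (G0 p) = 0"
  proof (cases "t = 0")
    case True
    then show ?thesis using J3_scale(1)[of p 0 0 0 0] by simp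
  next
    case False
    then obtain t' where t': "norm t' = 1" "hdot t' p = 0" "t = of_real (norm t) *s t'" using unit_scale[OF t] by blast
    then obtain a where a: "t = a *s t'" by blast
    show ?thesis using u[OF t'(2,1)] unfolding a by simp
  qed
  then show "hdot (J1 p t) (G0 p) = 0" "hdot (J2 p t t) (G0 p) = 0" "hdot (J3 p t t t) (G0 p) = 0" by auto
qed

lemma tangential_2: assumes p: "norm p = 1" and t: "hdot t p = 0" "hdot t' p = 0"
  shows "hdot (J2 p t t') (G0 p) = 0"
proof -
  have "hdot (J2 p (t + t') (t + t')) (G0 p) = 0" using p t by (intro tangential_1) auto
  then show ?thesis using tangential_1(2)[OF p t(1)] tangential_1(2)[OF p t(2)] J2_sym[of p t' t] p by simp
qed

text \<open>Polarisation of a symmetric cubic form that vanishes on the diagonal: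
  \<open>a + b\<close> gives the sum of the two mixed terms, and replacing \<open>b\<close> by its
  negative separates them by parity.\<close>

lemma tangential_3: assumes p: "norm p = 1" and t: "hdot u p = 0" "hdot v p = 0" "hdot w p = 0"
  shows "hdot (J3 p u v w) (G0 p) = 0"
proof -
  have pc: "p \<in> cball 0 1" using p by simp
  note sy = J3_sym[OF pc]
  have s: "J3 p a b a = J3 p a a b" "J3 p b a a = J3 p a a b" for a b using sy by metis+
  have 1: "hdot (J3 p a a b) (G0 p) = 0" if "hdot a p = 0" "hdot b p = 0" for a b
  proof -
    have x: "hdot (J3 p a a b) (G0 p) + hdot (J3 p b b a) (G0 p) = 0" if "hdot a p = 0" "hdot b p = 0" for a b
    proof -
      have "3 * (hdot (J3 p a a b) (G0 p) + hdot (J3 p b b a) (G0 p)) = 0"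
        using tangential_1(3)[of p "a + b"] tangential_1(3)[of p a] tangential_1(3)[of p b] p that
        by (simp add: s[of a b] s[of b a] distrib_left add.commute)
      then show ?thesis by (metis mult_eq_0_iff zero_neq_numeral)
    qed
    have "hdot (J3 p a a (- 1 *s b)) (G0 p) + hdot (J3 p (- 1 *s b) (- 1 *s b) a) (G0 p) = 0"
      by (rule x) (use that in auto)
    then have "- hdot (J3 p a a b) (G0 p) + hdot (J3 p b b a) (G0 p) = 0" by (simp only: J3_scale hdot_scale) simp
    then show ?thesis using x[OF that] by algebra
  qed
  have "hdot (J3 p (u + v) (u + v) w) (G0 p) = 0" by (rule 1) (use t in auto)
  then have "hdot (J3 p u v w) (G0 p) + hdot (J3 p v u w) (G0 p) = 0" using 1[OF t(1,3)] 1[OF t(2,3)] by (simp add: add.commute)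
  then show ?thesis using sy(2)[of v u w] by simp
qed

text \<open>With \<open>x = sqrt (1 - s)\<close> one has \<open>s = (1 - x) * (1 + x)\<close>, so
  the limit is half the radial derivative of the squared norm, and this half cancels the 2 in
  \<open>g\<close>. The mean value theorem is used because derivatives exist only inside the
  ball.\<close>

lemma normal_derivative:
  assumes p: "norm p = 1"
  shows "((\<lambda>s. (1 - (norm (G0 (of_real (sqrt (1 - s)) *s p)))\<^sup>2) / s) \<longlongrightarrow> Re (hdot (J1 p p) (G0 p))) (at_right (0::real))"
proof -
  define f where "f x = (norm (G0 (of_real x *s p)))\<^sup>2" for x :: real
  define g where "g x = 2 * Re (hdot (J1 (of_real x *s p) p) (G0 (of_real x *s p)))" for x :: real
  have b: "of_real x *s p \<in> cball 0 1" if "x \<in> {0..1}" for x :: real using that p by (simp add: norm_smult)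
  have cG: "continuous_on {0..1} (\<lambda>x::real. G0 (of_real x *s p))" "continuous_on {0..1} (\<lambda>x::real. J1 (of_real x *s p) p)"
    by (intro continuous_intros b; simp)+
  have cf: "continuous_on {0..1} f" unfolding f_def by (intro continuous_intros cG)
  have cg: "continuous_on {0..1} g" unfolding g_def by (intro continuous_intros cG)
  have fd: "(f has_real_derivative g x) (at x)" if x: "0 < x" "x < 1" for x
  proof -
    have i: "0 + of_real x *s p \<in> ball 0 1" using x p by (simp add: norm_smult)
    have "((\<lambda>t. G0 (of_real t *s p) $ k) has_vector_derivative J1 (of_real x *s p) p $ k) (at x)" for k
      using has_vector_derivative_real_field[OF derJ(1)[OF i, of k]] by simp
    then have "((\<lambda>t. (\<Sum>k\<in>UNIV. G0 (of_real t *s p) $ k * cnj (G0 (of_real t *s p) $ k))) has_vector_derivative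
       (\<Sum>k\<in>UNIV. G0 (of_real x *s p) $ k * cnj (J1 (of_real x *s p) p $ k) + J1 (of_real x *s p) p $ k * cnj (G0 (of_real x *s p) $ k))) (at x)"
      by (intro derivative_intros has_vector_derivative_mult)
    then have "((\<lambda>t. hdot (G0 (of_real t *s p)) (G0 (of_real t *s p))) has_vector_derivative
       (hdot (G0 (of_real x *s p)) (J1 (of_real x *s p) p) + hdot (J1 (of_real x *s p) p) (G0 (of_real x *s p)))) (at x)"
      by (simp add: hdot_def sum.distrib)
    then have "((\<lambda>t. Re (hdot (G0 (of_real t *s p)) (G0 (of_real t *s p)))) has_real_derivative
       Re (hdot (G0 (of_real x *s p)) (J1 (of_real x *s p) p) + hdot (J1 (of_real x *s p) p) (G0 (of_real x *s p)))) (at x)"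
      unfolding has_real_derivative_iff_has_vector_derivative by (rule bounded_linear.has_vector_derivative[OF bounded_linear_Re])
    moreover have "Re (hdot (G0 (of_real x *s p)) (J1 (of_real x *s p) p)) = Re (hdot (J1 (of_real x *s p) p) (G0 (of_real x *s p)))"
      by (metis cnj_hdot complex_cnj(1) complex.sel(1) cnj.sel(1))
    moreover have "f = (\<lambda>x. (norm (G0 (of_real x *s p)))\<^sup>2)" by (rule ext) (simp add: f_def)
    ultimately show ?thesis by (simp add: g_def hdot_self_Re)
  qed
  have f1: "f 1 = 1" using bdry[OF p] by (simp add: f_def)
  have "\<exists>z. x < z \<and> z < 1 \<and> 1 - f x = (1 - x) * g z" if x: "0 < x" "x < 1" for x
  proof -
    have fdx: "\<exists>D. (f has_real_derivative D) (at y)" if "x < y" "y < 1" for y using fd[of y] that x by auto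
    have "\<exists>l z. x < z \<and> z < 1 \<and> DERIV f z :> l \<and> f 1 - f x = (1 - x) * l"
      by (rule MVT) (use x in \<open>auto intro!: continuous_on_subset[OF cf] fdx simp: real_differentiable_def\<close>)
    then obtain l z where z: "x < z" "z < 1" "DERIV f z :> l" "f 1 - f x = (1 - x) * l" by blast
    have "l = g z" using DERIV_unique[OF z(3) fd] z x by auto
    then show ?thesis using z f1 by auto
  qed
  then obtain Z where Z: "\<And>x. 0 < x \<Longrightarrow> x < 1 \<Longrightarrow> x < Z x \<and> Z x < 1 \<and> 1 - f x = (1 - x) * g (Z x)" by metis
  have q: "((\<lambda>s. sqrt (1 - s)) \<longlongrightarrow> 1) (at_right (0::real))" by (auto intro!: tendsto_eq_intros)
  have Zs: "sqrt (1 - s) < Z (sqrt (1 - s)) \<and> Z (sqrt (1 - s)) < 1 \<and> 0 < sqrt (1 - s)" if "0 < s \<and> s < 1" for s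
    using Z[of "sqrt (1 - s)"] that by auto
  have "((\<lambda>s. Z (sqrt (1 - s))) \<longlongrightarrow> 1) (at_right (0::real))"
  proof (rule tendsto_sandwich[OF _ _ q tendsto_const])
    show "\<forall>\<^sub>F s in at_right 0. sqrt (1 - s) \<le> Z (sqrt (1 - s))"
      by (rule eventually_mono[OF ev01]) (drule Zs, linarith)
    show "\<forall>\<^sub>F s in at_right 0. Z (sqrt (1 - s)) \<le> 1"
      by (rule eventually_mono[OF ev01]) (drule Zs, linarith)
  qed
  moreover have "\<forall>\<^sub>F s in at_right (0::real). Z (sqrt (1 - s)) \<in> {0..1}"
    by (rule eventually_mono[OF ev01], drule Zs, unfold atLeastAtMost_iff) linarith
  ultimately have "((\<lambda>s. g (Z (sqrt (1 - s)))) \<longlongrightarrow> g 1) (at_right 0)"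
    by (intro continuous_on_tendsto_compose[OF cg]) auto
  then have "((\<lambda>s. g (Z (sqrt (1 - s))) / (1 + sqrt (1 - s))) \<longlongrightarrow> g 1 / (1 + 1)) (at_right 0)"
    by (intro tendsto_intros q) auto
  then have "((\<lambda>s. g (Z (sqrt (1 - s))) / (1 + sqrt (1 - s))) \<longlongrightarrow> Re (hdot (J1 p p) (G0 p))) (at_right 0)"
    by (simp add: g_def)
  then show ?thesis
  proof (rule Lim_transform_eventually)
    show "\<forall>\<^sub>F s in at_right (0::real). g (Z (sqrt (1 - s))) / (1 + sqrt (1 - s)) = (1 - (norm (G0 (of_real (sqrt (1 - s)) *s p)))\<^sup>2) / s"
    proof (rule eventually_mono[OF ev01])
      fix s :: real assume s: "0 < s \<and> s < 1"
      define x where "x = sqrt (1 - s)"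
      have x: "0 < x" "x < 1" "s = (1 - x) * (1 + x)" using s by (auto simp: x_def algebra_simps)
      have "1 - f x = (1 - x) * g (Z x)" using Z[of x] x by simp
      then have "(1 - f x) / s = g (Z x) / (1 + x)" unfolding x(3) using x(2) by simp
      then show "g (Z (sqrt (1 - s))) / (1 + sqrt (1 - s)) = (1 - (norm (G0 (of_real (sqrt (1 - s)) *s p)))\<^sup>2) / s"
        unfolding x_def[symmetric] f_def[symmetric] by simp
    qed
  qed
qed

text \<open>Mode 0 divided by \<open>s\<close> says that
  \<open>\<kappa> - |J1 t|^2 - s |J2 t t|^2 / 4\<close> is of order \<open>s^2\<close> for unit
  tangential \<open>t\<close>, where \<open>\<kappa>\<close> does not depend on \<open>t\<close>.
  Order zero gives conformality. At order one the difference quotient \<open>bs\<close> is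
  sesquilinear for every \<open>s\<close>, and so is its limit \<open>b\<close>, although on unit
  vectors it computes the quartic expression \<open>|J2 t t|^2 / 4\<close>. Thus the quartic form is
  divisible by \<open>hdot t t\<close>. Mode 1 yields the linear form \<open>\<xi>\<close> in the
  same way.\<close>

lemma boundary_forms:
  assumes p: "norm p = 1" and dim: "CARD('a) \<ge> 2"
  obtains K :: real and \<xi> :: "complex^'a \<Rightarrow> complex" and b :: "complex^'a \<Rightarrow> complex^'a \<Rightarrow> complex" where
    "K = Re (hdot (J1 p p) (G0 p))"
    "\<And>t t'. hdot t p = 0 \<Longrightarrow> hdot t' p = 0 \<Longrightarrow> hdot (J1 p t) (J1 p t') = of_real K * hdot t t'"
    "\<And>t t'. hdot t p = 0 \<Longrightarrow> hdot t' p = 0 \<Longrightarrow> \<xi> (t + t') = \<xi> t + \<xi> t'"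
    "\<And>t l. hdot t p = 0 \<Longrightarrow> \<xi> (l *s t) = l * \<xi> t"
    "\<And>t t'. hdot t p = 0 \<Longrightarrow> hdot t' p = 0 \<Longrightarrow> hdot (J2 p t t) (J1 p t') = 2 * (hdot t t' * \<xi> t)"
    "\<And>t t' t''. hdot t p = 0 \<Longrightarrow> hdot t' p = 0 \<Longrightarrow> hdot t'' p = 0 \<Longrightarrow> b (t + t') t'' = b t t'' + b t' t''"
    "\<And>t t' l. hdot t p = 0 \<Longrightarrow> hdot t' p = 0 \<Longrightarrow> b (l *s t) t' = l * b t t'"
    "\<And>t t'. hdot t p = 0 \<Longrightarrow> hdot t' p = 0 \<Longrightarrow> b t' t = cnj (b t t')"
    "\<And>t t'. hdot t p = 0 \<Longrightarrow> hdot t' p = 0 \<Longrightarrow> hdot (J2 p t t) (J2 p t' t') = 4 * (hdot t t' * b t t')"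
proof -
  obtain C where C: "\<And>p t s. norm p = 1 \<Longrightarrow> norm t = 1 \<Longrightarrow> hdot t p = 0 \<Longrightarrow> 0 < s \<Longrightarrow> s < 1 \<Longrightarrow>
      circle_bound C (of_real (sqrt (1 - s)) *s p) t s"
    by (rule circle_est) blast
  define c where "c s = of_real (sqrt (1 - s)) *s p" for s
  note L = radial_tendsto[OF p, folded c_def]
  define \<kappa> where "\<kappa> s = (1 - (norm (G0 (c s)))\<^sup>2) / s" for s
  define K where "K = Re (hdot (J1 p p) (G0 p))"
  have \<kappa>: "(\<kappa> \<longlongrightarrow> K) (at_right 0)" using normal_derivative[OF p] by (simp add: \<kappa>_def[abs_def] c_def K_def)
  have pc: "p \<in> cball 0 1" using p by simp
  define bs where "bs s t t' = (of_real (\<kappa> s) * hdot t t' - hdot (J1 (c s) t) (J1 (c s) t')) / of_real s" for s t t'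
  define xs where "xs s t = - hdot (J1 (c s) t) (G0 (c s)) / of_real s" for s t
  have lim0: "((\<lambda>s::real. A * s ^ Suc n) \<longlongrightarrow> 0) (at_right 0)" for A n
    by (auto intro!: tendsto_eq_intros)
  have unit: "hdot (J1 p t) (J1 p t) = of_real K \<and> ((\<lambda>s. bs s t t) \<longlongrightarrow> hdot (J2 p t t) (J2 p t t) / 4) (at_right 0) \<and>
      ((\<lambda>s. xs s t) \<longlongrightarrow> hdot (J2 p t t) (J1 p t) / 2) (at_right 0)"
    if t: "hdot t p = 0" "norm t = 1" for t
  proof (intro conjI)
    define d where "d s = \<kappa> s - (norm (J1 (c s) t))\<^sup>2 - s * (norm (J2 (c s) t t))\<^sup>2 / 4" for s
    have d: "\<bar>d s\<bar> \<le> C * s\<^sup>2" if s: "0 < s" "s < 1" for s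
    proof -
      have "\<bar>1 - (norm (G0 (c s)))\<^sup>2 - s * (norm (J1 (c s) t))\<^sup>2 - s\<^sup>2 * (norm (J2 (c s) t t))\<^sup>2 / 4\<bar> \<le> C * s ^ 3"
        using C[OF p t(2,1) s, unfolded circle_bound_def] by (simp add: c_def)
      moreover have "1 - (norm (G0 (c s)))\<^sup>2 - s * (norm (J1 (c s) t))\<^sup>2 - s\<^sup>2 * (norm (J2 (c s) t t))\<^sup>2 / 4 = s * d s"
        using s by (simp add: d_def \<kappa>_def field_simps power2_eq_square)
      ultimately have "s * \<bar>d s\<bar> \<le> s * (C * s\<^sup>2)" using s by (simp add: abs_mult eval_nat_numeral mult_ac)
      then show ?thesis using s by (simp add: mult_le_cancel_left_pos)
    qed
    have "((\<lambda>s. d s) \<longlongrightarrow> 0) (at_right 0)"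
      by (rule Lim_null_comparison[OF _ lim0[of C 1]], rule eventually_mono[OF ev01]) (use d in \<open>auto simp: power2_eq_square\<close>)
    moreover have "((\<lambda>s. d s) \<longlongrightarrow> K - (norm (J1 p t))\<^sup>2 - 0 * (norm (J2 p t t))\<^sup>2 / 4) (at_right 0)"
      unfolding d_def by (intro tendsto_intros \<kappa> L) auto
    ultimately have "K = (norm (J1 p t))\<^sup>2" using tendsto_unique[OF trivial_limit_at_right_real] by fastforce
    then show "hdot (J1 p t) (J1 p t) = of_real K" by (simp add: hdot_self)
    have dd: "((\<lambda>s. d s / s) \<longlongrightarrow> 0) (at_right 0)"
    proof (rule Lim_null_comparison[OF _ lim0[of C 0]], rule eventually_mono[OF ev01])
      fix s :: real assume s: "0 < s \<and> s < 1"
      then show "norm (d s / s) \<le> C * s ^ Suc 0" using d[of s] by (simp add: field_simps power2_eq_square)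
    qed
    have "((\<lambda>s. complex_of_real (d s / s) + hdot (J2 (c s) t t) (J2 (c s) t t) / 4) \<longlongrightarrow> of_real 0 + hdot (J2 p t t) (J2 p t t) / 4) (at_right 0)"
      by (intro tendsto_intros dd L) auto
    then have "((\<lambda>s. complex_of_real (d s / s) + hdot (J2 (c s) t t) (J2 (c s) t t) / 4) \<longlongrightarrow> hdot (J2 p t t) (J2 p t t) / 4) (at_right 0)"
      by simp
    then show "((\<lambda>s. bs s t t) \<longlongrightarrow> hdot (J2 p t t) (J2 p t t) / 4) (at_right 0)"
    proof (rule Lim_transform_eventually, intro eventually_mono[OF ev01])
      fix s :: real assume s: "0 < s \<and> s < 1"
      show "complex_of_real (d s / s) + hdot (J2 (c s) t t) (J2 (c s) t t) / 4 = bs s t t"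
        using s t by (simp add: d_def bs_def hdot_self field_simps)
    qed
    have "((\<lambda>s. (hdot (J1 (c s) t) (G0 (c s)) + of_real s / 2 * hdot (J2 (c s) t t) (J1 (c s) t)) / of_real s) \<longlongrightarrow> 0) (at_right 0)"
    proof (rule Lim_null_comparison[OF _ lim0[of C 0]], rule eventually_mono[OF ev01])
      fix s :: real assume s: "0 < s \<and> s < 1"
      then have "cmod (hdot (J1 (c s) t) (G0 (c s)) + of_real s / 2 * hdot (J2 (c s) t t) (J1 (c s) t)) \<le> C * s\<^sup>2"
        using C[OF p t(2,1), unfolded circle_bound_def] by (simp add: c_def)
      then show "norm ((hdot (J1 (c s) t) (G0 (c s)) + of_real s / 2 * hdot (J2 (c s) t t) (J1 (c s) t)) / of_real s) \<le> C * s ^ Suc 0"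
        using s by (simp add: norm_divide field_simps power2_eq_square)
    qed
    then have "((\<lambda>s. hdot (J2 (c s) t t) (J1 (c s) t) / 2 - (hdot (J1 (c s) t) (G0 (c s)) + of_real s / 2 * hdot (J2 (c s) t t) (J1 (c s) t)) / of_real s)
       \<longlongrightarrow> hdot (J2 p t t) (J1 p t) / 2 - 0) (at_right 0)"
      by (intro tendsto_intros L) auto
    then have "((\<lambda>s. hdot (J2 (c s) t t) (J1 (c s) t) / 2 - (hdot (J1 (c s) t) (G0 (c s)) + of_real s / 2 * hdot (J2 (c s) t t) (J1 (c s) t)) / of_real s)
       \<longlongrightarrow> hdot (J2 p t t) (J1 p t) / 2) (at_right 0)" by simp
    then show "((\<lambda>s. xs s t) \<longlongrightarrow> hdot (J2 p t t) (J1 p t) / 2) (at_right 0)"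
      by (rule Lim_transform_eventually, intro eventually_mono[OF ev01]) (auto simp: xs_def field_simps)
  qed
  define T where "T = {t. hdot t p = 0}"
  have Ta: "t + t' \<in> T" "t - t' \<in> T" if "t \<in> T" "t' \<in> T" for t t' using that by (auto simp: T_def)
  have Ts: "l *s t \<in> T" if "t \<in> T" for t l using that by (auto simp: T_def)
  note T = Ta Ts
  have uT: "\<exists>a t'. norm t' = 1 \<and> t' \<in> T \<and> t = of_real a *s t' \<and> hdot t t = (of_real a)\<^sup>2" if tn: "t \<in> T" "t \<noteq> 0" for t
  proof -
    have h: "hdot t p = 0" using tn by (simp add: T_def)
    obtain t' where "norm t' = 1" "hdot t' p = 0" "t = of_real (norm t) *s t'" by (rule unit_scale[OF h tn(2)])
    then show ?thesis by (intro exI[of _ "norm t"] exI[of _ t']) (simp add: T_def hdot_self)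
  qed
  have K1: "hdot (J1 p t) (J1 p t) = of_real K * hdot t t" if "t \<in> T" for t
  proof (cases "t = 0")
    case False
    from uT[OF that False] obtain a t' where a: "norm t' = 1" "t' \<in> T" "t = of_real a *s t'" "hdot t t = (of_real a)\<^sup>2" by blast
    show ?thesis using unit[of t'] a(1,2) hdot_unit[OF a(1)] unfolding a(3) by (simp add: T_def)
  qed simp
  have ex\<xi>: "\<exists>l. ((\<lambda>s. xs s t) \<longlongrightarrow> l) (at_right 0) \<and> hdot (J2 p t t) (J1 p t) = 2 * (hdot t t * l)" if t: "t \<in> T" for t
  proof (cases "t = 0")
    case True
    then show ?thesis by (intro exI[of _ 0]) (simp add: xs_def)
  next
    case False
    from uT[OF that False] obtain a t' where a: "norm t' = 1" "t' \<in> T" "t = of_real a *s t'" "hdot t t = (of_real a)\<^sup>2" by blast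
    have "((\<lambda>s. of_real a * xs s t') \<longlongrightarrow> of_real a * (hdot (J2 p t' t') (J1 p t') / 2)) (at_right 0)"
      using unit[of t'] a by (intro tendsto_intros) (auto simp: T_def)
    moreover have "(\<lambda>s. of_real a * xs s t') = (\<lambda>s. xs s t)" by (rule ext) (simp add: xs_def a(3))
    ultimately show ?thesis
      by (intro exI[of _ "of_real a * (hdot (J2 p t' t') (J1 p t') / 2)"]) (use hdot_unit[OF a(1)] in \<open>simp add: a(3) power2_eq_square\<close>)
  qed
  have exb: "\<exists>l. ((\<lambda>s. bs s t t) \<longlongrightarrow> l) (at_right 0) \<and> hdot (J2 p t t) (J2 p t t) = 4 * (hdot t t * l)" if t: "t \<in> T" for t
  proof (cases "t = 0")
    case True
    then show ?thesis by (intro exI[of _ 0]) (simp add: bs_def)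
  next
    case False
    from uT[OF that False] obtain a t' where a: "norm t' = 1" "t' \<in> T" "t = of_real a *s t'" "hdot t t = (of_real a)\<^sup>2" by blast
    have "((\<lambda>s. (of_real a)\<^sup>2 * bs s t' t') \<longlongrightarrow> (of_real a)\<^sup>2 * (hdot (J2 p t' t') (J2 p t' t') / 4)) (at_right 0)"
      using unit[of t'] a by (intro tendsto_intros) (auto simp: T_def)
    moreover have "(\<lambda>s. (of_real a)\<^sup>2 * bs s t' t') = (\<lambda>s. bs s t t)"
      by (rule ext) (simp add: bs_def a(3) power2_eq_square right_diff_distrib)
    ultimately show ?thesis
      by (intro exI[of _ "(of_real a)\<^sup>2 * (hdot (J2 p t' t') (J2 p t' t') / 4)"]) (use hdot_unit[OF a(1)] in \<open>simp add: a(3) power2_eq_square\<close>)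
  qed
  define \<xi> where "\<xi> t = Lim (at_right 0) (\<lambda>s. xs s t)" for t
  define b where "b t t' = Lim (at_right 0) (\<lambda>s. bs s t t')" for t t'
  have \<xi>: "((\<lambda>s. xs s t) \<longlongrightarrow> \<xi> t) (at_right 0)" "hdot (J2 p t t) (J1 p t) = 2 * (hdot t t * \<xi> t)" if "t \<in> T" for t
    using ex\<xi>[OF that] Lim_at_right_0 unfolding \<xi>_def by blast+
  \<comment> \<open>Convergence is known on the diagonal only; sesquilinearity at fixed
    \<open>s\<close> transfers it to pairs.\<close>
  have pol: "bs s t t' = (bs s (t + t') (t + t') - bs s (t - t') (t - t') + \<i> * bs s (t + \<i> *s t') (t + \<i> *s t') - \<i> * bs s (t - \<i> *s t') (t - \<i> *s t')) / 4" for s t t'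
    by (cases "s = 0") (simp_all add: bs_def field_simps)
  have "\<exists>l. ((\<lambda>s. bs s t t') \<longlongrightarrow> l) (at_right 0)" if t: "t \<in> T" "t' \<in> T" for t t'
  proof -
    obtain l1 l2 l3 l4 where l: "((\<lambda>s. bs s (t + t') (t + t')) \<longlongrightarrow> l1) (at_right 0)" "((\<lambda>s. bs s (t - t') (t - t')) \<longlongrightarrow> l2) (at_right 0)"
      "((\<lambda>s. bs s (t + \<i> *s t') (t + \<i> *s t')) \<longlongrightarrow> l3) (at_right 0)" "((\<lambda>s. bs s (t - \<i> *s t') (t - \<i> *s t')) \<longlongrightarrow> l4) (at_right 0)"
      using exb[of "t + t'"] exb[of "t - t'"] exb[of "t + \<i> *s t'"] exb[of "t - \<i> *s t'"] T t by metis
    show ?thesis by (subst pol, rule exI[of _ "(l1 - l2 + \<i> * l3 - \<i> * l4) / 4"]) (intro tendsto_intros l, simp)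
  qed
  then have bl: "((\<lambda>s. bs s t t') \<longlongrightarrow> b t t') (at_right 0)" if "t \<in> T" "t' \<in> T" for t t'
    using that Lim_at_right_0 unfolding b_def by blast
  have bd: "hdot (J2 p t t) (J2 p t t) = 4 * (hdot t t * b t t)" if "t \<in> T" for t
    using exb[OF that] Lim_at_right_0 unfolding b_def by blast
  note uniq = tendsto_unique[OF trivial_limit_at_right_real]
  have x1: "\<xi> (t + t') = \<xi> t + \<xi> t'" if "t \<in> T" "t' \<in> T" for t t'
  proof (rule uniq)
    show "((\<lambda>s. xs s (t + t')) \<longlongrightarrow> \<xi> (t + t')) (at_right 0)" by (intro \<xi>(1) T that)
    have "((\<lambda>s. xs s t + xs s t') \<longlongrightarrow> \<xi> t + \<xi> t') (at_right 0)" by (intro tendsto_intros \<xi> that)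
    then show "((\<lambda>s. xs s (t + t')) \<longlongrightarrow> \<xi> t + \<xi> t') (at_right 0)" by (simp add: xs_def add_divide_distrib diff_divide_distrib)
  qed
  have x2: "\<xi> (l *s t) = l * \<xi> t" if "t \<in> T" for t l
  proof (rule uniq)
    show "((\<lambda>s. xs s (l *s t)) \<longlongrightarrow> \<xi> (l *s t)) (at_right 0)" by (intro \<xi>(1) T that)
    have "((\<lambda>s. l * xs s t) \<longlongrightarrow> l * \<xi> t) (at_right 0)" by (intro tendsto_intros \<xi> that)
    then show "((\<lambda>s. xs s (l *s t)) \<longlongrightarrow> l * \<xi> t) (at_right 0)" by (simp add: xs_def)
  qed
  have b1: "b (t + t') t'' = b t t'' + b t' t''" if "t \<in> T" "t' \<in> T" "t'' \<in> T" for t t' t''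
  proof (rule uniq)
    show "((\<lambda>s. bs s (t + t') t'') \<longlongrightarrow> b (t + t') t'') (at_right 0)" by (intro bl T that)
    have "((\<lambda>s. bs s t t'' + bs s t' t'') \<longlongrightarrow> b t t'' + b t' t'') (at_right 0)" by (intro tendsto_intros bl that)
    then show "((\<lambda>s. bs s (t + t') t'') \<longlongrightarrow> b t t'' + b t' t'') (at_right 0)"
      by (simp add: bs_def add_divide_distrib diff_divide_distrib algebra_simps)
  qed
  have b2: "b (l *s t) t' = l * b t t'" if "t \<in> T" "t' \<in> T" for t t' l
  proof (rule uniq)
    show "((\<lambda>s. bs s (l *s t) t') \<longlongrightarrow> b (l *s t) t') (at_right 0)" by (intro bl T that)
    have "((\<lambda>s. l * bs s t t') \<longlongrightarrow> l * b t t') (at_right 0)" by (intro tendsto_intros bl that)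
    then show "((\<lambda>s. bs s (l *s t) t') \<longlongrightarrow> l * b t t') (at_right 0)" by (simp add: bs_def algebra_simps)
  qed
  have b3: "b t' t = cnj (b t t')" if "t \<in> T" "t' \<in> T" for t t'
  proof (rule uniq)
    show "((\<lambda>s. bs s t' t) \<longlongrightarrow> b t' t) (at_right 0)" by (intro bl that)
    have "((\<lambda>s. cnj (bs s t t')) \<longlongrightarrow> cnj (b t t')) (at_right 0)" by (intro tendsto_intros bl that)
    then show "((\<lambda>s. bs s t' t) \<longlongrightarrow> cnj (b t t')) (at_right 0)" by (simp add: bs_def cnj_hdot)
  qed
  have b1': "b t'' (t + t') = b t'' t + b t'' t'" if "t \<in> T" "t' \<in> T" "t'' \<in> T" for t t' t''
    using b1[OF that] b3[of "t + t'" t''] b3[of t t''] b3[of t' t''] T(1)[OF that(1,2)] that by simp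
  have b2': "b t' (l *s t) = cnj l * b t' t" if "t \<in> T" "t' \<in> T" for t t' l
    using b2[OF that] b3[of "l *s t" t'] b3[of t t'] T(3)[OF that(1)] that by simp
  have J: "J2 p x y = J2 p y x" for x y by (rule J2_sym[OF pc])
  have p1: "hdot (J1 p t) (J1 p t') = of_real K * hdot t t'" if t: "t \<in> T" "t' \<in> T" for t t'
  proof -
    have a: "hdot (J1 p t) (J1 p t') + hdot (J1 p t') (J1 p t) = of_real K * (hdot t t' + hdot t' t)"
      using K1[of "t + t'"] K1[OF t(1)] K1[OF t(2)] T t by (simp add: algebra_simps)
    have "hdot (J1 p t) (J1 p (\<i> *s t')) + hdot (J1 p (\<i> *s t')) (J1 p t) = of_real K * (hdot t (\<i> *s t') + hdot (\<i> *s t') t)"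
      using K1[of "t + \<i> *s t'"] K1[OF t(1)] K1[of "\<i> *s t'"] T t by (simp add: algebra_simps)
    then have "\<i> * (hdot (J1 p t') (J1 p t) - hdot (J1 p t) (J1 p t')) = \<i> * (of_real K * (hdot t' t - hdot t t'))"
      by (simp add: algebra_simps)
    then have "hdot (J1 p t') (J1 p t) - hdot (J1 p t) (J1 p t') = of_real K * (hdot t' t - hdot t t')" by simp
    then have "2 * hdot (J1 p t) (J1 p t') = 2 * (of_real K * hdot t t')" using a by algebra
    then show ?thesis by simp
  qed
  have p2: "hdot (J2 p y y) (J1 p x) = 2 * (hdot y x * \<xi> y)" if t: "x \<in> T" "y \<in> T" for x y
  proof -
    \<comment> \<open>The diagonal identity at \<open>x + l *s y\<close> is a polynomial in
      \<open>l\<close> and \<open>cnj l\<close>; its coefficient of \<open>l * l\<close> is the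
      claim.\<close>
    have "hdot (J2 p y y) (J1 p x) - 2 * (hdot y x * \<xi> y) = 0"
    proof (rule coeff_20_eq_0)
      fix l
      have e: "hdot (J2 p (x + l *s y) (x + l *s y)) (J1 p (x + l *s y)) = 2 * (hdot (x + l *s y) (x + l *s y) * \<xi> (x + l *s y))"
        by (intro \<xi> T t)
      have "\<xi> (x + l *s y) = \<xi> x + l * \<xi> y" using x1 x2 T t by simp
      from e[unfolded this]
      show "(hdot (J2 p x x) (J1 p x) - 2 * (hdot x x * \<xi> x))
        + (hdot (J2 p x x) (J1 p y) - 2 * (hdot x y * \<xi> x)) * cnj l + 0 * (cnj l * cnj l)
        + (2 * hdot (J2 p x y) (J1 p x) - 2 * (hdot y x * \<xi> x + hdot x x * \<xi> y)) * l
        + (2 * hdot (J2 p x y) (J1 p y) - 2 * (hdot y y * \<xi> x + hdot x y * \<xi> y)) * (l * cnj l) + 0 * (l * cnj l * cnj l)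
        + (hdot (J2 p y y) (J1 p x) - 2 * (hdot y x * \<xi> y)) * (l * l)
        + (hdot (J2 p y y) (J1 p y) - 2 * (hdot y y * \<xi> y)) * (l * l * cnj l) + 0 * (l * l * (cnj l * cnj l)) = 0"
        by (simp add: J[of y x] algebra_simps)
    qed
    then show ?thesis by simp
  qed
  have p3: "hdot (J2 p y y) (J2 p x x) = 4 * (hdot y x * b y x)" if t: "x \<in> T" "y \<in> T" for x y
  proof -
    have "hdot (J2 p y y) (J2 p x x) - 4 * (hdot y x * b y x) = 0"
    proof (rule coeff_20_eq_0)
      fix l
      have e: "hdot (J2 p (x + l *s y) (x + l *s y)) (J2 p (x + l *s y) (x + l *s y)) = 4 * (hdot (x + l *s y) (x + l *s y) * b (x + l *s y) (x + l *s y))"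
        by (intro bd T t)
      have "b (x + l *s y) (x + l *s y) = b x x + cnj l * b x y + l * b y x + l * cnj l * b y y"
        using T t by (simp add: b1 b1' b2 b2' algebra_simps)
      from e[unfolded this]
      show "(hdot (J2 p x x) (J2 p x x) - 4 * (hdot x x * b x x))
        + (2 * hdot (J2 p x x) (J2 p x y) - 4 * (hdot x y * b x x + hdot x x * b x y)) * cnj l
        + (hdot (J2 p x x) (J2 p y y) - 4 * (hdot x y * b x y)) * (cnj l * cnj l)
        + (2 * hdot (J2 p x y) (J2 p x x) - 4 * (hdot y x * b x x + hdot x x * b y x)) * l
        + (4 * hdot (J2 p x y) (J2 p x y) - 4 * (hdot y y * b x x + hdot x y * b y x + hdot y x * b x y + hdot x x * b y y)) * (l * cnj l)
        + (2 * hdot (J2 p x y) (J2 p y y) - 4 * (hdot y y * b x y + hdot x y * b y y)) * (l * cnj l * cnj l)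
        + (hdot (J2 p y y) (J2 p x x) - 4 * (hdot y x * b y x)) * (l * l)
        + (2 * hdot (J2 p y y) (J2 p x y) - 4 * (hdot y y * b y x + hdot y x * b y y)) * (l * l * cnj l)
        + (hdot (J2 p y y) (J2 p y y) - 4 * (hdot y y * b y y)) * (l * l * (cnj l * cnj l)) = 0"
        by (simp add: J[of y x] algebra_simps)
    qed
    then show ?thesis by simp
  qed
  show ?thesis
    by (rule that[of K \<xi> b]; (rule K_def | rule p1 x1 x2 p2 b1 b2 b3 p3; simp add: T_def))
qed

end

section \<open>The second fundamental form at the boundary\<close>

text \<open>Linear dependence as the vanishing of two by two minors: in this form it is polynomial
  in the entries, so the maximum principle can carry it into the ball.\<close>

definition par :: "complex^'b \<Rightarrow> complex^'b \<Rightarrow> bool" where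
  "par a b \<longleftrightarrow> (\<forall>i j. a$i * b$j = a$j * b$i)"

lemma par_scale: "par a (c *s a)" and par_0 [simp]: "par 0 b" "par a 0"
  by (simp_all add: par_def)

lemma parD: assumes "par a b" "a \<noteq> 0" shows "\<exists>c. b = c *s a"
proof -
  obtain i where i: "a $ i \<noteq> 0" using assms(2) by (auto simp: vec_eq_iff)
  have "b $ j = (b$i / a$i) * a $ j" for j
  proof -
    have "a$i * b$j = a$j * b$i" using assms(1) unfolding par_def by blast
    then show ?thesis using i by (simp add: field_simps)
  qed
  then have "b = (b$i / a$i) *s a" unfolding vec_eq_iff vector_smult_component by blast
  then show ?thesis by blast
qed

definition m2 :: "complex^'b \<Rightarrow> complex^'b \<Rightarrow> complex^'b \<Rightarrow> complex^'b \<Rightarrow> complex" where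
  "m2 l k a b = hdot a l * hdot b k - hdot a k * hdot b l"

text \<open>The determinant of the pairings of four vectors with four functionals, by Laplace expansion along two rows.\<close>

definition D4 :: "(nat \<Rightarrow> complex^'b) \<Rightarrow> complex^'b \<Rightarrow> complex^'b \<Rightarrow> complex^'b \<Rightarrow> complex^'b \<Rightarrow> complex" where
  "D4 l a b c d = m2 (l 1) (l 2) a b * m2 (l 3) (l 4) c d - m2 (l 1) (l 3) a b * m2 (l 2) (l 4) c d
     + m2 (l 1) (l 4) a b * m2 (l 2) (l 3) c d + m2 (l 2) (l 3) a b * m2 (l 1) (l 4) c d
     - m2 (l 2) (l 4) a b * m2 (l 1) (l 3) c d + m2 (l 3) (l 4) a b * m2 (l 1) (l 2) c d"

lemma m2_lin: "m2 l k a (c + d) = m2 l k a c + m2 l k a d" "m2 l k (c + d) a = m2 l k c a + m2 l k d a"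
  "m2 l k a (x *s c) = x * m2 l k a c" "m2 l k (x *s c) a = x * m2 l k c a" "m2 l k a a = 0"
  by (simp_all add: m2_def algebra_simps)

lemma m2_0: "m2 l k 0 b = 0" "m2 l k a 0 = 0" and m2_swap: "m2 l k b a = - m2 l k a b"
  by (simp_all add: m2_def)

lemma D4_lin: "D4 l a b (c + c') d = D4 l a b c d + D4 l a b c' d" "D4 l a b c (d + d') = D4 l a b c d + D4 l a b c d'"
  "D4 l a b (x *s c) d = x * D4 l a b c d" "D4 l a b c (x *s d) = x * D4 l a b c d"
  by (simp_all add: D4_def m2_lin algebra_simps)

lemma D4_alt: "D4 l a b c c = 0" "D4 l a b d c = - D4 l a b c d" "D4 l a b a d = 0" "D4 l a b b d = 0"
proof -
  show "D4 l a b c c = 0" unfolding D4_def m2_lin by simp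
  show "D4 l a b d c = - D4 l a b c d" unfolding D4_def m2_swap[of _ _ d c] by simp
  show "D4 l a b a d = 0" unfolding D4_def m2_def by algebra
  show "D4 l a b b d = 0" unfolding D4_def m2_def by algebra
qed

lemma D4_alt': "D4 l a b d a = 0" "D4 l a b d b = 0"
  using D4_alt(2)[of l a b d a] D4_alt(2)[of l a b d b] D4_alt(3)[of l a b d] D4_alt(4)[of l a b d] by simp_all

lemma D4_0: "D4 l 0 b c d = 0" "D4 l a 0 c d = 0"
  unfolding D4_def m2_0 by simp_all

lemma D4_par: assumes "par a c" shows "D4 l a b c d = 0"
proof (cases "a = 0")
  case False
  then obtain x where "c = x *s a" using parD[OF assms False] by blast
  then show ?thesis by (simp add: D4_lin D4_alt(3))
qed (simp add: D4_0)

lemma holomorphic_hdot: "(\<And>k. (\<lambda>t. f t $ k) holomorphic_on S) \<Longrightarrow> (\<lambda>t. hdot (f t) l) holomorphic_on S"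
  unfolding hdot_def by (intro holomorphic_intros)

lemma holomorphic_D4:
  assumes "\<And>l. (\<lambda>t. hdot (a t) l) holomorphic_on S" "\<And>l. (\<lambda>t. hdot (b t) l) holomorphic_on S"
    "\<And>l. (\<lambda>t. hdot (c t) l) holomorphic_on S" "\<And>l. (\<lambda>t. hdot (d t) l) holomorphic_on S"
  shows "(\<lambda>t. D4 l (a t) (b t) (c t) (d t)) holomorphic_on S"
  unfolding D4_def m2_def by (intro holomorphic_on_add holomorphic_on_diff holomorphic_on_mult assms)

lemma continuous_on_D4:
  assumes "continuous_on S a" "continuous_on S b" "continuous_on S c" "continuous_on S d"
  shows "continuous_on S (\<lambda>t. D4 l (a t) (b t) (c t) (d t))"
  unfolding D4_def m2_def by (intro continuous_intros assms)

section \<open>Moving boundary identities into the ball\<close>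

lemma det_eq_0_hdot:
  fixes A :: "complex^'b^'b"
  assumes "\<And>j. hdot (A $ j) g = 0" "g \<noteq> 0"
  shows "det A = 0"
proof (rule ccontr)
  assume "det A \<noteq> 0"
  then have "invertible A" by (simp add: invertible_det_nz)
  then obtain B where "B ** A = mat 1" by (auto simp: invertible_def)
  then have "\<forall>x. A *v x = 0 \<longrightarrow> x = 0" using matrix_left_invertible_ker by blast
  moreover have "A *v (\<chi> i. cnj (g $ i)) = 0"
    using assms(1) by (simp add: vec_eq_iff matrix_vector_mult_def hdot_def)
  ultimately have "(\<chi> i. cnj (g $ i)) = 0" by blast
  then show False using assms(2) by (auto simp: vec_eq_iff)
qed

context jets begin

lemma hdotJ_hol:
  "(\<lambda>t. hdot (J1 (z + t *s d) (u + t *s u')) l) holomorphic_on {t. z + t *s d \<in> ball 0 1}"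
  "(\<lambda>t. hdot (J2 (z + t *s d) (u + t *s u') (v + t *s v')) l) holomorphic_on {t. z + t *s d \<in> ball 0 1}"
  by (rule holomorphic_hdot, rule holJ)+

lemma lineJ_cont:
  "continuous_on {t. z + t *s d \<in> cball 0 1} (\<lambda>t. J1 (z + t *s d) (u + t *s u'))"
  "continuous_on {t. z + t *s d \<in> cball 0 1} (\<lambda>t. J2 (z + t *s d) (u + t *s u') (v + t *s v'))"
  "continuous_on {t. z + t *s d \<in> cball 0 1} (\<lambda>t. J3 (z + t *s d) (u + t *s u') (v + t *s v') (w + t *s w'))"
  by (intro continuous_intros; simp)+

text \<open>On the sphere all rows are orthogonal to \<open>G0 p\<close>, so the determinant
  vanishes there; being polynomial in the jets, it vanishes along the chords. The rows have the
  shape of the combination that \<open>annih_ex\<close> has to exclude.\<close>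

lemma tangential_jets_dependent:
  fixes a b c b' c' d e f :: "'b \<Rightarrow> complex^'a"
  assumes z: "z \<in> cball 0 1" "hdot z w = 1"
    and v: "\<And>j. hdot (a j) w = 0" "\<And>j. hdot (b j) w = 0" "\<And>j. hdot (c j) w = 0" "\<And>j. hdot (b' j) w = 0" "\<And>j. hdot (c' j) w = 0"
      "\<And>j. hdot (d j) w = 0" "\<And>j. hdot (e j) w = 0" "\<And>j. hdot (f j) w = 0"
  shows "det (\<chi> j. J1 z (a j) + J2 z (b j) (c j) + J2 z (b' j) (c' j) + J3 z (d j) (e j) (f j)) = 0"
proof -
  define V where "V = (\<lambda>(j::'b, n::nat). if n = 0 then a j else if n = 1 then b j else if n = 2 then c j else if n = 3 then b' j
     else if n = 4 then c' j else if n = 5 then d j else if n = 6 then e j else f j)"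
  define \<Phi> where "\<Phi> z V = det (\<chi> j. J1 z (V (j,0)) + J2 z (V (j,1)) (V (j,2)) + J2 z (V (j,3)) (V (j,4)) + J3 z (V (j,5)) (V (j,6)) (V (j,7)))"
    for z and V :: "'b \<times> nat \<Rightarrow> complex^'a"
  have "\<Phi> z V = 0"
  proof (rule max_principle_tangential[where \<Phi>=\<Phi> and v=V, OF _ _ _ z])
    fix z d :: "complex^'a" and v e :: "'b \<times> nat \<Rightarrow> complex^'a"
    show "(\<lambda>t. \<Phi> (z + t *s d) (\<lambda>i. v i + t *s e i)) holomorphic_on {t. z + t *s d \<in> ball 0 1}"
      unfolding \<Phi>_def det_def vec_lambda_beta vector_add_component
      by (intro holomorphic_on_sum holomorphic_on_mult holomorphic_on_prod holomorphic_on_const holomorphic_on_add holJ)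
    have "continuous_on {t. z + t *s d \<in> cball 0 1} (\<lambda>t. J1 (z + t *s d) (v (j,0) + t *s e (j,0)) $ k)"
      "continuous_on {t. z + t *s d \<in> cball 0 1} (\<lambda>t. J2 (z + t *s d) (v (j,n) + t *s e (j,n)) (v (j,n') + t *s e (j,n')) $ k)"
      "continuous_on {t. z + t *s d \<in> cball 0 1} (\<lambda>t. J3 (z + t *s d) (v (j,n) + t *s e (j,n)) (v (j,n') + t *s e (j,n')) (v (j,n'') + t *s e (j,n'')) $ k)"
      for j n n' n'' k by (intro continuous_on_component lineJ_cont)+
    then show "continuous_on {t. z + t *s d \<in> cball 0 1} (\<lambda>t. \<Phi> (z + t *s d) (\<lambda>i. v i + t *s e i))"
      unfolding \<Phi>_def det_def vec_lambda_beta vector_add_component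
      by (intro continuous_on_sum continuous_on_mult continuous_on_prod continuous_on_const continuous_on_add) auto
  next
    fix p :: "complex^'a" and v assume p: "norm p = 1" and v: "\<And>i::'b \<times> nat. hdot (v i) p = 0"
    show "\<Phi> p v = 0" unfolding \<Phi>_def
    proof (rule det_eq_0_hdot[of _ "G0 p"])
      show "G0 p \<noteq> 0" using bdry[OF p] by auto
    qed (simp add: tangential_1(1)[OF p v] tangential_2[OF p v v] tangential_3[OF p v v v])
  next
    show "hdot (V i) w = 0" for i using v by (cases i) (simp add: V_def)
  qed
  then show ?thesis by (simp add: \<Phi>_def V_def)
qed

text \<open>The direction \<open>w - (Q / 2 P) v\<close> in the plane of \<open>v, w\<close> along which the second fundamental form
  should vanish, with denominators cleared so that it depends polynomially on the jets.\<close>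

definition asym :: "(nat \<Rightarrow> complex^'b) \<Rightarrow> complex^'a \<Rightarrow> complex^'a \<Rightarrow> complex^'a \<Rightarrow> complex^'a" where
  "asym l z v w = (2 * D4 l (J1 z v) (J1 z w) (J2 z v v) (J2 z v w)) *s w - D4 l (J1 z v) (J1 z w) (J2 z v v) (J2 z w w) *s v"

lemma asym_par:
  assumes bd: "\<And>p v w. norm p = 1 \<Longrightarrow> hdot v p = 0 \<Longrightarrow> hdot w p = 0 \<Longrightarrow> par (J1 p (asym l p v w)) (J2 p (asym l p v w) (asym l p v w))"
    and z: "z \<in> cball 0 1" "hdot z w' = 1" and v: "hdot v w' = 0" "hdot w w' = 0"
  shows "par (J1 z (asym l z v w)) (J2 z (asym l z v w) (asym l z v w))"
  unfolding par_def
proof (intro allI)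
  fix i j
  define P where "P z v w = D4 l (J1 z v) (J1 z w) (J2 z v v) (J2 z v w)" for z v w
  define Q where "Q z v w = D4 l (J1 z v) (J1 z w) (J2 z v v) (J2 z w w)" for z v w
  \<comment> \<open>The coefficients \<open>P\<close> and \<open>Q\<close> are not affine along a
    chord. Expanding the jets at \<open>asym\<close> leaves jets at \<open>v\<close> and
    \<open>w\<close>, whose arguments are affine, with holomorphic coefficients.\<close>
  define X where "X z v w k = 2 * P z v w * J1 z w $ k - Q z v w * J1 z v $ k" for z v w k
  define Y where "Y z v w k = 4 * P z v w * P z v w * J2 z w w $ k - 2 * P z v w * Q z v w * J2 z v w $ k
      - 2 * P z v w * Q z v w * J2 z w v $ k + Q z v w * Q z v w * J2 z v v $ k" for z v w k
  have XY: "J1 z (asym l z v w) $ k = X z v w k" "J2 z (asym l z v w) (asym l z v w) $ k = Y z v w k" for z v w k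
    by (simp_all add: asym_def X_def Y_def P_def[symmetric] Q_def[symmetric] algebra_simps)
  define \<Phi> where "\<Phi> z V = X z (V False) (V True) i * Y z (V False) (V True) j - X z (V False) (V True) j * Y z (V False) (V True) i"
    for z and V :: "bool \<Rightarrow> complex^'a"
  have "\<Phi> z (\<lambda>b. if b then w else v) = 0"
  proof (rule max_principle_tangential[where \<Phi>=\<Phi> and v="\<lambda>b. if b then w else v", OF _ _ _ z])
    fix z d :: "complex^'a" and v e :: "bool \<Rightarrow> complex^'a"
    let ?D = "{t. z + t *s d \<in> ball 0 1}" and ?E = "{t. z + t *s d \<in> cball 0 1}"
    have h: "(\<lambda>t. P (z + t *s d) (v b + t *s e b) (v b' + t *s e b')) holomorphic_on ?D"
      "(\<lambda>t. Q (z + t *s d) (v b + t *s e b) (v b' + t *s e b')) holomorphic_on ?D" for b b'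
      unfolding P_def Q_def by (intro holomorphic_D4 hdotJ_hol)+
    show "(\<lambda>t. \<Phi> (z + t *s d) (\<lambda>i. v i + t *s e i)) holomorphic_on ?D"
      unfolding \<Phi>_def X_def Y_def
      by (intro holomorphic_on_mult holomorphic_on_const holomorphic_on_add holomorphic_on_diff holJ h)
    have c: "continuous_on ?E (\<lambda>t. P (z + t *s d) (v b + t *s e b) (v b' + t *s e b'))"
      "continuous_on ?E (\<lambda>t. Q (z + t *s d) (v b + t *s e b) (v b' + t *s e b'))" for b b'
      unfolding P_def Q_def by (intro continuous_on_D4 lineJ_cont)+
    show "continuous_on ?E (\<lambda>t. \<Phi> (z + t *s d) (\<lambda>i. v i + t *s e i))"
      unfolding \<Phi>_def X_def Y_def
      by (intro continuous_on_mult continuous_on_const continuous_on_add continuous_on_diff continuous_on_component lineJ_cont c)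
  next
    fix p :: "complex^'a" and v :: "bool \<Rightarrow> complex^'a" assume p: "norm p = 1" and v: "\<And>i. hdot (v i) p = 0"
    show "\<Phi> p v = 0" using bd[OF p v v, of False True] by (simp add: \<Phi>_def par_def XY)
  qed (use v in auto)
  then show "J1 z (asym l z v w) $ i * J2 z (asym l z v w) (asym l z v w) $ j = J1 z (asym l z v w) $ j * J2 z (asym l z v w) (asym l z v w) $ i"
    by (simp add: \<Phi>_def XY)
qed

text \<open>In the second case \<open>u\<close> maximises the Hermitian form \<open>b'\<close> on unit vectors. Then \<open>h y y\<close> for \<open>y\<close> orthogonal to \<open>u\<close> is
  orthogonal to the independent vectors coming from \<open>G0 p\<close>, \<open>J1 p\<close> and \<open>h u\<close>, so it vanishes by counting dimensions.\<close>

lemma boundary_dichotomy: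
  assumes p: "norm p = 1" and dim: "CARD('b) + 1 = 2 * CARD('a)" "CARD('a) \<ge> 2"
  shows "(\<forall>t. hdot t p = 0 \<longrightarrow> par (J1 p t) (J2 p t t)) \<or>
    (\<exists>u x U. norm u = 1 \<and> hdot u p = 0 \<and> Re (hdot (J1 p p) (G0 p)) > 0 \<and>
      (\<forall>e. \<exists>v y. hdot y p = 0 \<and> J1 p v + J2 p u y = e) \<and>
      (\<forall>t t'. hdot t p = 0 \<longrightarrow> hdot t' p = 0 \<longrightarrow> x (t + t') = x t + x t' \<and> U (t + t') = U t + U t') \<and>
      (\<forall>t c. hdot t p = 0 \<longrightarrow> x (c *s t) = c * x t \<and> U (c *s t) = c *s U t) \<and>
      (\<forall>t. hdot t p = 0 \<longrightarrow> J2 p t t = (2 * x t) *s J1 p t + (2 * hdot t u) *s U t))"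
proof -
  obtain K :: real and \<xi> b where KF: "K = Re (hdot (J1 p p) (G0 p))"
    and F1: "\<And>t t'. hdot t p = 0 \<Longrightarrow> hdot t' p = 0 \<Longrightarrow> hdot (J1 p t) (J1 p t') = of_real K * hdot t t'"
    and F2: "\<And>t t'. hdot t p = 0 \<Longrightarrow> hdot t' p = 0 \<Longrightarrow> \<xi> (t + t') = \<xi> t + \<xi> t'"
    and F3: "\<And>t l. hdot t p = 0 \<Longrightarrow> \<xi> (l *s t) = l * \<xi> t"
    and F4: "\<And>t t'. hdot t p = 0 \<Longrightarrow> hdot t' p = 0 \<Longrightarrow> hdot (J2 p t t) (J1 p t') = 2 * (hdot t t' * \<xi> t)"
    and F5: "\<And>t t' t''. hdot t p = 0 \<Longrightarrow> hdot t' p = 0 \<Longrightarrow> hdot t'' p = 0 \<Longrightarrow> b (t + t') t'' = b t t'' + b t' t''"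
    and F6: "\<And>t t' l. hdot t p = 0 \<Longrightarrow> hdot t' p = 0 \<Longrightarrow> b (l *s t) t' = l * b t t'"
    and F7: "\<And>t t'. hdot t p = 0 \<Longrightarrow> hdot t' p = 0 \<Longrightarrow> b t' t = cnj (b t t')"
    and F8: "\<And>t t'. hdot t p = 0 \<Longrightarrow> hdot t' p = 0 \<Longrightarrow> hdot (J2 p t t) (J2 p t' t') = 4 * (hdot t t' * b t t')"
    using boundary_forms[OF p dim(2)] by blast
  define T where "T = {t. hdot t p = 0}"
  have T: "t + t' \<in> T" "t - t' \<in> T" if "t \<in> T" "t' \<in> T" for t t' using that by (auto simp: T_def)
  have Ts: "l *s t \<in> T" if "t \<in> T" for t l using that by (auto simp: T_def)
  have TD: "hdot t p = 0" if "t \<in> T" for t using that by (simp add: T_def)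
  note F = F1[OF TD TD] F2[OF TD TD] F3[OF TD] F4[OF TD TD] F5[OF TD TD TD] F6[OF TD TD] F7[OF TD TD] F8[OF TD TD]
  have pc: "p \<in> cball 0 1" using p by simp
  have J: "J2 p x y = J2 p y x" for x y by (rule J2_sym[OF pc])
  have hpp: "hdot p p = 1" using p by (rule hdot_unit)
  show ?thesis
  proof (cases "K = 0")
    case True
    have "J1 p t = 0" if "t \<in> T" for t using F(1)[OF that that] True by simp
    then show ?thesis by (auto simp: T_def)
  next
    case False
    have "\<exists>t0. t0 \<in> T \<and> t0 \<noteq> 0"
    proof (rule ccontr)
      assume c: "\<not> (\<exists>t0. t0 \<in> T \<and> t0 \<noteq> 0)"
      define f :: "complex^'a \<Rightarrow> complex^1" where "f v = (\<chi> i. hdot v p)" for v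
      have "lin f" by (rule linI) (simp_all add: f_def vec_eq_iff)
      moreover have "x = 0" if "f x = 0" for x using that c by (auto simp: f_def vec_eq_iff T_def)
      ultimately have "CARD('a) \<le> CARD(1)" by (rule lin_inj_card_le)
      then show False using dim by simp
    qed
    then obtain t0 where t0: "t0 \<in> T" "t0 \<noteq> 0" by blast
    have "of_real ((norm (J1 p t0))\<^sup>2) = complex_of_real (K * (norm t0)\<^sup>2)"
      using F(1)[OF t0(1) t0(1)] by (simp add: hdot_self)
    then have "(norm (J1 p t0))\<^sup>2 = K * (norm t0)\<^sup>2" using of_real_eq_iff by blast
    then have "0 \<le> K * (norm t0)\<^sup>2" by (metis zero_le_power2)
    then have K: "K > 0" using False t0(2) by (simp add: zero_le_mult_iff)
    define x where "x t = \<xi> t / of_real K" for t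
    \<comment> \<open>The component of the second fundamental form along the range of
      \<open>J1\<close> is removed: \<open>F4\<close> and conformality make \<open>h t t\<close>
      orthogonal to every tangential \<open>J1 p t'\<close>. The form \<open>b'\<close> is
      \<open>b\<close> corrected accordingly.\<close>
    define h where "h t t' = (1/2) *s (J2 p t t' - x t *s J1 p t' - x t' *s J1 p t)" for t t'
    define b' where "b' t t' = b t t' - \<xi> t * cnj (\<xi> t') / of_real K" for t t'
    have x1: "x (t + t') = x t + x t'" if "t \<in> T" "t' \<in> T" for t t' using F(2)[OF that] by (simp add: x_def add_divide_distrib)
    have x2: "x (l *s t) = l * x t" if "t \<in> T" for t l using F(3)[OF that] by (simp add: x_def)
    have h1: "h (t + t') s = h t s + h t' s" "h s (t + t') = h s t + h s t'" if "t \<in> T" "t' \<in> T" for t t' s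
      unfolding h_def x1[OF that] by (simp_all add: vec_eq_iff algebra_simps add_divide_distrib diff_divide_distrib)
    have h2: "h (l *s t) s = l *s h t s" "h s (l *s t) = l *s h s t" if "t \<in> T" for t s l
      by (simp_all add: h_def x2[OF that] vec_eq_iff algebra_simps)
    have hs: "h t t' = h t' t" for t t' by (simp add: h_def J[of t t'] vec_eq_iff algebra_simps)
    have J2h: "J2 p t t' = 2 *s h t t' + x t *s J1 p t' + x t' *s J1 p t" for t t' by (simp add: h_def vec_eq_iff)
    have b'1: "b' (t + t') s = b' t s + b' t' s" if "t \<in> T" "t' \<in> T" "s \<in> T" for t t' s
      unfolding b'_def F(2)[OF that(1,2)] F(5)[OF that] by (simp add: algebra_simps add_divide_distrib)
    have b'2: "b' (l *s t) s = l * b' t s" if "t \<in> T" "s \<in> T" for t l s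
      by (simp add: b'_def F(3)[OF that(1)] F(6)[OF that] algebra_simps)
    have b'3: "b' t' t = cnj (b' t t')" if "t \<in> T" "t' \<in> T" for t t'
      by (simp add: b'_def F(7)[OF that] mult.commute)
    have b'4: "b' s (t + t') = b' s t + b' s t'" if "t \<in> T" "t' \<in> T" "s \<in> T" for t t' s
      using b'1[OF that] b'3[of "t + t'" s] b'3[of t s] b'3[of t' s] T(1)[OF that(1,2)] that by simp
    have b'5: "b' s (l *s t) = cnj l * b' s t" if "t \<in> T" "s \<in> T" for t l s
      using b'2[OF that] b'3[of "l *s t" s] b'3[of t s] Ts[OF that(1)] that by simp
    have hL: "hdot (h t t) (J1 p t') = 0" if "t \<in> T" "t' \<in> T" for t t'
      using K F(4)[OF that] F(1)[OF that] by (simp add: h_def x_def field_simps)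
    have hh: "hdot (h t t) (h t' t') = hdot t t' * b' t t'" if t: "t \<in> T" "t' \<in> T" for t t'
    proof -
      have "hdot (h t t) (h t' t') = hdot (h t t) (J2 p t' t') / 2"
        unfolding h_def[of t' t'] using hL[OF t] by simp
      also have "\<dots> = (hdot (J2 p t t) (J2 p t' t') - 2 * x t * hdot (J1 p t) (J2 p t' t')) / 4"
        by (simp add: h_def field_simps)
      also have "hdot (J1 p t) (J2 p t' t') = 2 * (hdot t t' * cnj (\<xi> t'))"
        using arg_cong[OF F(4)[OF t(2,1)], of cnj] by (simp add: cnj_hdot)
      finally have "4 * hdot (h t t) (h t' t') = 4 * (hdot t t' * b t t' - x t * (hdot t t' * cnj (\<xi> t')))" using F(8)[OF t] by (simp add: field_simps)
      then have e: "hdot (h t t) (h t' t') = hdot t t' * b t t' - x t * (hdot t t' * cnj (\<xi> t'))" by (simp only: mult_cancel_left) simp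
      show ?thesis unfolding e by (simp add: x_def b'_def algebra_simps)
    qed
    have h2L: "hdot (h t t') (J1 p s) = 0" if "t \<in> T" "t' \<in> T" "s \<in> T" for t t' s
      using hL[OF T(1)[OF that(1,2)] that(3)] hL[OF that(1,3)] hL[OF that(2,3)] that T(1)
      by (simp add: h1 hs[of t' t])
    have hG: "hdot (h t t') (G0 p) = 0" if "t \<in> T" "t' \<in> T" for t t'
      using tangential_1(1)[OF p] tangential_2[OF p] that by (simp add: h_def T_def)
    have polar: "4 *s h t t' = h (t + t') (t + t') - h (t - t') (t - t')" if "t \<in> T" "t' \<in> T" for t t'
    proof -
      have "t - t' = t + (-1) *s t'" by simp
      then show ?thesis using that by (simp only: h1 h2 Ts hs[of t' t]) (simp add: vec_eq_iff)
    qed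
    show ?thesis
    proof (cases "\<forall>t\<in>T. h t t = 0")
      case True
      have "par (J1 p t) (J2 p t t)" if "t \<in> T" for t
        using J2h[of t t] True that par_scale[of "J1 p t" "2 * x t"] by (simp add: vec_eq_iff par_def algebra_simps)
      then show ?thesis by (auto simp: T_def)
    next
      case False
      then obtain t1 where t1: "t1 \<in> T" "h t1 t1 \<noteq> 0" by blast
      have bpos: "Re (b' t t) * (norm t)\<^sup>2 = (norm (h t t))\<^sup>2" "b' t t = of_real (Re (b' t t))" if "t \<in> T" for t
      proof -
        show r: "b' t t = of_real (Re (b' t t))" using b'3[OF that that] by (simp add: complex_eq_iff)
        have "of_real ((norm (h t t))\<^sup>2) = of_real ((norm t)\<^sup>2) * b' t t" using hh[OF that that] by (simp add: hdot_self)
        then have "of_real ((norm (h t t))\<^sup>2) = complex_of_real ((norm t)\<^sup>2 * Re (b' t t))" using r by (metis of_real_mult)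
        then show "Re (b' t t) * (norm t)\<^sup>2 = (norm (h t t))\<^sup>2" using of_real_eq_iff by (metis mult.commute)
      qed
      \<comment> \<open>Extended to all vectors, \<open>x\<close> has a representing vector; this
        gives the continuity in \<open>t\<close> that the maximum over the compact set
        \<open>S\<close> requires.\<close>
      define x' where "x' v = x (prj p v)" for v
      have pT: "prj p v \<in> T" for v by (simp add: T_def)
      have "\<exists>\<zeta>. \<forall>v. x' v = hdot v \<zeta>"
        by (rule functional_hdot) (simp_all add: x'_def prj_add prj_scale x1 x2 pT)
      then obtain \<zeta> where \<zeta>: "\<And>v. x' v = hdot v \<zeta>" by blast
      have x\<zeta>: "x t = hdot t \<zeta>" if "t \<in> T" for t
        using \<zeta>[of t] that by (simp add: x'_def T_def prj_id)
      define S where "S = T \<inter> sphere 0 1"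
      have "closed T" unfolding T_def by (intro closed_Collect_eq continuous_intros)
      then have cS: "compact S" unfolding S_def by (intro closed_Int_compact) auto
      have "(1 / of_real (norm t1)) *s t1 \<in> S" using t1 h2(1)[OF t1(1), of 0 t1] by (auto simp: S_def Ts norm_smult norm_divide)
      then have neS: "S \<noteq> {}" by blast
      have "continuous_on S (\<lambda>t. (norm ((1/2) *s (J2 p t t - (2 * hdot t \<zeta>) *s J1 p t)))\<^sup>2)"
        by (intro continuous_intros) (use p in auto)
      then obtain u where u: "u \<in> S" and um: "\<And>t. t \<in> S \<Longrightarrow> (norm ((1/2) *s (J2 p t t - (2 * hdot t \<zeta>) *s J1 p t)))\<^sup>2
          \<le> (norm ((1/2) *s (J2 p u u - (2 * hdot u \<zeta>) *s J1 p u)))\<^sup>2"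
        using continuous_attains_sup[OF cS neS] by blast
      have h\<zeta>: "(1/2) *s (J2 p t t - (2 * hdot t \<zeta>) *s J1 p t) = h t t" if "t \<in> T" for t
        by (simp add: h_def x\<zeta>[OF that] vec_eq_iff algebra_simps)
      have uT: "u \<in> T" "norm u = 1" using u by (auto simp: S_def)
      have huu: "hdot u u = 1" by (rule hdot_unit[OF uT(2)])
      define \<mu> where "\<mu> = Re (b' u u)"
      have max: "Re (b' t t) \<le> \<mu> * (norm t)\<^sup>2" if "t \<in> T" for t
      proof (cases "t = 0")
        case True
        then show ?thesis using b'2[OF that that, of 0] by simp
      next
        case False
        define s where "s = (1 / of_real (norm t)) *s t"
        have s: "s \<in> T" "norm s = 1" using False that by (auto simp: s_def Ts norm_smult norm_divide)
        have "(norm (h s s))\<^sup>2 \<le> (norm (h u u))\<^sup>2" using um[of s] s h\<zeta>[OF s(1)] h\<zeta>[OF uT(1)] by (simp add: S_def)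
        then have "Re (b' s s) \<le> \<mu>" using bpos(1)[OF s(1)] bpos(1)[OF uT(1)] s uT by (simp add: \<mu>_def)
        moreover have "b' s s = b' t t / of_real ((norm t)\<^sup>2)"
          using that by (simp add: s_def b'2 b'5 Ts power2_eq_square)
        ultimately show ?thesis using False bpos(2)[OF that]
          by (metis (no_types, lifting) Re_complex_of_real divide_le_eq norm_eq_zero of_real_divide power2_less_eq_zero_iff zero_less_power2 power_eq_0_iff)
      qed
      have "Re (b' t1 t1) * (norm t1)\<^sup>2 > 0" using bpos(1)[OF t1(1)] t1(2) by simp
      then have "Re (b' t1 t1) > 0" by (simp add: zero_less_mult_iff)
      then have "0 < \<mu> * (norm t1)\<^sup>2" using max[OF t1(1)] by linarith
      then have \<mu>: "\<mu> > 0" by (simp add: zero_less_mult_iff)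
      have buu: "b' u u = of_real \<mu>" using bpos(2)[OF uT(1)] by (simp add: \<mu>_def)
      \<comment> \<open>At a maximiser the mixed terms of the Hermitian form vanish, since otherwise
        \<open>u + l *s y\<close> with small \<open>l\<close> would give a larger value.\<close>
      have buy: "b' u y = 0" if y: "y \<in> T" "hdot y u = 0" for y
      proof (rule quadratic_form_no_linear_part[where A = "\<mu> * (norm y)\<^sup>2"])
        fix l
        have uy: "hdot u y = 0" using y(2) hdot_0_sym[of y u] by simp
        have "Re (b' (u + l *s y) (u + l *s y)) \<le> \<mu> * (norm (u + l *s y))\<^sup>2" by (rule max) (simp add: T Ts uT y)
        moreover have "(norm (u + l *s y))\<^sup>2 = 1 + (cmod l)\<^sup>2 * (norm y)\<^sup>2"
          using uT uy by (simp add: norm_add_sq norm_smult power_mult_distrib)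
        moreover have "b' (u + l *s y) (u + l *s y) = of_real \<mu> + cnj l * b' u y + l * cnj (b' u y) + (l * cnj l) * b' y y"
          using uT y b'3[OF uT(1) y(1)] by (simp add: b'1 b'2 b'4 b'5 T Ts buu algebra_simps)
        moreover have "Re (l * cnj (b' u y)) = Re (cnj l * b' u y)" by simp
        moreover have "0 \<le> Re ((l * cnj l) * b' y y)"
        proof -
          have "0 \<le> Re (b' y y)"
          proof (cases "y = 0")
            case True then show ?thesis using b'2[OF y(1,1), of 0] by simp
          next
            case False
            then have "0 < (norm y)\<^sup>2" by simp
            then show ?thesis using bpos(1)[OF y(1)] by (metis zero_le_power2 zero_le_mult_iff not_le)
          qed
          then show ?thesis by (metis bpos(2)[OF y(1)] complex_norm_square of_real_mult Re_complex_of_real mult_nonneg_nonneg zero_le_power2)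
        qed
        ultimately show "2 * Re (cnj l * b' u y) \<le> (cmod l)\<^sup>2 * (\<mu> * (norm y)\<^sup>2)"
          by (simp add: algebra_simps)
      qed
      have byu: "b' y u = 0" if "y \<in> T" "hdot y u = 0" for y using buy[OF that] b'3[OF uT(1) that(1)] by simp
      have hyu: "hdot u y = 0" if "hdot y u = 0" for y using that hdot_0_sym[of y u] by simp
      have e1: "hdot (h u y) (h s s) = (hdot u s * b' y s + hdot y s * b' u s) / 2" if "y \<in> T" "s \<in> T" for y s
      proof -
        have "hdot (4 *s h u y) (h s s) = hdot (u + y) s * b' (u + y) s - hdot (u - y) s * b' (u - y) s"
          unfolding polar[OF uT(1) that(1)] using that uT by (simp add: hh T)
        moreover have "b' (u - y) s = b' u s - b' y s"
          using b'1[OF uT(1) Ts[OF that(1), of "-1"] that(2)] b'2[OF that, of "-1"] by simp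
        ultimately have "4 * hdot (h u y) (h s s) = 4 * ((hdot u s * b' y s + hdot y s * b' u s) / 2)"
          using that uT by (simp add: b'1 algebra_simps)
        then show ?thesis by (simp only: mult_cancel_left) simp
      qed
      have e2: "hdot (h u y) (h u y) = (b' y y + of_real \<mu> * hdot y y) / 4" if y: "y \<in> T" "hdot y u = 0" for y
      proof -
        have "hdot (h u y) (4 *s h u y) = hdot (h u y) (h (u + y) (u + y)) - hdot (h u y) (h (u - y) (u - y))"
          by (simp add: polar[OF uT(1) y(1)])
        also have "\<dots> = b' y y + of_real \<mu> * hdot y y"
        proof -
          have "b' y (u + y) = b' y y" "b' u (u + y) = of_real \<mu>" using y uT by (simp_all add: b'4 byu buy buu)
          moreover have "u - y = u + (-1) *s y" by simp
          moreover have "b' y (u + (-1) *s y) = - b' y y" "b' u (u + (-1) *s y) = of_real \<mu>"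
            using y uT by (simp_all only: b'4 b'5 Ts byu buy buu) auto
          ultimately show ?thesis using y uT T Ts by (simp add: e1 huu hyu add_divide_distrib diff_divide_distrib)
        qed
        finally show ?thesis by (simp add: eq_divide_eq mult.commute)
      qed
      have e3: "hdot (h u u) (h u y) = 0" if y: "y \<in> T" "hdot y u = 0" for y
        using e1[OF y(1) uT(1)] byu[OF y] y by (metis add_0 cnj_hdot complex_cnj_zero divide_eq_0_iff mult_zero_left mult_zero_right)
      have e4: "hdot (h u u) (h y y) = 0" if y: "y \<in> T" "hdot y u = 0" for y
        using hh[OF uT(1) y(1)] hyu[OF y(2)] by simp
      have e5: "hdot (h u y') (h y y) = 0" if y: "y \<in> T" "hdot y u = 0" "y' \<in> T" "hdot y' u = 0" for y y'
        using e1[OF y(3,1)] hyu[OF y(2)] buy[OF y(1,2)] by simp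
      \<comment> \<open>For \<open>y\<close> orthogonal to \<open>u\<close>, \<open>e2\<close>
        bounds the squared length of \<open>h u y\<close> below by \<open>\<mu> |y|^2 / 4\<close>,
        and \<open>e3\<close> separates the component along \<open>u\<close>.\<close>
      have huy0: "y = 0" if y: "y \<in> T" "h u y = 0" for y
      proof -
        define a y' where "a = hdot y u" and "y' = y - a *s u"
        have y': "y' \<in> T" "hdot y' u = 0" "y = a *s u + y'" using y uT T Ts by (auto simp: y'_def a_def huu)
        have "h u y = a *s h u u + h u y'" using y' uT Ts by (simp add: h1 h2)
        then have z: "a *s h u u + h u y' = 0" using y by simp
        then have "hdot (a *s h u u + h u y') (h u y') = 0" "hdot (a *s h u u + h u y') (h u u) = 0" by simp_all
        moreover have "hdot (h u y') (h u u) = 0" using e3[OF y'(1,2)] hdot_0_sym by blast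
        moreover have "hdot (h u u) (h u u) = of_real \<mu>" using hh[OF uT(1,1)] huu buu by simp
        ultimately have "a = 0" "hdot (h u y') (h u y') = 0" using e3[OF y'(1,2)] \<mu> by auto
        moreover have "of_real (Re (b' y' y') + \<mu> * (norm y')\<^sup>2) = complex_of_real 0"
          using e2[OF y'(1,2)] \<open>hdot (h u y') (h u y') = 0\<close> bpos(2)[OF y'(1)] by (simp add: hdot_self)
        then have r: "Re (b' y' y') + \<mu> * (norm y')\<^sup>2 = 0" using of_real_eq_iff by blast
        have "y' = 0"
        proof (rule ccontr)
          assume "y' \<noteq> 0"
          then have n: "0 < (norm y')\<^sup>2" by simp
          then have "0 \<le> Re (b' y' y')" using bpos(1)[OF y'(1)] by (metis zero_le_power2 zero_le_mult_iff not_le)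
          moreover have "0 < \<mu> * (norm y')\<^sup>2" using n \<mu> by simp
          ultimately show False using r by linarith
        qed
        ultimately show "y = 0" using y'(3) by simp
      qed
      have Gn: "hdot (G0 p) (G0 p) = 1" using bdry[OF p] by (rule hdot_unit)
      have L0: "t = 0" if "t \<in> T" "J1 p t = 0" for t using F(1)[OF that(1,1)] that(2) K by simp
      have LG: "hdot (J1 p t) (G0 p) = 0" if "t \<in> T" for t using tangential_1(1)[OF p] that by (simp add: T_def)
      have null: "h y y = 0" if y: "y \<in> T" "hdot y u = 0" for y
      proof (rule ccontr)
        assume hy: "h y y \<noteq> 0"
        \<comment> \<open>Two copies of the source have one dimension more than the target. The two
          components along \<open>p\<close> multiply \<open>G0 p\<close> and \<open>h y y\<close>,
          the tangential parts go through \<open>J1 p\<close> and \<open>h u\<close>; if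
          \<open>h y y\<close> were nonzero, this map would be injective.\<close>
        define f :: "complex^('a+'a) \<Rightarrow> complex^'b" where
          "f v = hdot (fsv v) p *s G0 p + J1 p (prj p (fsv v)) + hdot (snv v) p *s h y y + h u (prj p (snv v))" for v
        have "lin f" by (rule linI) (simp_all add: f_def prj_add prj_scale h1 h2 pT vec_eq_iff algebra_simps)
        moreover have "v = 0" if f0: "f v = 0" for v
        proof -
          have "hdot (f v) (G0 p) = 0" using f0 by simp
          then have a: "hdot (fsv v) p = 0" using LG[OF pT] hG[OF y(1,1)] hG[OF uT(1) pT] Gn by (simp add: f_def)
          have "hdot (f v) (J1 p (prj p (fsv v))) = 0" using f0 by simp
          then have "hdot (J1 p (prj p (fsv v))) (J1 p (prj p (fsv v))) = 0"
            using a h2L[OF y(1,1) pT] h2L[OF uT(1) pT pT] by (simp add: f_def)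
          then have "prj p (fsv v) = 0" using L0[OF pT] by simp
          then have fv: "fsv v = 0" using a by (simp add: prj_def)
          have yo: "hdot (h u (prj p (snv v))) (h y y) = 0"
          proof -
            define a y' where "a = hdot (prj p (snv v)) u" and "y' = prj p (snv v) - a *s u"
            have y': "y' \<in> T" "hdot y' u = 0" "prj p (snv v) = a *s u + y'" using pT uT T Ts by (auto simp: y'_def a_def huu)
            have "h u (prj p (snv v)) = a *s h u u + h u y'" unfolding y'(3) using y' uT Ts by (simp add: h1 h2)
            then show ?thesis using e4[OF y] e5[OF y y'(1,2)] by simp
          qed
          have "hdot (f v) (h y y) = 0" using f0 by simp
          then have c: "hdot (snv v) p = 0" using a fv yo hy by (simp add: f_def prj_def)
          then have "h u (prj p (snv v)) = 0" using f0 a fv by (simp add: f_def lin_0[OF lin_J1] prj_def)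
          then have "prj p (snv v) = 0" using huy0[OF pT] by simp
          then have "snv v = 0" using c by (simp add: prj_def)
          then show "v = 0" using fv prv_eq_0 by blast
        qed
        ultimately have "CARD('a + 'a) \<le> CARD('b)" by (rule lin_inj_card_le)
        then show False using dim by simp
      qed
      \<comment> \<open>With \<open>t = hdot t u *s u + y\<close> and \<open>h y y = 0\<close>, the
        vector \<open>h t t\<close> is divisible by \<open>hdot t u\<close>, and \<open>U t\<close>
        is the cofactor.\<close>
      define U where "U t = h u (2 *s t - hdot t u *s u)" for t
      have U: "U t = 2 *s h u t - hdot t u *s h u u" if "t \<in> T" for t
      proof -
        have "U t = h u (2 *s t + (- hdot t u) *s u)" by (simp add: U_def vec_eq_iff)
        also have "\<dots> = 2 *s h u t + (- hdot t u) *s h u u" using that uT Ts by (simp only: h1 h2)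
        finally show ?thesis by (simp add: vec_eq_iff)
      qed
      have J2U: "J2 p t t = (2 * x t) *s J1 p t + (2 * hdot t u) *s U t" if t: "t \<in> T" for t
      proof -
        define y where "y = t - hdot t u *s u"
        have y: "y \<in> T" "hdot y u = 0" "t = hdot t u *s u + y" using t uT T Ts by (auto simp: y_def huu)
        have y2: "y = t + (- hdot t u) *s u" by (simp add: y_def)
        have "h y y = h t t - (2 * hdot t u) *s h u t + (hdot t u * hdot t u) *s h u u"
          using t uT Ts by (simp only: y2 h1 h2 T hs[of t u]) (simp add: vec_eq_iff algebra_simps)
        then have "h t t = (2 * hdot t u) *s h u t - (hdot t u * hdot t u) *s h u u" using null[OF y(1,2)] by (simp add: vec_eq_iff algebra_simps)
        then have "h t t = hdot t u *s U t" unfolding U[OF t] by (simp add: vec_eq_iff algebra_simps)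
        then show ?thesis using J2h[of t t] by (simp add: vec_eq_iff algebra_simps)
      qed
      have surj: "\<exists>v y. hdot y p = 0 \<and> J1 p v + J2 p u y = e" for e
      proof -
        \<comment> \<open>The additional coordinate carries the constraint that \<open>y\<close> is
          tangential and makes the linear system square, so injectivity suffices.\<close>
        define f :: "complex^('a+'a) \<Rightarrow> complex^('b option)" where
          "f v = (\<chi> j. case j of None \<Rightarrow> hdot (snv v) p | Some k \<Rightarrow> (J1 p (fsv v) + J2 p u (prj p (snv v))) $ k)" for v
        have "lin f" by (rule linI) (simp_all add: f_def prj_add prj_scale vec_eq_iff algebra_simps split: option.split)
        moreover have "v = 0" if f0: "f v = 0" for v
        proof -
          have a: "hdot (snv v) p = 0" using f0 by (auto simp: f_def vec_eq_iff dest: spec[of _ None])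
          have b: "J1 p (fsv v) + J2 p u (snv v) = 0"
          proof -
            have "(J1 p (fsv v) + J2 p u (prj p (snv v))) $ k = 0" for k
              using arg_cong[OF f0, of "\<lambda>e. e $ Some k"] by (simp add: f_def)
            then show ?thesis using a by (simp add: vec_eq_iff prj_id)
          qed
          have sT: "snv v \<in> T" using a by (simp add: T_def)
          have d: "fsv v = hdot (fsv v) p *s p + prj p (fsv v)" by (simp add: prj_def hpp)
          have b2: "hdot (fsv v) p *s J1 p p + (J1 p (prj p (fsv v) + x u *s snv v + x (snv v) *s u) + 2 *s h u (snv v)) = 0"
            using b J2h[of u "snv v"] by (subst (asm) d) (simp add: vec_eq_iff algebra_simps)
          have tt: "prj p (fsv v) + x u *s snv v + x (snv v) *s u \<in> T" using pT sT uT T Ts by simp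
          have "hdot (fsv v) p * hdot (J1 p p) (G0 p) = 0"
            using arg_cong[OF b2, of "\<lambda>e. hdot e (G0 p)"] LG[OF tt] hG[OF uT(1) sT] by (simp only: hdot_add hdot_scale hdot_zero) simp
          then have c: "hdot (fsv v) p = 0" using K KF by auto
          then have b3: "J1 p (prj p (fsv v) + x u *s snv v + x (snv v) *s u) + 2 *s h u (snv v) = 0" using b2 by simp
          have "hdot (J1 p (prj p (fsv v) + x u *s snv v + x (snv v) *s u)) (J1 p (prj p (fsv v) + x u *s snv v + x (snv v) *s u)) = 0"
            using arg_cong[OF b3, of "\<lambda>e. hdot e (J1 p (prj p (fsv v) + x u *s snv v + x (snv v) *s u))"] h2L[OF uT(1) sT tt]
            by (simp only: hdot_add(1) hdot_scale(1) hdot_zero) simp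
          then have z: "J1 p (prj p (fsv v) + x u *s snv v + x (snv v) *s u) = 0" by (simp only: hdot_eq_0_iff)
          then have "2 *s h u (snv v) = 0" using b3 by simp
          then have "h u (snv v) = 0" by (simp add: vec_eq_iff)
          then have s0: "snv v = 0" using huy0[OF sT] by simp
          have "prj p (fsv v) + x u *s snv v + x (snv v) *s u = 0" by (rule L0[OF tt z])
          moreover have "x 0 = 0" using x2[of 0 0] by (simp add: T_def)
          ultimately have "prj p (fsv v) = 0" using s0 by simp
          then have "fsv v = 0" using c by (simp add: prj_def)
          then show "v = 0" using s0 prv_eq_0 by blast
        qed
        moreover have "CARD('a + 'a) = CARD('b option)" using dim by simp
        ultimately obtain v where v: "f v = (\<chi> j. case j of None \<Rightarrow> 0 | Some k \<Rightarrow> e $ k)" using lin_inj_surj by metis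
        then have "J1 p (fsv v) + J2 p u (prj p (snv v)) = e"
        proof -
          have "(J1 p (fsv v) + J2 p u (prj p (snv v))) $ k = e $ k" for k
            using arg_cong[OF v, of "\<lambda>e. e $ Some k"] by (simp add: f_def)
          then show ?thesis by (simp add: vec_eq_iff)
        qed
        then show ?thesis using hdot_prj by blast
      qed
      have "U (t + t') = U t + U t'" if "t \<in> T" "t' \<in> T" for t t'
        using that uT by (simp add: U T h1 vec_eq_iff algebra_simps)
      moreover have "U (c *s t) = c *s U t" if "t \<in> T" for t c
        using that uT by (simp add: U Ts h2 vec_eq_iff algebra_simps)
      ultimately show ?thesis
        apply (intro disjI2 exI[of _ u] exI[of _ x] exI[of _ U] conjI)
        using uT K KF surj x1 x2 J2U unfolding T_def mem_Collect_eq by metis+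
    qed
  qed
qed

end

section \<open>Asymptotic directions at all points of the ball\<close>

lemma ex_orthogonal: assumes "CARD('a) \<ge> 2" shows "\<exists>w::complex^'a. norm w = 1 \<and> hdot v w = 0"
proof -
  have "\<not> card (UNIV :: 'a set) \<le> Suc 0" using assms by simp
  then obtain i j :: 'a where ij: "i \<noteq> j" by (auto simp: card_le_Suc0_iff_eq)
  define w where "w = (if v $ i = 0 then axis i 1 else cnj (v $ j) *s axis i 1 - cnj (v $ i) *s axis j (1::complex))"
  have "w $ i \<noteq> 0 \<or> w $ j \<noteq> 0" using ij by (auto simp: w_def axis_def)
  then have w0: "w \<noteq> 0" by auto
  have "hdot v w = 0" by (simp add: w_def)
  then have "hdot v ((1 / of_real (norm w)) *s w) = 0" by simp
  moreover have "norm ((1 / of_real (norm w)) *s w) = 1" using w0 by (simp add: norm_smult norm_divide)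
  ultimately show ?thesis by blast
qed

lemma ex_orthogonal2:
  fixes v w :: "complex^'a"
  assumes "CARD('a) \<ge> 3" shows "\<exists>x. norm x = 1 \<and> hdot v x = 0 \<and> hdot w x = 0"
proof -
  define f where "f x = (\<chi> i::2. if i = 1 then hdot x v else hdot x w)" for x :: "complex^'a"
  have l: "lin f" by (rule linI) (auto simp: f_def vec_eq_iff)
  have "\<not> (\<forall>x. f x = 0 \<longrightarrow> x = 0)"
  proof
    assume "\<forall>x. f x = 0 \<longrightarrow> x = 0"
    then have "CARD('a) \<le> CARD(2)" using lin_inj_card_le[OF l] by blast
    then show False using assms by simp
  qed
  then obtain x where x: "f x = 0" "x \<noteq> 0" by blast
  have "hdot x v = 0" using arg_cong[OF x(1), of "\<lambda>y. y $ 1"] by (simp add: f_def)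
  moreover have "hdot x w = 0" using arg_cong[OF x(1), of "\<lambda>y. y $ 2"] by (simp add: f_def)
  ultimately have "hdot v ((1 / of_real (norm x)) *s x) = 0" "hdot w ((1 / of_real (norm x)) *s x) = 0"
    using hdot_0_sym[of x v] hdot_0_sym[of x w] by simp_all
  moreover have "norm ((1 / of_real (norm x)) *s x) = 1" using x by (simp add: norm_smult norm_divide)
  ultimately show ?thesis by blast
qed

context jets begin

text \<open>If all tangential vectors are asymptotic, the determinants vanish and
  \<open>asym\<close> is 0. Otherwise the terms along \<open>J1\<close> drop out of the
  determinants, and \<open>asym\<close> becomes a multiple of
  \<open>hdot v u *s w - hdot w u *s v\<close>. This vector is orthogonal to \<open>u\<close>, so
  the term with \<open>U\<close> disappears.\<close>

lemma asym_bd: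
  assumes p: "norm p = 1" and vw: "hdot v p = 0" "hdot w p = 0" and dim: "CARD('b) + 1 = 2 * CARD('a)" "CARD('a) \<ge> 2"
  shows "par (J1 p (asym l p v w)) (J2 p (asym l p v w) (asym l p v w))"
proof -
  consider "\<forall>t. hdot t p = 0 \<longrightarrow> par (J1 p t) (J2 p t t)"
    | (nd) u x U where "\<And>t t'. hdot t p = 0 \<Longrightarrow> hdot t' p = 0 \<Longrightarrow> x (t + t') = x t + x t' \<and> U (t + t') = U t + U t'"
      "\<And>t. hdot t p = 0 \<Longrightarrow> J2 p t t = (2 * x t) *s J1 p t + (2 * hdot t u) *s U t"
    using boundary_dichotomy[OF p dim] by blast
  then show ?thesis
  proof cases
    case 1
    then have "par (J1 p v) (J2 p v v)" using vw by blast
    then have "asym l p v w = 0" by (simp add: asym_def D4_par)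
    then show ?thesis by simp
  next
    case nd
    note J = nd(2)
    have xU: "x (v + w) = x v + x w" "U (v + w) = U v + U w" using nd(1)[OF vw] by auto
    define \<alpha> \<beta> where "\<alpha> = hdot v u" and "\<beta> = hdot w u"
    have Jw: "J2 p w w = (2 * x w) *s J1 p w + (2 * \<beta>) *s U w" and Jv: "J2 p v v = (2 * x v) *s J1 p v + (2 * \<alpha>) *s U v"
      using J vw by (simp_all add: \<alpha>_def \<beta>_def)
    have "J2 p (v + w) (v + w) = (2 * (x v + x w)) *s J1 p (v + w) + (2 * (\<alpha> + \<beta>)) *s (U v + U w)"
      using J[of "v + w"] vw by (simp add: xU \<alpha>_def \<beta>_def)
    moreover have "J2 p w v = J2 p v w" by (rule J2_sym) (use p in simp)
    ultimately have "2 *s J2 p v w = 2 *s (x w *s J1 p v + x v *s J1 p w + \<beta> *s U v + \<alpha> *s U w)"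
      using Jv Jw by (simp add: vec_eq_iff algebra_simps)
    then have Jvw: "J2 p v w = x w *s J1 p v + (x v *s J1 p w + (\<beta> *s U v + \<alpha> *s U w))"
      unfolding vector_mul_lcancel by (simp add: add.assoc)
    define \<Omega> where "\<Omega> = D4 l (J1 p v) (J1 p w) (U v) (U w)"
    have P: "D4 l (J1 p v) (J1 p w) (J2 p v v) (J2 p v w) = 2 * \<alpha> * \<alpha> * \<Omega>"
      unfolding Jv Jvw by (simp add: D4_lin D4_alt(1,3,4) D4_alt' \<Omega>_def)
    have Q: "D4 l (J1 p v) (J1 p w) (J2 p v v) (J2 p w w) = 4 * \<alpha> * \<beta> * \<Omega>"
      unfolding Jv Jw by (simp add: D4_lin D4_alt(1,3,4) D4_alt' \<Omega>_def)
    define d where "d = \<alpha> *s w - \<beta> *s v"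
    have a: "asym l p v w = (4 * \<alpha> * \<Omega>) *s d" unfolding asym_def P Q by (simp add: d_def vec_eq_iff algebra_simps)
    have "hdot d u = 0" "hdot d p = 0" using vw by (simp_all add: d_def \<alpha>_def \<beta>_def)
    then have "J2 p d d = (2 * x d) *s J1 p d" using J by simp
    then show ?thesis by (simp add: a par_def)
  qed
qed

text \<open>To free \<open>v\<close> and \<open>w\<close> from the orthogonality condition, take
  \<open>w0\<close> orthogonal to both, tilt it by \<open>\<epsilon>\<close> times \<open>z\<close>
  so that \<open>z\<close> has a nonzero product with it, project \<open>v\<close> and
  \<open>w\<close>, and let \<open>\<epsilon>\<close> tend to 0.\<close>

lemma asym_par_all:
  assumes z: "z \<in> cball 0 1" "z \<noteq> 0" and dim: "CARD('b) + 1 = 2 * CARD('a)" "CARD('a) \<ge> 3"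
  shows "par (J1 z (asym l z v w)) (J2 z (asym l z v w) (asym l z v w))"
  unfolding par_def
proof (intro allI)
  fix i j
  obtain w0 where w0: "norm w0 = 1" "hdot v w0 = 0" "hdot w w0 = 0" using ex_orthogonal2[OF dim(2)] by blast
  define W where "W \<epsilon> = w0 + of_real \<epsilon> *s z" for \<epsilon> :: real
  define f where "f \<epsilon> = asym l z (prj (W \<epsilon>) v) (prj (W \<epsilon>) w)" for \<epsilon>
  define g where "g \<epsilon> = J1 z (f \<epsilon>) $ i * J2 z (f \<epsilon>) (f \<epsilon>) $ j - J1 z (f \<epsilon>) $ j * J2 z (f \<epsilon>) (f \<epsilon>) $ i" for \<epsilon>
  have Wt: "(W \<longlongrightarrow> w0) (at_right 0)"
  proof -
    have "((\<lambda>\<epsilon>. w0 + of_real \<epsilon> *s z) \<longlongrightarrow> w0 + of_real 0 *s z) (at_right 0)" by (intro tendsto_intros)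
    then show ?thesis by (simp add: W_def[abs_def])
  qed
  have n0: "hdot w0 w0 = 1" using w0 by (simp add: hdot_unit)
  have pt: "((\<lambda>\<epsilon>. prj (W \<epsilon>) y) \<longlongrightarrow> y) (at_right 0)" if "hdot y w0 = 0" for y
  proof -
    have "((\<lambda>\<epsilon>. y - (hdot y (W \<epsilon>) / hdot (W \<epsilon>) (W \<epsilon>)) *s W \<epsilon>) \<longlongrightarrow> y - (hdot y w0 / hdot w0 w0) *s w0) (at_right 0)"
      by (intro tendsto_intros Wt) (simp add: n0)
    then show ?thesis by (simp add: prj_def that)
  qed
  have tJ1: "((\<lambda>\<epsilon>. J1 z (F \<epsilon>)) \<longlongrightarrow> J1 z y) (at_right 0)" if "(F \<longlongrightarrow> y) (at_right (0::real))" for F y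
    unfolding J1_def by (intro tendsto_intros that)
  have tJ: "((\<lambda>\<epsilon>. J2 z (F \<epsilon>) (F' \<epsilon>)) \<longlongrightarrow> J2 z y y') (at_right 0)"
    if "(F \<longlongrightarrow> y) (at_right (0::real))" "(F' \<longlongrightarrow> y') (at_right 0)" for F F' y y'
    unfolding J2_def by (intro tendsto_intros that)
  have tD: "((\<lambda>\<epsilon>. D4 l (A \<epsilon>) (B \<epsilon>) (C \<epsilon>) (D \<epsilon>)) \<longlongrightarrow> D4 l a b c d) (at_right (0::real))"
    if "(A \<longlongrightarrow> a) (at_right 0)" "(B \<longlongrightarrow> b) (at_right 0)" "(C \<longlongrightarrow> c) (at_right 0)" "(D \<longlongrightarrow> d) (at_right 0)" for A B C D a b c d
    unfolding D4_def m2_def by (intro tendsto_intros that)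
  have tf: "(f \<longlongrightarrow> asym l z v w) (at_right 0)"
    unfolding f_def asym_def by (intro tendsto_intros tD tJ1 tJ pt w0)
  have "(g \<longlongrightarrow> J1 z (asym l z v w) $ i * J2 z (asym l z v w) (asym l z v w) $ j
      - J1 z (asym l z v w) $ j * J2 z (asym l z v w) (asym l z v w) $ i) (at_right 0)"
    unfolding g_def by (intro tendsto_intros tendsto_vec_nth tJ1 tJ tf)
  moreover have "eventually (\<lambda>\<epsilon>. g \<epsilon> = 0) (at_right 0)"
  proof -
    have "eventually (\<lambda>\<epsilon>. hdot z (W \<epsilon>) \<noteq> 0) (at_right 0)"
    proof (cases "hdot z w0 = 0")
      case True
      then have "hdot z (W \<epsilon>) \<noteq> 0" if "\<epsilon> > 0" for \<epsilon> using z that by (simp add: W_def)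
      then show ?thesis by (auto simp: eventually_at_right_less intro: eventually_mono[OF eventually_at_right_less])
    next
      case False
      show ?thesis by (rule tendsto_imp_eventually_ne[OF _ False]) (intro tendsto_intros Wt)
    qed
    then show ?thesis
    proof (rule eventually_mono)
      fix \<epsilon> assume e: "hdot z (W \<epsilon>) \<noteq> 0"
      define w' where "w' = cnj (1 / hdot z (W \<epsilon>)) *s W \<epsilon>"
      have "hdot z w' = 1" "hdot (prj (W \<epsilon>) v) w' = 0" "hdot (prj (W \<epsilon>) w) w' = 0" using e by (simp_all add: w'_def)
      moreover have "CARD('a) \<ge> 2" using dim by simp
      ultimately have "par (J1 z (f \<epsilon>)) (J2 z (f \<epsilon>) (f \<epsilon>))"
        unfolding f_def using asym_par[OF asym_bd[OF _ _ _ dim(1)] z(1), of w' "prj (W \<epsilon>) v" "prj (W \<epsilon>) w" l] by blast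
      then show "g \<epsilon> = 0" by (simp add: g_def par_def)
    qed
  qed
  ultimately have "J1 z (asym l z v w) $ i * J2 z (asym l z v w) (asym l z v w) $ j
      - J1 z (asym l z v w) $ j * J2 z (asym l z v w) (asym l z v w) $ i = 0"
    using tendsto_eventually tendsto_unique[OF trivial_limit_at_right_real] by blast
  then show "J1 z (asym l z v w) $ i * J2 z (asym l z v w) (asym l z v w) $ j
      = J1 z (asym l z v w) $ j * J2 z (asym l z v w) (asym l z v w) $ i" by simp
qed

end

section \<open>Pairs of first and second fundamental forms\<close>

lemma dual_vector: assumes "\<And>c. y \<noteq> c *s u" shows "\<exists>\<eta>. hdot u \<eta> = 0 \<and> hdot y \<eta> = 1"
proof -
  define y' where "y' = prj u y"
  have y: "y = (hdot y u / hdot u u) *s u + y'" unfolding y'_def by (rule prj_decomp)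
  have "y' \<noteq> 0" using assms[of "hdot y u / hdot u u"] y by auto
  moreover have u: "hdot u y' = 0" using hdot_0_sym[of u y'] by (simp add: y'_def)
  moreover have "hdot y y' = hdot y' y'" using u y by (metis add_0 hdot_add(1) hdot_scale(1) mult_zero_right)
  ultimately have "hdot u ((1 / cnj (hdot y' y')) *s y') = 0 \<and> hdot y ((1 / cnj (hdot y' y')) *s y') = 1" by simp
  then show ?thesis by blast
qed

locale bilinear_form =
  fixes L :: "complex^'a \<Rightarrow> complex^'b" and B :: "complex^'a \<Rightarrow> complex^'a \<Rightarrow> complex^'b"
  assumes linL: "lin L" and B_add: "B (v + v') y = B v y + B v' y" and B_scale: "B (c *s v) y = c *s B v y" and B_sym: "B v y = B y v"
begin

lemma B_add2: "B y (v + v') = B y v + B y v'" and B_scale2: "B y (c *s v) = c *s B y v"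
  using B_add[of v v' y] B_scale[of c v y] by (simp_all add: B_sym[of y])
lemma linB: "lin (B y)" by (rule linI) (simp_all add: B_add2 B_scale2)

lemmas L_simps = lin_add[OF linL] lin_scale[OF linL] lin_diff[OF linL] lin_0[OF linL] lin_neg[OF linL]
lemmas B_simps = B_add B_scale B_add2 B_scale2 lin_0[OF linB] lin_diff[OF linB] lin_neg[OF linB]

lemma B_0: "B 0 y = 0"
  by (simp add: B_sym[of _ y] B_simps)

definition asy :: "complex^'a \<Rightarrow> bool" where "asy d \<longleftrightarrow> par (L d) (B d d)"

lemma asy_scale: "asy d \<Longrightarrow> asy (c *s d)"
  by (simp add: asy_def par_def L_simps B_simps)

lemma asy_0 [simp]: "asy 0" by (simp add: asy_def L_simps)

text \<open>Each minor is a cubic polynomial in \<open>s\<close>, and its values at 1, -1, 2 and -2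
  determine the constant term.\<close>

lemma asy_limit:
  assumes a: "\<And>s. s \<noteq> 0 \<Longrightarrow> asy (s *s d + v)" shows "asy v"
  unfolding asy_def par_def
proof (intro allI)
  fix i j
  define f where "f s = L (s *s d + v) $ i * B (s *s d + v) (s *s d + v) $ j - L (s *s d + v) $ j * B (s *s d + v) (s *s d + v) $ i" for s
  have f0: "f s = 0" if "s \<noteq> 0" for s
    using a[OF that] by (simp add: f_def asy_def par_def)
  define c0 c1 c2 c3 where "c0 = L v $ i * B v v $ j - L v $ j * B v v $ i"
    and "c1 = L d $ i * B v v $ j - L d $ j * B v v $ i + 2 * (L v $ i * B d v $ j - L v $ j * B d v $ i)"
    and "c2 = L v $ i * B d d $ j - L v $ j * B d d $ i + 2 * (L d $ i * B d v $ j - L d $ j * B d v $ i)"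
    and "c3 = L d $ i * B d d $ j - L d $ j * B d d $ i"
  have f: "f s = c0 + c1 * s + c2 * (s * s) + c3 * (s * s * s)" for s
    unfolding f_def L_simps B_simps B_sym[of v d] c0_def c1_def c2_def c3_def by (simp add: algebra_simps)
  have "c0 + c1 + c2 + c3 = 0" using f[of 1] f0[of 1] by simp
  moreover have "c0 - c1 + c2 - c3 = 0" using f[of "-1"] f0[of "-1"] by simp
  moreover have "c0 + 2 * c1 + 4 * c2 + 8 * c3 = 0" using f[of 2] f0[of 2] by (simp add: mult.commute)
  moreover have "c0 - 2 * c1 + 4 * c2 - 8 * c3 = 0" using f[of "-2"] f0[of "-2"] by (simp add: mult.commute)
  ultimately have "6 * c0 = 0" by algebra
  then show "L v $ i * B v v $ j = L v $ j * B v v $ i" by (simp add: c0_def)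
qed

lemma asyD: assumes "asy d" "\<And>x. L x = 0 \<Longrightarrow> x = 0" shows "\<exists>c. B d d = (2 * c) *s L d"
proof (cases "d = 0")
  case False
  then have "L d \<noteq> 0" using assms(2) by blast
  then obtain c where "B d d = c *s L d" using parD assms(1) asy_def by blast
  then have "B d d = (2 * (c / 2)) *s L d" by simp
  then show ?thesis by blast
qed (simp add: B_0)

text \<open>Comparing \<open>B (d + d') (d + d')\<close> with \<open>B (d + 2 d') (d + 2 d')\<close> for independent \<open>d, d'\<close> shows additivity.\<close>

lemma asymptotic_subspace:
  assumes S: "\<And>d d'. d \<in> S \<Longrightarrow> d' \<in> S \<Longrightarrow> d + d' \<in> S" "\<And>c d. d \<in> S \<Longrightarrow> c *s d \<in> S"
    and asy: "\<And>d. d \<in> S \<Longrightarrow> asy d" and inj: "\<And>x. L x = 0 \<Longrightarrow> x = 0"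
  shows "\<exists>x. (\<forall>d\<in>S. \<forall>d'\<in>S. x (d + d') = x d + x d') \<and> (\<forall>d\<in>S. \<forall>c. x (c *s d) = c * x d) \<and> (\<forall>d\<in>S. B d d = (2 * x d) *s L d)"
proof -
  have "\<forall>d\<in>S. \<exists>c. B d d = (2 * c) *s L d" using asyD[OF asy inj] by blast
  then obtain x0 where x0: "\<And>d. d \<in> S \<Longrightarrow> B d d = (2 * x0 d) *s L d" by metis
  \<comment> \<open>At \<open>d = 0\<close> the factor is arbitrary, while additivity requires the
    value 0.\<close>
  define x where "x d = (if d = 0 then 0 else x0 d)" for d
  have x: "B d d = (2 * x d) *s L d" if "d \<in> S" for d using x0[OF that] by (simp add: x_def B_0 L_simps)
  have Linj: "a = b" if "a *s L d = b *s L d" "d \<noteq> 0" for a b d using that inj by (auto simp: vector_mul_rcancel)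
  have sc: "x (c *s d) = c * x d" if d: "d \<in> S" for c d
  proof (cases "c = 0 \<or> d = 0")
    case False
    have "(2 * x (c *s d)) *s L (c *s d) = (c * c) *s B d d" using x[OF S(2)[OF d, of c]] by (simp add: B_simps)
    then have "(2 * x (c *s d) * c) *s L d = (c * c * (2 * x d)) *s L d" unfolding x[OF d] by (simp add: L_simps)
    then have "2 * x (c *s d) * c = c * c * (2 * x d)" using Linj False by blast
    then show ?thesis using False by simp
  qed (auto simp: x_def)
  have ad: "x (d + d') = x d + x d'" if d: "d \<in> S" "d' \<in> S" for d d'
  proof (cases "d = 0 \<or> (\<exists>c. d' = c *s d)")
    case True
    then show ?thesis
    proof
      assume "\<exists>c. d' = c *s d"
      then obtain c where c: "d' = c *s d" by blast
      then have "d + d' = (1 + c) *s d" by (simp add: vec_eq_iff algebra_simps)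
      then show ?thesis using sc[OF d(1)] unfolding c by (simp only:) (simp add: algebra_simps)
    qed (simp add: x_def)
  next
    case False
    have ind: "a = 0 \<and> b = 0" if "a *s L d + b *s L d' = 0" for a b
    proof -
      have "L (a *s d + b *s d') = 0" using that by (simp add: L_simps)
      then have z: "a *s d + b *s d' = 0" using inj by blast
      have "b = 0"
      proof (rule ccontr)
        assume "b \<noteq> 0"
        then have "d' = (- a / b) *s d" using z by (simp add: vec_eq_iff field_simps eq_neg_iff_add_eq_0)
        then show False using False by blast
      qed
      then show ?thesis using z False by simp
    qed
    define X where "X = B d d'"
    have e: "2 *s X = (2 * x (d + d') - 2 * x d) *s L d + (2 * x (d + d') - 2 * x d') *s L d'"
    proof -
      have "B d d + 2 *s X + B d' d' = (2 * x (d + d')) *s (L d + L d')"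
        using x[OF S(1)[OF d]] by (simp add: B_simps L_simps X_def B_sym[of d' d] vec_eq_iff algebra_simps)
      then show ?thesis unfolding x[OF d(1)] x[OF d(2)] by (simp add: vec_eq_iff algebra_simps)
    qed
    have f: "4 *s X = (2 * x (d + 2 *s d') - 2 * x d) *s L d + (4 * x (d + 2 *s d') - 8 * x d') *s L d'"
    proof -
      have "B d d + 4 *s X + 4 *s B d' d' = (2 * x (d + 2 *s d')) *s (L d + 2 *s L d')"
        using x[OF S(1)[OF d(1) S(2)[OF d(2), of 2]]] by (simp only: B_simps L_simps X_def B_sym[of d' d]) (simp add: vec_eq_iff algebra_simps)
      then show ?thesis unfolding x[OF d(1)] x[OF d(2)] by (simp add: vec_eq_iff algebra_simps)
    qed
    \<comment> \<open>Eliminating \<open>X\<close> gives two equations, one for each of the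
      independent vectors \<open>L d\<close> and \<open>L d'\<close>; the value at
      \<open>d + 2 *s d'\<close> is then eliminated between them.\<close>
    have "(2 * (2 * x (d + d') - 2 * x d) - (2 * x (d + 2 *s d') - 2 * x d)) *s L d
        + (2 * (2 * x (d + d') - 2 * x d') - (4 * x (d + 2 *s d') - 8 * x d')) *s L d' = 2 *s (2 *s X) - 4 *s X"
      unfolding e f by (simp add: vec_eq_iff algebra_simps)
    also have "\<dots> = 0" by (simp add: vec_eq_iff)
    finally have "2 * (2 * x (d + d') - 2 * x d) - (2 * x (d + 2 *s d') - 2 * x d) = 0"
      "2 * (2 * x (d + d') - 2 * x d') - (4 * x (d + 2 *s d') - 8 * x d') = 0" using ind by blast+
    then have "4 * (x (d + d') - (x d + x d')) = 0" by algebra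
    then have "x (d + d') - (x d + x d') = 0" by (metis mult_eq_0_iff zero_neq_numeral)
    then show ?thesis by simp
  qed
  show ?thesis using x sc ad by blast
qed

end

text \<open>\<open>L\<close> and \<open>B\<close> are the first and second fundamental form of the map at a point, \<open>w\<close> is a hyperplane.\<close>

locale nd_form = bilinear_form L B for L :: "complex^'a \<Rightarrow> complex^'b" and B +
  fixes u w :: "complex^'a"
  assumes w0: "w \<noteq> 0" and uw: "hdot u w = 0"
    and surj: "\<exists>x y. hdot y w = 0 \<and> L x + B u y = e"
    and dim: "CARD('b) + 1 = 2 * CARD('a)" "CARD('a) \<ge> 3"
begin

text \<open>Source and target have equal dimension once the constraint \<open>hdot y w = 0\<close>
  is turned into an additional coordinate, so surjectivity gives injectivity.\<close>

lemma nd_inj: assumes "hdot y w = 0" "L x + B u y = 0" shows "x = 0" "y = 0"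
proof -
  define f :: "complex^('a+'a) \<Rightarrow> complex^('b option)" where
    "f v = (\<chi> j. case j of None \<Rightarrow> hdot (snv v) w | Some k \<Rightarrow> (L (fsv v) + B u (snv v)) $ k)" for v
  have l: "lin f" by (rule linI) (simp_all add: f_def L_simps B_simps vec_eq_iff algebra_simps split: option.split)
  have "\<exists>v. e = f v" for e
  proof -
    define y1 where "y1 = (e $ None / hdot w w) *s w"
    obtain x y where xy: "hdot y w = 0" "L x + B u y = (\<chi> k. e $ Some k) - B u y1" using surj by blast
    have "L x + B u (y1 + y) = (\<chi> k. e $ Some k)" using xy(2) by (simp add: B_simps algebra_simps)
    moreover have "hdot (y1 + y) w = e $ None" using xy w0 by (simp add: y1_def)
    ultimately have "f (prv x (y1 + y)) = e" by (auto simp: f_def vec_eq_iff split: option.split)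
    then show ?thesis by blast
  qed
  then have s: "surj f" by (simp only: surj_def) blast
  have "f (prv x y) = 0" using assms by (auto simp: f_def vec_eq_iff split: option.split)
  moreover have "CARD('a + 'a) = CARD('b option)" using dim by simp
  ultimately have "prv x y = 0" using lin_surj_inj[OF l s] by blast
  then have "fsv (prv x y) = 0" "snv (prv x y) = 0" by (simp_all only: prv_eq_0)
  then show "x = 0" "y = 0" by simp_all
qed

lemma L_inj: "L x = 0 \<Longrightarrow> x = 0"
  using nd_inj(1)[of 0 x] by (simp add: B_simps)

text \<open>Coordinates of \<open>e\<close> in the direct sum of the range of \<open>L\<close> and
  the image under \<open>B u\<close> of the hyperplane orthogonal to \<open>w\<close>; they are well
  defined by \<open>nd_inj\<close>.\<close>

definition yc where "yc e = (SOME y. hdot y w = 0 \<and> (\<exists>x. L x + B u y = e))"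
definition xc where "xc e = (SOME x. L x + B u (yc e) = e)"

lemma yc_w [simp]: "hdot (yc e) w = 0" and xc_yc: "L (xc e) + B u (yc e) = e"
proof -
  have "hdot (yc e) w = 0 \<and> (\<exists>x. L x + B u (yc e) = e)" unfolding yc_def by (rule someI_ex) (use surj in blast)
  then show "hdot (yc e) w = 0" and "L (xc e) + B u (yc e) = e" unfolding xc_def by (auto intro: someI_ex)
qed

lemma xy_unique: assumes "hdot y w = 0" "L x + B u y = e" shows "xc e = x" "yc e = y"
proof -
  have "L (xc e - x) + B u (yc e - y) = 0" using xc_yc[of e] assms(2) by (simp add: L_simps B_simps algebra_simps)
  moreover have "hdot (yc e - y) w = 0" using assms by simp
  ultimately show "xc e = x" "yc e = y" using nd_inj[of "yc e - y" "xc e - x"] by auto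
qed

lemma xy_add: "xc (e + e') = xc e + xc e'" "yc (e + e') = yc e + yc e'"
proof -
  have "L (xc e + xc e') + B u (yc e + yc e') = e + e'"
    using xc_yc[of e] xc_yc[of e'] by (simp add: L_simps B_simps) (metis add.assoc add.commute add.left_commute)
  moreover have "hdot (yc e + yc e') w = 0" by simp
  ultimately show "xc (e + e') = xc e + xc e'" "yc (e + e') = yc e + yc e'" using xy_unique by blast+
qed

lemma xy_scale: "xc (c *s e) = c *s xc e" "yc (c *s e) = c *s yc e"
proof -
  have "L (c *s xc e) + B u (c *s yc e) = c *s (L (xc e) + B u (yc e))"
    by (simp add: L_simps B_simps vector_add_ldistrib)
  then have "L (c *s xc e) + B u (c *s yc e) = c *s e" by (simp add: xc_yc)
  moreover have "hdot (c *s yc e) w = 0" by simp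
  ultimately show "xc (c *s e) = c *s xc e" "yc (c *s e) = c *s yc e" using xy_unique by blast+
qed

lemma xy_L: "xc (L x) = x" "yc (L x) = 0"
  using xy_unique[of 0 x "L x"] by (simp_all add: B_simps)

lemma yc_B: "hdot y w = 0 \<Longrightarrow> yc (B u y) = y" "hdot y w = 0 \<Longrightarrow> xc (B u y) = 0"
  using xy_unique[of y 0 "B u y"] by (simp_all add: L_simps)

lemma u_nz: "u \<noteq> 0"
proof
  assume u: "u = 0"
  have "CARD('a) \<ge> 2" using dim by simp
  then obtain y where y: "norm y = 1" "hdot w y = 0" using ex_orthogonal by blast
  then have "hdot y w = 0" using hdot_0_sym by blast
  then have "y = 0" using nd_inj(2)[of y 0] by (simp add: u B_0 L_simps)
  then show False using y by simp
qed

end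

locale asym_form = nd_form +
  assumes asym: "d = (2 * D4 l (L v) (L y) (B v v) (B v y)) *s y - D4 l (L v) (L y) (B v v) (B y y) *s v \<Longrightarrow> asy d"
begin

text \<open>The functionals in \<open>asym\<close> are free. The condition on \<open>y\<close> makes
  \<open>L u\<close>, \<open>L y\<close>, \<open>B u u\<close>, \<open>B u y\<close> independent,
  and functionals adapted to them through \<open>xc\<close> and \<open>yc\<close> turn the leading
  determinant into 1; the asymptotic direction is then \<open>2 *s y - Q *s u\<close>.\<close>

lemma asy_shift: assumes y: "\<And>c. yc (B u y) \<noteq> c *s u" shows "\<exists>b. asy (y - b *s u)"
proof -
  have yu: "y \<noteq> c *s u" for c using y[of c] by (auto simp: B_simps xy_scale yc_B uw)
  have sw: "u \<noteq> c *s v" if "\<And>c. v \<noteq> c *s u" for c v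
  proof
    assume "u = c *s v"
    then have "c \<noteq> 0" "v = (1 / c) *s u" using u_nz by auto
    then show False using that by blast
  qed
  obtain \<eta>1 where e1: "hdot y \<eta>1 = 0" "hdot u \<eta>1 = 1" using dual_vector[OF sw[OF yu]] by blast
  obtain \<eta>2 where e2: "hdot u \<eta>2 = 0" "hdot y \<eta>2 = 1" using dual_vector[OF yu] by blast
  obtain \<eta>3 where e3: "hdot (yc (B u y)) \<eta>3 = 0" "hdot u \<eta>3 = 1" using dual_vector[OF sw[OF y]] by blast
  obtain \<eta>4 where e4: "hdot u \<eta>4 = 0" "hdot (yc (B u y)) \<eta>4 = 1" using dual_vector[OF y] by blast
  have fx: "\<exists>\<xi>. \<forall>e. hdot (xc e) \<eta> = hdot e \<xi>" and fy: "\<exists>\<xi>. \<forall>e. hdot (yc e) \<eta> = hdot e \<xi>" for \<eta>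
    by (rule functional_hdot; simp add: xy_add xy_scale)+
  obtain l1 l2 l3 l4 where l: "\<And>e. hdot (xc e) \<eta>1 = hdot e l1" "\<And>e. hdot (xc e) \<eta>2 = hdot e l2"
    "\<And>e. hdot (yc e) \<eta>3 = hdot e l3" "\<And>e. hdot (yc e) \<eta>4 = hdot e l4" using fx[of \<eta>1] fx[of \<eta>2] fy[of \<eta>3] fy[of \<eta>4] by blast
  define l where "l = (\<lambda>i::nat. if i = 1 then l1 else if i = 2 then l2 else if i = 3 then l3 else l4)"
  have P: "D4 l (L u) (L y) (B u u) (B u y) = 1"
    by (simp add: D4_def m2_def l_def l[symmetric] xy_L yc_B uw e1 e2 e3 e4)
  define Q where "Q = D4 l (L u) (L y) (B u u) (B y y)"
  have "asy (2 *s y - Q *s u)" by (rule asym[of _ l u y]) (simp add: P Q_def)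
  then have "asy ((1/2) *s (2 *s y - Q *s u))" by (rule asy_scale)
  moreover have "(1/2) *s (2 *s y - Q *s u) = y - (Q / 2) *s u" by (simp add: vec_eq_iff algebra_simps)
  ultimately show ?thesis by metis
qed

text \<open>The form \<open>B\<close> modulo the range of \<open>L\<close>, read in the hyperplane:
  a commutative product for which \<open>u\<close> acts as the identity on the hyperplane and
  asymptotic vectors have square zero. What follows is algebra in this product.\<close>

definition star where "star v y = yc (B v y)"

lemma star_simps: "star (v + v') y = star v y + star v' y" "star y (v + v') = star y v + star y v'"
  "star (c *s v) y = c *s star v y" "star y (c *s v) = c *s star y v"
  by (simp_all add: star_def B_simps xy_add xy_scale)
lemma star_sym: "star v y = star y v" by (simp add: star_def B_sym[of v y])
lemma star_u: "hdot y w = 0 \<Longrightarrow> star u y = y" "hdot y w = 0 \<Longrightarrow> star y u = y"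
  by (simp_all add: star_def yc_B B_sym[of y u])
lemma star_asy: assumes "asy d" shows "star d d = 0"
proof -
  obtain c where "B d d = (2 * c) *s L d" using asyD[OF assms L_inj] by blast
  then show ?thesis by (simp add: star_def xy_scale xy_L)
qed

definition D where "D = {d. hdot d w = 0 \<and> asy d}"

lemma D_w: "d \<in> D \<Longrightarrow> hdot d w = 0" and D_star: "d \<in> D \<Longrightarrow> star d d = 0" and D_scale: "d \<in> D \<Longrightarrow> c *s d \<in> D"
  by (simp_all add: D_def star_asy asy_scale)

text \<open>The vector \<open>u\<close> is a nonzero idempotent for \<open>star\<close>, whereas
  elements of \<open>D\<close> have square zero.\<close>

lemma D_u: assumes "d \<in> D" "d \<noteq> 0" "a *s d + b *s u = 0" shows "a = 0" "b = 0"
proof -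
  show b: "b = 0"
  proof (rule ccontr)
    assume b: "b \<noteq> 0"
    then have "u = (- a / b) *s d" using assms(3) by (simp add: vec_eq_iff field_simps eq_neg_iff_add_eq_0)
    then have "star u u = 0" using D_star[OF assms(1)] by (metis star_simps(3,4) vector_smult_rzero)
    then show False using star_u(1)[OF uw] u_nz by simp
  qed
  then show "a = 0" using assms by simp
qed

lemma V_split: assumes "hdot y w = 0" shows "\<exists>b. y - b *s u \<in> D"
proof (cases "\<exists>c. y = c *s u")
  case True
  then obtain c where "y - c *s u = 0" by auto
  then have "y - c *s u \<in> D" by (simp only: D_def mem_Collect_eq hdot_zero asy_0 simp_thms)
  then show ?thesis by blast
next
  case False
  then have "\<And>c. yc (B u y) \<noteq> c *s u" using assms by (simp add: yc_B)
  then obtain b where "asy (y - b *s u)" using asy_shift by blast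
  then have "y - b *s u \<in> D" using assms uw by (simp add: D_def)
  then show ?thesis by blast
qed

text \<open>Both \<open>d + d'\<close> and \<open>d - d'\<close> lie in \<open>D\<close> after
  subtracting multiples \<open>b\<close>, \<open>b'\<close> of \<open>u\<close>. Adding the two
  equations "square equals zero" eliminates the product of \<open>d\<close> and \<open>d'\<close>
  and leaves a linear relation between \<open>d\<close>, \<open>d'\<close> and \<open>u\<close> that
  forces \<open>b = 0\<close>.\<close>

lemma D_add: assumes d: "d \<in> D" "d' \<in> D" shows "d + d' \<in> D"
proof (cases "d = 0 \<or> (\<exists>c. d' = c *s d)")
  case True
  then show ?thesis
  proof
    assume "\<exists>c. d' = c *s d"
    then obtain c where c: "d' = c *s d" by blast
    then have "d + d' = (1 + c) *s d" by (simp add: vec_eq_iff algebra_simps)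
    then show ?thesis using D_scale[OF d(1)] by metis
  qed (use d in simp)
next
  case False
  have dd: "star d d = 0" "star d' d' = 0" "star d' d = star d d'" "star u d = d" "star d u = d" "star u d' = d'" "star d' u = d'" "star u u = u"
    using d uw by (simp_all add: D_star star_u D_w star_sym[of d' d])
  have h: "hdot (d + s *s d') w = 0" for s using d by (simp add: D_w)
  obtain b where b: "(d + 1 *s d') - b *s u \<in> D" using V_split[OF h] by blast
  obtain b' where b': "(d + (-1) *s d') - b' *s u \<in> D" using V_split[OF h] by blast
  have e: "star (d + s *s d' + t *s u) (d + s *s d' + t *s u) = (2 * s) *s star d d' + (2 * t) *s (d + s *s d') + (t * t) *s u" for s t
    unfolding star_simps dd by (simp add: vec_eq_iff algebra_simps)
  have mt: "x - c *s y = x + (- c) *s y" for x y :: "complex^'a" and c by simp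
  have 1: "(2 * 1) *s star d d' + (2 * (- b)) *s (d + 1 *s d') + (- b * - b) *s u = 0"
    using D_star[OF b] unfolding mt e .
  have 2: "(2 * (-1)) *s star d d' + (2 * (- b')) *s (d + (-1) *s d') + (- b' * - b') *s u = 0"
    using D_star[OF b'] unfolding mt e .
  have s: "(- 2 * (b + b')) *s d + (- 2 * (b - b')) *s d' + (b * b + b' * b') *s u = 0"
    using arg_cong2[OF 1 2, of "(+)"] by (simp add: vec_eq_iff algebra_simps)
  have "b = 0"
  proof (cases "b = b'")
    case True
    then have "(- 4 * b) *s d + (2 * (b * b)) *s u = 0" using s by (simp add: vec_eq_iff algebra_simps)
    then show ?thesis using D_u(1)[OF d(1)] False by fastforce
  next
    case ne: False
    \<comment> \<open>For different \<open>b\<close> and \<open>b'\<close> the relation expresses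
      \<open>d'\<close> by \<open>u\<close> and \<open>d\<close>; its square being zero kills the
      component along \<open>u\<close>, against the independence of \<open>d\<close> and
      \<open>d'\<close>.\<close>
    define p q where "p = (b * b + b' * b') / (2 * (b - b'))" and "q = - (b + b') / (b - b')"
    have "d' = p *s u + q *s d"
    proof -
      have "- (2 * (b - b')) * d' $ i = 2 * (b + b') * d $ i - (b * b + b' * b') * u $ i" for i
        using arg_cong[OF s, of "\<lambda>v. v $ i"] by (simp add: algebra_simps)
      then have h: "d' $ i = (2 * (b + b') * d $ i - (b * b + b' * b') * u $ i) / (- (2 * (b - b')))" for i
        using ne by (simp add: eq_divide_eq mult.commute)
      have g: "(2 * s1 * x - A * y) / (- (2 * E)) = A / (2 * E) * y + (- s1 / E) * x" if "E \<noteq> 0" for s1 x A y E :: complex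
        using that by (simp add: field_simps)
      have nz: "b - b' \<noteq> 0" using ne by simp
      have "d' $ i = p * u $ i + q * d $ i" for i
        unfolding p_def q_def by (rule trans[OF h g[OF nz]])
      then show ?thesis unfolding vec_eq_iff vector_add_component vector_smult_component by blast
    qed
    then have "star (p *s u + q *s d) (p *s u + q *s d) = 0" using dd by metis
    then have "(2 * (p * q)) *s d + (p * p) *s u = 0" unfolding star_simps dd by (simp add: vec_eq_iff algebra_simps)
    then have "p * p = 0" using D_u(2)[OF d(1)] False by blast
    then have "d' = q *s d" using \<open>d' = p *s u + q *s d\<close> by simp
    then show ?thesis using False by blast
  qed
  then show ?thesis using b by simp
qed

lemma D_nontrivial: "\<exists>d\<in>D. d \<noteq> 0"
proof -
  obtain y where y: "norm y = 1" "hdot u y = 0" "hdot w y = 0" using ex_orthogonal2[OF dim(2)] by blast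
  have "hdot y w = 0" using y(3) hdot_0_sym by blast
  then obtain b where b: "y - b *s u \<in> D" using V_split by blast
  have "y - b *s u \<noteq> 0"
  proof
    assume "y - b *s u = 0"
    then have "hdot (y - b *s u) y = 0" by simp
    then have "hdot y y = 0" using y(2) by simp
    then show False using y(1) by simp
  qed
  then show ?thesis using b by blast
qed

text \<open>The plane \<open>D\<close> extends by one further direction, a shift of the kernel of \<open>B u\<close> modulo the range of \<open>L\<close>.\<close>

lemma asy_extension:
  assumes \<nu>: "yc (B u \<nu>) = 0" and d: "d \<in> D" "d \<noteq> 0"
  shows "\<exists>l. star d \<nu> = l *s d \<and> asy (d + \<nu> - l *s u)"
proof -
  have u\<nu>: "star u \<nu> = 0" "star \<nu> u = 0" using \<nu> by (simp_all add: star_def B_sym[of \<nu> u])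
  have dd: "star d d = 0" "star u d = d" "star d u = d" "star u u = u" using d uw by (simp_all add: D_star star_u D_w)
  have ex: "\<exists>b. asy (d + c *s \<nu> - b *s u)" for c
  proof (rule asy_shift)
    fix c'
    have "yc (B u (d + c *s \<nu>)) = d" using \<nu> by (simp add: B_simps xy_add xy_scale yc_B D_w[OF d(1)])
    moreover have "d \<noteq> c' *s u" using D_u(1)[OF d, of 1 "- c'"] by auto
    ultimately show "yc (B u (d + c *s \<nu>)) \<noteq> c' *s u" by simp
  qed
  define p q where "p = star d \<nu>" and "q = star \<nu> \<nu>"
  have eq: "(2 * c) *s p + (c * c) *s q - (2 * b) *s d + (b * b) *s u = 0" if "asy (d + c *s \<nu> - b *s u)" for b c
  proof -
    have m: "d + c *s \<nu> - b *s u = d + c *s \<nu> + (- b) *s u" by simp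
    have "star (d + c *s \<nu> + (- b) *s u) (d + c *s \<nu> + (- b) *s u) = (2 * c) *s p + (c * c) *s q - (2 * b) *s d + (b * b) *s u"
      unfolding star_simps dd u\<nu> star_sym[of \<nu> d] p_def q_def by (simp add: vec_eq_iff algebra_simps)
    then show ?thesis using star_asy[OF that] unfolding m by simp
  qed
  obtain b1 b2 b3 b4 where b: "asy (d + 1 *s \<nu> - b1 *s u)" "asy (d + (-1) *s \<nu> - b2 *s u)"
    "asy (d + 2 *s \<nu> - b3 *s u)" "asy (d + (-2) *s \<nu> - b4 *s u)"
    using ex[of 1] ex[of "-1"] ex[of 2] ex[of "-2"] by metis
  note E = eq[OF b(1)] eq[OF b(2)] eq[OF b(3)] eq[OF b(4)]
  \<comment> \<open>The two conditions on the weights eliminate \<open>p\<close> and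
    \<open>q\<close> from the equations for the four values of \<open>c\<close>. Independence of
    \<open>d\<close> and \<open>u\<close> then gives relations between the shifts, which force
    \<open>b2 = - b1\<close>.\<close>
  have comb: "(a1 * b1 + a2 * b2 + a3 * b3 + a4 * b4 = 0) \<and> (a1 * (b1 * b1) + a2 * (b2 * b2) + a3 * (b3 * b3) + a4 * (b4 * b4) = 0)"
    if a: "a1 - a2 + 2 * a3 - 2 * a4 = 0" "a1 + a2 + 4 * a3 + 4 * a4 = 0" for a1 a2 a3 a4
  proof -
    have "a1 *s ((2 * 1) *s p + (1 * 1) *s q - (2 * b1) *s d + (b1 * b1) *s u) + a2 *s ((2 * - 1) *s p + (- 1 * - 1) *s q - (2 * b2) *s d + (b2 * b2) *s u)
       + a3 *s ((2 * 2) *s p + (2 * 2) *s q - (2 * b3) *s d + (b3 * b3) *s u) + a4 *s ((2 * - 2) *s p + (- 2 * - 2) *s q - (2 * b4) *s d + (b4 * b4) *s u)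
      = (2 * (a1 - a2 + 2 * a3 - 2 * a4)) *s p + (a1 + a2 + 4 * a3 + 4 * a4) *s q + (- 2 * (a1 * b1 + a2 * b2 + a3 * b3 + a4 * b4)) *s d
        + (a1 * (b1 * b1) + a2 * (b2 * b2) + a3 * (b3 * b3) + a4 * (b4 * b4)) *s u"
      by (simp add: vec_eq_iff algebra_simps)
    then have "(- 2 * (a1 * b1 + a2 * b2 + a3 * b3 + a4 * b4)) *s d + (a1 * (b1 * b1) + a2 * (b2 * b2) + a3 * (b3 * b3) + a4 * (b4 * b4)) *s u = 0"
      unfolding E a by simp
    note z = D_u[OF d this]
    have "- 2 * (a1 * b1 + a2 * b2 + a3 * b3 + a4 * b4) = 0 \<Longrightarrow> a1 * b1 + a2 * b2 + a3 * b3 + a4 * b4 = 0"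
      by (simp only: mult_eq_0_iff neg_equal_0_iff_equal zero_neq_numeral[symmetric]) simp
    then show ?thesis using z by blast
  qed
  have 1: "-4 * b1 + -4 * b2 + b3 + b4 = 0" "-4 * (b1 * b1) + -4 * (b2 * b2) + b3 * b3 + b4 * b4 = 0" using comb[of "-4" "-4" 1 1] by simp_all
  have 2: "-2 * b1 + 2 * b2 + b3 - b4 = 0" using comb[of "-2" 2 1 "-1"] by simp
  have "8 * ((b1 + b2) * (b1 + b2)) = 0" using 1 2 by algebra
  then have "b2 = - b1" by (simp add: eq_neg_iff_add_eq_0 add.commute)
  then have "4 *s p = 4 *s (b1 *s d)" using arg_cong2[OF E(1) E(2), of "(-)"] by (simp add: vec_eq_iff algebra_simps)
  then have "p = b1 *s d" unfolding vector_mul_lcancel by simp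
  then show ?thesis using b(1) by (auto simp: p_def)
qed

text \<open>Adjoining one direction \<open>\<nu>'\<close> to \<open>D\<close> gives a hyperplane
  \<open>S\<close> of asymptotic vectors complementary to \<open>u\<close>. On \<open>S\<close> the
  form \<open>B\<close> is a linear form times \<open>L\<close>; the coordinate along
  \<open>u\<close> is \<open>\<beta>\<close>, and everything else in \<open>B v v\<close> is
  divisible by it.\<close>

lemma second_form_structure:
  obtains \<xi> \<beta> Y \<nu> \<kappa> where "lin Y" "\<And>v. B v v = (2 * hdot v \<xi>) *s L v + hdot v \<beta> *s Y v"
    "\<nu> \<noteq> 0" "Y \<nu> = L \<kappa>" "\<And>e. \<exists>v v'. e = L v + Y v'"
proof -
  \<comment> \<open>As \<open>y\<close> is the \<open>yc\<close> coordinate of \<open>B u y\<close>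
    for \<open>y\<close> in the hyperplane, subtracting the coordinate of \<open>B u w\<close>
    produces a vector that \<open>B u\<close> maps into the range of \<open>L\<close>.\<close>
  define \<nu>0 where "\<nu>0 = w - yc (B u w)"
  have \<nu>w: "hdot \<nu>0 w \<noteq> 0" using w0 by (simp add: \<nu>0_def)
  have \<nu>y: "yc (B u \<nu>0) = 0" using xy_add(2)[of "B u \<nu>0" "B u (yc (B u w))"]
    by (simp add: \<nu>0_def B_simps yc_B)
  obtain d1 where d1: "d1 \<in> D" "d1 \<noteq> 0" using D_nontrivial by blast
  obtain l where l: "star d1 \<nu>0 = l *s d1" "asy (d1 + \<nu>0 - l *s u)" using asy_extension[OF \<nu>y d1] by blast
  define \<nu>' where "\<nu>' = \<nu>0 - l *s u"
  have asy1: "asy (d + \<nu>')" if d: "d \<in> D" "d \<noteq> 0" for d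
  proof -
    obtain l' where l': "star d \<nu>0 = l' *s d" "asy (d + \<nu>0 - l' *s u)" using asy_extension[OF \<nu>y d] by blast
    \<comment> \<open>Every nonzero element of \<open>D\<close> is an eigenvector of multiplication
      by \<open>\<nu>0\<close>, so this multiplication is a scalar on \<open>D\<close>.\<close>
    have "l' = l"
    proof (cases "\<exists>c. d = c *s d1")
      case True
      then obtain c where c: "d = c *s d1" by blast
      then have "l' *s d = l *s d" using l'(1) l(1) by (auto simp: star_simps mult.commute)
      then show ?thesis using d(2) unfolding vector_mul_rcancel by blast
    next
      case False
      have nz: "d + d1 \<noteq> 0"
      proof
        assume "d + d1 = 0"
        then have "d = (-1) *s d1" by (simp add: eq_neg_iff_add_eq_0)
        then show False using False by blast
      qed
      obtain k where k: "star (d + d1) \<nu>0 = k *s (d + d1)" using asy_extension[OF \<nu>y D_add[OF d(1) d1(1)] nz] by blast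
      have e: "(k - l') *s d = (l - k) *s d1" using k l l' by (simp add: star_simps vec_eq_iff algebra_simps)
      have "k = l'"
      proof (rule ccontr)
        assume "k \<noteq> l'"
        then have "(1 / (k - l')) * (k - l') = 1" by simp
        then have "d = ((1 / (k - l')) * (k - l')) *s d" by (simp only: vector_smult_lid)
        also have "\<dots> = (1 / (k - l') * (l - k)) *s d1" unfolding vector_smult_assoc[symmetric] e ..
        finally have "d = (1 / (k - l') * (l - k)) *s d1" .
        then show False using False by blast
      qed
      then have "(l - k) *s d1 = 0" using e by simp
      then show ?thesis using d1 \<open>k = l'\<close> by simp
    qed
    then show ?thesis using l'(2) by (simp add: \<nu>'_def algebra_simps)
  qed
  have asy2: "asy \<nu>'"
    by (rule asy_limit[of d1]) (use asy1[OF D_scale[OF d1(1)]] d1(2) in auto)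
  define S where "S = {d + c *s \<nu>' | d c. d \<in> D}"
  have S_add: "e + e' \<in> S" if ee: "e \<in> S" "e' \<in> S" for e e'
  proof -
    obtain d c d' c' where "d \<in> D" "d' \<in> D" "e = d + c *s \<nu>'" "e' = d' + c' *s \<nu>'" using ee by (auto simp: S_def)
    then have "d + d' \<in> D" "e + e' = (d + d') + (c + c') *s \<nu>'" by (simp_all add: D_add vec_eq_iff algebra_simps)
    then show ?thesis unfolding S_def by blast
  qed
  have S_scale: "k *s e \<in> S" if ee: "e \<in> S" for e k
  proof -
    obtain d c where "d \<in> D" "e = d + c *s \<nu>'" using ee by (auto simp: S_def)
    then have "k *s d \<in> D" "k *s e = k *s d + (k * c) *s \<nu>'" by (simp_all add: D_scale vec_eq_iff algebra_simps)
    then show ?thesis unfolding S_def by blast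
  qed
  have S_asy: "asy e" if ee: "e \<in> S" for e
  proof -
    obtain d c where e: "d \<in> D" "e = d + c *s \<nu>'" using ee by (auto simp: S_def)
    show ?thesis
    proof (cases "c = 0")
      case True
      then show ?thesis using e by (simp add: D_def)
    next
      case False
      have "asy ((1 / c) *s d + \<nu>')"
        using asy1[OF D_scale[OF e(1)], of "1 / c"] asy2 False by (cases "d = 0") auto
      then have "asy (c *s ((1 / c) *s d + \<nu>'))" by (rule asy_scale)
      moreover have "c *s ((1 / c) *s d + \<nu>') = e" using False e(2) by (simp add: vector_add_ldistrib)
      ultimately show ?thesis by simp
    qed
  qed
  obtain x where x: "\<And>e e'. e \<in> S \<Longrightarrow> e' \<in> S \<Longrightarrow> x (e + e') = x e + x e'" "\<And>e c. e \<in> S \<Longrightarrow> x (c *s e) = c * x e"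
    "\<And>e. e \<in> S \<Longrightarrow> B e e = (2 * x e) *s L e"
    using asymptotic_subspace[of S, OF S_add S_scale S_asy L_inj] by blast
  have nS: "b = 0" if b: "b *s u \<in> S" for b
  proof -
    obtain d c where e: "d \<in> D" "b *s u = d + c *s \<nu>'" using b by (auto simp: S_def)
    have "hdot (b *s u) w = c * hdot \<nu>0 w" unfolding e(2) using D_w[OF e(1)] uw by (simp add: \<nu>'_def)
    then have "c = 0" using uw \<nu>w by simp
    then have "1 *s d + (- b) *s u = 0" using e by simp
    then have "d \<noteq> 0 \<Longrightarrow> - b = 0" using D_u(2)[OF e(1)] by blast
    then show ?thesis using u_nz e(2) \<open>c = 0\<close> by (cases "d = 0") auto
  qed
  have "\<exists>b. v - b *s u \<in> S" for v
  proof -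
    define s where "s = hdot v w / hdot \<nu>0 w"
    have "hdot (v - s *s \<nu>0) w = 0" using \<nu>w by (simp add: s_def)
    then obtain b where b: "v - s *s \<nu>0 - b *s u \<in> D" using V_split by blast
    have "v - (b + s * l) *s u = (v - s *s \<nu>0 - b *s u) + s *s \<nu>'" by (simp add: \<nu>'_def vec_eq_iff algebra_simps)
    then show ?thesis using b unfolding S_def by blast
  qed
  then obtain bt where bt: "\<And>v. v - bt v *s u \<in> S" by metis
  have bt_u: "bt v = b" if "v - b *s u \<in> S" for v b
  proof -
    have "(v - b *s u) + (-1) *s (v - bt v *s u) \<in> S" using S_add[OF that S_scale[OF bt]] .
    moreover have "(v - b *s u) + (-1) *s (v - bt v *s u) = (bt v - b) *s u" by (simp add: vec_eq_iff algebra_simps)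
    ultimately show ?thesis using nS[of "bt v - b"] by simp
  qed
  have bt_add: "bt (v + v') = bt v + bt v'" for v v'
    using S_add[OF bt[of v] bt[of v']] by (intro bt_u) (simp add: algebra_simps)
  have bt_scale: "bt (c *s v) = c * bt v" for c v
    using S_scale[OF bt[of v], of c] by (intro bt_u) (simp add: vec_eq_iff algebra_simps)
  define e where "e v = v - bt v *s u" for v
  have e_add: "e (v + v') = e v + e v'" and e_scale: "e (c *s v) = c *s e v" for v v' c
    by (simp_all add: e_def bt_add bt_scale vec_eq_iff algebra_simps)
  have eS: "e v \<in> S" for v by (simp add: e_def bt)
  obtain \<beta> where \<beta>: "\<And>v. bt v = hdot v \<beta>" using functional_hdot[of bt] bt_add bt_scale by blast
  have "\<exists>\<xi>. \<forall>v. x (e v) = hdot v \<xi>" by (rule functional_hdot) (simp_all add: e_add e_scale x eS)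
  then obtain \<xi> where \<xi>: "\<And>v. x (e v) = hdot v \<xi>" by blast
  \<comment> \<open>Expand \<open>B\<close> at \<open>v = bt v *s u + e v\<close> and replace
    \<open>L (e v)\<close> by \<open>L v - bt v *s L u\<close>: what remains besides
    \<open>L v\<close> has the factor \<open>bt v\<close>, with cofactor \<open>Y v\<close>.\<close>
  define Y where "Y v = bt v *s B u u + 2 *s B u (e v) - (2 * x (e v)) *s L u" for v
  have lY: "lin Y" by (rule linI) (simp_all add: Y_def bt_add bt_scale e_add e_scale x eS B_simps vec_eq_iff algebra_simps)
  have ve: "v = bt v *s u + e v" for v by (simp add: e_def)
  have B: "B v v = (2 * hdot v \<xi>) *s L v + hdot v \<beta> *s Y v" for v
  proof -
    have "B v v = (bt v * bt v) *s B u u + (2 * bt v) *s B u (e v) + B (e v) (e v)"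
      by (subst (1 2) ve) (simp add: B_simps B_sym[of "e v" u] vec_eq_iff algebra_simps)
    moreover have "L v = bt v *s L u + L (e v)" by (subst ve) (simp add: L_simps)
    ultimately show ?thesis unfolding \<beta>[symmetric] \<xi>[symmetric] Y_def x(3)[OF eS] by (simp add: vec_eq_iff algebra_simps)
  qed
  have btu: "bt u = 1" "e u = 0"
  proof -
    have "0 \<in> S" using S_scale[OF bt[of 0], of 0] by simp
    then show "bt u = 1" by (intro bt_u) simp
    then show "e u = 0" by (simp add: e_def)
  qed
  have bte: "bt s = 0" "e s = s" if "s \<in> S" for s
  proof -
    show "bt s = 0" using that by (intro bt_u) simp
    then show "e s = s" by (simp add: e_def)
  qed
  \<comment> \<open>The half compensates the factor 2 in \<open>Y\<close>: up to a multiple of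
    \<open>L u\<close>, \<open>Y \<nu>\<close> is \<open>B u \<nu>0\<close>, which lies in the range
    of \<open>L\<close>.\<close>
  define \<nu> where "\<nu> = l *s u + (1/2) *s \<nu>'"
  have "0 \<in> D" using D_scale[OF d1(1), of 0] by simp
  moreover have "\<nu>' = 0 + 1 *s \<nu>'" by simp
  ultimately have \<nu>'S: "\<nu>' \<in> S" unfolding S_def by blast
  have b\<nu>: "bt \<nu> = l" "e \<nu> = (1/2) *s \<nu>'"
    by (simp_all add: \<nu>_def bt_add bt_scale e_add e_scale btu bte[OF \<nu>'S])
  have "\<nu> \<noteq> 0"
  proof
    assume "\<nu> = 0"
    then have "hdot \<nu> w = 0" by simp
    then show False using \<nu>w uw by (simp add: \<nu>_def \<nu>'_def)
  qed
  moreover have "Y \<nu> = L (xc (B u \<nu>0) - (2 * x (e \<nu>)) *s u)"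
  proof -
    have "B u \<nu>0 = L (xc (B u \<nu>0))" using xc_yc[of "B u \<nu>0"] by (simp add: \<nu>y B_simps)
    moreover have "\<nu>0 = l *s u + \<nu>'" by (simp add: \<nu>'_def)
    then have "B u \<nu>0 = l *s B u u + B u \<nu>'" by (simp add: B_simps)
    ultimately show ?thesis unfolding Y_def b\<nu> by (simp add: L_simps B_simps)
  qed
  moreover have "\<exists>v v'. a = L v + Y v'" for a
  proof -
    define y where "y = yc a"
    define v' where "v' = bt y *s u + (1/2) *s e y"
    have b: "bt v' = bt y" "e v' = (1/2) *s e y"
      by (simp_all add: v'_def bt_add bt_scale e_add e_scale btu bte[OF eS])
    have "B u y = bt y *s B u u + B u (e y)" by (subst ve[of y]) (simp add: B_simps)
    then have "B u y = L ((2 * x (e v')) *s u) + Y v'" unfolding Y_def b by (simp add: L_simps B_simps)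
    then have "a = L (xc a + (2 * x (e v')) *s u) + Y v'" using xc_yc[of a] by (simp add: L_simps y_def algebra_simps)
    then show ?thesis by blast
  qed
  ultimately show ?thesis using that lY B by blast
qed

end

section \<open>Nondegenerate boundary points\<close>

text \<open>An exponential weight makes the sum of squares nonincreasing. Derivatives are required
  in the open interval only, because the ends of a segment may lie on the sphere.\<close>

lemma gronwall_zero:
  fixes f f' :: "'i::finite \<Rightarrow> real \<Rightarrow> complex"
  assumes c: "\<And>i. continuous_on {0..1} (f i)"
    and d: "\<And>i t. 0 < t \<Longrightarrow> t < 1 \<Longrightarrow> (f i has_vector_derivative f' i t) (at t)"
    and b: "\<And>i t. 0 < t \<Longrightarrow> t < 1 \<Longrightarrow> cmod (f' i t) \<le> M * (\<Sum>j\<in>UNIV. cmod (f j t))"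
    and z: "\<And>i. f i 0 = 0" and t: "0 \<le> t" "t \<le> 1"
  shows "f i t = 0"
proof (cases "t = 0")
  case False
  then have t0: "0 < t" using t by simp
  define N where "N = real CARD('i)"
  \<comment> \<open>The factor \<open>N\<close> comes from bounding the square of the sum of the
    norms by \<open>N\<close> times the sum of their squares.\<close>
  define K where "K = 2 * \<bar>M\<bar> * N"
  define g where "g s = exp (- K * s) * (\<Sum>j\<in>UNIV. f j s \<bullet> f j s)" for s
  have "g t \<le> g 0"
  proof (rule DERIV_nonpos_imp_decreasing_open[OF less_imp_le[OF t0]])
    fix s assume s: "0 < s" "s < t"
    then have s1: "0 < s" "s < 1" using t by auto
    have D: "((\<lambda>s. f j s \<bullet> f j s) has_real_derivative 2 * (f j s \<bullet> f' j s)) (at s)" for j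
      unfolding has_field_derivative_def
      by (rule has_derivative_eq_rhs[OF has_derivative_inner[OF d[OF s1, of j, unfolded has_vector_derivative_def] d[OF s1, of j, unfolded has_vector_derivative_def]]])
        (simp add: fun_eq_iff inner_commute algebra_simps del: inner_complex_def)
    let ?S = "\<Sum>j\<in>UNIV. f j s \<bullet> f j s" and ?S' = "\<Sum>j\<in>UNIV. 2 * (f j s \<bullet> f' j s)"
    have "(g has_real_derivative exp (- K * s) * ?S' + (exp (- K * s) * (- K)) * ?S) (at s)"
      unfolding g_def by (auto intro!: derivative_eq_intros D simp: algebra_simps)
    moreover have "exp (- K * s) * ?S' + (exp (- K * s) * (- K)) * ?S \<le> 0"
    proof -
      have "?S' \<le> (\<Sum>j\<in>UNIV. 2 * (cmod (f j s) * (\<bar>M\<bar> * (\<Sum>j\<in>UNIV. cmod (f j s)))))"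
      proof (rule sum_mono, rule mult_left_mono)
        fix j
        have "f j s \<bullet> f' j s \<le> cmod (f j s) * cmod (f' j s)" by (rule norm_cauchy_schwarz)
        also have "cmod (f' j s) \<le> \<bar>M\<bar> * (\<Sum>j\<in>UNIV. cmod (f j s))"
          by (rule order_trans[OF b[OF s1]]) (intro mult_right_mono sum_nonneg, auto)
        finally show "f j s \<bullet> f' j s \<le> cmod (f j s) * (\<bar>M\<bar> * (\<Sum>j\<in>UNIV. cmod (f j s)))"
          by (simp add: mult_left_mono)
      qed simp
      also have "\<dots> = 2 * \<bar>M\<bar> * (\<Sum>j\<in>UNIV. cmod (f j s))\<^sup>2"
        by (simp add: sum_distrib_left[symmetric] sum_distrib_right[symmetric] power2_eq_square mult_ac)
      also have "\<dots> \<le> 2 * \<bar>M\<bar> * ((\<Sum>j\<in>UNIV. (cmod (f j s))\<^sup>2) * N)"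
        unfolding N_def by (intro mult_left_mono sum_squared_le_sum_of_squares) auto
      also have "\<dots> = K * ?S" by (simp add: K_def power2_norm_eq_inner mult_ac)
      finally have "?S' - K * ?S \<le> 0" by simp
      then have "exp (- K * s) * (?S' - K * ?S) \<le> 0" by (simp add: mult_le_0_iff)
      then show ?thesis by (simp add: algebra_simps)
    qed
    ultimately show "\<exists>y. DERIV g s :> y \<and> y \<le> 0" by blast
  next
    show "continuous_on {0..t} g" unfolding g_def
      by (intro continuous_intros continuous_on_subset[OF c]) (use t in auto)
  qed
  also have "g 0 = 0" by (simp add: g_def z)
  finally have "(\<Sum>j\<in>UNIV. f j t \<bullet> f j t) \<le> 0" by (simp add: g_def mult_le_0_iff)
  then have "(\<Sum>j\<in>UNIV. f j t \<bullet> f j t) = 0" by (intro antisym sum_nonneg) auto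
  then have "f i t \<bullet> f i t = 0" by (subst (asm) sum_nonneg_eq_0_iff) auto
  then show ?thesis by simp
qed (simp add: z)

text \<open>Strict convexity of the ball; it places the interior of a segment where the jets can be
  differentiated.\<close>

lemma segment_in_ball:
  fixes x y :: "complex^'n"
  assumes "norm x \<le> 1" "norm y \<le> 1" "x \<noteq> y" "0 < t" "t < 1"
  shows "norm (x + t *\<^sub>R (y - x)) < 1"
proof -
  have "(norm (x + t *\<^sub>R (y - x)))\<^sup>2 = (1 - t) * (norm x)\<^sup>2 + t * (norm y)\<^sup>2 - t * (1 - t) * (norm (y - x))\<^sup>2"
    by (simp add: power2_norm_eq_inner inner_add_left inner_add_right inner_diff_left inner_diff_right inner_commute algebra_simps)
  also have "\<dots> < (1 - t) * 1 + t * 1"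
  proof -
    have "(1 - t) * (norm x)\<^sup>2 \<le> (1 - t) * 1" "t * (norm y)\<^sup>2 \<le> t * 1"
      using assms by (intro mult_left_mono; simp add: power_le_one)+
    moreover have "0 < t * (1 - t) * (norm (y - x))\<^sup>2" using assms by simp
    ultimately show ?thesis by linarith
  qed
  finally have "(norm (x + t *\<^sub>R (y - x)))\<^sup>2 < 1" by simp
  then show ?thesis by (simp add: power_less_one_iff)
qed

lemma norm_prj_le: "norm (prj w v) \<le> 2 * norm v"
proof (cases "w = 0")
  case False
  have "norm ((hdot v w / hdot w w) *s w) = cmod (hdot v w) / norm w"
    using False by (simp add: norm_smult norm_divide hdot_self power2_eq_square norm_mult)
  also have "\<dots> \<le> norm v" using cmod_hdot_le[of v w] False by (simp add: divide_le_eq)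
  finally show ?thesis using norm_triangle_ineq4[of v "(hdot v w / hdot w w) *s w"] by (simp add: prj_def)
qed (simp add: prj_def)

lemma prj_expand: assumes "hdot h w = 0" shows "h = (\<Sum>i\<in>UNIV. h $ i *s prj w (axis i 1))"
proof -
  have l: "lin (prj w)" by (rule linI) (simp_all add: prj_add prj_scale)
  show ?thesis using lin_expand[OF l, of h] prj_id[OF assms] by simp
qed

lemma cmod_sum_le: assumes "norm x \<le> C" shows "cmod (\<Sum>i\<in>UNIV. (x::complex^'n) $ i * f i) \<le> C * (\<Sum>i\<in>UNIV. cmod (f i))"
proof -
  have "cmod (\<Sum>i\<in>UNIV. x $ i * f i) \<le> (\<Sum>i\<in>UNIV. C * cmod (f i))"
    by (rule sum_norm_le) (simp only: norm_mult, intro mult_right_mono order_trans[OF Finite_Cartesian_Product.norm_nth_le assms], simp)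
  then show ?thesis by (simp add: sum_distrib_left)
qed

lemma lin_bound: assumes "lin f" shows "norm (f x) \<le> norm x * (\<Sum>i\<in>UNIV. norm (f (axis i 1)))"
proof -
  have "norm (f x) \<le> (\<Sum>i\<in>UNIV. norm x * norm (f (axis i 1)))"
    by (subst lin_expand[OF assms]) (rule sum_norm_le, simp only: norm_smult, intro mult_right_mono Finite_Cartesian_Product.norm_nth_le norm_ge_zero)
  then show ?thesis by (simp add: sum_distrib_left)
qed

context jets begin

text \<open>Solutions for the coordinate vectors at \<open>p\<close>, projected to the new
  hyperplane, form an approximate right inverse at \<open>z\<close>, \<open>w\<close>. An error
  below one half makes it correctable with bounds uniform in \<open>z\<close>, \<open>w\<close> and
  \<open>e\<close>, as the differential inequality in \<open>transport\<close> requires.\<close>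

lemma nd_near:
  assumes p: "norm p = 1" and u: "hdot u p = 0"
    and surj: "\<And>e. \<exists>x y. hdot y p = 0 \<and> J1 p x + J2 p u y = e"
  shows "\<exists>\<rho>>0. \<exists>c\<ge>0. \<rho> \<le> 1/2 \<and> (\<forall>z w e. z \<in> cball 0 1 \<longrightarrow> dist z p < \<rho> \<longrightarrow> dist w p < \<rho> \<longrightarrow>
     (\<exists>x y. hdot y w = 0 \<and> J1 z x + J2 z (prj w u) y = e \<and> norm x \<le> c * norm e \<and> norm y \<le> c * norm e))"
proof -
  have "\<forall>i::'b. \<exists>x y. hdot y p = 0 \<and> J1 p x + J2 p u y = axis i 1" using surj by blast
  then obtain X Y where XY: "\<And>i::'b. hdot (Y i) p = 0" "\<And>i. J1 p (X i) + J2 p u (Y i) = axis i 1"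
    by metis
  define R where "R z w i = J1 z (X i) + J2 z (prj w u) (prj w (Y i))" for z w i
  define E where "E x = (\<Sum>i\<in>UNIV. norm (R (fst x) (snd x) i - axis i 1))" for x
  let ?D = "{x. fst x \<in> cball 0 1 \<and> snd x \<noteq> 0}"
  have "continuous_on ?D E" unfolding E_def R_def prj_def
    by (intro continuous_intros) auto
  moreover have "(p, p) \<in> ?D" using p by auto
  moreover have "E (p, p) = 0" by (simp add: E_def R_def prj_id u XY)
  ultimately have "\<exists>\<delta>>0. \<forall>x\<in>?D. dist x (p, p) < \<delta> \<longrightarrow> dist (E x) 0 < 1/2"
    unfolding continuous_on_iff by (elim ballE[of _ _ "(p, p)"] allE[of _ "1/2"]) simp_all
  then obtain \<delta> where \<delta>0: "\<delta> > 0" "\<And>x. x \<in> ?D \<Longrightarrow> dist x (p, p) < \<delta> \<Longrightarrow> dist (E x) 0 < 1/2" by blast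
  have \<delta>: "\<delta> > 0" "\<And>x. x \<in> ?D \<Longrightarrow> dist x (p, p) < \<delta> \<Longrightarrow> E x < 1/2"
    using \<delta>0 by (fastforce simp: dist_real_def)+
  define \<rho> where "\<rho> = min (\<delta> / 2) (1/2)"
  \<comment> \<open>One factor 2 bounds \<open>f\<close> by \<open>e\<close>; the second in the last
    term is the bound of \<open>norm_prj_le\<close>.\<close>
  define c where "c = 2 * (\<Sum>i\<in>UNIV. norm (X i)) + 4 * (\<Sum>i\<in>UNIV. norm (Y i))"
  have c: "c \<ge> 0" "2 * (\<Sum>i\<in>UNIV. norm (X i)) \<le> c" "4 * (\<Sum>i\<in>UNIV. norm (Y i)) \<le> c" by (simp_all add: c_def sum_nonneg)
  have "\<exists>x y. hdot y w = 0 \<and> J1 z x + J2 z (prj w u) y = e \<and> norm x \<le> c * norm e \<and> norm y \<le> c * norm e"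
    if z: "z \<in> cball 0 1" "dist z p < \<rho>" and w: "dist w p < \<rho>" for z w e
  proof -
    have "w \<noteq> 0" using w p by (auto simp: \<rho>_def)
    moreover have "dist (z, w) (p, p) < \<delta>"
    proof -
      have "dist (z, w) (p, p) \<le> dist z p + dist w p" unfolding dist_Pair_Pair by (rule sqrt_sum_squares_le_sum) auto
      then show ?thesis using z w by (simp add: \<rho>_def)
    qed
    ultimately have E: "E (z, w) < 1/2" using \<delta>(2) z by simp
    define T where "T e = (\<Sum>i\<in>UNIV. e $ i *s R z w i)" for e :: "complex^'b"
    have lT: "lin T" by (rule linI) (simp_all add: T_def vec_eq_iff sum.distrib sum_distrib_left algebra_simps)
    have Te: "norm (T e - e) \<le> norm e / 2" for e
    proof -
      have l: "lin (\<lambda>e. T e - e)" by (rule linI) (simp_all add: lin_add[OF lT] lin_scale[OF lT] vec_eq_iff algebra_simps)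
      have "T (axis i 1) = R z w i" for i
        by (simp add: T_def axis_def if_distrib[of "\<lambda>a. a *s _"] cong: if_cong)
      then have "norm (T e - e) \<le> norm e * E (z, w)" using lin_bound[OF l, of e] by (simp add: E_def)
      also have "\<dots> \<le> norm e * (1/2)" using E by (intro mult_left_mono) auto
      finally show ?thesis by simp
    qed
    have "e = 0" if "T e = 0" for e using Te[of e] that by simp
    then obtain f where f: "T f = e" using lin_inj_surj[OF lT] by blast
    have nf: "norm f \<le> 2 * norm e" using Te[of f] norm_triangle_ineq2[of f "f - T f"] f by (simp add: norm_minus_commute)
    define x y where "x = (\<Sum>i\<in>UNIV. f $ i *s X i)" and "y = (\<Sum>i\<in>UNIV. f $ i *s prj w (Y i))"
    have "hdot y w = 0" by (simp add: y_def hdot_sum)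
    moreover have "J1 z x + J2 z (prj w u) y = e"
      unfolding f[symmetric] T_def R_def x_def y_def by (simp add: lin_sum[OF lin_J1] lin_sum[OF lin_J2(1)] sum.distrib vector_add_ldistrib)
    moreover have "norm x \<le> c * norm e"
    proof -
      have "norm x \<le> (\<Sum>i\<in>UNIV. (2 * norm e) * norm (X i))" unfolding x_def
        by (rule sum_norm_le) (simp only: norm_smult, intro mult_right_mono order_trans[OF Finite_Cartesian_Product.norm_nth_le nf] norm_ge_zero)
      also have "\<dots> = (2 * (\<Sum>i\<in>UNIV. norm (X i))) * norm e" by (simp add: sum_distrib_left[symmetric])
      also have "\<dots> \<le> c * norm e" by (rule mult_right_mono[OF c(2)]) simp
      finally show ?thesis .
    qed
    moreover have "norm y \<le> c * norm e"
    proof -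
      have "norm y \<le> (\<Sum>i\<in>UNIV. (2 * norm e) * (2 * norm (Y i)))" unfolding y_def
        by (rule sum_norm_le) (simp only: norm_smult, intro mult_mono norm_prj_le order_trans[OF Finite_Cartesian_Product.norm_nth_le nf], auto)
      also have "\<dots> = (4 * (\<Sum>i\<in>UNIV. norm (Y i))) * norm e" by (simp add: sum_distrib_left[symmetric])
      also have "\<dots> \<le> c * norm e" by (rule mult_right_mono[OF c(3)]) simp
      finally show ?thesis .
    qed
    ultimately show ?thesis by blast
  qed
  moreover have "\<rho> > 0" "\<rho> \<le> 1/2" using \<delta>(1) by (simp_all add: \<rho>_def)
  ultimately show ?thesis using c(1) by blast
qed

end

lemma det_axis: "det ((\<chi> j. axis j (1::complex)) :: complex^'n^'n) = 1"
proof -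
  have "((\<chi> j. axis j (1::complex)) :: complex^'n^'n) = mat 1" by (simp add: vec_eq_iff mat_def axis_def)
  then show ?thesis by simp
qed

context jets begin

lemma J3_0: "J3 z 0 v w = 0" using J3_scale(1)[of z 0 0 v w] by simp

lemma derJ_hdot:
  assumes t: "z + t *s d \<in> ball 0 1"
  shows "((\<lambda>t. hdot (G0 (z + t *s d)) l) has_field_derivative hdot (J1 (z + t *s d) d) l) (at t)"
    and "((\<lambda>t. hdot (J1 (z + t *s d) v) l) has_field_derivative hdot (J2 (z + t *s d) v d) l) (at t)"
    and "((\<lambda>t. hdot (J2 (z + t *s d) v w) l) has_field_derivative hdot (J3 (z + t *s d) v w d) l) (at t)"
  unfolding hdot_def by (intro DERIV_sum DERIV_cmult_right derJ[OF t])+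

lemma hdot_constant_on_segment:
  assumes b: "\<And>t. 0 < t \<Longrightarrow> t < 1 \<Longrightarrow> z0 + of_real t *s h \<in> ball 0 1 \<and> hdot (J1 (z0 + of_real t *s h) h) l = 0"
    and c: "\<And>t. t \<in> {0..1} \<Longrightarrow> z0 + of_real t *s h \<in> cball 0 1"
  shows "hdot (G0 (z0 + h) - G0 z0) l = 0"
proof -
  define g where "g (i::unit) t = hdot (G0 (z0 + of_real t *s h) - G0 z0) l" for i and t :: real
  have "g () 1 = 0"
  proof (rule gronwall_zero[where f' = "\<lambda>_ _. 0" and M = 0])
    show "continuous_on {0..1} (g i)" for i unfolding g_def by (intro continuous_intros c)
    show "(g i has_vector_derivative 0) (at t)" if t: "0 < t" "t < 1" for i t
    proof -
      have "((\<lambda>t. hdot (G0 (z0 + t *s h)) l - hdot (G0 z0) l) has_field_derivative 0) (at (of_real t))"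
        using DERIV_diff[OF derJ_hdot(1)[of z0 "of_real t" h l] DERIV_const[of "hdot (G0 z0) l"]] b[OF t] by simp
      then show ?thesis unfolding g_def hdot_diff by (rule has_vector_derivative_real_field)
    qed
  qed (simp_all add: g_def)
  then show ?thesis by (simp add: g_def)
qed

text \<open>The goal shared by the degenerate and the nondegenerate case: the functions
  \<open>K(\<cdot>,p)\<close> lie in the span of two fixed functions on an open set, written without
  the denominator.\<close>

definition kernel_spanned where "kernel_spanned \<longleftrightarrow>
  (\<exists>Z f1 f2 p1 \<epsilon>. open Z \<and> Z \<noteq> {} \<and> Z \<subseteq> ball 0 1 \<and> norm p1 = 1 \<and> \<epsilon> > 0 \<and>
    (\<forall>p. norm p = 1 \<longrightarrow> dist p p1 < \<epsilon> \<longrightarrow> (\<exists>a b. \<forall>z'\<in>Z. 1 - hdot (G0 z') (G0 p) = (1 - hdot z' p) * (a * f1 z' + b * f2 z'))))"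

end

section \<open>Functionals annihilating tangential jets, and their transport\<close>

locale nd_jets = jets G0 G1 G2 G3
  for G0 :: "complex^'a \<Rightarrow> complex^'b" and G1 G2 G3 +
  fixes p0 u :: "complex^'a" and \<rho> c :: real
  assumes p0: "norm p0 = 1" and \<rho>: "\<rho> > 0" "\<rho> \<le> 1/2" and c: "c \<ge> 0"
    and nd: "z \<in> cball 0 1 \<Longrightarrow> dist z p0 < \<rho> \<Longrightarrow> dist w p0 < \<rho> \<Longrightarrow>
      \<exists>x y. hdot y w = 0 \<and> J1 z x + J2 z (prj w u) y = e \<and> norm x \<le> c * norm e \<and> norm y \<le> c * norm e"
    and dim: "CARD('b) + 1 = 2 * CARD('a)" "CARD('a) \<ge> 3"
begin

definition near :: "complex^'a \<Rightarrow> complex^'a \<Rightarrow> bool" where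
  "near z w \<longleftrightarrow> z \<in> cball 0 1 \<and> dist z p0 < \<rho> \<and> dist w p0 < \<rho> \<and> hdot z w = 1"

lemma near_nz: "dist z p0 < \<rho> \<Longrightarrow> z \<noteq> 0"
  using p0 \<rho> by (auto simp: dist_norm)

lemma nearD: "near z w \<Longrightarrow> z \<in> cball 0 1" "near z w \<Longrightarrow> hdot z w = 1" "near z w \<Longrightarrow> z \<noteq> 0" "near z w \<Longrightarrow> w \<noteq> 0"
  by (auto simp: near_def near_nz)

lemma nd_form: assumes "z \<in> cball 0 1" "dist z p0 < \<rho>" "dist w p0 < \<rho>" shows "nd_form (J1 z) (J2 z) (prj w u) w"
proof -
  have "bilinear_form (J1 z) (J2 z)"
    by (rule bilinear_form.intro) (use lin_J1 J2_sym[OF assms(1)] in auto)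
  moreover have "nd_form_axioms (J1 z) (J2 z) (prj w u) w"
  proof (rule nd_form_axioms.intro)
    show "\<exists>x y. hdot y w = 0 \<and> J1 z x + J2 z (prj w u) y = e" for e using nd[OF assms] by blast
  qed (use dim assms near_nz in auto)
  ultimately show ?thesis by (rule nd_form.intro)
qed

lemma asym_form: assumes "z \<in> cball 0 1" "dist z p0 < \<rho>" "dist w p0 < \<rho>" shows "asym_form (J1 z) (J2 z) (prj w u) w"
proof -
  interpret nd_form "J1 z" "J2 z" "prj w u" w by (rule nd_form[OF assms])
  show ?thesis
    by (rule asym_form.intro[OF nd_form[OF assms]], rule asym_form_axioms.intro)
      (use asym_par_all[OF assms(1) near_nz[OF assms(2)] dim] in \<open>simp add: asy_def asym_def\<close>)
qed

text \<open>The substitute for the value of the map at the reflected point \<open>w\<close>. The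
  first condition fixes the scale; on the sphere, for \<open>z = w = p\<close>, multiples of
  \<open>G0 p\<close> satisfy the annihilation conditions.\<close>

definition annih :: "complex^'a \<Rightarrow> complex^'a \<Rightarrow> complex^'b \<Rightarrow> bool" where
  "annih z w \<xi> \<longleftrightarrow> (\<forall>x. hdot (J1 z x) \<xi> = hdot x w) \<and> (\<forall>y. hdot y w = 0 \<longrightarrow> hdot (J2 z (prj w u) y) \<xi> = 0)
    \<and> (\<forall>h h'. hdot h w = 0 \<longrightarrow> hdot h' w = 0 \<longrightarrow> hdot (J2 z h h') \<xi> = 0)
    \<and> (\<forall>h h' h''. hdot h w = 0 \<longrightarrow> hdot h' w = 0 \<longrightarrow> hdot h'' w = 0 \<longrightarrow> hdot (J3 z h h' h'') \<xi> = 0)"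

lemma annihD: "annih z w \<xi> \<Longrightarrow> hdot (J1 z x) \<xi> = hdot x w"
  "annih z w \<xi> \<Longrightarrow> hdot h w = 0 \<Longrightarrow> hdot h' w = 0 \<Longrightarrow> hdot (J2 z h h') \<xi> = 0"
  "annih z w \<xi> \<Longrightarrow> hdot h w = 0 \<Longrightarrow> hdot h' w = 0 \<Longrightarrow> hdot h'' w = 0 \<Longrightarrow> hdot (J3 z h h' h'') \<xi> = 0"
  unfolding annih_def by blast+

text \<open>The first two conditions define \<open>\<xi>\<close> by coordinates. If some tangential
  second or third derivative had a nonzero product with it, then that vector together with
  tangential first and second derivatives would generate all coordinate vectors, against
  \<open>tangential_jets_dependent\<close>.\<close>

lemma annih_ex: assumes n: "near z w" shows "\<exists>\<xi>. annih z w \<xi>"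
proof -
  interpret F: nd_form "J1 z" "J2 z" "prj w u" w by (rule nd_form) (use n in \<open>auto simp: near_def\<close>)
  have "\<exists>\<xi>. \<forall>e. hdot (F.xc e) w = hdot e \<xi>" by (rule functional_hdot) (simp_all add: F.xy_add F.xy_scale)
  then obtain \<xi> where \<xi>: "\<And>e. hdot e \<xi> = hdot (F.xc e) w" by metis
  have kill: "hdot (J2 z b c + J3 z d e f) \<xi> = 0"
    if h: "hdot b w = 0" "hdot c w = 0" "hdot d w = 0" "hdot e w = 0" "hdot f w = 0" for b c d e f
  proof (rule ccontr)
    define e0 where "e0 = J2 z b c + J3 z d e f"
    define s where "s = hdot e0 \<xi>"
    assume "hdot (J2 z b c + J3 z d e f) \<xi> \<noteq> 0"
    then have s: "s \<noteq> 0" by (simp add: s_def e0_def)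
    \<comment> \<open>The multiple of \<open>e0\<close> to be split off so that the remaining
      coordinate \<open>a j\<close> becomes orthogonal to \<open>w\<close>.\<close>
    define t where "t j = hdot (axis j 1) \<xi> / s" for j :: 'b
    define a where "a j = F.xc (axis j 1) - t j *s F.xc e0" for j
    define y where "y j = F.yc (axis j 1) - t j *s F.yc e0" for j
    have a: "hdot (a j) w = 0" for j using s unfolding a_def t_def by (simp only: hdot_diff hdot_scale \<xi>[symmetric] s_def[symmetric]) simp
    have y: "hdot (y j) w = 0" for j by (simp add: y_def)
    have "J1 z (a j) + J2 z (prj w u) (y j) + J2 z (t j *s b) c + J3 z (t j *s d) e f = axis j 1" for j
    proof -
      have "J1 z (a j) + J2 z (prj w u) (y j) + t j *s e0 = (J1 z (F.xc (axis j 1)) + J2 z (prj w u) (F.yc (axis j 1)))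
         - t j *s (J1 z (F.xc e0) + J2 z (prj w u) (F.yc e0)) + t j *s e0"
        by (simp add: a_def y_def vec_eq_iff algebra_simps)
      then show ?thesis unfolding F.xc_yc by (simp add: e0_def vector_add_ldistrib add.assoc)
    qed
    moreover have "det (\<chi> j. J1 z (a j) + J2 z (prj w u) (y j) + J2 z (t j *s b) c + J3 z (t j *s d) e f) = 0"
      by (rule tangential_jets_dependent[OF nearD(1,2)[OF n]]) (simp_all add: a y h)
    ultimately have "det ((\<chi> j. axis j (1::complex)) :: complex^'b^'b) = 0" by simp
    then show False by (simp add: det_axis)
  qed
  have "annih z w \<xi>" unfolding annih_def
  proof (intro conjI allI impI)
    show "hdot (J1 z x) \<xi> = hdot x w" for x by (simp add: \<xi> F.xy_L)
    show "hdot (J2 z (prj w u) y) \<xi> = 0" if "hdot y w = 0" for y using that by (simp add: \<xi> F.yc_B)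
    show "hdot (J2 z h h') \<xi> = 0" if "hdot h w = 0" "hdot h' w = 0" for h h'
      using kill[of h h' 0 0 0] that by (simp add: J3_0)
    show "hdot (J3 z h h' h'') \<xi> = 0" if "hdot h w = 0" "hdot h' w = 0" "hdot h'' w = 0" for h h' h''
      using kill[of 0 0 h h' h''] that by simp
  qed
  then show ?thesis by blast
qed

definition X where "X z w = (SOME \<xi>. annih z w \<xi>)"

lemma X: "near z w \<Longrightarrow> annih z w (X z w)"
  unfolding X_def by (rule someI_ex) (rule annih_ex)

lemma X_nz: "near z w \<Longrightarrow> X z w \<noteq> 0"
  using annihD(1)[OF X, of z w z] by (auto simp: near_def)

lemma annih_unique:
  assumes n: "near z w" and lz: "\<And>h. hdot h w = 0 \<Longrightarrow> hdot (J1 z h) l = 0" "\<And>h. hdot h w = 0 \<Longrightarrow> hdot (J2 z (prj w u) h) l = 0"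
  shows "\<exists>k. l = k *s X z w"
proof -
  interpret F: nd_form "J1 z" "J2 z" "prj w u" w by (rule nd_form) (use n in \<open>auto simp: near_def\<close>)
  define k where "k = hdot (J1 z w) l / hdot w w"
  have "hdot e l = hdot e (cnj k *s X z w)" for e
  proof -
    have d: "F.xc e = (hdot (F.xc e) w / hdot w w) *s w + prj w (F.xc e)" by (rule prj_decomp)
    have "hdot e l = hdot (J1 z (F.xc e)) l + hdot (J2 z (prj w u) (F.yc e)) l" using F.xc_yc[of e] by (metis hdot_add(1))
    also have "\<dots> = hdot (J1 z (F.xc e)) l" by (simp add: lz)
    also have "\<dots> = k * hdot (F.xc e) w" by (subst d) (simp add: lz k_def)
    also have "hdot (F.xc e) w = hdot e (X z w)"
    proof -
      have "hdot e (X z w) = hdot (J1 z (F.xc e)) (X z w) + hdot (J2 z (prj w u) (F.yc e)) (X z w)" using F.xc_yc[of e] by (metis hdot_add(1))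
      then show ?thesis using annihD(1,2)[OF X[OF n]] by simp
    qed
    finally show ?thesis by simp
  qed
  then show ?thesis using hdot_ext by blast
qed

text \<open>Along the segment between two points of the hyperplane polar to \<open>w\<close>,
  products of first and second jets with the fixed \<open>l = X z0 w\<close> have as derivatives
  products with second and third jets in tangential directions. These jets are annihilated by
  \<open>X (Z t) w\<close>, so their products with \<open>l\<close> are bounded by the original
  ones. Starting at zero, all of them stay zero.\<close>

lemma transport:
  assumes n0: "near z0 w" and n1: "near z1 w"
  shows "\<exists>k. X z0 w = k *s X z1 w" and "hdot (G0 z1 - G0 z0) (X z0 w) = 0"
proof -
  define h where "h = z1 - z0"
  define Z where "Z t = z0 + of_real t *s h" for t
  define l where "l = X z0 w"
  define \<mu> where "\<mu> = prj w u"
  have hw: "hdot h w = 0" "hdot \<mu> w = 0" using nearD(2)[OF n0] nearD(2)[OF n1] by (simp_all add: h_def \<mu>_def)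
  have Zc: "Z t = (1 - t) *\<^sub>R z0 + t *\<^sub>R z1" for t by (simp add: Z_def h_def of_real_smult algebra_simps)
  have Zn: "near (Z t) w" if "0 \<le> t" "t \<le> 1" for t
  proof -
    have "Z t \<in> cball 0 1" "Z t \<in> ball p0 \<rho>" unfolding Zc
      using n0 n1 that by (intro convexD convex_cball convex_ball; simp add: near_def dist_commute)+
    moreover have "hdot (Z t) w = 1" using nearD(2)[OF n0] hw by (simp add: Z_def)
    ultimately show ?thesis using n0 by (simp add: near_def dist_commute)
  qed
  define f where "f i t = (case i of Inl j \<Rightarrow> hdot (J1 (Z t) (prj w (axis j 1))) l | Inr j \<Rightarrow> hdot (J2 (Z t) \<mu> (prj w (axis j 1))) l)" for i :: "'a + 'a" and t
  define f' where "f' i t = (case i of Inl j \<Rightarrow> hdot (J2 (Z t) (prj w (axis j 1)) h) l | Inr j \<Rightarrow> hdot (J3 (Z t) \<mu> (prj w (axis j 1)) h) l)" for i :: "'a + 'a" and t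
  \<comment> \<open>A vector annihilated by \<open>X (Z t) w\<close> has tangential coordinates, so
    its product with \<open>l\<close> is a combination of the entries of \<open>f\<close> with
    coefficients controlled by \<open>c\<close>.\<close>
  have ker: "cmod (hdot e l) \<le> c * norm e * (\<Sum>i\<in>UNIV. cmod (f i t))" if t: "0 \<le> t" "t \<le> 1" and e: "hdot e (X (Z t) w) = 0" for e t
  proof -
    obtain x y where xy: "hdot y w = 0" "J1 (Z t) x + J2 (Z t) \<mu> y = e" "norm x \<le> c * norm e" "norm y \<le> c * norm e"
      using nd[of "Z t" w e] Zn[OF t] unfolding near_def \<mu>_def by blast
    have "hdot x w = 0" using e annihD(1,2)[OF X[OF Zn[OF t]]] hw xy by (metis add.right_neutral hdot_add(1))
    then have ex: "x = (\<Sum>i\<in>UNIV. x $ i *s prj w (axis i 1))" by (rule prj_expand)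
    have ey: "y = (\<Sum>i\<in>UNIV. y $ i *s prj w (axis i 1))" by (rule prj_expand[OF xy(1)])
    have "hdot e l = (\<Sum>i\<in>UNIV. x $ i * f (Inl i) t) + (\<Sum>i\<in>UNIV. y $ i * f (Inr i) t)"
      unfolding xy(2)[symmetric] by (subst ex, subst ey) (simp add: lin_sum[OF lin_J1] lin_sum[OF lin_J2(1)] hdot_sum f_def)
    then have "cmod (hdot e l) \<le> cmod (\<Sum>i\<in>UNIV. x $ i * f (Inl i) t) + cmod (\<Sum>i\<in>UNIV. y $ i * f (Inr i) t)"
      by (simp add: norm_triangle_ineq)
    also have "\<dots> \<le> c * norm e * (\<Sum>i\<in>UNIV. cmod (f (Inl i) t)) + c * norm e * (\<Sum>i\<in>UNIV. cmod (f (Inr i) t))"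
      by (intro add_mono cmod_sum_le xy)
    finally show ?thesis by (simp add: sum_UNIV_sum distrib_left)
  qed
  have Zcont: "continuous_on {0..1} Z" unfolding Z_def by (intro continuous_intros)
  have Zcb: "t \<in> {0..1} \<Longrightarrow> Z t \<in> cball 0 1" for t using Zn by (auto simp: near_def)
  have bd: "\<exists>M. \<forall>t\<in>{0..1}. norm (e t) \<le> M" if "continuous_on {0..1} e" for e :: "real \<Rightarrow> complex^'b"
  proof -
    have "bounded (e ` {0..1})" using compact_continuous_image[OF that] compact_imp_bounded by blast
    then show ?thesis by (auto simp: bounded_iff)
  qed
  have "\<exists>M. \<forall>t\<in>{0..1}. norm (J2 (Z t) (prj w (axis j 1)) h) \<le> M" "\<exists>M. \<forall>t\<in>{0..1}. norm (J3 (Z t) \<mu> (prj w (axis j 1)) h) \<le> M" for j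
    by (intro bd continuous_intros Zcont; simp only: Zcb)+
  then obtain M1 M2 where M: "\<And>t j. t \<in> {0..1} \<Longrightarrow> norm (J2 (Z t) (prj w (axis j 1)) h) \<le> M1 j"
    "\<And>t j. t \<in> {0..1} \<Longrightarrow> norm (J3 (Z t) \<mu> (prj w (axis j 1)) h) \<le> M2 j" by metis
  define M where "M = (\<Sum>j\<in>UNIV. \<bar>M1 j\<bar> + \<bar>M2 j\<bar>)"
  have M12: "M1 j \<le> M" "M2 j \<le> M" for j
    using member_le_sum[of j UNIV "\<lambda>j. \<bar>M1 j\<bar> + \<bar>M2 j\<bar>"] unfolding M_def by (auto)
  have in_ball: "Z t \<in> ball 0 1" if "0 < t" "t < 1" "z0 \<noteq> z1" for t
    unfolding Z_def h_def of_real_smult mem_ball_0 by (rule segment_in_ball) (use n0 n1 that in \<open>auto simp: near_def\<close>)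
  have f0: "f i t = 0" if t: "0 \<le> t" "t \<le> 1" for i t
  proof (cases "z0 = z1")
    case True
    then have "Z t = z0" by (simp add: Z_def h_def)
    then show ?thesis using annihD(1,2)[OF X[OF n0]] hw by (simp add: f_def l_def split: sum.split)
  next
    case False
    show ?thesis
    proof (rule gronwall_zero[where f = f and f' = f' and M = "c * M"])
      show "continuous_on {0..1} (f i)" for i
        unfolding f_def by (cases i) (simp_all, (intro continuous_intros Zcont Zcb; assumption?)+)
      show "(f i has_vector_derivative f' i t) (at t)" if t: "0 < t" "t < 1" for i t
      proof (cases i)
        case (Inl j)
        show ?thesis unfolding f_def f'_def Inl sum.case Z_def
          by (rule has_vector_derivative_real_field[OF derJ_hdot(2)[OF in_ball[OF t False, unfolded Z_def]]])
      next
        case (Inr j)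
        show ?thesis unfolding f_def f'_def Inr sum.case Z_def
          by (rule has_vector_derivative_real_field[OF derJ_hdot(3)[OF in_ball[OF t False, unfolded Z_def]]])
      qed
      show "cmod (f' i t) \<le> c * M * (\<Sum>j\<in>UNIV. cmod (f j t))" if t: "0 < t" "t < 1" for i t
      proof -
        have t': "0 \<le> t" "t \<le> 1" "t \<in> {0..1}" using t by auto
        have S: "0 \<le> (\<Sum>j\<in>UNIV. cmod (f j t))" by (intro sum_nonneg) simp
        obtain e where e: "f' i t = hdot e l" "hdot e (X (Z t) w) = 0" "norm e \<le> M"
        proof (cases i)
          case (Inl j)
          show ?thesis
            by (rule that[of "J2 (Z t) (prj w (axis j 1)) h"])
              (use annihD(2)[OF X[OF Zn[OF t'(1,2)]]] hw order_trans[OF M(1)[OF t'(3)] M12(1)] in \<open>auto simp: f'_def Inl\<close>)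
        next
          case (Inr j)
          show ?thesis
            by (rule that[of "J3 (Z t) \<mu> (prj w (axis j 1)) h"])
              (use annihD(3)[OF X[OF Zn[OF t'(1,2)]]] hw order_trans[OF M(2)[OF t'(3)] M12(2)] in \<open>auto simp: f'_def Inr\<close>)
        qed
        have "cmod (f' i t) \<le> c * norm e * (\<Sum>j\<in>UNIV. cmod (f j t))" using ker[OF t'(1,2) e(2)] e(1) by simp
        also have "\<dots> \<le> c * M * (\<Sum>j\<in>UNIV. cmod (f j t))" using c e(3) S by (intro mult_right_mono mult_left_mono)
        finally show ?thesis .
      qed
      show "f i 0 = 0" for i using annihD(1,2)[OF X[OF n0]] hw by (simp add: f_def l_def Z_def split: sum.split)
    qed (use t in auto)
  qed
  have Jh: "hdot (J1 (Z t) v) l = 0" if "0 \<le> t" "t \<le> 1" "hdot v w = 0" for t v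
    by (subst prj_expand[OF that(3)]) (use f0[OF that(1,2), of "Inl _"] in \<open>simp add: lin_sum[OF lin_J1] hdot_sum f_def\<close>)
  have Jh2: "hdot (J2 (Z t) \<mu> v) l = 0" if "0 \<le> t" "t \<le> 1" "hdot v w = 0" for t v
    by (subst prj_expand[OF that(3)]) (use f0[OF that(1,2), of "Inr _"] in \<open>simp add: lin_sum[OF lin_J2(1)] hdot_sum f_def\<close>)
  have Z1: "Z 1 = z1" by (simp add: Z_def h_def)
  show "\<exists>k. X z0 w = k *s X z1 w"
    using annih_unique[OF n1, of l] Jh[of 1] Jh2[of 1] unfolding Z1 l_def \<mu>_def by simp
  show "hdot (G0 z1 - G0 z0) (X z0 w) = 0"
  proof (cases "z0 = z1")
    case False
    have "hdot (G0 (z0 + h) - G0 z0) l = 0"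
      by (rule hdot_constant_on_segment) (use in_ball[OF _ _ False] Zcb Jh hw in \<open>auto simp: Z_def\<close>)
    then show ?thesis by (simp add: h_def l_def)
  qed simp
qed

end

section \<open>The functionals of one centre as the hyperplane varies\<close>

lemma dual_vector2:
  assumes "\<And>a b. y \<noteq> a *s u + b *s v" shows "\<exists>\<eta>. hdot u \<eta> = 0 \<and> hdot v \<eta> = 0 \<and> hdot y \<eta> = 1"
proof (cases "\<exists>c. v = c *s u")
  case True
  then obtain c where c: "v = c *s u" by blast
  have "y \<noteq> a *s u" for a using assms[of a 0] by simp
  then obtain \<eta> where "hdot u \<eta> = 0" "hdot y \<eta> = 1" using dual_vector by blast
  then show ?thesis using c by (intro exI[of _ \<eta>]) simp
next
  case False
  define v' y' where "v' = prj u v" and "y' = prj v' (prj u y)"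
  have v: "v = (hdot v u / hdot u u) *s u + v'" unfolding v'_def by (rule prj_decomp)
  have v'u: "hdot v' u = 0" "hdot u v' = 0" by (simp_all add: v'_def hdot_0_sym[of u])
  have y: "y = (hdot y u / hdot u u) *s u + ((hdot (prj u y) v' / hdot v' v') *s v' + y')"
    unfolding y'_def using prj_decomp[of y u] prj_decomp[of "prj u y" v'] by simp
  have y'u: "hdot y' u = 0" by (simp add: y'_def prj_def[of v'] v'u)
  have y'v: "hdot y' v' = 0" by (simp add: y'_def)
  have o: "hdot u y' = 0" "hdot v' y' = 0" using y'u y'v by (simp_all add: hdot_0_sym[of u] hdot_0_sym[of v'])
  have "hdot v y' = 0" by (subst v) (simp add: o)
  moreover have "hdot y y' = hdot y' y'" by (subst y) (simp add: o)
  moreover have "y' \<noteq> 0"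
  proof
    assume "y' = 0"
    then have "y = (hdot y u / hdot u u) *s u + (hdot (prj u y) v' / hdot v' v') *s v'" using y by simp
    also have "v' = v - (hdot v u / hdot u u) *s u" by (simp add: v'_def prj_def)
    also have "(hdot y u / hdot u u) *s u + (hdot (prj u y) (v - (hdot v u / hdot u u) *s u) / hdot (v - (hdot v u / hdot u u) *s u) (v - (hdot v u / hdot u u) *s u)) *s (v - (hdot v u / hdot u u) *s u)
      = (hdot y u / hdot u u - (hdot (prj u y) (v - (hdot v u / hdot u u) *s u) / hdot (v - (hdot v u / hdot u u) *s u) (v - (hdot v u / hdot u u) *s u)) * (hdot v u / hdot u u)) *s u
       + (hdot (prj u y) (v - (hdot v u / hdot u u) *s u) / hdot (v - (hdot v u / hdot u u) *s u) (v - (hdot v u / hdot u u) *s u)) *s v"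
      by (simp only: vec_eq_iff vector_smult_component vector_add_component vector_minus_component ring_distribs) algebra
    finally show False using assms by blast
  qed
  ultimately have "hdot u ((1 / cnj (hdot y' y')) *s y') = 0 \<and> hdot v ((1 / cnj (hdot y' y')) *s y') = 0 \<and> hdot y ((1 / cnj (hdot y' y')) *s y') = 1"
    using o by simp
  then show ?thesis by blast
qed

lemma multiple_if_annihilated: assumes "\<And>b. hdot \<delta> b = 0 \<Longrightarrow> hdot y b = 0" shows "\<exists>k. y = k *s \<delta>"
proof (rule ccontr)
  assume "\<not> ?thesis"
  then obtain \<eta> where "hdot \<delta> \<eta> = 0" "hdot y \<eta> = 1" using dual_vector[of y \<delta>] by blast
  then show False using assms by force
qed

text \<open>For independent \<open>\<delta>\<close>, \<open>\<nu>\<close>, \<open>\<kappa>\<close>,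
  polarisation forces \<open>v1 = - q \<kappa>\<close> and \<open>v2 = q \<nu>\<close> modulo
  \<open>\<delta>\<close> with one common \<open>q\<close>, and in the combination on the left these
  parts cancel. If \<open>\<kappa>\<close> is a multiple of \<open>\<nu>\<close>, the quadric is a
  product of two linear forms, one of which must vanish on the hyperplane.\<close>

lemma quadric_on_hyperplane:
  fixes \<delta> \<nu> \<kappa> :: "complex^'a"
  assumes f: "\<And>b. hdot \<delta> b = 0 \<Longrightarrow> hdot v1 b * hdot \<nu> b + hdot v2 b * hdot \<kappa> b = 0"
    and ind: "\<And>a b. \<delta> \<noteq> a *s \<nu> + b *s \<kappa>" and \<nu>: "\<nu> \<noteq> 0"
  shows "\<exists>k1 k2. \<forall>w. hdot \<nu> w \<noteq> 0 \<longrightarrow> hdot v1 w + hdot \<kappa> w / hdot \<nu> w * hdot v2 w = (k1 + hdot \<kappa> w / hdot \<nu> w * k2) * hdot \<delta> w"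
proof -
  have pol: "hdot v1 b * hdot \<nu> b' + hdot v1 b' * hdot \<nu> b + hdot v2 b * hdot \<kappa> b' + hdot v2 b' * hdot \<kappa> b = 0"
    if "hdot \<delta> b = 0" "hdot \<delta> b' = 0" for b b'
  proof -
    have "hdot \<delta> (b + b') = 0" using that by simp
    from f[OF this] f[OF that(1)] f[OF that(2)] show ?thesis unfolding hdot_add by algebra
  qed
  show ?thesis
  proof (cases "\<exists>r. \<kappa> = r *s \<nu>")
    case True
    then obtain r where r: "\<kappa> = r *s \<nu>" by blast
    have "\<exists>k. v1 + r *s v2 = k *s \<delta>"
    proof (rule ccontr)
      assume a: "\<not> ?thesis"
      obtain b1 where b1: "hdot \<delta> b1 = 0" "hdot (v1 + r *s v2) b1 = 1" using dual_vector[of "v1 + r *s v2" \<delta>] a by blast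
      have "\<nu> \<noteq> k *s \<delta>" for k
      proof
        assume k: "\<nu> = k *s \<delta>"
        then have "k \<noteq> 0" using \<nu> by auto
        then have "\<delta> = (1 / k) *s \<nu> + 0 *s \<kappa>" using k by simp
        then show False using ind by blast
      qed
      then obtain b2 where b2: "hdot \<delta> b2 = 0" "hdot \<nu> b2 = 1" using dual_vector[of \<nu> \<delta>] by blast
      have g: "hdot (v1 + r *s v2) b * hdot \<nu> b = 0" if "hdot \<delta> b = 0" for b
        using f[OF that] by (simp add: r algebra_simps)
      have "hdot \<delta> (b1 + b2) = 0" using b1 b2 by simp
      from g[OF this] g[OF b1(1)] g[OF b2(1)] b1(2) b2(2) show False by (simp only: hdot_add(2)) simp
    qed
    then obtain k where k: "v1 + r *s v2 = k *s \<delta>" by blast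
    have h: "hdot v1 w + r * hdot v2 w = k * hdot \<delta> w" for w using arg_cong[OF k, of "\<lambda>x. hdot x w"] by simp
    show ?thesis by (rule exI[of _ k], rule exI[of _ 0]) (simp add: r h)
  next
    case False
    have exch: "x \<noteq> a *s \<delta> + b *s y" if d: "\<And>a b. \<delta> \<noteq> a *s x + b *s y" and xy: "\<And>r. x \<noteq> r *s y" for x y a b
    proof
      assume e: "x = a *s \<delta> + b *s y"
      show False
      proof (cases "a = 0")
        case a: False
        have "\<delta> = (1 / a) *s (a *s \<delta>)" using a by simp
        also have "a *s \<delta> = x - b *s y" using e by simp
        finally have "\<delta> = (1 / a) *s x + (- b / a) *s y" by (simp add: vec_eq_iff algebra_simps)
        then show False using d by blast
      qed (use e xy in simp)
    qed
    have "\<nu> \<noteq> r *s \<kappa>" for r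
    proof
      assume "\<nu> = r *s \<kappa>"
      then have "\<kappa> = (1 / r) *s \<nu>" using \<nu> by auto
      then show False using False by blast
    qed
    from exch[OF ind this]
    obtain n where n: "hdot \<delta> n = 0" "hdot \<kappa> n = 0" "hdot \<nu> n = 1" using dual_vector2[of \<nu> \<delta> \<kappa>] by blast
    have "\<delta> \<noteq> a *s \<kappa> + b *s \<nu>" for a b using ind[of b a] by (simp add: add.commute)
    from exch[OF this] False
    obtain k where k: "hdot \<delta> k = 0" "hdot \<nu> k = 0" "hdot \<kappa> k = 1" using dual_vector2[of \<kappa> \<delta> \<nu>] by blast
    define q where "q = hdot v2 n"
    have z: "hdot v1 n = 0" "hdot v2 k = 0" using f[OF n(1)] f[OF k(1)] n k by simp_all
    have kn: "hdot v1 k = - q" using pol[OF n(1) k(1)] n k z by (simp add: q_def eq_neg_iff_add_eq_0 add.commute)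
    have "\<exists>k1. v1 + q *s \<kappa> = k1 *s \<delta>"
      by (rule multiple_if_annihilated) (use pol[OF _ n(1)] n z in \<open>simp add: q_def mult.commute\<close>)
    then obtain k1 where k1: "v1 + q *s \<kappa> = k1 *s \<delta>" by blast
    have "\<exists>k2. v2 - q *s \<nu> = k2 *s \<delta>"
      by (rule multiple_if_annihilated) (use pol[OF _ k(1)] k z kn in \<open>simp add: mult.commute\<close>)
    then obtain k2 where k2: "v2 - q *s \<nu> = k2 *s \<delta>" by blast
    have 1: "hdot v1 w = k1 * hdot \<delta> w - q * hdot \<kappa> w" for w using arg_cong[OF k1, of "\<lambda>x. hdot x w"] by (simp add: algebra_simps)
    have 2: "hdot v2 w = k2 * hdot \<delta> w + q * hdot \<nu> w" for w using arg_cong[OF k2, of "\<lambda>x. hdot x w"] by (simp add: algebra_simps)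
    show ?thesis by (rule exI[of _ k1], rule exI[of _ k2]) (simp add: 1 2 field_simps)
  qed
qed

context nd_jets begin

text \<open>\<open>X z w\<close> annihilates tangential second derivatives, so \<open>Y h\<close>
  has product zero with it whenever \<open>h\<close> is orthogonal to \<open>w\<close>; on other
  vectors only a factor remains, and \<open>Y \<nu> = J1 z \<kappa>\<close> determines it. The
  vectors \<open>\<nu>\<close>, \<open>\<kappa>\<close> depend on \<open>z\<close> but not on
  \<open>w\<close>.\<close>

lemma center_structure:
  assumes z: "z \<in> cball 0 1" "dist z p0 < \<rho>"
  shows "\<exists>Y \<nu> \<kappa>. \<nu> \<noteq> 0 \<and> (\<forall>e. \<exists>v v'. e = J1 z v + Y v') \<and>
    (\<forall>w. near z w \<longrightarrow> hdot \<nu> w \<noteq> 0 \<and> (\<forall>v. hdot (Y v) (X z w) = hdot \<kappa> w / hdot \<nu> w * hdot v w))"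
proof -
  interpret A: asym_form "J1 z" "J2 z" "prj p0 u" p0 by (rule asym_form[OF z]) (use \<rho> in simp)
  obtain \<xi> \<beta> Y \<nu> \<kappa> where S: "lin Y" "\<And>v. J2 z v v = (2 * hdot v \<xi>) *s J1 z v + hdot v \<beta> *s Y v"
    "\<nu> \<noteq> 0" "Y \<nu> = J1 z \<kappa>" "\<And>e. \<exists>v v'. e = J1 z v + Y v'" by (rule A.second_form_structure) (rule that; assumption)
  have pol: "2 *s J2 z v v' = J1 z ((2 * hdot v \<xi>) *s v' + (2 * hdot v' \<xi>) *s v) + (hdot v \<beta> *s Y v' + hdot v' \<beta> *s Y v)" for v v'
  proof -
    have "2 *s J2 z v v' = J2 z (v + v') (v + v') - J2 z v v - J2 z v' v'"
      using J2_sym[OF z(1), of v' v] by (simp add: vec_eq_iff)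
    also have "\<dots> = J1 z ((2 * hdot v \<xi>) *s v' + (2 * hdot v' \<xi>) *s v) + (hdot v \<beta> *s Y v' + hdot v' \<beta> *s Y v)"
      unfolding S(2) by (simp add: lin_add[OF S(1)] vec_eq_iff algebra_simps)
    finally show ?thesis .
  qed
  have "hdot \<nu> w \<noteq> 0 \<and> (\<forall>v. hdot (Y v) (X z w) = hdot \<kappa> w / hdot \<nu> w * hdot v w)" if n: "near z w" for w
  proof -
    define t where "t = prj w u"
    have tw: "hdot t w = 0" by (simp add: t_def)
    interpret F: nd_form "J1 z" "J2 z" t w unfolding t_def by (rule nd_form) (use n in \<open>auto simp: near_def\<close>)
    \<comment> \<open>Otherwise \<open>t\<close> itself would be asymptotic, against the
      independence of the ranges of \<open>J1 z\<close> and \<open>J2 z t\<close>.\<close>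
    have bt: "hdot t \<beta> \<noteq> 0"
    proof
      assume "hdot t \<beta> = 0"
      then have "J1 z ((- 2 * hdot t \<xi>) *s t) + J2 z t t = 0" using S(2)[of t] by (simp add: vec_eq_iff)
      then show False using F.nd_inj(2)[OF tw] F.u_nz by blast
    qed
    have Y1: "hdot (Y h) (X z w) = 0" if "hdot h w = 0" "hdot h \<beta> \<noteq> 0" for h
      using annihD(2)[OF X[OF n] that(1,1)] annihD(1)[OF X[OF n], of h] that unfolding S(2) by simp
    have Yh: "hdot (Y h) (X z w) = 0" if "hdot h w = 0" for h
    proof (cases "hdot h \<beta> = 0")
      case True
      then have "hdot (Y (h + t)) (X z w) = 0" using Y1[of "h + t"] bt tw that by simp
      then show ?thesis using Y1[OF tw bt] by (simp add: lin_add[OF S(1)])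
    qed (use Y1 that in blast)
    have \<nu>w: "hdot \<nu> w \<noteq> 0"
    proof
      assume a: "hdot \<nu> w = 0"
      \<comment> \<open>With this \<open>s\<close> the terms with \<open>Y t\<close> in
        \<open>2 *s J2 z t h\<close> cancel, so \<open>J2 z t h\<close> lies in the range of
        \<open>J1 z\<close> and \<open>h\<close> must be 0.\<close>
      define s where "s = - hdot \<nu> \<beta> / (2 * hdot t \<beta>)"
      define h where "h = \<nu> + s *s t"
      have hb: "hdot h \<beta> = - (s * hdot t \<beta>)" using bt by (simp add: h_def s_def)
      have Yhh: "Y h = J1 z \<kappa> + s *s Y t" by (simp add: h_def lin_add[OF S(1)] lin_scale[OF S(1)] S(4))
      have "2 *s J2 z t h = J1 z ((2 * hdot t \<xi>) *s h + (2 * hdot h \<xi>) *s t + hdot t \<beta> *s \<kappa>)"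
        unfolding pol hb Yhh by (simp add: vec_eq_iff algebra_simps)
      then have "J1 z (- ((2 * hdot t \<xi>) *s h + (2 * hdot h \<xi>) *s t + hdot t \<beta> *s \<kappa>)) + J2 z t (2 *s h) = 0"
        unfolding J1_neg J2_scale by simp
      moreover have "hdot (2 *s h) w = 0" using a tw by (simp add: h_def)
      ultimately have "2 *s h = 0" using F.nd_inj(2) by blast
      then have h0: "h = 0" by simp
      then have "s \<noteq> 0" using S(3) by (auto simp: h_def)
      have "J1 z \<kappa> + s *s Y t = 0" using Yhh h0 lin_0[OF S(1)] by simp
      then have "s *s J2 z t t = J1 z ((s * (2 * hdot t \<xi>)) *s t - hdot t \<beta> *s \<kappa>)"
        unfolding S(2) by (simp add: vec_eq_iff algebra_simps eq_neg_iff_add_eq_0) (metis (no_types) add.commute add_eq_0_iff mult.left_commute mult_minus_right)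
      then have "J1 z (- ((s * (2 * hdot t \<xi>)) *s t - hdot t \<beta> *s \<kappa>)) + J2 z t (s *s t) = 0"
        unfolding J1_neg J2_scale by simp
      then have "s *s t = 0" by (rule F.nd_inj(2)[rotated]) (simp add: tw)
      then show False using \<open>s \<noteq> 0\<close> F.u_nz by simp
    qed
    define C where "C = hdot (Y w) (X z w) / hdot w w"
    have C: "hdot (Y v) (X z w) = C * hdot v w" for v
      by (subst prj_decomp[of v w]) (simp add: lin_add[OF S(1)] lin_scale[OF S(1)] Yh C_def)
    have "hdot \<kappa> w = C * hdot \<nu> w" using C[of \<nu>] annihD(1)[OF X[OF n], of \<kappa>] S(4) by simp
    then show ?thesis using C \<nu>w by simp
  qed
  then show ?thesis using S(3,5) by blast
qed

text \<open>Write the increment of \<open>G0\<close> as \<open>J1 z v1 + Y v2\<close>. Its product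
  with \<open>X z w\<close> vanishes when \<open>w\<close> is polar to both \<open>z\<close> and
  \<open>z'\<close>; clearing the denominator gives a quadric vanishing on the hyperplane orthogonal
  to \<open>z' - z\<close>, and \<open>quadric_on_hyperplane\<close> divides by it.\<close>

lemma center_relation:
  assumes z: "z \<in> cball 0 1" "dist z p0 < \<rho>"
  shows "\<exists>\<nu> \<kappa>. \<nu> \<noteq> 0 \<and> (\<forall>w. near z w \<longrightarrow> hdot \<nu> w \<noteq> 0) \<and>
    (\<forall>z' w'. near z w' \<longrightarrow> near z' w' \<longrightarrow> (\<forall>a b. z' - z \<noteq> a *s \<nu> + b *s \<kappa>) \<longrightarrow>
      (\<exists>k1 k2. \<forall>w. near z w \<longrightarrow> hdot (G0 z' - G0 z) (X z w) = (k1 + hdot \<kappa> w / hdot \<nu> w * k2) * hdot (z' - z) w))"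
proof -
  obtain Y \<nu> \<kappa> where S: "\<nu> \<noteq> 0" "\<And>e. \<exists>v v'. e = J1 z v + Y v'" "\<And>w. near z w \<Longrightarrow> hdot \<nu> w \<noteq> 0"
    "\<And>w v. near z w \<Longrightarrow> hdot (Y v) (X z w) = hdot \<kappa> w / hdot \<nu> w * hdot v w"
    using center_structure[OF z] by blast
  have "\<exists>k1 k2. \<forall>w. near z w \<longrightarrow> hdot (G0 z' - G0 z) (X z w) = (k1 + hdot \<kappa> w / hdot \<nu> w * k2) * hdot (z' - z) w"
    if n: "near z w'" "near z' w'" and ind: "\<forall>a b. z' - z \<noteq> a *s \<nu> + b *s \<kappa>" for z' w'
  proof -
    define \<delta> where "\<delta> = z' - z"
    obtain v1 v2 where v: "G0 z' - G0 z = J1 z v1 + Y v2" using S(2) by blast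
    have E: "hdot (G0 z' - G0 z) (X z w) = hdot v1 w + hdot \<kappa> w / hdot \<nu> w * hdot v2 w" if "near z w" for w
      unfolding v using annihD(1)[OF X[OF that]] S(4)[OF that] by simp
    define f where "f b = hdot v1 b * hdot \<nu> b + hdot v2 b * hdot \<kappa> b" for b
    have f0: "f w = 0" if "near z w" "near z' w" for w
    proof -
      have "hdot v1 w + hdot \<kappa> w / hdot \<nu> w * hdot v2 w = 0" using E[OF that(1)] transport(2)[OF that] by simp
      then show ?thesis using S(3)[OF that(1)] by (simp add: f_def field_simps)
    qed
    have fb: "f b = 0" if b: "hdot \<delta> b = 0" for b
    proof -
      \<comment> \<open>Move \<open>w'\<close> along \<open>b\<close> and rescale, so that the
        product with \<open>z\<close> stays 1: the result is polar to both points, and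
        \<open>f\<close> vanishes there. As \<open>f\<close> is homogeneous and
        \<open>f w' = 0\<close>, comparing powers of \<open>t\<close> isolates
        \<open>f b\<close>.\<close>
      define W where "W t = w' + of_real t *s b" for t :: real
      define V where "V t = (1 / cnj (hdot z (W t))) *s W t" for t
      have W0: "hdot z (W 0) = 1" using nearD(2)[OF n(1)] by (simp add: W_def)
      have tW: "(W \<longlongrightarrow> W 0) (at_right 0)" unfolding W_def[abs_def] by (intro tendsto_intros)
      have th: "((\<lambda>t. hdot z (W t)) \<longlongrightarrow> 1) (at_right 0)" using tendsto_hdot[OF tendsto_const tW, of z] W0 by simp
      have "((\<lambda>t. (1 / cnj (hdot z (W t))) *s W t) \<longlongrightarrow> (1 / cnj 1) *s W 0) (at_right 0)"
        by (intro tendsto_intros tW th) simp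
      then have "((\<lambda>t. dist (V t) p0) \<longlongrightarrow> dist w' p0) (at_right 0)"
        unfolding V_def by (intro tendsto_intros) (simp add: W_def)
      then have e1: "eventually (\<lambda>t. dist (V t) p0 < \<rho>) (at_right 0)"
        by (rule order_tendstoD) (use n in \<open>simp add: near_def\<close>)
      have e2: "eventually (\<lambda>t. hdot z (W t) \<noteq> 0) (at_right 0)" by (rule tendsto_imp_eventually_ne[OF th]) simp
      have "eventually (\<lambda>t. f (W t) = 0) (at_right 0)" using e1 e2
      proof eventually_elim
        case (elim t)
        have "hdot z (V t) = 1" using elim by (simp add: V_def)
        moreover have "hdot \<delta> (V t) = 0" using nearD(2)[OF n(1)] nearD(2)[OF n(2)] b by (simp add: V_def W_def \<delta>_def)
        then have "hdot z' (V t) = hdot z (V t)" by (simp add: \<delta>_def)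
        ultimately have "f (V t) = 0" using f0[of "V t"] n elim by (simp add: near_def)
        moreover have "f (V t) = (1 / hdot z (W t)) * (1 / hdot z (W t)) * f (W t)"
          unfolding f_def V_def hdot_scale by (simp add: algebra_simps)
        ultimately show ?case using elim by simp
      qed
      then obtain t0 where t0: "t0 > 0" "\<And>t. 0 < t \<Longrightarrow> t < t0 \<Longrightarrow> f (W t) = 0"
        unfolding eventually_at_right_field by auto
      define f1 where "f1 = hdot v1 b * hdot \<nu> w' + hdot v1 w' * hdot \<nu> b + hdot v2 b * hdot \<kappa> w' + hdot v2 w' * hdot \<kappa> b"
      have fW: "f (W t) = of_real t * (f1 + of_real t * f b)" for t
        using f0[OF n] unfolding f_def W_def f1_def by (simp add: algebra_simps)
      have g: "f1 + of_real t * f b = 0" if "0 < t" "t < t0" for t using t0(2)[OF that] that unfolding fW by simp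
      have "f1 + of_real (t0/2) * f b = 0" "f1 + of_real (t0/4) * f b = 0" by (rule g; use t0(1) in simp)+
      then have "(of_real (t0/2) - of_real (t0/4)) * f b = 0" by algebra
      then show ?thesis using t0(1) by (simp flip: of_real_diff)
    qed
    have "\<exists>k1 k2. \<forall>w. hdot \<nu> w \<noteq> 0 \<longrightarrow> hdot v1 w + hdot \<kappa> w / hdot \<nu> w * hdot v2 w = (k1 + hdot \<kappa> w / hdot \<nu> w * k2) * hdot \<delta> w"
      by (rule quadric_on_hyperplane) (use fb ind S(1) in \<open>auto simp: f_def \<delta>_def\<close>)
    then show ?thesis using E S(3) unfolding \<delta>_def by metis
  qed
  then show ?thesis using S(1,3) by blast
qed

end

section \<open>Comparison of two centres\<close>

text \<open>The kernel functions are compared on \<open>Z\<close>; hyperplanes from \<open>W\<close>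
  miss \<open>Z\<close>, which keeps the denominators of \<open>K\<close> away from zero.\<close>

locale overlap = nd_jets +
  fixes Z W :: "(complex^'a) set"
  assumes openZ: "open Z" and Z_ne: "Z \<noteq> {}" and Z_ball: "Z \<subseteq> ball 0 1" and Z_near: "z' \<in> Z \<Longrightarrow> dist z' p0 < \<rho>"
    and openW: "open W" and WZ: "w \<in> W \<Longrightarrow> z' \<in> Z \<Longrightarrow> hdot z' w \<noteq> 1"
begin

text \<open>The points \<open>z\<close> that can serve as centres, and the functions on \<open>Z\<close> attached to them; for a point
  \<open>p\<close> of the sphere, \<open>K p p\<close> is a multiple of the kernel function of the map.\<close>

definition K :: "complex^'a \<Rightarrow> complex^'a \<Rightarrow> complex^'a \<Rightarrow> complex" where
  "K z w z' = hdot (G0 z' - G0 z) (X z w) / (hdot z' w - 1)"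

definition ok where "ok z w \<longleftrightarrow> near z w \<and> (\<forall>z'\<in>Z. hdot z' w \<noteq> 1)"

definition center where "center z \<longleftrightarrow> z \<in> cball 0 1 \<and> dist z p0 < \<rho> \<and> (\<forall>z'\<in>Z. \<exists>w. near z w \<and> near z' w)"

lemma ok_near: "ok z w \<Longrightarrow> near z w" and ok_W: "w \<in> W \<Longrightarrow> near z w \<Longrightarrow> ok z w"
  by (auto simp: ok_def WZ)

definition spn :: "(complex^'a \<Rightarrow> complex) \<Rightarrow> (complex^'a \<Rightarrow> complex) \<Rightarrow> (complex^'a \<Rightarrow> complex) \<Rightarrow> bool" where
  "spn f g h \<longleftrightarrow> (\<exists>a b. \<forall>z'\<in>Z. h z' = a * f z' + b * g z')"

lemma spnI: "(\<And>z'. z' \<in> Z \<Longrightarrow> h z' = a * f z' + b * g z') \<Longrightarrow> spn f g h"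
  unfolding spn_def by blast

lemma three_term_spn:
  assumes "\<And>z'. z' \<in> Z \<Longrightarrow> (r2 - r3) * f1 z' + (r3 - r1) * f2 z' + (r1 - r2) * f3 z' = 0" "r1 \<noteq> r2"
  shows "spn f1 f2 f3"
proof (rule spnI)
  fix z' assume z': "z' \<in> Z"
  show "f3 z' = (- (r2 - r3) / (r1 - r2)) * f1 z' + (- (r3 - r1) / (r1 - r2)) * f2 z'"
  proof -
    have "(r1 - r2) * f3 z' = - (r2 - r3) * f1 z' - (r3 - r1) * f2 z'" using assms(1)[OF z'] by algebra
    then have f3: "f3 z' = (- (r2 - r3) * f1 z' - (r3 - r1) * f2 z') / (r1 - r2)" using assms(2) by (simp add: eq_divide_eq mult.commute)
    have "(a * x - b * y) / c = a / c * x + - b / c * y" for a b c x y :: complex by (simp add: diff_divide_distrib)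
    then show ?thesis unfolding f3 .
  qed
qed

text \<open>At a fixed \<open>z'\<close>, \<open>K z w z'\<close> is an affine function of the ratio
  \<open>hdot \<kappa> w / hdot \<nu> w\<close>, so three of its values satisfy a linear relation
  whose coefficients do not involve \<open>z'\<close>. Points \<open>z'\<close> with
  \<open>z' - z\<close> in the span of \<open>\<nu>\<close>, \<open>\<kappa>\<close> are reached by
  continuity along a vector orthogonal to both.\<close>

lemma three_term:
  assumes z: "center z"
  shows "\<exists>\<nu> \<kappa>. \<nu> \<noteq> 0 \<and> (\<forall>w. near z w \<longrightarrow> hdot \<nu> w \<noteq> 0) \<and>
    (\<forall>w1 w2 w3. ok z w1 \<longrightarrow> ok z w2 \<longrightarrow> ok z w3 \<longrightarrow> hdot \<kappa> w1 / hdot \<nu> w1 \<noteq> hdot \<kappa> w2 / hdot \<nu> w2 \<longrightarrow>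
      spn (K z w1) (K z w2) (K z w3)) \<and>
    (\<forall>w1 w2 z'. ok z w1 \<longrightarrow> ok z w2 \<longrightarrow> z' \<in> Z \<longrightarrow> hdot \<kappa> w1 / hdot \<nu> w1 = hdot \<kappa> w2 / hdot \<nu> w2 \<longrightarrow> K z w1 z' = K z w2 z')"
proof -
  obtain \<nu> \<kappa> where N: "\<nu> \<noteq> 0" "\<And>w. near z w \<Longrightarrow> hdot \<nu> w \<noteq> 0"
    and R: "\<And>z' w'. near z w' \<Longrightarrow> near z' w' \<Longrightarrow> (\<forall>a b. z' - z \<noteq> a *s \<nu> + b *s \<kappa>) \<Longrightarrow>
      \<exists>k1 k2. \<forall>w. near z w \<longrightarrow> hdot (G0 z' - G0 z) (X z w) = (k1 + hdot \<kappa> w / hdot \<nu> w * k2) * hdot (z' - z) w"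
    using center_relation[of z] z unfolding center_def by blast
  define r where "r w = hdot \<kappa> w / hdot \<nu> w" for w
  obtain v where v: "norm v = 1" "hdot \<nu> v = 0" "hdot \<kappa> v = 0" using ex_orthogonal2[OF dim(2)] by blast
  have gen: "\<exists>k1 k2. \<forall>w. ok z w \<longrightarrow> K z w z' = k1 + r w * k2"
    if z': "z' \<in> Z" and ind: "\<forall>a b. z' - z \<noteq> a *s \<nu> + b *s \<kappa>" for z'
  proof -
    obtain w' where "near z w'" "near z' w'" using z z' unfolding center_def by blast
    then obtain k1 k2 where k: "\<And>w. near z w \<Longrightarrow> hdot (G0 z' - G0 z) (X z w) = (k1 + r w * k2) * hdot (z' - z) w"
      using R ind unfolding r_def by blast
    have "K z w z' = k1 + r w * k2" if "ok z w" for w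
    proof -
      have "hdot (z' - z) w = hdot z' w - 1" using nearD(2)[OF ok_near[OF that]] by simp
      moreover have "hdot z' w - 1 \<noteq> 0" using that z' by (simp add: ok_def)
      ultimately show ?thesis unfolding K_def k[OF ok_near[OF that]] by simp
    qed
    then show ?thesis by blast
  qed
  have lim: "f z' = 0" if z': "z' \<in> Z" and c: "continuous_on Z f"
    and f: "\<And>z'. z' \<in> Z \<Longrightarrow> \<forall>a b. z' - z \<noteq> a *s \<nu> + b *s \<kappa> \<Longrightarrow> f z' = 0" for f :: "complex^'a \<Rightarrow> complex" and z'
  proof (cases "\<forall>a b. z' - z \<noteq> a *s \<nu> + b *s \<kappa>")
    case False
    then obtain a b where ab: "z' - z = a *s \<nu> + b *s \<kappa>" by blast
    have t1: "((\<lambda>t::real. z' + of_real t *s v) \<longlongrightarrow> z') (at_right 0)"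
    proof -
      have "((\<lambda>t::real. z' + of_real t *s v) \<longlongrightarrow> z' + of_real 0 *s v) (at_right 0)" by (intro tendsto_intros)
      then show ?thesis by simp
    qed
    have "isCont f z'" using c openZ z' by (simp add: continuous_on_eq_continuous_at)
    then have t2: "((\<lambda>t::real. f (z' + of_real t *s v)) \<longlongrightarrow> f z') (at_right 0)" by (rule isCont_tendsto_compose) (rule t1)
    have "eventually (\<lambda>t::real. z' + of_real t *s v \<in> Z) (at_right 0)" by (rule topological_tendstoD[OF t1 openZ z'])
    moreover have "eventually (\<lambda>t::real. t > 0) (at_right 0)" by (rule eventually_at_right_less)
    ultimately have "eventually (\<lambda>t::real. f (z' + of_real t *s v) = 0) (at_right 0)"
    proof eventually_elim
      case (elim t)
      have "z' + of_real t *s v - z \<noteq> a' *s \<nu> + b' *s \<kappa>" for a' b'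
      proof
        assume "z' + of_real t *s v - z = a' *s \<nu> + b' *s \<kappa>"
        then have "hdot (z' - z + of_real t *s v) v = 0" using v by (simp add: algebra_simps)
        then have "of_real t * hdot v v = (0::complex)" unfolding ab using v by simp
        then show False using v elim by (simp add: hdot_unit)
      qed
      then show ?case using f elim by blast
    qed
    then have "((\<lambda>t::real. f (z' + of_real t *s v)) \<longlongrightarrow> 0) (at_right 0)" by (rule tendsto_eventually)
    then show ?thesis using t2 tendsto_unique[OF trivial_limit_at_right_real] by blast
  qed (use f z' in blast)
  have cK: "continuous_on Z (K z w)" if "ok z w" for w
    unfolding K_def[abs_def] using that Z_ball by (intro continuous_intros) (auto simp: ok_def)
  have T: "(r w2 - r w3) * K z w1 z' + (r w3 - r w1) * K z w2 z' + (r w1 - r w2) * K z w3 z' = 0"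
    if w: "ok z w1" "ok z w2" "ok z w3" and z': "z' \<in> Z" for w1 w2 w3 z'
  proof (rule lim[OF z', where f = "\<lambda>z'. (r w2 - r w3) * K z w1 z' + (r w3 - r w1) * K z w2 z' + (r w1 - r w2) * K z w3 z'"])
    show "continuous_on Z (\<lambda>z'. (r w2 - r w3) * K z w1 z' + (r w3 - r w1) * K z w2 z' + (r w1 - r w2) * K z w3 z')"
      by (intro continuous_intros cK w)
    fix z' assume "z' \<in> Z" "\<forall>a b. z' - z \<noteq> a *s \<nu> + b *s \<kappa>"
    then obtain k1 k2 where k: "\<And>w. ok z w \<Longrightarrow> K z w z' = k1 + r w * k2" using gen by blast
    show "(r w2 - r w3) * K z w1 z' + (r w3 - r w1) * K z w2 z' + (r w1 - r w2) * K z w3 z' = 0"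
      unfolding k[OF w(1)] k[OF w(2)] k[OF w(3)] by algebra
  qed
  have "spn (K z w1) (K z w2) (K z w3)" if "ok z w1" "ok z w2" "ok z w3" "r w1 \<noteq> r w2" for w1 w2 w3
    by (rule three_term_spn[OF T[OF that(1-3)] that(4)])
  moreover have "K z w1 z' = K z w2 z'" if w: "ok z w1" "ok z w2" and z': "z' \<in> Z" and rr: "r w1 = r w2" for w1 w2 z'
  proof -
    have "K z w1 z' - K z w2 z' = 0"
    proof (rule lim[OF z', where f = "\<lambda>z'. K z w1 z' - K z w2 z'"])
      show "continuous_on Z (\<lambda>z'. K z w1 z' - K z w2 z')" by (intro continuous_intros cK w)
      fix z' assume "z' \<in> Z" "\<forall>a b. z' - z \<noteq> a *s \<nu> + b *s \<kappa>"
      then obtain k1 k2 where k: "\<And>w. ok z w \<Longrightarrow> K z w z' = k1 + r w * k2" using gen by blast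
      show "K z w1 z' - K z w2 z' = 0" unfolding k[OF w(1)] k[OF w(2)] rr by simp
    qed
    then show ?thesis by simp
  qed
  ultimately show ?thesis using N unfolding r_def by blast
qed

text \<open>By \<open>transport\<close>, centres on a common hyperplane have parallel functionals,
  and the difference of their values is annihilated; only the scale of \<open>X\<close>
  remains.\<close>

lemma K_proportional:
  assumes n: "near p w" "near z w"
  shows "\<exists>k. k \<noteq> 0 \<and> (\<forall>z'. K p w z' = k * K z w z')"
proof -
  obtain k where k: "X p w = k *s X z w" using transport(1)[OF n] by blast
  have "k \<noteq> 0" using X_nz[OF n(1)] k by auto
  moreover have "K p w z' = cnj k * K z w z'" for z'
  proof -
    have "hdot (G0 z' - G0 p) (X z w) = hdot (G0 z' - G0 z) (X z w)"
      using transport(2)[OF n(2,1)] by simp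
    then show ?thesis unfolding K_def k hdot_scale by simp
  qed
  ultimately show ?thesis by (intro exI[of _ "cnj k"]) simp
qed

text \<open>If the function vanished, \<open>G0\<close> would map \<open>Z\<close> into an affine
  hyperplane, and all first and second derivatives on \<open>Z\<close> would be orthogonal to
  \<open>\<xi>\<close>; but these span the target.\<close>

lemma K_not_zero: assumes n: "ok z w" shows "\<exists>z'\<in>Z. K z w z' \<noteq> 0"
proof (rule ccontr)
  define \<xi> where "\<xi> = X z w"
  assume "\<not> ?thesis"
  then have G: "hdot (G0 z') \<xi> = hdot (G0 z) \<xi>" if "z' \<in> Z" for z'
    using n that by (auto simp: K_def ok_def \<xi>_def)
  have stay: "eventually (\<lambda>t. z' + t *s v \<in> Z) (nhds (0::complex))" if z': "z' \<in> Z" for z' v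
  proof -
    have "((\<lambda>t. z' + t *s v) \<longlongrightarrow> z' + 0 *s v) (nhds (0::complex))" by (intro tendsto_intros filterlim_ident)
    then show ?thesis using topological_tendstoD[OF _ openZ] z' by simp
  qed
  have der0: "g' = 0" if z': "z' \<in> Z" and g: "((\<lambda>t. g (z' + t *s v)) has_field_derivative g') (at 0)" and e: "\<And>z'. z' \<in> Z \<Longrightarrow> g z' = C" for g g' z' v C
  proof -
    have "eventually (\<lambda>t. C = g (z' + t *s v)) (nhds 0)" using stay[OF z', of v] by (rule eventually_mono) (simp add: e)
    from DERIV_cong_ev[THEN iffD2, OF refl this refl g] have "((\<lambda>t. C) has_field_derivative g') (at 0)" .
    then show ?thesis using DERIV_unique DERIV_const by blast
  qed
  have J1_0: "hdot (J1 z' v) \<xi> = 0" if z': "z' \<in> Z" for z' v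
  proof -
    have "((\<lambda>t. hdot (G0 (z' + t *s v)) \<xi>) has_field_derivative hdot (J1 z' v) \<xi>) (at 0)"
      using derJ_hdot(1)[of z' 0 v \<xi>] z' Z_ball by auto
    from der0[where g = "\<lambda>z'. hdot (G0 z') \<xi>", OF z' this G] show ?thesis .
  qed
  have J2_0: "hdot (J2 z' v v') \<xi> = 0" if z': "z' \<in> Z" for z' v v'
  proof -
    have "((\<lambda>t. hdot (J1 (z' + t *s v') v) \<xi>) has_field_derivative hdot (J2 z' v v') \<xi>) (at 0)"
      using derJ_hdot(2)[of z' 0 v' v \<xi>] z' Z_ball by auto
    from der0[where g = "\<lambda>z'. hdot (J1 z' v) \<xi>", OF z' this J1_0] show ?thesis .
  qed
  obtain z' where z': "z' \<in> Z" using Z_ne by blast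
  have "dist p0 p0 < \<rho>" "z' \<in> cball 0 1" using \<rho> z' Z_ball by auto
  then obtain x y where "J1 z' x + J2 z' (prj p0 u) y = \<xi>" using nd[of z' p0 \<xi>] Z_near[OF z'] by blast
  then have "hdot \<xi> \<xi> = 0" using J1_0[OF z', of x] J2_0[OF z', of "prj p0 u" y] by (metis add_0 hdot_add(1))
  then show False using X_nz[OF ok_near[OF n]] by (simp add: \<xi>_def)
qed

text \<open>If the ratio equals \<open>r\<close> on all shared hyperplanes in \<open>W\<close>, then
  \<open>\<kappa> - r *s \<nu>\<close> annihilates an open part of the vectors polar to
  \<open>z\<close> and \<open>p\<close>, hence lies in the span of \<open>z\<close> and
  \<open>p - z\<close>. Its product with \<open>w0\<close> leaves a multiple of
  \<open>p - z\<close>, and \<open>ind\<close> makes it zero.\<close>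

lemma ratio_nonconstant:
  assumes n: "w0 \<in> W" "near z w0" "near p w0" and ind: "\<And>a b. p - z \<noteq> a *s \<nu> + b *s \<kappa>"
    and \<nu>: "\<And>w. near z w \<Longrightarrow> hdot \<nu> w \<noteq> 0"
  shows "(\<exists>w\<in>W. near z w \<and> near p w \<and> hdot \<kappa> w / hdot \<nu> w \<noteq> hdot \<kappa> w0 / hdot \<nu> w0) \<or>
    (\<forall>w. near z w \<longrightarrow> hdot \<kappa> w / hdot \<nu> w = hdot \<kappa> w0 / hdot \<nu> w0)"
proof (rule disjCI)
  define r where "r = hdot \<kappa> w0 / hdot \<nu> w0"
  define y where "y = \<kappa> - r *s \<nu>"
  assume nc: "\<not> (\<forall>w. near z w \<longrightarrow> hdot \<kappa> w / hdot \<nu> w = hdot \<kappa> w0 / hdot \<nu> w0)"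
  show "\<exists>w\<in>W. near z w \<and> near p w \<and> hdot \<kappa> w / hdot \<nu> w \<noteq> hdot \<kappa> w0 / hdot \<nu> w0"
  proof (rule ccontr)
    assume "\<not> ?thesis"
    then have c: "hdot y w = 0" if "w \<in> W" "near z w" "near p w" for w
      using that \<nu>[OF that(2)] by (auto simp: y_def r_def field_simps)
    have "y \<noteq> a *s z + b *s (p - z)" for a b
    proof
      assume y: "y = a *s z + b *s (p - z)"
      have "hdot y w0 = 0" using c n by blast
      then have "a = 0" using nearD(2)[OF n(2)] nearD(2)[OF n(3)] unfolding y by simp
      then have y2: "y = b *s (p - z)" using y by simp
      show False
      proof (cases "b = 0")
        case True
        then have "\<kappa> = r *s \<nu>" using y2 by (simp add: y_def)
        then have "hdot \<kappa> w / hdot \<nu> w = r" if "near z w" for w using \<nu>[OF that] by simp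
        then show False using nc n(2) by (metis r_def)
      next
        case False
        have "p - z = (1 / b) *s (b *s (p - z))" using False by simp
        also have "\<dots> = (- r / b) *s \<nu> + (1 / b) *s \<kappa>" unfolding y2[symmetric] by (simp add: y_def vec_eq_iff algebra_simps)
        finally show False using ind by blast
      qed
    qed
    then obtain b where b: "hdot z b = 0" "hdot (p - z) b = 0" "hdot y b = 1" using dual_vector2[of y z "p - z"] by blast
    have t1: "((\<lambda>t::real. w0 + of_real t *s b) \<longlongrightarrow> w0) (at_right 0)"
    proof -
      have "((\<lambda>t::real. w0 + of_real t *s b) \<longlongrightarrow> w0 + of_real 0 *s b) (at_right 0)" by (intro tendsto_intros)
      then show ?thesis by simp
    qed
    have "eventually (\<lambda>t::real. w0 + of_real t *s b \<in> W) (at_right 0)" by (rule topological_tendstoD[OF t1 openW n(1)])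
    moreover have "eventually (\<lambda>t::real. w0 + of_real t *s b \<in> ball p0 \<rho>) (at_right 0)"
      by (rule topological_tendstoD[OF t1 open_ball]) (use n in \<open>simp add: near_def dist_commute\<close>)
    moreover have "eventually (\<lambda>t::real. t > 0) (at_right 0)" by (rule eventually_at_right_less)
    ultimately have "eventually (\<lambda>t::real. False) (at_right 0)"
    proof eventually_elim
      case (elim t)
      have "hdot p b = 0" using b by simp
      then have "near z (w0 + of_real t *s b)" "near p (w0 + of_real t *s b)"
        using n b elim by (simp_all add: near_def dist_commute)
      then have "hdot y (w0 + of_real t *s b) = 0" using c elim by blast
      moreover have "hdot y w0 = 0" using c n by blast
      ultimately show ?case using b elim by simp
    qed
    then show False by simp
  qed
qed

definition dep :: "(complex^'a \<Rightarrow> complex) \<Rightarrow> (complex^'a \<Rightarrow> complex) \<Rightarrow> bool" where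
  "dep f g \<longleftrightarrow> (\<exists>a b. (a \<noteq> 0 \<or> b \<noteq> 0) \<and> (\<forall>z'\<in>Z. a * f z' + b * g z' = 0))"

lemma depI: "a \<noteq> 0 \<or> b \<noteq> 0 \<Longrightarrow> (\<And>z'. z' \<in> Z \<Longrightarrow> a * f z' + b * g z' = 0) \<Longrightarrow> dep f g"
  unfolding dep_def by blast

lemma spn_trans: assumes "spn f g h1" "spn f g h2" "spn h1 h2 h" shows "spn f g h"
proof -
  obtain a b a' b' c d where "\<And>z'. z' \<in> Z \<Longrightarrow> h1 z' = a * f z' + b * g z'" "\<And>z'. z' \<in> Z \<Longrightarrow> h2 z' = a' * f z' + b' * g z'"
    "\<And>z'. z' \<in> Z \<Longrightarrow> h z' = c * h1 z' + d * h2 z'" using assms unfolding spn_def by metis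
  then show ?thesis by (intro spnI[of h "c * a + d * a'" f "c * b + d * b'" g]) (simp add: algebra_simps)
qed

definition multiple :: "(complex^'a \<Rightarrow> complex) \<Rightarrow> (complex^'a \<Rightarrow> complex) \<Rightarrow> bool" where
  "multiple f g \<longleftrightarrow> (\<exists>c. \<forall>z'\<in>Z. g z' = c * f z')"

lemma multipleI: fixes f g :: "complex^'a \<Rightarrow> complex" shows "(\<And>z'. z' \<in> Z \<Longrightarrow> g z' = k * f z') \<Longrightarrow> multiple f g"
  unfolding multiple_def by blast

lemma multiple_trans: "multiple f g \<Longrightarrow> multiple g h \<Longrightarrow> multiple f h"
  unfolding multiple_def by (metis mult.assoc)

lemma multiple_sym: assumes "multiple f g" "z1 \<in> Z" "g z1 \<noteq> 0" shows "multiple g f"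
proof -
  obtain c where c: "\<And>z'. z' \<in> Z \<Longrightarrow> g z' = c * f z'" using assms(1) multiple_def by blast
  have "c \<noteq> 0" using c[OF assms(2)] assms(3) by auto
  then show ?thesis using c by (intro multipleI[where k = "1 / c"]) simp
qed

lemma dep_multiple: assumes "dep f g" "z1 \<in> Z" "f z1 \<noteq> 0" shows "multiple f g"
proof -
  obtain a b where ab: "a \<noteq> 0 \<or> b \<noteq> 0" "\<forall>z'\<in>Z. a * f z' + b * g z' = 0" using assms(1) unfolding dep_def by blast
  have b: "b \<noteq> 0" using ab(1) bspec[OF ab(2) assms(2)] assms(3) by auto
  have "g z' = (- a / b) * f z'" if "z' \<in> Z" for z'
  proof -
    have e: "b * g z' = - a * f z'" using bspec[OF ab(2) that] by algebra
    have "g z' = (- a * f z') / b" unfolding e[symmetric] using b by simp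
    then show ?thesis by simp
  qed
  then show ?thesis by (rule multipleI)
qed

lemma multiples_dep: assumes "multiple f g1" "multiple f g2" shows "dep g1 g2"
proof -
  obtain c1 c2 where c: "\<And>z'. z' \<in> Z \<Longrightarrow> g1 z' = c1 * f z'" "\<And>z'. z' \<in> Z \<Longrightarrow> g2 z' = c2 * f z'" using assms multiple_def by metis
  show ?thesis
  proof (cases "c1 = 0 \<and> c2 = 0")
    case True
    then show ?thesis using c by (intro depI[of 1 0]) auto
  next
    case False
    then show ?thesis using c by (intro depI[of c2 "- c1"]) auto
  qed
qed

lemma spn_multiple: assumes "multiple f g1" "multiple f g2" "spn g1 g2 h" shows "multiple f h"
proof -
  obtain c1 c2 a b where "\<And>z'. z' \<in> Z \<Longrightarrow> g1 z' = c1 * f z'" "\<And>z'. z' \<in> Z \<Longrightarrow> g2 z' = c2 * f z'"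
    "\<And>z'. z' \<in> Z \<Longrightarrow> h z' = a * g1 z' + b * g2 z'" using assms unfolding multiple_def spn_def by metis
  then show ?thesis by (intro multipleI[where k = "a * c1 + b * c2"]) (simp add: algebra_simps)
qed

lemma multiple_spn: "multiple f h \<Longrightarrow> spn f g h"
  unfolding multiple_def spn_def by (metis add_0_right mult_zero_left)

lemma K_multiple: assumes "near p w" "near z w" shows "multiple (K z w) (K p w)"
  using K_proportional[OF assms] multipleI by blast

text \<open>By \<open>three_term\<close> the two independent functions span all functions of
  \<open>z\<close>. A centre \<open>p\<close> shares two hyperplanes of different ratio with
  \<open>z\<close>; the corresponding functions of \<open>p\<close> are multiples of those of
  \<open>z\<close>, and together they span \<open>K p p\<close>.\<close>

lemma span_from_good_center:
  assumes z: "center z" and w: "w1 \<in> W" "near z w1" "w2 \<in> W" "near z w2" and good: "\<not> dep (K z w1) (K z w2)"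
  obtains \<nu> \<kappa> where "\<And>p w0. center p \<Longrightarrow> ok p p \<Longrightarrow> w0 \<in> W \<Longrightarrow> near z w0 \<Longrightarrow> near p w0 \<Longrightarrow> \<forall>a b. p - z \<noteq> a *s \<nu> + b *s \<kappa>
    \<Longrightarrow> spn (K z w1) (K z w2) (K p p)"
proof -
  obtain \<nu> \<kappa> where N: "\<And>w. near z w \<Longrightarrow> hdot \<nu> w \<noteq> 0"
    and R: "\<And>w1 w2 w3. ok z w1 \<Longrightarrow> ok z w2 \<Longrightarrow> ok z w3 \<Longrightarrow> hdot \<kappa> w1 / hdot \<nu> w1 \<noteq> hdot \<kappa> w2 / hdot \<nu> w2 \<Longrightarrow>
      spn (K z w1) (K z w2) (K z w3)"
    and E: "\<And>w1 w2 z'. ok z w1 \<Longrightarrow> ok z w2 \<Longrightarrow> z' \<in> Z \<Longrightarrow> hdot \<kappa> w1 / hdot \<nu> w1 = hdot \<kappa> w2 / hdot \<nu> w2 \<Longrightarrow> K z w1 z' = K z w2 z'"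
    using three_term[OF z] by blast
  have ww: "ok z w1" "ok z w2" using w ok_W by auto
  have ne: "hdot \<kappa> w1 / hdot \<nu> w1 \<noteq> hdot \<kappa> w2 / hdot \<nu> w2"
    using good depI[of 1 "-1" "K z w1" "K z w2"] E[OF ww] by auto
  have "spn (K z w1) (K z w2) (K p p)"
    if p: "center p" "ok p p" "w0 \<in> W" "near z w0" "near p w0" and ind: "\<forall>a b. p - z \<noteq> a *s \<nu> + b *s \<kappa>" for p w0
  proof -
    have "\<exists>w\<in>W. near z w \<and> near p w \<and> hdot \<kappa> w / hdot \<nu> w \<noteq> hdot \<kappa> w0 / hdot \<nu> w0"
      using ratio_nonconstant[OF p(3,4,5), of \<nu> \<kappa>] ind N ne w(2,4) by metis
    then obtain w where w': "w \<in> W" "near z w" "near p w" "hdot \<kappa> w0 / hdot \<nu> w0 \<noteq> hdot \<kappa> w / hdot \<nu> w" by metis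
    have o: "ok z w0" "ok z w" "ok p w0" "ok p w" using w' p ok_W by auto
    have bck: "spn (K z w0) (K z w) (K z v)" if "ok z v" for v
      by (rule R[OF o(1,2) that w'(4)])
    obtain \<nu>' \<kappa>' where R': "\<And>w1 w2 w3. ok p w1 \<Longrightarrow> ok p w2 \<Longrightarrow> ok p w3 \<Longrightarrow> hdot \<kappa>' w1 / hdot \<nu>' w1 \<noteq> hdot \<kappa>' w2 / hdot \<nu>' w2 \<Longrightarrow>
      spn (K p w1) (K p w2) (K p w3)"
      and E': "\<And>w1 w2 z'. ok p w1 \<Longrightarrow> ok p w2 \<Longrightarrow> z' \<in> Z \<Longrightarrow> hdot \<kappa>' w1 / hdot \<nu>' w1 = hdot \<kappa>' w2 / hdot \<nu>' w2 \<Longrightarrow> K p w1 z' = K p w2 z'"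
      using three_term[OF p(1)] by blast
    \<comment> \<open>Equal ratios at \<open>p\<close> would make the two shared functions
      proportional, and then all functions of \<open>z\<close> would be, contrary to
      \<open>good\<close>.\<close>
    have ne': "hdot \<kappa>' w0 / hdot \<nu>' w0 \<noteq> hdot \<kappa>' w / hdot \<nu>' w"
    proof
      assume "hdot \<kappa>' w0 / hdot \<nu>' w0 = hdot \<kappa>' w / hdot \<nu>' w"
      then have "multiple (K p w) (K p w0)" using E'[OF o(3,4)] by (intro multipleI[where k = 1]) simp
      then have "multiple (K z w) (K z w0)"
        using multiple_trans[OF multiple_trans[OF K_multiple[OF w'(3,2)]] K_multiple[OF p(4,5)]] by blast
      moreover have "multiple (K z w) (K z w)" by (rule multipleI[where k = 1]) simp
      ultimately have "multiple (K z w) (K z v)" if "ok z v" for v using spn_multiple bck[OF that] by blast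
      then show False using multiples_dep good ww by blast
    qed
    have "spn (K p w0) (K p w) (K p p)" by (rule R'[OF o(3,4) p(2) ne'])
    moreover have "spn (K z w1) (K z w2) (K z v)" if "ok z v" for v
      by (rule R[OF ww that ne])
    then have "spn (K z w1) (K z w2) (K p w0)" "spn (K z w1) (K z w2) (K p w)"
      using spn_trans o multiple_spn K_multiple[OF p(5,4)] K_multiple[OF w'(3,2)] by blast+
    ultimately show ?thesis using spn_trans by blast
  qed
  then show ?thesis using that by blast
qed

text \<open>As \<open>Z1\<close> is open, some centre \<open>z\<close> in it avoids the plane
  through \<open>p\<close> spanned by \<open>\<nu>\<close>, \<open>\<kappa>\<close>. There the
  hyperplanes shared with \<open>p\<close> either detect a change of the ratio at \<open>p\<close>
  or show it to be constant; in both cases all functions of \<open>p\<close> are multiples of one. A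
  hyperplane shared by \<open>p\<close> and \<open>z1\<close> links it to
  \<open>K z1 w1\<close>.\<close>

lemma multiple_from_bad_centers:
  assumes Z1: "\<And>z. z \<in> Z1 \<Longrightarrow> center z" "open Z1" "z1 \<in> Z1"
    and bad: "\<And>z w w'. z \<in> Z1 \<Longrightarrow> w \<in> W \<Longrightarrow> near z w \<Longrightarrow> w' \<in> W \<Longrightarrow> near z w' \<Longrightarrow> dep (K z w) (K z w')"
    and ex: "\<And>z. z \<in> Z1 \<Longrightarrow> \<exists>w\<in>W. near p w \<and> near z w" and p: "center p" "ok p p"
    and w1: "w1 \<in> W" "near z1 w1"
  shows "multiple (K z1 w1) (K p p)"
proof -
  obtain \<nu> \<kappa> where N: "\<And>w. near p w \<Longrightarrow> hdot \<nu> w \<noteq> 0"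
    and R: "\<And>w1 w2 w3. ok p w1 \<Longrightarrow> ok p w2 \<Longrightarrow> ok p w3 \<Longrightarrow> hdot \<kappa> w1 / hdot \<nu> w1 \<noteq> hdot \<kappa> w2 / hdot \<nu> w2 \<Longrightarrow>
      spn (K p w1) (K p w2) (K p w3)"
    and E: "\<And>w1 w2 z'. ok p w1 \<Longrightarrow> ok p w2 \<Longrightarrow> z' \<in> Z \<Longrightarrow> hdot \<kappa> w1 / hdot \<nu> w1 = hdot \<kappa> w2 / hdot \<nu> w2 \<Longrightarrow> K p w1 z' = K p w2 z'"
    using three_term[OF p(1)] by blast
  have "\<exists>z\<in>Z1. \<forall>a b. z - p \<noteq> a *s \<nu> + b *s \<kappa>"
  proof (cases "\<forall>a b. z1 - p \<noteq> a *s \<nu> + b *s \<kappa>")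
    case False
    then obtain a b where ab: "z1 - p = a *s \<nu> + b *s \<kappa>" by blast
    obtain v where v: "norm v = 1" "hdot \<nu> v = 0" "hdot \<kappa> v = 0" using ex_orthogonal2[OF dim(2)] by blast
    obtain e where e: "e > 0" "ball z1 e \<subseteq> Z1" using Z1(2,3) open_contains_ball by blast
    define z where "z = z1 + of_real (e/2) *s v"
    have "z \<in> Z1" using e v by (auto simp: z_def dist_norm norm_smult subset_iff)
    moreover have "z - p \<noteq> a' *s \<nu> + b' *s \<kappa>" for a' b'
    proof
      assume "z - p = a' *s \<nu> + b' *s \<kappa>"
      then have "hdot ((z1 - p) + of_real (e/2) *s v) v = 0" using v by (simp add: z_def algebra_simps)
      then show False unfolding ab using v e by (simp add: hdot_unit)
    qed
    ultimately show ?thesis by blast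
  qed (use Z1(3) in blast)
  then obtain z where z: "z \<in> Z1" "\<And>a b. z - p \<noteq> a *s \<nu> + b *s \<kappa>" by blast
  obtain w0 where w0: "w0 \<in> W" "near p w0" "near z w0" using ex[OF z(1)] by blast
  have o0: "ok p w0" "ok z w0" using w0 ok_W by auto
  have all: "multiple (K p w0) (K p w)" if w: "ok p w" for w
  proof (cases "\<exists>v\<in>W. near p v \<and> near z v \<and> hdot \<kappa> v / hdot \<nu> v \<noteq> hdot \<kappa> w0 / hdot \<nu> w0")
    case True
    then obtain v where v: "v \<in> W" "near p v" "near z v" "hdot \<kappa> w0 / hdot \<nu> w0 \<noteq> hdot \<kappa> v / hdot \<nu> v" by metis
    have "spn (K p w0) (K p v) (K p w)" by (rule R[OF o0(1) ok_W[OF v(1,2)] w v(4)])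
    moreover have "multiple (K p w0) (K p v)"
    proof -
      obtain y where "y \<in> Z" "K z w0 y \<noteq> 0" using K_not_zero[OF o0(2)] by blast
      then have "multiple (K z w0) (K z v)" using dep_multiple bad z(1) w0 v by blast
      then show ?thesis using multiple_trans K_multiple[OF w0(3,2)] K_multiple[OF v(2,3)] by blast
    qed
    moreover have "multiple (K p w0) (K p w0)" by (rule multipleI[where k = 1]) simp
    ultimately show ?thesis using spn_multiple by blast
  next
    case False
    then have "hdot \<kappa> w / hdot \<nu> w = hdot \<kappa> w0 / hdot \<nu> w0"
      using ratio_nonconstant[OF w0 z(2) N] ok_near[OF w] by blast
    then have "K p w z' = 1 * K p w0 z'" if "z' \<in> Z" for z' using E[OF w o0(1) that] by simp
    then show ?thesis by (rule multipleI)
  qed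
  obtain w where w: "w \<in> W" "near p w" "near z1 w" using ex[OF Z1(3)] by blast
  obtain y where y: "y \<in> Z" "K p w y \<noteq> 0" using K_not_zero[OF ok_W[OF w(1,2)]] by blast
  obtain y1 where y1: "y1 \<in> Z" "K z1 w1 y1 \<noteq> 0" using K_not_zero[OF ok_W[OF w1]] by blast
  have "multiple (K z1 w1) (K z1 w)" by (rule dep_multiple[OF bad[OF Z1(3) w1 w(1,3)] y1])
  moreover have "multiple (K z1 w) (K p w)" by (rule K_multiple[OF w(2,3)])
  moreover have "multiple (K p w) (K p w0)" by (rule multiple_sym[OF all[OF ok_W[OF w(1,2)]] y])
  ultimately show ?thesis using multiple_trans all[OF p(2)] by blast
qed

text \<open>On the sphere \<open>G0 p\<close> is orthogonal to the tangential first and second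
  derivatives, so by \<open>annih_unique\<close> it is a multiple of \<open>X p p\<close>.\<close>

lemma K_boundary:
  assumes p: "norm p = 1" "dist p p0 < \<rho>"
  shows "ok p p" "\<exists>k. \<forall>z'\<in>Z. 1 - hdot (G0 z') (G0 p) = (1 - hdot z' p) * (k * K p p z')"
proof -
  have n: "near p p" using p by (simp add: near_def hdot_unit)
  have ne: "hdot z' p \<noteq> 1" if "z' \<in> Z" for z'
  proof
    assume "hdot z' p = 1"
    then have "1 \<le> norm z' * norm p" using cmod_hdot_le[of z' p] by simp
    moreover have "norm z' < 1" using that Z_ball by auto
    ultimately show False using p by simp
  qed
  then show "ok p p" using n by (simp add: ok_def)
  have "\<exists>k. G0 p = k *s X p p"
    by (rule annih_unique[OF n]) (simp_all add: tangential_1(1)[OF p(1)] tangential_2[OF p(1)])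
  then obtain k where k: "G0 p = k *s X p p" by blast
  have "1 - hdot (G0 z') (G0 p) = (1 - hdot z' p) * (cnj k * K p p z')" if "z' \<in> Z" for z'
  proof -
    have "hdot (G0 p) (G0 p) = 1" using bdry[OF p(1)] by (rule hdot_unit)
    then have "1 - hdot (G0 z') (G0 p) = - hdot (G0 z' - G0 p) (G0 p)" by simp
    also have "\<dots> = - (cnj k * hdot (G0 z' - G0 p) (X p p))" by (subst (2) k) simp
    also have "\<dots> = (1 - hdot z' p) * (cnj k * K p p z')" using ne[OF that] by (simp add: K_def field_simps)
    finally show ?thesis .
  qed
  then show "\<exists>k. \<forall>z'\<in>Z. 1 - hdot (G0 z') (G0 p) = (1 - hdot z' p) * (k * K p p z')" by blast
qed

end

text \<open>Cramer's rule in the span of \<open>w\<close> and \<open>g\<close>: the determinant of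
  the two equations is 1 at \<open>x\<close>, \<open>y\<close>, and the solution depends
  continuously on the points.\<close>

lemma common_hyperplane:
  fixes x y w g :: "complex^'a"
  assumes "hdot x w = 1" "hdot y w = 1" "hdot x g = 0" "hdot y g = 1" "r > 0"
  shows "\<exists>e>0. \<forall>x' y'. dist x' x < e \<longrightarrow> dist y' y < e \<longrightarrow> (\<exists>w'. dist w' w < r \<and> hdot x' w' = 1 \<and> hdot y' w' = 1)"
proof -
  define D where "D q = hdot (fst q) w * hdot (snd q) g - hdot (fst q) g * hdot (snd q) w" for q
  define V where "V q = cnj ((hdot (snd q) g - hdot (fst q) g) / D q) *s w + cnj ((hdot (fst q) w - hdot (snd q) w) / D q) *s g" for q
  have fs: "(fst \<longlongrightarrow> x) (nhds (x, y))" "(snd \<longlongrightarrow> y) (nhds (x, y))"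
    using tendsto_fst[OF filterlim_ident[of "nhds (x, y)"]] tendsto_snd[OF filterlim_ident[of "nhds (x, y)"]] by simp_all
  have "(D \<longlongrightarrow> hdot x w * hdot y g - hdot x g * hdot y w) (nhds (x, y))"
    unfolding D_def[abs_def] by (intro tendsto_intros fs)
  then have tD: "(D \<longlongrightarrow> 1) (nhds (x, y))" using assms by simp
  have "(V \<longlongrightarrow> cnj ((hdot y g - hdot x g) / 1) *s w + cnj ((hdot x w - hdot y w) / 1) *s g) (nhds (x, y))"
    unfolding V_def[abs_def] by (intro tendsto_intros fs tD) simp_all
  then have tV: "(V \<longlongrightarrow> w) (nhds (x, y))" using assms by simp
  have "eventually (\<lambda>q. D q \<noteq> 0 \<and> dist (V q) w < r) (nhds (x, y))"
    by (intro eventually_conj tendsto_imp_eventually_ne[OF tD] tendstoD[OF tV assms(5)]) simp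
  then obtain d where d: "d > 0" "\<And>q. dist q (x, y) < d \<Longrightarrow> D q \<noteq> 0 \<and> dist (V q) w < r"
    unfolding eventually_nhds_metric by blast
  have "\<exists>w'. dist w' w < r \<and> hdot x' w' = 1 \<and> hdot y' w' = 1" if "dist x' x < d/2" "dist y' y < d/2" for x' y'
  proof -
    have "dist (x', y') (x, y) \<le> dist x' x + dist y' y" unfolding dist_Pair_Pair by (rule sqrt_sum_squares_le_sum) auto
    then have q: "D (x', y') \<noteq> 0" "dist (V (x', y')) w < r" using d(2)[of "(x', y')"] that by auto
    have "hdot x' (V (x', y')) = ((hdot y' g - hdot x' g) * hdot x' w + (hdot x' w - hdot y' w) * hdot x' g) / D (x', y')"
      by (simp add: V_def add_divide_distrib)
    also have "\<dots> = 1" using q(1) by (simp add: D_def algebra_simps)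
    finally have 1: "hdot x' (V (x', y')) = 1" .
    have "hdot y' (V (x', y')) = ((hdot y' g - hdot x' g) * hdot y' w + (hdot x' w - hdot y' w) * hdot y' g) / D (x', y')"
      by (simp add: V_def add_divide_distrib)
    also have "\<dots> = 1" using q(1) by (simp add: D_def algebra_simps)
    finally show ?thesis using 1 q(2) by blast
  qed
  then show ?thesis using d(1) by (intro exI[of _ "d/2"]) auto
qed

text \<open>For \<open>n\<close> orthogonal to both directions, \<open>hdot (p - z) n\<close>
  vanishes on the plane. If it vanishes at \<open>p0\<close>, rotating \<open>p0\<close> towards
  \<open>n\<close> or multiplying it by a phase makes it nonzero.\<close>

lemma sphere_point_off_plane:
  fixes p0 z \<nu> \<kappa> :: "complex^'a"
  assumes "CARD('a) \<ge> 3" "norm p0 = 1" "e > 0"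
  shows "\<exists>p1 d. norm p1 = 1 \<and> d > 0 \<and> (\<forall>p. dist p p1 < d \<longrightarrow> dist p p0 < e \<and> (\<forall>a b. p - z \<noteq> a *s \<nu> + b *s \<kappa>))"
proof -
  obtain n where n: "norm n = 1" "hdot \<nu> n = 0" "hdot \<kappa> n = 0" using ex_orthogonal2[OF assms(1)] by blast
  have close: thesis if f: "(f \<longlongrightarrow> p0) (at_right 0)" and t: "\<And>t. 0 < t \<Longrightarrow> t < pi \<Longrightarrow> dist (f t) p0 < e \<Longrightarrow> thesis" for f thesis
  proof -
    obtain s where s: "s > 0" "\<And>t. 0 < t \<Longrightarrow> t < s \<Longrightarrow> dist (f t) p0 < e"
      using tendstoD[OF f assms(3)] unfolding eventually_at_right_field by auto
    then show ?thesis using t[of "min (s/2) 1"] pi_gt3 by auto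
  qed
  have "\<exists>p1. norm p1 = 1 \<and> dist p1 p0 < e \<and> hdot (p1 - z) n \<noteq> 0"
  proof (cases "hdot (p0 - z) n = 0")
    case False
    then show ?thesis using assms by (intro exI[of _ p0]) simp
  next
    case True
    show ?thesis
    proof (cases "hdot p0 n = 0")
      case True0: True
      define f where "f t = of_real (cos t) *s p0 + of_real (sin t) *s n" for t :: real
      have "(f \<longlongrightarrow> of_real (cos 0) *s p0 + of_real (sin 0) *s n) (at_right 0)" unfolding f_def[abs_def] by (intro tendsto_intros)
      then have "(f \<longlongrightarrow> p0) (at_right 0)" by simp
      then obtain t where t: "0 < t" "t < pi" "dist (f t) p0 < e" by (rule close)
      have "(norm (f t))\<^sup>2 = 1"
        unfolding f_def using True0 n assms(2) by (simp add: norm_add_sq norm_smult power_mult_distrib)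
      then have "norm (f t) = 1" using power2_eq_1_iff[of "norm (f t)"] norm_ge_zero[of "f t"] by linarith
      moreover have "hdot (f t - z) n \<noteq> 0"
      proof -
        have "hdot z n = 0" using True True0 by simp
        then have "hdot (f t - z) n = of_real (sin t)" using True0 n by (simp add: f_def hdot_unit)
        moreover have "sin t > 0" using t by (intro sin_gt_zero)
        ultimately show ?thesis by simp
      qed
      ultimately show ?thesis using t(3) by blast
    next
      case False
      define f where "f t = cis t *s p0" for t :: real
      have "(f \<longlongrightarrow> cis 0 *s p0) (at_right 0)" unfolding f_def[abs_def] cis_conv_exp by (intro tendsto_intros)
      then have "(f \<longlongrightarrow> p0) (at_right 0)" by simp
      then obtain t where t: "0 < t" "t < pi" "dist (f t) p0 < e" by (rule close)
      have "hdot (f t - z) n = (cis t - 1) * hdot p0 n" using True by (simp add: f_def algebra_simps)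
      moreover have "sin t > 0" using t by (intro sin_gt_zero)
      then have "cis t - 1 \<noteq> 0" by (auto simp: complex_eq_iff)
      ultimately have "hdot (f t - z) n \<noteq> 0" using False by simp
      moreover have "norm (f t) = 1" using assms by (simp add: f_def norm_smult)
      ultimately show ?thesis using t(3) by blast
    qed
  qed
  then obtain p1 where p1: "norm p1 = 1" "dist p1 p0 < e" "hdot (p1 - z) n \<noteq> 0" by blast
  have "((\<lambda>p. hdot (p - z) n) \<longlongrightarrow> hdot (p1 - z) n) (nhds p1)" by (intro tendsto_intros filterlim_ident)
  then have "eventually (\<lambda>p. hdot (p - z) n \<noteq> 0) (nhds p1)" using p1(3) by (rule tendsto_imp_eventually_ne)
  then obtain d where d: "d > 0" "\<And>p. dist p p1 < d \<Longrightarrow> hdot (p - z) n \<noteq> 0" unfolding eventually_nhds_metric by blast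
  define d' where "d' = min d (e - dist p1 p0)"
  have "dist p p0 < e \<and> (\<forall>a b. p - z \<noteq> a *s \<nu> + b *s \<kappa>)" if "dist p p1 < d'" for p
  proof
    show "dist p p0 < e" using that dist_triangle[of p p0 p1] by (simp add: d'_def)
    have "hdot (p - z) n \<noteq> 0" using that d(2) by (simp add: d'_def)
    then show "\<forall>a b. p - z \<noteq> a *s \<nu> + b *s \<kappa>" using n by (metis add_0 hdot_add(1) hdot_scale(1) mult_zero_right)
  qed
  moreover have "d' > 0" using d p1 by (simp add: d'_def)
  ultimately show ?thesis using p1(1) by blast
qed

context nd_jets begin

text \<open>The hyperplane \<open>w1\<close> contains \<open>p0\<close>, \<open>z1\<close> and \<open>z2\<close>, whereas \<open>w2\<close> contains \<open>p0\<close> and \<open>z1\<close> but not \<open>z2\<close>. Hence points near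
  \<open>p0\<close> and points near \<open>z1\<close> are centres for a neighbourhood \<open>Z\<close> of \<open>z2\<close>, and they share hyperplanes missing \<open>Z\<close>.\<close>

lemma kernel_span:
  kernel_spanned
proof -
  have d2: "CARD('a) \<ge> 2" using dim by simp
  obtain t1 where t1: "norm t1 = 1" "hdot p0 t1 = 0" using ex_orthogonal[OF d2] by blast
  obtain t2 where t2: "norm t2 = 1" "hdot p0 t2 = 0" "hdot t1 t2 = 0" using ex_orthogonal2[OF dim(2)] by blast
  have o: "hdot t1 p0 = 0" "hdot t2 p0 = 0" "hdot t2 t1 = 0" "hdot p0 p0 = 1" "hdot t1 t1 = 1" "hdot t2 t2 = 1"
    using t1 t2 p0 by (simp_all add: hdot_0_sym[of _ p0] hdot_0_sym[of t2 t1] hdot_unit)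
  \<comment> \<open>The chosen points lie within \<open>3 \<eta>\<close> of \<open>p0\<close>, which
    leaves a margin \<open>\<eta>\<close> inside the radius \<open>\<rho>\<close>.\<close>
  define \<eta> where "\<eta> = \<rho> / 4"
  have \<eta>: "0 < \<eta>" "\<eta> \<le> 1/8" "\<eta>\<^sup>2 \<le> \<eta> / 8" using \<rho> by (simp_all add: \<eta>_def power2_eq_square)
  define w1 where "w1 = p0 + of_real \<eta> *s t1"
  define w2 where "w2 = w1 + of_real \<eta> *s t2"
  \<comment> \<open>The first coefficient gives \<open>hdot z1 w1 = 1\<close>. For \<open>z2\<close>
    only half a step is taken along \<open>t2\<close>: with a full one the squared norm would be
    \<open>1 + \<eta>^4\<close>.\<close>
  define z1 where "z1 = of_real (1 - \<eta>\<^sup>2) *s p0 + of_real \<eta> *s t1"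
  define z2 where "z2 = z1 + of_real (\<eta>/2) *s t2"
  have sq: "(norm z1)\<^sup>2 = (1 - \<eta>\<^sup>2)\<^sup>2 + \<eta>\<^sup>2" "(norm z2)\<^sup>2 = (1 - \<eta>\<^sup>2)\<^sup>2 + \<eta>\<^sup>2 + (\<eta>/2)\<^sup>2"
    unfolding z2_def z1_def using t1 t2 p0 o by (simp_all add: norm_add_sq norm_smult power_mult_distrib norm_of_real power_divide norm_divide del: of_real_diff of_real_power)
  have "\<eta>\<^sup>2 \<le> 1/64" using \<eta> by linarith
  then have e2: "\<eta>\<^sup>2 * \<eta>\<^sup>2 \<le> \<eta>\<^sup>2 * (1/64)" by (rule mult_left_mono) simp
  have "(norm z1)\<^sup>2 < 1" "(norm z2)\<^sup>2 < 1"
    unfolding sq using e2 \<eta>(1) by (simp_all add: power2_diff power_divide power4_eq_xxxx power2_eq_square algebra_simps)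
  then have zb: "z1 \<in> ball 0 1" "z2 \<in> ball 0 1" by (simp_all add: power_less_one_iff)
  have n_le: "norm (of_real a *s t1) = \<bar>a\<bar>" "norm (of_real a *s t2) = \<bar>a\<bar>" "norm (of_real a *s p0) = \<bar>a\<bar>" for a :: real
    using t1 t2 p0 by (simp_all add: norm_smult)
  have dw1: "dist w1 p0 \<le> \<eta>" using \<eta>(1) by (simp add: w1_def dist_norm n_le)
  have dw2: "dist w2 p0 \<le> 2 * \<eta>"
    using norm_triangle_ineq[of "of_real \<eta> *s t1" "of_real \<eta> *s t2"] \<eta>(1) unfolding n_le by (simp add: w2_def w1_def dist_norm add.assoc)
  have dz1: "dist z1 p0 \<le> 2 * \<eta>"
  proof -
    have "z1 - p0 = of_real \<eta> *s t1 + of_real (- \<eta>\<^sup>2) *s p0" by (simp add: z1_def vec_eq_iff algebra_simps)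
    then have "dist z1 p0 \<le> \<eta> + \<eta>\<^sup>2" using norm_triangle_ineq[of "of_real \<eta> *s t1" "of_real (- \<eta>\<^sup>2) *s p0"] \<eta>(1) unfolding dist_norm n_le by simp
    then show ?thesis using \<eta> by simp
  qed
  have dz2: "dist z2 p0 \<le> 3 * \<eta>"
    using dist_triangle[of z2 p0 z1] dz1 \<eta>(1) unfolding z2_def dist_norm by (simp add: norm_smult norm_divide t2(1))
  have h: "hdot p0 w1 = 1" "hdot z1 w1 = 1" "hdot z2 w1 = 1" "hdot p0 w2 = 1" "hdot z1 w2 = 1"
    unfolding w2_def w1_def z2_def z1_def using t1 t2 o by (simp_all add: power2_eq_square)
  have h2: "hdot z2 w2 \<noteq> 1"
  proof -
    have "hdot z2 w2 = 1 + of_real (\<eta>/2 * \<eta>)" unfolding w2_def z2_def using t1 t2 o h(2) by (simp add: w1_def z1_def)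
    then show ?thesis using \<eta>(1) by simp
  qed
  have g: "hdot p0 (of_real (2/\<eta>) *s t2) = 0" "hdot z1 (of_real (2/\<eta>) *s t2) = 0" "hdot z2 (of_real (2/\<eta>) *s t2) = 1"
    "hdot p0 (of_real (1/\<eta>) *s t1) = 0" "hdot z1 (of_real (1/\<eta>) *s t1) = 1"
    unfolding z2_def z1_def using t1 t2 o \<eta>(1) by (simp_all flip: of_real_mult)
  have "((\<lambda>q. hdot (snd q) (fst q)) \<longlongrightarrow> hdot z2 w2) (nhds (w2, z2))"
    using tendsto_fst[OF filterlim_ident[of "nhds (w2, z2)"]] tendsto_snd[OF filterlim_ident[of "nhds (w2, z2)"]] by (intro tendsto_hdot) simp_all
  then have "eventually (\<lambda>q. hdot (snd q) (fst q) \<noteq> 1) (nhds (w2, z2))" using h2 by (rule tendsto_imp_eventually_ne)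
  then obtain d where d: "d > 0" "\<And>q. dist q (w2, z2) < d \<Longrightarrow> hdot (snd q) (fst q) \<noteq> 1" unfolding eventually_nhds_metric by blast
  define r where "r = min (d/2) \<eta>"
  have r: "r > 0" "r \<le> \<eta>" "r \<le> d/2" using d \<eta> by (auto simp: r_def)
  have WZ: "hdot z' w \<noteq> 1" if "dist w w2 < r" "dist z' z2 < d/2" for w z'
  proof -
    have "dist (w, z') (w2, z2) \<le> dist w w2 + dist z' z2" unfolding dist_Pair_Pair by (rule sqrt_sum_squares_le_sum) auto
    then show ?thesis using d(2)[of "(w, z')"] that r by auto
  qed
  obtain e1 where e1: "e1 > 0" "\<And>x' y'. dist x' p0 < e1 \<Longrightarrow> dist y' z2 < e1 \<Longrightarrow> \<exists>w'. dist w' w1 < \<eta> \<and> hdot x' w' = 1 \<and> hdot y' w' = 1"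
    using common_hyperplane[OF h(1,3) g(1,3) \<eta>(1)] by blast
  obtain e2 where e2: "e2 > 0" "\<And>x' y'. dist x' z1 < e2 \<Longrightarrow> dist y' z2 < e2 \<Longrightarrow> \<exists>w'. dist w' w1 < \<eta> \<and> hdot x' w' = 1 \<and> hdot y' w' = 1"
    using common_hyperplane[OF h(2,3) g(2,3) \<eta>(1)] by blast
  obtain e3 where e3: "e3 > 0" "\<And>x' y'. dist x' p0 < e3 \<Longrightarrow> dist y' z1 < e3 \<Longrightarrow> \<exists>w'. dist w' w2 < r \<and> hdot x' w' = 1 \<and> hdot y' w' = 1"
    using common_hyperplane[OF h(4,5) g(4,5) r(1)] by blast
  obtain e4 where e4: "e4 > 0" "ball z1 e4 \<subseteq> ball 0 1" using zb(1) open_contains_ball[of "ball 0 1"] by blast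
  obtain e5 where e5: "e5 > 0" "ball z2 e5 \<subseteq> ball 0 1" using zb(2) open_contains_ball[of "ball 0 1"] by blast
  define e where "e = min e1 (min e2 (min e3 (min e4 (min e5 (min (d/2) \<eta>)))))"
  have e: "e > 0" "e \<le> e1" "e \<le> e2" "e \<le> e3" "e \<le> e4" "e \<le> e5" "e \<le> d/2" "e \<le> \<eta>"
    unfolding e_def using e1(1) e2(1) e3(1) e4(1) e5(1) d(1) \<eta>(1) by linarith+
  define Z where "Z = ball z2 e"
  define W where "W = ball w2 r"
  define Z1 where "Z1 = ball z1 e"
  have \<rho>\<eta>: "\<rho> = 4 * \<eta>" by (simp add: \<eta>_def)
  have near_ball: "dist x p0 < \<rho>" if "dist x y < \<eta>" "dist y p0 \<le> 3 * \<eta>" for x y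
    using dist_triangle[of x p0 y] that unfolding \<rho>\<eta> by simp
  interpret overlap G0 G1 G2 G3 p0 u \<rho> c Z W
  proof unfold_locales
    show "Z \<subseteq> ball 0 1" unfolding Z_def using e e5 subset_ball[of e e5 z2] by blast
    show "dist z' p0 < \<rho>" if "z' \<in> Z" for z' by (rule near_ball[OF _ dz2]) (use that e in \<open>simp add: Z_def dist_commute\<close>)
    show "hdot z' w \<noteq> 1" if "w \<in> W" "z' \<in> Z" for w z'
      using that e by (intro WZ) (simp_all add: W_def Z_def dist_commute)
  qed (use e in \<open>simp_all add: Z_def W_def\<close>)
  have dw1': "dist w p0 < \<rho>" if "dist w w1 < \<eta>" for w by (rule near_ball[OF that]) (use dw1 \<eta> in simp)
  have dw2': "dist w p0 < \<rho>" if "dist w w2 < r" for w by (rule near_ball[of w w2]) (use dw2 \<eta> that r in simp_all)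
  have Zc: "z' \<in> cball 0 1" "dist z' p0 < \<rho>" "dist z' z2 < e" if "z' \<in> Z" for z'
  proof -
    show "z' \<in> cball 0 1" using Z_ball that ball_subset_cball by blast
    show "dist z' p0 < \<rho>" by (rule Z_near[OF that])
    show "dist z' z2 < e" using that by (simp add: Z_def dist_commute)
  qed
  have Z1c: "z \<in> cball 0 1" "dist z p0 < \<rho>" "dist z z1 < e" if "z \<in> Z1" for z
  proof -
    show dz: "dist z z1 < e" using that by (simp add: Z1_def dist_commute)
    show "dist z p0 < \<rho>" by (rule near_ball[of z z1]) (use dz e dz1 \<eta> in simp_all)
    have "z \<in> ball z1 e4" using dz e by (simp add: dist_commute)
    then show "z \<in> cball 0 1" using e4 by (auto simp: subset_iff)
  qed
  have cZ1: "center z" if z: "z \<in> Z1" for z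
    unfolding center_def
  proof (intro conjI ballI)
    fix z' assume z': "z' \<in> Z"
    obtain w where w: "dist w w1 < \<eta>" "hdot z w = 1" "hdot z' w = 1" using e2(2)[of z z'] Z1c(3)[OF z] Zc(3)[OF z'] e by force
    then show "\<exists>w. near z w \<and> near z' w" using Z1c[OF z] Zc[OF z'] dw1' unfolding near_def by blast
  qed (use Z1c z in auto)
  have cP: "center p" if p: "norm p = 1" "dist p p0 < e" for p
    unfolding center_def
  proof (intro conjI ballI)
    show pc: "p \<in> cball 0 1" "dist p p0 < \<rho>" using p e unfolding \<rho>\<eta> by auto
    fix z' assume z': "z' \<in> Z"
    obtain w where w: "dist w w1 < \<eta>" "hdot p w = 1" "hdot z' w = 1" using e1(2)[of p z'] p Zc(3)[OF z'] e by force
    then show "\<exists>w. near p w \<and> near z' w" using pc Zc[OF z'] dw1' unfolding near_def by blast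
  qed
  have ov: "\<exists>w\<in>W. near p w \<and> near z w" if p: "norm p = 1" "dist p p0 < e" and z: "z \<in> Z1" for p z
  proof -
    obtain w where w: "dist w w2 < r" "hdot p w = 1" "hdot z w = 1" using e3(2)[of p z] p Z1c(3)[OF z] e by force
    moreover have "w \<in> W" using w by (simp add: W_def dist_commute)
    ultimately show ?thesis using cP[OF p] Z1c[OF z] dw2' unfolding near_def center_def by blast
  qed
  have okp: "ok p p" if p: "norm p = 1" "dist p p0 < e" for p
    by (rule K_boundary(1)) (use p cP[OF p] in \<open>auto simp: center_def\<close>)
  have fin: "\<exists>a b. \<forall>z'\<in>Z. 1 - hdot (G0 z') (G0 p) = (1 - hdot z' p) * (a * f1 z' + b * f2 z')"
    if p: "norm p = 1" "dist p p0 < e" and s: "spn f1 f2 (K p p)" for p f1 f2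
  proof -
    obtain k where k: "\<And>z'. z' \<in> Z \<Longrightarrow> 1 - hdot (G0 z') (G0 p) = (1 - hdot z' p) * (k * K p p z')"
      using K_boundary(2)[OF p(1)] cP[OF p] unfolding center_def by blast
    obtain a b where ab: "\<And>z'. z' \<in> Z \<Longrightarrow> K p p z' = a * f1 z' + b * f2 z'" using s unfolding spn_def by blast
    have "1 - hdot (G0 z') (G0 p) = (1 - hdot z' p) * ((k * a) * f1 z' + (k * b) * f2 z')" if "z' \<in> Z" for z'
      unfolding k[OF that] ab[OF that] by (simp add: algebra_simps)
    then show ?thesis by blast
  qed
  have Zne: "open Z" "Z \<noteq> {}" "Z \<subseteq> ball 0 1" using openZ Z_ne Z_ball .
  show ?thesis
  proof (cases "\<exists>z\<in>Z1. \<exists>w\<in>W. \<exists>w'\<in>W. near z w \<and> near z w' \<and> \<not> dep (K z w) (K z w')")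
    case True
    then obtain z w w' where z: "z \<in> Z1" and ww: "w \<in> W" "near z w" "w' \<in> W" "near z w'" "\<not> dep (K z w) (K z w')" by blast
    obtain \<nu> \<kappa> where S: "\<And>p w0. center p \<Longrightarrow> ok p p \<Longrightarrow> w0 \<in> W \<Longrightarrow> near z w0 \<Longrightarrow> near p w0 \<Longrightarrow> \<forall>a b. p - z \<noteq> a *s \<nu> + b *s \<kappa>
      \<Longrightarrow> spn (K z w) (K z w') (K p p)" using span_from_good_center[OF cZ1[OF z] ww] by metis
    obtain p1 d where p1: "norm p1 = 1" "d > 0" "\<And>p. dist p p1 < d \<Longrightarrow> dist p p0 < e \<and> (\<forall>a b. p - z \<noteq> a *s \<nu> + b *s \<kappa>)"
      using sphere_point_off_plane[OF dim(2) p0 e(1)] by metis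
    have "\<exists>a b. \<forall>z'\<in>Z. 1 - hdot (G0 z') (G0 p) = (1 - hdot z' p) * (a * K z w z' + b * K z w' z')" if p: "norm p = 1" "dist p p1 < d" for p
    proof -
      have p': "dist p p0 < e" "\<forall>a b. p - z \<noteq> a *s \<nu> + b *s \<kappa>" using p1(3)[OF p(2)] by auto
      obtain w0 where "w0 \<in> W" "near p w0" "near z w0" using ov[OF p(1) p'(1) z] by blast
      then have "spn (K z w) (K z w') (K p p)" using S cP[OF p(1) p'(1)] okp[OF p(1) p'(1)] p'(2) by blast
      then show ?thesis by (rule fin[OF p(1) p'(1)])
    qed
    then show ?thesis unfolding kernel_spanned_def using Zne p1(1,2) by blast
  next
    case False
    have z1: "z1 \<in> Z1" using e by (simp add: Z1_def)
    obtain w where w: "w \<in> W" "near z1 w" using ov[OF p0 _ z1] e by auto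
    \<comment> \<open>A single function spans here, so it takes the role of both \<open>f1\<close>
      and \<open>f2\<close>.\<close>
    have "\<exists>a b. \<forall>z'\<in>Z. 1 - hdot (G0 z') (G0 p) = (1 - hdot z' p) * (a * K z1 w z' + b * K z1 w z')" if p: "norm p = 1" "dist p p0 < e" for p
    proof (rule fin[OF p], rule multiple_spn, rule multiple_from_bad_centers[OF cZ1 _ z1 _ _ cP[OF p] okp[OF p] w])
      show "open Z1" by (simp add: Z1_def)
      show "dep (K z w) (K z w')" if "z \<in> Z1" "w \<in> W" "near z w" "w' \<in> W" "near z w'" for z w w' using False that by blast
      show "\<exists>w\<in>W. near p w \<and> near z w" if "z \<in> Z1" for z by (rule ov[OF p that])
    qed
    then show ?thesis unfolding kernel_spanned_def using Zne p0 e(1) by blast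
  qed
qed

end

section \<open>The degenerate case\<close>

lemma prj_hdot: "hdot z (prj v z) = hdot (prj v z) (prj v z)" "hdot v (prj v z) = 0"
proof -
  show 0: "hdot v (prj v z) = 0" using hdot_0_sym[of v "prj v z"] by simp
  show "hdot z (prj v z) = hdot (prj v z) (prj v z)" by (subst (1) prj_decomp[of z v]) (simp add: 0)
qed

context jets begin

lemma bilinear_jets: "z \<in> cball 0 1 \<Longrightarrow> bilinear_form (J1 z) (J2 z)"
  by (rule bilinear_form.intro) (auto simp: lin_J1 intro: J2_sym)

lemma ex_dual_pair:
  fixes z v :: "complex^'a"
  assumes "prj v z \<noteq> 0" shows "\<exists>w. hdot z w = 1 \<and> hdot v w = 0"
  using assms prj_hdot(1)[of z v] prj_hdot(2)[of v z] by (intro exI[of _ "(1 / cnj (hdot (prj v z) (prj v z))) *s prj v z"]) simp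

text \<open>Unless \<open>z\<close> is a multiple of \<open>v\<close>, some \<open>w\<close> is
  polar to \<open>z\<close> and orthogonal to \<open>v\<close>, and the maximum principle applies to
  the minors. The exceptional directions are limits of others, which \<open>asy_limit\<close>
  covers.\<close>

lemma par_everywhere:
  assumes bd: "\<And>p t. norm p = 1 \<Longrightarrow> hdot t p = 0 \<Longrightarrow> par (J1 p t) (J2 p t t)"
    and z: "z \<in> cball 0 1" "z \<noteq> 0" and dim: "CARD('a) \<ge> 2"
  shows "par (J1 z v) (J2 z v v)"
proof -
  interpret bilinear_form "J1 z" "J2 z" by (rule bilinear_jets[OF z(1)])
  have 1: "par (J1 z v) (J2 z v v)" if w: "hdot z w = 1" "hdot v w = 0" for v w
    unfolding par_def
  proof (intro allI)
    fix i j
    define \<Phi> where "\<Phi> z V = J1 z (V ()) $ i * J2 z (V ()) (V ()) $ j - J1 z (V ()) $ j * J2 z (V ()) (V ()) $ i"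
      for z and V :: "unit \<Rightarrow> complex^'a"
    have "\<Phi> z (\<lambda>_. v) = 0"
    proof (rule max_principle_tangential[where \<Phi> = \<Phi> and v = "\<lambda>_. v", OF _ _ _ z(1) w(1)])
      fix z d :: "complex^'a" and v e :: "unit \<Rightarrow> complex^'a"
      show "(\<lambda>t. \<Phi> (z + t *s d) (\<lambda>i. v i + t *s e i)) holomorphic_on {t. z + t *s d \<in> ball 0 1}"
        unfolding \<Phi>_def by (intro holomorphic_on_diff holomorphic_on_mult holJ)
      show "continuous_on {t. z + t *s d \<in> cball 0 1} (\<lambda>t. \<Phi> (z + t *s d) (\<lambda>i. v i + t *s e i))"
        unfolding \<Phi>_def by (intro continuous_on_diff continuous_on_mult continuous_on_component lineJ_cont)
    next
      fix p :: "complex^'a" and v :: "unit \<Rightarrow> complex^'a" assume "norm p = 1" "\<And>i. hdot (v i) p = 0"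
      then show "\<Phi> p v = 0" using bd[of p "v ()"] by (simp add: \<Phi>_def par_def)
    qed (use w in simp)
    then show "J1 z v $ i * J2 z v v $ j = J1 z v $ j * J2 z v v $ i" by (simp add: \<Phi>_def)
  qed
  have 2: "asy v" if "prj v z \<noteq> 0" for v
    using ex_dual_pair[OF that] 1 unfolding asy_def by blast
  have "asy v"
  proof (cases "prj v z = 0 \<and> v \<noteq> 0")
    case True
    define k where "k = hdot z v / hdot v v"
    have k: "z = k *s v" using prj_decomp[of z v] True by (simp add: k_def)
    obtain e where e: "norm e = 1" "hdot v e = 0" using ex_orthogonal[OF dim] by blast
    have "asy (s *s e + v)" if s: "s \<noteq> 0" for s
    proof (rule 2)
      show "prj (s *s e + v) z \<noteq> 0"
      proof
        assume "prj (s *s e + v) z = 0"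
        then have zz: "z = (hdot z (s *s e + v) / hdot (s *s e + v) (s *s e + v)) *s (s *s e + v)"
          using prj_decomp[of z "s *s e + v"] by simp
        define l where "l = hdot z (s *s e + v) / hdot (s *s e + v) (s *s e + v)"
        have "hdot z e = l * s" using e arg_cong[OF zz, of "\<lambda>y. hdot y e"] unfolding l_def[symmetric] by (simp add: hdot_unit)
        moreover have "hdot z e = 0" using k e by simp
        ultimately have "l = 0" using s by simp
        then show False using zz z(2) unfolding l_def[symmetric] by simp
      qed
    qed
    then show ?thesis by (rule asy_limit)
  qed (use 2 in auto)
  then show ?thesis by (simp add: asy_def)
qed

text \<open>Without such a point the differential vanishes on all tangential vectors. Moved inwards
  this gives \<open>J1 z z = 0\<close>, so the map is constant on radii, although its norm is 1 on
  the sphere and less at 0.\<close>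

lemma ex_conformal_factor_pos:
  assumes dim: "CARD('a) \<ge> 2"
  shows "\<exists>p. norm p = 1 \<and> Re (hdot (J1 p p) (G0 p)) > 0 \<and> (\<forall>t. hdot t p = 0 \<longrightarrow> J1 p t = 0 \<longrightarrow> t = 0)"
proof (rule ccontr)
  assume neg: "\<not> ?thesis"
  have bd: "J1 p t = 0" if p: "norm p = 1" "hdot t p = 0" for p t
  proof -
    obtain K :: real and \<xi> b where K: "K = Re (hdot (J1 p p) (G0 p))"
      "\<And>t t'. hdot t p = 0 \<Longrightarrow> hdot t' p = 0 \<Longrightarrow> hdot (J1 p t) (J1 p t') = of_real K * hdot t t'"
      using boundary_forms[OF p(1) dim] by metis
    have sq: "(norm (J1 p t))\<^sup>2 = K * (norm t)\<^sup>2" if "hdot t p = 0" for t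
      using K(2)[OF that that] unfolding hdot_self of_real_mult[symmetric] of_real_eq_iff .
    have "\<not> K > 0"
    proof
      assume "K > 0"
      then have "t = 0" if "hdot t p = 0" "J1 p t = 0" for t using sq[OF that(1)] that(2) by simp
      then show False using neg p(1) K(1) \<open>K > 0\<close> by blast
    qed
    then have "K * (norm t)\<^sup>2 \<le> 0" by (simp add: mult_le_0_iff)
    then show ?thesis using sq[OF p(2)] by (metis norm_eq_zero power2_less_eq_zero_iff)
  qed
  have 1: "J1 z v = 0" if z: "z \<in> cball 0 1" and w: "hdot z w = 1" "hdot v w = 0" for z v w
  proof -
    have "J1 z v $ k = 0" for k
    proof -
      define \<Phi> where "\<Phi> z V = J1 z (V ()) $ k" for z and V :: "unit \<Rightarrow> complex^'a"
      have "\<Phi> z (\<lambda>_. v) = 0"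
      proof (rule max_principle_tangential[where \<Phi> = \<Phi> and v = "\<lambda>_. v", OF _ _ _ z w(1)])
        fix z d :: "complex^'a" and v e :: "unit \<Rightarrow> complex^'a"
        show "(\<lambda>t. \<Phi> (z + t *s d) (\<lambda>i. v i + t *s e i)) holomorphic_on {t. z + t *s d \<in> ball 0 1}"
          unfolding \<Phi>_def by (rule holJ)
        show "continuous_on {t. z + t *s d \<in> cball 0 1} (\<lambda>t. \<Phi> (z + t *s d) (\<lambda>i. v i + t *s e i))"
          unfolding \<Phi>_def by (intro continuous_on_component lineJ_cont)
      qed (use w bd in \<open>auto simp: \<Phi>_def\<close>)
      then show ?thesis by (simp add: \<Phi>_def)
    qed
    then show ?thesis by (simp add: vec_eq_iff)
  qed
  \<comment> \<open>\<open>z\<close> is the difference of \<open>z + e\<close> and \<open>e\<close>,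
    and each of these is orthogonal to some vector polar to \<open>z\<close>.\<close>
  have 2: "J1 z z = 0" if z: "z \<in> cball 0 1" "z \<noteq> 0" for z
  proof -
    obtain e where e: "norm e = 1" "hdot z e = 0" using ex_orthogonal[OF dim] by blast
    have ez: "hdot e z = 0" using e hdot_0_sym by blast
    have "J1 z e = 0" by (rule 1[of _ "(1 / cnj (hdot z z)) *s z"]) (use z ez in simp_all)
    moreover have "J1 z (z + e) = 0"
      by (rule 1[of _ "(1 / cnj (hdot z z)) *s z - e"]) (use z e ez in \<open>simp_all add: hdot_unit\<close>)
    ultimately show ?thesis by simp
  qed
  obtain p where p: "norm p = 1" "hdot (0::complex^'a) p = 0" using ex_orthogonal[OF dim] by blast
  define l where "l = G0 p - G0 0"
  have "hdot (G0 (0 + p) - G0 0) l = 0"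
  proof (rule hdot_constant_on_segment)
    fix t :: real assume t: "0 < t" "t < 1"
    have "of_real t *s p \<in> cball 0 1" "of_real t *s p \<noteq> 0" using t p by (auto simp: norm_smult)
    from 2[OF this] have "of_real t *s J1 (of_real t *s p) p = 0" by simp
    then show "0 + of_real t *s p \<in> ball 0 1 \<and> hdot (J1 (0 + of_real t *s p) p) l = 0" using t p by (simp add: norm_smult)
  qed (use p in \<open>simp add: norm_smult\<close>)
  then have "hdot l l = 0" unfolding l_def by (simp only: add_0)
  then have "l = 0" by simp
  then have "G0 p = G0 0" by (simp add: l_def)
  then show False using bdry[OF p(1)] inside[of 0] by simp
qed

text \<open>If the second fundamental form is a multiple of the first, then \<open>G0 z' - G0 z\<close> is a multiple of \<open>J1 z (z' - z)\<close>.\<close>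

lemma kernel_span_linear:
  assumes bd: "\<And>p t. norm p = 1 \<Longrightarrow> hdot t p = 0 \<Longrightarrow> par (J1 p t) (J2 p t t)" and dim: "CARD('a) \<ge> 3"
  shows kernel_spanned
proof -
  have dim2: "CARD('a) \<ge> 2" using dim by simp
  obtain q where q: "norm q = 1" "Re (hdot (J1 q q) (G0 q)) > 0" "\<And>t. hdot t q = 0 \<Longrightarrow> J1 q t = 0 \<Longrightarrow> t = 0"
    using ex_conformal_factor_pos[OF dim2] by blast
  have Jp: "hdot (J1 p v) (G0 p) = hdot v p * hdot (J1 p p) (G0 p)" if p: "norm p = 1" for p v
    by (subst prj_decomp[of v p]) (simp add: tangential_1(1)[OF p] hdot_unit[OF p])
  have inj: "x = 0" if x: "J1 q x = 0" for x
  proof -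
    have "hdot x q = 0" using Jp[OF q(1), of x] x q(2) by auto
    then show ?thesis using q(3) x by blast
  qed
  then obtain g where g: "lin g" "\<And>x. g (J1 q x) = x"
    using vec.linear_injective_left_inverse[OF lin_J1, of q] vec.linear_inj_iff_eq_0[OF lin_J1, of q] by (auto simp: fun_eq_iff)
  define C where "C = (\<Sum>i\<in>UNIV. norm (g (axis i 1))) + 1"
  have C: "C > 0" by (simp add: C_def sum_nonneg add_nonneg_pos)
  have low: "norm x \<le> C * norm (J1 q x)" for x
  proof -
    have "norm (g (J1 q x)) \<le> norm (J1 q x) * (\<Sum>i\<in>UNIV. norm (g (axis i 1)))" by (rule lin_bound[OF g(1)])
    also have "\<dots> \<le> norm (J1 q x) * C" unfolding C_def by (intro mult_left_mono) auto
    finally show ?thesis by (simp add: g(2) mult.commute)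
  qed
  define E where "E z = (\<Sum>i\<in>UNIV. norm (J1 z (axis i 1) - J1 q (axis i 1)))" for z
  have "continuous_on (cball 0 1) E" unfolding E_def using q(1) by (intro continuous_intros) auto
  then have "\<exists>\<delta>>0. \<forall>z\<in>cball 0 1. dist z q < \<delta> \<longrightarrow> dist (E z) (E q) < 1 / (2 * C)"
    unfolding continuous_on_iff using q(1) C by (elim ballE[of _ _ q] allE[of _ "1 / (2 * C)"]) simp_all
  then obtain \<delta> where \<delta>0: "\<delta> > 0" "\<And>z. z \<in> cball 0 1 \<Longrightarrow> dist z q < \<delta> \<Longrightarrow> dist (E z) (E q) < 1 / (2 * C)" by blast
  have "E q = 0" by (simp add: E_def)
  then have \<delta>: "\<delta> > 0" "z \<in> cball 0 1 \<Longrightarrow> dist z q < \<delta> \<Longrightarrow> E z < 1 / (2 * C)" for z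
    using \<delta>0(1) \<delta>0(2)[of z] by (simp_all add: dist_real_def)
  define \<rho> where "\<rho> = min \<delta> (1/2)"
  define N where "N = cball 0 1 \<inter> ball q \<rho>"
  have \<rho>: "\<rho> > 0" "\<rho> \<le> 1/2" using \<delta> by (auto simp: \<rho>_def)
  have N: "z \<in> cball 0 1" "z \<noteq> 0" if "z \<in> N" for z
    using that q(1) \<rho> by (auto simp: N_def dist_norm)
  have low2: "norm x \<le> 2 * C * norm (J1 z x)" if z: "z \<in> N" for x z
  proof -
    have l: "lin (\<lambda>x. J1 z x - J1 q x)" by (rule linI) (simp_all add: vec_eq_iff algebra_simps)
    have "norm (J1 z x - J1 q x) \<le> norm x * E z" unfolding E_def by (rule lin_bound[OF l])
    also have "\<dots> \<le> norm x * (1 / (2 * C))"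
      using \<delta>(2)[of z] z by (intro mult_left_mono) (auto simp: N_def \<rho>_def dist_commute)
    finally have "norm (J1 q x) \<le> norm (J1 z x) + norm x / (2 * C)"
      using norm_triangle_ineq4[of "J1 z x" "J1 z x - J1 q x"] by simp
    then have "C * norm (J1 q x) \<le> C * (norm (J1 z x) + norm x / (2 * C))" using C by (intro mult_left_mono) auto
    then have "C * norm (J1 q x) \<le> C * norm (J1 z x) + norm x / 2" using C by (simp add: distrib_left)
    then show ?thesis using low[of x] by simp
  qed
  have inj2: "J1 z x = 0 \<Longrightarrow> x = 0" if "z \<in> N" for z x using low2[OF that, of x] by simp
  have cvx: "convex N" unfolding N_def by (intro convex_Int convex_cball convex_ball)
  \<comment> \<open>Along the segment the derivative \<open>J2 h h\<close> of \<open>J1 h\<close> is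
    a multiple of \<open>J1 h\<close> by \<open>par_everywhere\<close>, with a factor bounded
    through \<open>low2\<close>; so a product with \<open>l\<close> that starts at zero stays
    zero.\<close>
  have seg: "hdot (J1 z1 (z1 - z0)) l = 0 \<and> hdot (G0 z1 - G0 z0) l = 0"
    if z: "z0 \<in> N" "z1 \<in> N" and l: "hdot (J1 z0 (z1 - z0)) l = 0" for z0 z1 l
  proof (cases "z0 = z1")
    case False
    define h where "h = z1 - z0"
    define Y where "Y t = z0 + of_real t *s h" for t
    have YN: "Y t \<in> N" if "t \<in> {0..1}" for t
    proof -
      have "Y t = (1 - t) *\<^sub>R z0 + t *\<^sub>R z1" by (simp add: Y_def h_def of_real_smult algebra_simps)
      then show ?thesis using that by (auto intro!: convexD[OF cvx z])
    qed
    have Yc: "continuous_on {0..1} Y" unfolding Y_def by (intro continuous_intros)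
    have Ycb: "t \<in> {0..1} \<Longrightarrow> Y t \<in> cball 0 1" for t using YN N by blast
    have Yb: "Y t \<in> ball 0 1" if "0 < t" "t < 1" for t
      unfolding Y_def h_def of_real_smult mem_ball_0 by (rule segment_in_ball) (use N[OF z(1)] N[OF z(2)] that False in auto)
    have "continuous_on {0..1} (\<lambda>t. J2 (Y t) h h)" by (intro continuous_intros Yc Ycb)
    then have "bounded ((\<lambda>t. J2 (Y t) h h) ` {0..1})" using compact_continuous_image compact_imp_bounded by blast
    then obtain M where "\<forall>x\<in>(\<lambda>t. J2 (Y t) h h) ` {0..1}. norm x \<le> M" unfolding bounded_iff by blast
    then have M: "norm (J2 (Y t) h h) \<le> M" if "t \<in> {0..1}" for t using that by blast
    have h0: "h \<noteq> 0" using False by (simp add: h_def)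
    define f where "f (i::unit) t = hdot (J1 (Y t) h) l" for i t
    have f0: "f () t = 0" if t: "0 \<le> t" "t \<le> 1" for t
    proof (rule gronwall_zero[where f' = "\<lambda>_ t. hdot (J2 (Y t) h h) l" and M = "M * (2 * C / norm h)", OF _ _ _ _ t])
      show "continuous_on {0..1} (f i)" for i unfolding f_def by (intro continuous_intros Yc Ycb)
      show "(f i has_vector_derivative hdot (J2 (Y t) h h) l) (at t)" if t: "0 < t" "t < 1" for i t
        unfolding f_def Y_def by (rule has_vector_derivative_real_field[OF derJ_hdot(2)[OF Yb[OF t, unfolded Y_def]]])
      show "f i 0 = 0" for i using l by (simp add: f_def Y_def h_def)
      show "cmod (hdot (J2 (Y t) h h) l) \<le> M * (2 * C / norm h) * (\<Sum>j\<in>UNIV. cmod (f j t))" if t: "0 < t" "t < 1" for i t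
      proof -
        have t': "t \<in> {0..1}" using t by simp
        have J0: "J1 (Y t) h \<noteq> 0" using inj2[OF YN[OF t']] h0 by blast
        obtain k where k: "J2 (Y t) h h = k *s J1 (Y t) h"
          using parD[OF par_everywhere[OF bd N[OF YN[OF t']] dim2] J0] by blast
        have "cmod k * norm h \<le> 2 * C * (cmod k * norm (J1 (Y t) h))"
          using mult_left_mono[OF low2[OF YN[OF t'], of h], of "cmod k"] by (simp add: mult_ac)
        also have "cmod k * norm (J1 (Y t) h) = norm (J2 (Y t) h h)" by (simp add: k norm_smult)
        also have "2 * C * \<dots> \<le> 2 * C * M" using M[OF t'] C by (intro mult_left_mono) auto
        finally have "cmod k \<le> M * (2 * C / norm h)" using h0 by (simp add: field_simps)
        moreover have "(\<Sum>j\<in>UNIV. cmod (f j t)) = cmod (hdot (J1 (Y t) h) l)" by (simp add: f_def)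
        ultimately show ?thesis unfolding k hdot_scale norm_mult by (simp only: mult_right_mono norm_ge_zero)
      qed
    qed
    have Y1: "Y 1 = z1" by (simp add: Y_def h_def)
    have "hdot (G0 (z0 + h) - G0 z0) l = 0"
      by (rule hdot_constant_on_segment) (use Yb Ycb f0 in \<open>auto simp: Y_def f_def\<close>)
    then show ?thesis using f0[of 1] unfolding f_def Y1 h_def by simp
  qed simp
  define Z where "Z = ball 0 1 \<inter> ball q \<rho>"
  have ZN: "Z \<subseteq> N" unfolding Z_def N_def using ball_subset_cball by blast
  have oZ: "open Z" by (auto simp: Z_def)
  have "of_real (1 - \<rho>/2) *s q \<in> Z"
  proof -
    have "of_real (1 - \<rho>/2) *s q - q = of_real (- \<rho>/2) *s q" by (simp add: vec_eq_iff algebra_simps)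
    then have "dist (of_real (1 - \<rho>/2) *s q) q = \<rho>/2" using \<rho> q(1) unfolding dist_norm by (simp add: norm_smult del: of_real_divide of_real_minus)
    moreover have "norm (of_real (1 - \<rho>/2) *s q) = 1 - \<rho>/2" using \<rho> q(1) unfolding norm_smult norm_of_real by simp
    ultimately show ?thesis using \<rho> by (simp add: Z_def dist_commute)
  qed
  then obtain y where y: "y \<in> Z" by blast
  have ne: "hdot x p \<noteq> 1" if "norm x < 1" "norm p = 1" for x p :: "complex^'n::finite"
    using cmod_hdot_le[of x p] that by auto
  define k where "k p = hdot (J1 p p) (G0 p)" for p
  have ker: "\<exists>\<phi>. \<phi> \<noteq> 0 \<and> G0 z' - G0 p = \<phi> *s J1 p (z' - p) \<and> 1 - hdot (G0 z') (G0 p) = (1 - hdot z' p) * (\<phi> * k p)"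
    if p: "norm p = 1" "p \<in> N" and z': "z' \<in> Z" for p z'
  proof -
    obtain \<phi> where \<phi>: "G0 z' - G0 p = \<phi> *s J1 p (z' - p)"
      using multiple_if_annihilated[of "J1 p (z' - p)" "G0 z' - G0 p"] seg[of p z'] p z' ZN by blast
    have G1: "hdot (G0 p) (G0 p) = 1" using bdry[OF p(1)] by (rule hdot_unit)
    have "hdot (G0 z' - G0 p) (G0 p) = \<phi> * (hdot (z' - p) p * k p)" unfolding \<phi> k_def hdot_scale by (rule arg_cong[OF Jp[OF p(1)]])
    then have "1 - hdot (G0 z') (G0 p) = (1 - hdot z' p) * (\<phi> * k p)"
      using hdot_unit[OF p(1)] G1 by (simp add: algebra_simps)
    moreover have "\<phi> \<noteq> 0"
    proof
      assume "\<phi> = 0"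
      then have "hdot (G0 z') (G0 p) = 1" using calculation by simp
      then show False using ne[of "G0 z'" "G0 p"] inside[of z'] bdry[OF p(1)] z' by (auto simp: Z_def)
    qed
    ultimately show ?thesis using \<phi> by blast
  qed
  have qN: "q \<in> N" using q(1) \<rho> by (simp add: N_def)
  define f1 where "f1 z' = (1 - hdot (G0 z') (G0 q)) / (1 - hdot z' q)" for z'
  have "\<exists>a. \<forall>z'\<in>Z. 1 - hdot (G0 z') (G0 p) = (1 - hdot z' p) * (a * f1 z')" if p: "norm p = 1" "dist p q < \<rho>" for p
  proof -
    have pN: "p \<in> N" using p by (simp add: N_def dist_commute)
    \<comment> \<open>The direction \<open>n\<close> is transversal to \<open>q - p\<close> and
      \<open>y - p\<close>, so a functional can annihilate the images of both differences under
      \<open>J1 p\<close> and be nonzero on that of \<open>n\<close>.\<close>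
    obtain n where n: "norm n = 1" "hdot (q - p) n = 0" "hdot (y - p) n = 0" using ex_orthogonal2[OF dim] by blast
    have "J1 p n \<noteq> a *s J1 p (q - p) + b *s J1 p (y - p)" for a b
    proof
      assume "J1 p n = a *s J1 p (q - p) + b *s J1 p (y - p)"
      then have "J1 p (n - (a *s (q - p) + b *s (y - p))) = 0" by simp
      then have "n = a *s (q - p) + b *s (y - p)" using inj2[OF pN] unfolding right_minus_eq[symmetric, of n] by blast
      then have "hdot n n = 0" using n by (metis add_0 hdot_add(1) hdot_scale(1) mult_zero_right)
      then show False using n by simp
    qed
    then obtain l where l: "hdot (J1 p (q - p)) l = 0" "hdot (J1 p (y - p)) l = 0" "hdot (J1 p n) l = 1" using dual_vector2 by blast
    have lq: "hdot (J1 q (q - p)) l = 0" "hdot (G0 q - G0 p) l = 0" using seg[OF pN qN l(1)] by auto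
    obtain a where a: "\<And>v. hdot (J1 p v) l = hdot v a" using functional_hdot[of "\<lambda>v. hdot (J1 p v) l"] by auto
    obtain b where b: "\<And>v. hdot (J1 q v) l = hdot v b" using functional_hdot[of "\<lambda>v. hdot (J1 q v) l"] by auto
    obtain \<phi> where \<phi>: "\<And>z'. z' \<in> Z \<Longrightarrow> \<phi> z' \<noteq> 0 \<and> G0 z' - G0 p = \<phi> z' *s J1 p (z' - p) \<and> 1 - hdot (G0 z') (G0 p) = (1 - hdot z' p) * (\<phi> z' * k p)"
      using ker[OF p(1) pN] by metis
    obtain \<psi> where \<psi>: "\<And>z'. z' \<in> Z \<Longrightarrow> \<psi> z' \<noteq> 0 \<and> G0 z' - G0 q = \<psi> z' *s J1 q (z' - q) \<and> 1 - hdot (G0 z') (G0 q) = (1 - hdot z' q) * (\<psi> z' * k q)"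
      using ker[OF q(1) qN] by metis
    have rel: "\<phi> z' * hdot (z' - p) a = \<psi> z' * hdot (z' - p) b" if "z' \<in> Z" for z'
    proof -
      have "\<phi> z' * hdot (z' - p) a = hdot (G0 z' - G0 p) l" using \<phi>[OF that] by (metis a hdot_scale(1))
      also have "\<dots> = hdot (G0 z' - G0 q) l" using lq(2) by simp
      also have "\<dots> = \<psi> z' * hdot (z' - q) b" using \<psi>[OF that] by (metis b hdot_scale(1))
      also have "hdot (z' - q) b = hdot (z' - p) b" using lq(1) b[of "q - p"] by simp
      finally show ?thesis .
    qed
    have ya: "hdot (y - p) a = 0" using a l(2) by metis
    have move: "eventually (\<lambda>t::real. z' + of_real t *s v \<in> Z \<and> t > 0) (at_right 0)" if "z' \<in> Z" for z' v
    proof -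
      have "((\<lambda>t::real. z' + of_real t *s v) \<longlongrightarrow> z' + of_real 0 *s v) (at_right 0)" by (intro tendsto_intros)
      then show ?thesis using topological_tendstoD[OF _ oZ, of _ "z' + of_real 0 *s v"] that
        by (intro eventually_conj eventually_at_right_less) simp_all
    qed
    \<comment> \<open>By \<open>rel\<close> the zeros of \<open>a\<close> in \<open>Z\<close> are
      zeros of \<open>b\<close>. As \<open>Z\<close> is open around \<open>y\<close>, small steps
      from \<open>y\<close> test all vectors orthogonal to \<open>a\<close>.\<close>
    have "\<exists>k. b = k *s a"
    proof (rule multiple_if_annihilated)
      fix v assume "hdot a v = 0"
      then have va: "hdot v a = 0" using hdot_0_sym by blast
      have yb: "hdot (y - p) b = 0" using rel[OF y] \<psi>[OF y] ya by simp
      obtain t :: real where t: "y + of_real t *s v \<in> Z" "t > 0"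
        using eventually_happens'[OF trivial_limit_at_right_real move[OF y]] by blast
      have "hdot (y + of_real t *s v - p) a = 0" using ya va by (simp add: algebra_simps)
      then have "hdot (y + of_real t *s v - p) b = 0" using rel[OF t(1)] \<psi>[OF t(1)] by simp
      then have "hdot v b = 0" using yb t(2) by (simp add: algebra_simps)
      then show "hdot b v = 0" using hdot_0_sym by blast
    qed
    then obtain \<beta> where \<beta>: "b = \<beta> *s a" by blast
    have e1: "\<phi> z' = cnj \<beta> * \<psi> z'" if "z' \<in> Z" "hdot (z' - p) a \<noteq> 0" for z'
      using rel[OF that(1)] that(2) by (simp add: \<beta>)
    have kq: "k q \<noteq> 0" using q(2) by (auto simp: k_def)
    define A where "A = cnj \<beta> * k p / k q"
    define D where "D z' = (1 - hdot (G0 z') (G0 p)) - (1 - hdot z' p) * (A * f1 z')" for z'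
    have f1: "f1 z' = \<psi> z' * k q" if "z' \<in> Z" for z'
      using \<psi>[OF that] ne[of z' q] that q(1) by (simp add: f1_def Z_def)
    have D0: "D z' = 0" if "z' \<in> Z" "hdot (z' - p) a \<noteq> 0" for z'
      using \<phi>[OF that(1)] kq by (simp add: D_def f1[OF that(1)] e1[OF that] A_def)
    \<comment> \<open>Points where the common factor vanishes are limits, along \<open>n\<close>, of
      points where it can be cancelled.\<close>
    have "D z' = 0" if z': "z' \<in> Z" for z'
    proof (cases "hdot (z' - p) a = 0")
      case True
      have cD: "continuous_on Z D" unfolding D_def[abs_def] f1_def
        using ZN N(1) ne[of _ q] q(1) by (intro continuous_intros) (auto simp: Z_def)
      have tt: "((\<lambda>t::real. z' + of_real t *s n) \<longlongrightarrow> z') (at_right 0)"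
      proof -
        have "((\<lambda>t::real. z' + of_real t *s n) \<longlongrightarrow> z' + of_real 0 *s n) (at_right 0)" by (intro tendsto_intros)
        then show ?thesis by simp
      qed
      have "isCont D z'" using cD oZ z' by (simp add: continuous_on_eq_continuous_at)
      then have "((\<lambda>t::real. D (z' + of_real t *s n)) \<longlongrightarrow> D z') (at_right 0)" by (rule isCont_tendsto_compose) (rule tt)
      moreover have "eventually (\<lambda>t::real. D (z' + of_real t *s n) = 0) (at_right 0)" using move[OF z', of n]
      proof eventually_elim
        case (elim t)
        have "hdot n a = 1" using a[of n] l(3) by simp
        then have "hdot (z' + of_real t *s n - p) a \<noteq> 0" using True elim by (simp add: algebra_simps)
        then show ?case using D0 elim by blast
      qed
      then have "((\<lambda>t::real. D (z' + of_real t *s n)) \<longlongrightarrow> 0) (at_right 0)" by (rule tendsto_eventually)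
      ultimately show ?thesis using tendsto_unique[OF trivial_limit_at_right_real] by blast
    qed (use D0 z' in blast)
    then show ?thesis unfolding D_def by (intro exI[of _ A]) auto
  qed
  then have "\<exists>a b. \<forall>z'\<in>Z. 1 - hdot (G0 z') (G0 p) = (1 - hdot z' p) * (a * f1 z' + b * f1 z')" if "norm p = 1" "dist p q < \<rho>" for p
    using that by (metis add.right_neutral mult_zero_left)
  moreover have "Z \<noteq> {}" "Z \<subseteq> ball 0 1" using y by (auto simp: Z_def)
  ultimately show ?thesis unfolding kernel_spanned_def using oZ q(1) \<rho>(1) by blast
qed

end

section \<open>The rank of the kernel\<close>

lemma lhol_cap_zero:
  fixes f :: "complex^'a \<Rightarrow> complex"
  assumes f: "lhol f" "continuous_on (cball 0 1) f" and d: "d \<noteq> 0" and z: "z \<in> ball 0 1"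
    and b: "\<And>t. norm (z + t *s d) = 1 \<Longrightarrow> f (z + t *s d) = 0"
  shows "f z = 0"
proof -
  have "f (z + 0 *s d) = 0"
  proof (rule chord_maximum_principle[OF _ _ d z b])
    show "(\<lambda>t. f (z + t *s d)) holomorphic_on {t. z + t *s d \<in> ball 0 1}" by (rule lholD[OF f(1)])
    show "continuous_on {t. z + t *s d \<in> cball 0 1} (\<lambda>t. f (z + t *s d))"
      by (rule continuous_on_compose2[OF f(2) continuous_on_line]) auto
  qed
  then show ?thesis by simp
qed

text \<open>The one-variable identity theorem on the line joining \<open>z\<close> to a point of
  \<open>U\<close>; the part of the line inside the ball is convex, hence connected.\<close>

lemma lhol_identity:
  fixes f :: "complex^'a \<Rightarrow> complex"
  assumes f: "lhol f" and U: "open U" "U \<noteq> {}" "U \<subseteq> ball 0 1" "\<And>z. z \<in> U \<Longrightarrow> f z = 0" and z: "z \<in> ball 0 1"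
  shows "f z = 0"
proof -
  obtain z0 where z0: "z0 \<in> U" using U(2) by blast
  define S where "S = {t. z0 + t *s (z - z0) \<in> ball 0 1}"
  define g where "g t = f (z0 + t *s (z - z0))" for t
  define V where "V = {t. z0 + t *s (z - z0) \<in> U}"
  have oV: "open V" unfolding V_def
    using continuous_open_preimage[OF continuous_on_line[of UNIV z0 "z - z0"] open_UNIV U(1)] by (simp add: vimage_def)
  have 0: "0 \<in> V" using z0 by (simp add: V_def)
  have "convex S" unfolding convex_def
  proof (intro ballI allI impI)
    fix s t :: complex and a b :: real assume h: "s \<in> S" "t \<in> S" "0 \<le> a" "0 \<le> b" "a + b = 1"
    have "z0 + (a *\<^sub>R s + b *\<^sub>R t) *s (z - z0) = a *\<^sub>R (z0 + s *s (z - z0)) + b *\<^sub>R (z0 + t *s (z - z0))"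
    proof -
      have b: "b = 1 - a" using h(5) by simp
      show ?thesis by (simp add: b scaleR_conv_of_real[of _ s] scaleR_conv_of_real[of _ t] of_real_smult[symmetric] vec_eq_iff algebra_simps)
    qed
    then show "a *\<^sub>R s + b *\<^sub>R t \<in> S" unfolding S_def mem_Collect_eq using h convexD[OF convex_ball, of "z0 + s *s (z - z0)" 0 1 "z0 + t *s (z - z0)" a b] by (simp add: S_def)
  qed
  then have conn: "connected S" by (rule convex_connected)
  have "g 1 = 0"
  proof (rule analytic_continuation[where f = g and U = V and S = S and \<xi> = 0 and w = 1])
    show "g holomorphic_on S" unfolding g_def S_def by (rule lholD[OF f])
    show "open S" unfolding S_def by (rule open_line)
    show "V \<subseteq> S" using U(3) by (auto simp: V_def S_def)
    show "0 islimpt V" using 0 oV by (simp add: interior_limit_point interior_open)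
    show "0 \<in> S" "1 \<in> S" using z z0 U(3) by (auto simp: S_def)
    show "g t = 0" if "t \<in> V" for t using that U(4) by (simp add: g_def V_def)
  qed (rule conn)
  then show ?thesis by (simp add: g_def)
qed

text \<open>Near \<open>p1\<close>, complex lines in a direction orthogonal to \<open>p1\<close>
  leave the ball only through a small cap, where \<open>f\<close> vanishes; the maximum principle
  gives zeros on an open set.\<close>

lemma boundary_uniqueness:
  fixes f :: "complex^'a \<Rightarrow> complex"
  assumes dim: "CARD('a) \<ge> 2" and f: "lhol f" "continuous_on (cball 0 1) f" and p: "norm p1 = 1" "\<epsilon> > 0"
    and b: "\<And>p. norm p = 1 \<Longrightarrow> dist p p1 < \<epsilon> \<Longrightarrow> f p = 0" and z: "z \<in> ball 0 1"
  shows "f z = 0"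
proof -
  obtain d where d: "norm d = 1" "hdot p1 d = 0" using ex_orthogonal[OF dim] by blast
  have dp: "hdot d p1 = 0" using d hdot_0_sym by blast
  \<comment> \<open>Moving along \<open>d\<close> keeps the product with \<open>p1\<close>, so on
    the sphere the squared distance to \<open>p1\<close> is at most twice the distance of the
    starting point.\<close>
  define r where "r = \<epsilon>\<^sup>2 / 2"
  define U where "U = ball 0 1 \<inter> ball p1 r"
  have r: "r > 0" using p by (simp add: r_def)
  have "f y = 0" if y: "y \<in> U" for y
  proof (rule lhol_cap_zero[OF f, of d])
    show "d \<noteq> 0" "y \<in> ball 0 1" using d y by (auto simp: U_def)
    fix t assume n: "norm (y + t *s d) = 1"
    have "(dist (y + t *s d) p1)\<^sup>2 = 2 - 2 * Re (hdot (y + t *s d) p1)"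
      unfolding dist_norm norm_diff_sq n p(1) by simp
    also have "\<dots> = 2 * Re (hdot (p1 - y) p1)" using dp hdot_unit[OF p(1)] by simp
    also have "\<dots> \<le> 2 * dist y p1"
      using complex_Re_le_cmod[of "hdot (p1 - y) p1"] cmod_hdot_le[of "p1 - y" p1] p(1) by (simp add: dist_norm norm_minus_commute)
    also have "\<dots> < \<epsilon>\<^sup>2" using y by (simp add: U_def r_def dist_commute)
    finally have "dist (y + t *s d) p1 < \<epsilon>" using p(2) by (simp add: power_less_imp_less_base)
    then show "f (y + t *s d) = 0" using b n by blast
  qed
  moreover have "U \<noteq> {}"
  proof -
    define s where "s = min (r/2) (1/2)"
    have s: "0 < s" "s < r" "s \<le> 1/2" using r by (auto simp: s_def)
    have "of_real (1 - s) *s p1 - p1 = of_real (- s) *s p1" by (simp add: vec_eq_iff algebra_simps)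
    then have "dist (of_real (1 - s) *s p1) p1 = s" using s p(1) unfolding dist_norm by (simp only: norm_smult norm_of_real)
    moreover have "norm (of_real (1 - s) *s p1) = 1 - s" using s p(1) unfolding norm_smult norm_of_real by simp
    ultimately have "of_real (1 - s) *s p1 \<in> U" using s by (simp add: U_def dist_commute)
    then show ?thesis by blast
  qed
  ultimately show ?thesis using lhol_identity[OF f(1), of U] z by (auto simp: U_def)
qed

lemma hdot_ne_1: fixes z w :: "complex^'a"
  assumes "norm z < 1" "norm w \<le> 1" shows "hdot z w \<noteq> 1" "hdot w z \<noteq> 1"
proof -
  have "norm z * norm w < 1" using assms by (metis mult_left_le norm_ge_zero order_le_less_trans)
  then show "hdot z w \<noteq> 1" "hdot w z \<noteq> 1" using cmod_hdot_le[of z w] cmod_hdot_le[of w z] by (auto simp: mult.commute)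
qed

definition kern :: "(complex^'a \<Rightarrow> complex^'b) \<Rightarrow> complex^'a \<Rightarrow> complex^'a \<Rightarrow> complex" where
  "kern F z w = (1 - hdot (F z) (F w)) / (1 - hdot z w)"

definition det3 :: "('a \<Rightarrow> 'a \<Rightarrow> complex) \<Rightarrow> 'a \<Rightarrow> 'a \<Rightarrow> 'a \<Rightarrow> 'a \<Rightarrow> 'a \<Rightarrow> 'a \<Rightarrow> complex" where
  "det3 k z1 z2 z3 w1 w2 w3 = k z1 w1 * (k z2 w2 * k z3 w3 - k z2 w3 * k z3 w2)
     - k z1 w2 * (k z2 w1 * k z3 w3 - k z2 w3 * k z3 w1) + k z1 w3 * (k z2 w1 * k z3 w2 - k z2 w2 * k z3 w1)"

text \<open>Minors rather than a factorisation: each is linear in the entries of one row or column,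
  which lets the identity be continued in one variable at a time.\<close>

definition rank_le_two :: "(complex^'a \<Rightarrow> complex^'a \<Rightarrow> complex) \<Rightarrow> bool" where
  "rank_le_two k \<longleftrightarrow> (\<forall>z1\<in>ball 0 1. \<forall>z2\<in>ball 0 1. \<forall>z3\<in>ball 0 1. \<forall>w1\<in>ball 0 1. \<forall>w2\<in>ball 0 1. \<forall>w3\<in>ball 0 1.
    det3 k z1 z2 z3 w1 w2 w3 = 0)"

context jets begin

lemma kernel_span_any:
  assumes dim: "CARD('b) + 1 = 2 * CARD('a)" "CARD('a) \<ge> 3"
  shows kernel_spanned
proof (cases "\<forall>p t. norm p = 1 \<longrightarrow> hdot t p = 0 \<longrightarrow> par (J1 p t) (J2 p t t)")
  case True
  then show ?thesis using kernel_span_linear[OF _ dim(2)] by blast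
next
  case False
  then obtain p where p: "norm p = 1" "\<not> (\<forall>t. hdot t p = 0 \<longrightarrow> par (J1 p t) (J2 p t t))" by blast
  have "CARD('a) \<ge> 2" using dim by simp
  then obtain u where u: "hdot u p = 0" "\<And>e. \<exists>v y. hdot y p = 0 \<and> J1 p v + J2 p u y = e"
    using boundary_dichotomy[OF p(1) dim(1)] p(2) by blast
  obtain \<rho> c where rc: "\<rho> > 0" "c \<ge> 0" "\<rho> \<le> 1/2" "\<And>z w e. z \<in> cball 0 1 \<Longrightarrow> dist z p < \<rho> \<Longrightarrow> dist w p < \<rho> \<Longrightarrow>
     (\<exists>x y. hdot y w = 0 \<and> J1 z x + J2 z (prj w u) y = e \<and> norm x \<le> c * norm e \<and> norm y \<le> c * norm e)"
    using nd_near[OF p(1) u] by blast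
  interpret nd_jets G0 G1 G2 G3 p u \<rho> c
    by unfold_locales (use p rc dim in auto)
  show ?thesis by (rule kernel_span)
qed

lemma lhol_kern: assumes "z \<in> ball 0 1"
  shows "lhol (\<lambda>w. cnj (kern G0 z w))" "lhol (\<lambda>w. kern G0 w z)"
    "continuous_on (cball 0 1) (\<lambda>w. cnj (kern G0 z w))"
proof -
  have e: "(\<lambda>w. cnj (kern G0 z w)) = (\<lambda>w. kern G0 w z)" by (simp add: kern_def cnj_hdot fun_eq_iff)
  show 1: "lhol (\<lambda>w. kern G0 w z)" unfolding lhol_def kern_def
  proof (intro allI holomorphic_on_divide holomorphic_on_diff holomorphic_on_const holomorphic_hdot holJ)
    show "(\<lambda>t. (a + t *s d) $ k) holomorphic_on {t. a + t *s d \<in> ball 0 1}" for a d k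
      by (simp, intro holomorphic_intros)
    show "1 - hdot (a + t *s d) z \<noteq> 0" if "t \<in> {t. a + t *s d \<in> ball 0 1}" for a d t
      using hdot_ne_1(1)[of "a + t *s d" z] that assms by simp
  qed
  then show "lhol (\<lambda>w. cnj (kern G0 z w))" by (simp only: e)
  show "continuous_on (cball 0 1) (\<lambda>w. cnj (kern G0 z w))" unfolding e kern_def
    using hdot_ne_1[of z] assms by (intro continuous_intros) auto
qed

lemma lhol_lin3: "lhol f \<Longrightarrow> lhol g \<Longrightarrow> lhol h \<Longrightarrow> lhol (\<lambda>w. c1 * f w + c2 * g w + c3 * h w)"
  for f g h :: "complex^'n \<Rightarrow> complex"
  unfolding lhol_def by (intro allI holomorphic_intros) auto

text \<open>The minors vanish for \<open>z\<close> in \<open>Z\<close> and \<open>w\<close> in a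
  piece of the sphere. The six variables are released one after another: those in \<open>w\<close>
  by \<open>boundary_uniqueness\<close> after conjugation, those in \<open>z\<close> by
  \<open>lhol_identity\<close>; antisymmetry brings each variable to the first slot.\<close>

lemma kernel_rank:
  assumes dim: "CARD('b) + 1 = 2 * CARD('a)" "CARD('a) \<ge> 3"
  shows "rank_le_two (kern G0)"
  unfolding rank_le_two_def
proof (intro ballI)
  fix z1 z2 z3 w1 w2 w3 :: "complex^'a"
  assume zw: "z1 \<in> ball 0 1" "z2 \<in> ball 0 1" "z3 \<in> ball 0 1" "w1 \<in> ball 0 1" "w2 \<in> ball 0 1" "w3 \<in> ball 0 1"
  obtain Z f1 f2 p1 \<epsilon> where Z: "open Z" "Z \<noteq> {}" "Z \<subseteq> ball 0 1" and p1: "norm p1 = 1" "\<epsilon> > 0"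
    and sp: "\<And>p. norm p = 1 \<Longrightarrow> dist p p1 < \<epsilon> \<Longrightarrow> \<exists>a b. \<forall>z'\<in>Z. 1 - hdot (G0 z') (G0 p) = (1 - hdot z' p) * (a * f1 z' + b * f2 z')"
    using kernel_span_any[OF dim] unfolding kernel_spanned_def by blast
  have dim2: "CARD('a) \<ge> 2" using dim by simp
  define k where "k = kern G0"
  define P where "P = {p. norm p = 1 \<and> dist p p1 < \<epsilon>}"
  define B where "B = ball (0::complex^'a) 1"
  have extw: "c1 * k z1 w + c2 * k z2 w + c3 * k z3 w = 0"
    if z: "z1 \<in> B" "z2 \<in> B" "z3 \<in> B" and h: "\<And>p. p \<in> P \<Longrightarrow> c1 * k z1 p + c2 * k z2 p + c3 * k z3 p = 0" and w: "w \<in> B"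
    for c1 c2 c3 z1 z2 z3 w
  proof -
    define f where "f w = cnj c1 * cnj (k z1 w) + cnj c2 * cnj (k z2 w) + cnj c3 * cnj (k z3 w)" for w
    have f: "f w = cnj (c1 * k z1 w + c2 * k z2 w + c3 * k z3 w)" for w by (simp add: f_def)
    have "f w = 0"
    proof (rule boundary_uniqueness[OF dim2 _ _ p1])
      show "lhol f" unfolding f_def k_def by (rule lhol_lin3) (use z in \<open>simp_all add: lhol_kern B_def\<close>)
      show "continuous_on (cball 0 1) f" unfolding f_def k_def
        by (intro continuous_on_add continuous_on_mult continuous_on_const lhol_kern(3)) (use z in \<open>simp_all add: B_def\<close>)
      show "f p = 0" if "norm p = 1" "dist p p1 < \<epsilon>" for p unfolding f using h[of p] that by (simp add: P_def)
    qed (use w B_def in simp)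
    then show ?thesis unfolding f complex_cnj_zero_iff .
  qed
  have extz: "c1 * k z w1 + c2 * k z w2 + c3 * k z w3 = 0"
    if w: "w1 \<in> B" "w2 \<in> B" "w3 \<in> B" and h: "\<And>z. z \<in> Z \<Longrightarrow> c1 * k z w1 + c2 * k z w2 + c3 * k z w3 = 0" and z: "z \<in> B"
    for c1 c2 c3 z w1 w2 w3
    by (rule lhol_identity[where f = "\<lambda>z. c1 * k z w1 + c2 * k z w2 + c3 * k z w3", OF lhol_lin3 Z(1,2,3) h])
      (use w z in \<open>simp_all add: k_def lhol_kern B_def\<close>)
  let ?D = "det3 k"
  note E = det3_def
  have D0: "?D z1 z2 z3 w1 w2 w3 = 0" if "z1 \<in> Z" "z2 \<in> Z" "z3 \<in> Z" "w1 \<in> P" "w2 \<in> P" "w3 \<in> P" for z1 z2 z3 w1 w2 w3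
  proof -
    have "\<exists>a b. \<forall>z'\<in>Z. k z' p = a * f1 z' + b * f2 z'" if p: "p \<in> P" for p
    proof -
      obtain a b where ab: "\<And>z'. z' \<in> Z \<Longrightarrow> 1 - hdot (G0 z') (G0 p) = (1 - hdot z' p) * (a * f1 z' + b * f2 z')"
        using sp p unfolding P_def by blast
      have "k z' p = a * f1 z' + b * f2 z'" if "z' \<in> Z" for z'
        using hdot_ne_1(1)[of z' p] that p Z(3) by (simp add: k_def kern_def ab[OF that] P_def subset_iff)
      then show ?thesis by blast
    qed
    then obtain a b where ab: "\<And>p z'. p \<in> P \<Longrightarrow> z' \<in> Z \<Longrightarrow> k z' p = a p * f1 z' + b p * f2 z'" by metis
    show ?thesis unfolding E ab[OF that(4) that(1)] ab[OF that(4) that(2)] ab[OF that(4) that(3)] ab[OF that(5) that(1)] ab[OF that(5) that(2)]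
      ab[OF that(5) that(3)] ab[OF that(6) that(1)] ab[OF that(6) that(2)] ab[OF that(6) that(3)] by (simp add: algebra_simps)
  qed
  have ZB: "z \<in> Z \<Longrightarrow> z \<in> B" for z using Z(3) by (auto simp: B_def)
  have w_exp: "?D z1 z2 z3 w1 w2 w3 = (k z2 w2 * k z3 w3 - k z2 w3 * k z3 w2) * k z1 w1 + (k z1 w3 * k z3 w2 - k z1 w2 * k z3 w3) * k z2 w1
      + (k z1 w2 * k z2 w3 - k z1 w3 * k z2 w2) * k z3 w1"
    "?D z1 z2 z3 w1 w2 w3 = (k z2 w2 * k z3 w3 - k z2 w3 * k z3 w2) * k z1 w1 + (k z2 w3 * k z3 w1 - k z2 w1 * k z3 w3) * k z1 w2
      + (k z2 w1 * k z3 w2 - k z2 w2 * k z3 w1) * k z1 w3"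
    and swap: "?D z1 z2 z3 w1 w2 w3 = - ?D z1 z2 z3 w2 w1 w3" "?D z1 z2 z3 w1 w2 w3 = - ?D z1 z2 z3 w3 w2 w1"
    "?D z1 z2 z3 w1 w2 w3 = - ?D z2 z1 z3 w1 w2 w3" "?D z1 z2 z3 w1 w2 w3 = - ?D z3 z2 z1 w1 w2 w3" for z1 z2 z3 w1 w2 w3
    unfolding E by (simp_all add: algebra_simps)
  have extD: "?D z1 z2 z3 w w2 w3 = 0" if "z1 \<in> B" "z2 \<in> B" "z3 \<in> B" "\<And>p. p \<in> P \<Longrightarrow> ?D z1 z2 z3 p w2 w3 = 0" "w \<in> B"
    for z1 z2 z3 w w2 w3
    unfolding w_exp(1) by (rule extw[OF that(1-3) _ that(5)]) (rule that(4)[unfolded w_exp(1)])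
  have extE: "?D z z2 z3 w1 w2 w3 = 0" if "w1 \<in> B" "w2 \<in> B" "w3 \<in> B" "\<And>z. z \<in> Z \<Longrightarrow> ?D z z2 z3 w1 w2 w3 = 0" "z \<in> B"
    for z z2 z3 w1 w2 w3
    unfolding w_exp(2) by (rule extz[OF that(1-3) _ that(5)]) (rule that(4)[unfolded w_exp(2)])
  have D1: "?D z1 z2 z3 w1 w2 w3 = 0" if "z1 \<in> Z" "z2 \<in> Z" "z3 \<in> Z" "w1 \<in> B" "w2 \<in> P" "w3 \<in> P" for z1 z2 z3 w1 w2 w3
    by (rule extD) (use that ZB D0 in auto)
  have D2: "?D z1 z2 z3 w1 w2 w3 = 0" if "z1 \<in> Z" "z2 \<in> Z" "z3 \<in> Z" "w1 \<in> B" "w2 \<in> B" "w3 \<in> P" for z1 z2 z3 w1 w2 w3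
  proof -
    have h: "?D z1 z2 z3 p w1 w3 = 0" if "p \<in> P" for p
      by (subst swap(1), subst D1) (use that \<open>z1 \<in> Z\<close> \<open>z2 \<in> Z\<close> \<open>z3 \<in> Z\<close> \<open>w1 \<in> B\<close> \<open>w3 \<in> P\<close> in simp_all)
    have "?D z1 z2 z3 w2 w1 w3 = 0" by (rule extD) (use that ZB h in auto)
    then show ?thesis by (subst swap(1)) simp
  qed
  have D3: "?D z1 z2 z3 w1 w2 w3 = 0" if "z1 \<in> Z" "z2 \<in> Z" "z3 \<in> Z" "w1 \<in> B" "w2 \<in> B" "w3 \<in> B" for z1 z2 z3 w1 w2 w3
  proof -
    have h: "?D z1 z2 z3 p w2 w1 = 0" if "p \<in> P" for p
      by (subst swap(2), subst D2) (use that \<open>z1 \<in> Z\<close> \<open>z2 \<in> Z\<close> \<open>z3 \<in> Z\<close> \<open>w1 \<in> B\<close> \<open>w2 \<in> B\<close> in simp_all)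
    have "?D z1 z2 z3 w3 w2 w1 = 0" by (rule extD) (use that ZB h in auto)
    then show ?thesis by (subst swap(2)) simp
  qed
  have D4: "?D z1 z2 z3 w1 w2 w3 = 0" if "z1 \<in> B" "z2 \<in> Z" "z3 \<in> Z" "w1 \<in> B" "w2 \<in> B" "w3 \<in> B" for z1 z2 z3 w1 w2 w3
    by (rule extE) (use that D3 in auto)
  have D5: "?D z1 z2 z3 w1 w2 w3 = 0" if "z1 \<in> B" "z2 \<in> B" "z3 \<in> Z" "w1 \<in> B" "w2 \<in> B" "w3 \<in> B" for z1 z2 z3 w1 w2 w3
  proof -
    have h: "?D z z1 z3 w1 w2 w3 = 0" if "z \<in> Z" for z
      by (subst swap(3), subst D4) (use that \<open>z1 \<in> B\<close> \<open>z3 \<in> Z\<close> \<open>w1 \<in> B\<close> \<open>w2 \<in> B\<close> \<open>w3 \<in> B\<close> in simp_all)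
    have "?D z2 z1 z3 w1 w2 w3 = 0" by (rule extE) (use that h in auto)
    then show ?thesis by (subst swap(3)) simp
  qed
  have h: "?D z z2 z1 w1 w2 w3 = 0" if "z \<in> Z" for z
    by (subst swap(4), subst D5) (use that zw in \<open>simp_all add: B_def\<close>)
  have "?D z3 z2 z1 w1 w2 w3 = 0" by (rule extE) (use zw h in \<open>auto simp: B_def\<close>)
  then show "det3 (kern G0) z1 z2 z3 w1 w2 w3 = 0" unfolding k_def[symmetric] by (subst swap(4)) simp
qed

end

section \<open>Automorphisms of the ball\<close>

lemma lin_bounded_linear: assumes "lin A" shows "bounded_linear A"
  by (rule bounded_linear_intro[where K = "\<Sum>i\<in>UNIV. norm (A (axis i 1))"])
    (use lin_bound[OF assms] in \<open>simp_all add: lin_add[OF assms] lin_scale[OF assms] flip: of_real_smult\<close>)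

lemma bounded_bilinear_smult: "bounded_bilinear (\<lambda>c (v::complex^'n). c *s v)"
  by (rule bounded_bilinear.intro) (auto simp: vec_eq_iff algebra_simps norm_smult intro!: exI[of _ 1])

lemma bounded_linear_hdot: "bounded_linear (\<lambda>h. hdot h b)"
  by (rule bounded_linear_intro[where K = "norm b"])
    (simp_all add: cmod_hdot_le flip: of_real_smult, simp add: scaleR_conv_of_real)

lemma holomorphic_quotient:
  fixes A :: "complex^'a \<Rightarrow> complex^'b"
  assumes A: "lin A" and b: "norm b \<le> 1"
  shows "holomorphic_map_on (\<lambda>z. (1 / (1 - hdot z b)) *s (c + A z)) (ball 0 1)"
  unfolding holomorphic_map_on_def
proof
  fix z :: "complex^'a" assume "z \<in> ball 0 1"
  then have ne: "1 - hdot z b \<noteq> 0" using hdot_ne_1(1)[of z b] b by simp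
  have D1: "((\<lambda>z. inverse (1 - hdot z b)) has_derivative (\<lambda>h. - (inverse (1 - hdot z b) * (0 - hdot h b) * inverse (1 - hdot z b)))) (at z within ball 0 1)"
    by (rule Deriv.has_derivative_inverse[where f = "\<lambda>z. 1 - hdot z b", OF ne]) (intro has_derivative_diff has_derivative_const bounded_linear_imp_has_derivative bounded_linear_hdot)
  have D2: "((\<lambda>z. c + A z) has_derivative (\<lambda>h. 0 + A h)) (at z within ball 0 1)"
    by (intro has_derivative_add has_derivative_const bounded_linear_imp_has_derivative lin_bounded_linear A)
  define L where "L h = inverse (1 - hdot z b) *s (0 + A h) + (- (inverse (1 - hdot z b) * (0 - hdot h b) * inverse (1 - hdot z b))) *s (c + A z)" for h
  have "((\<lambda>z. (1 / (1 - hdot z b)) *s (c + A z)) has_derivative L) (at z within ball 0 1)"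
    using bounded_bilinear.FDERIV[OF bounded_bilinear_smult D1 D2] by (simp add: L_def[abs_def] inverse_eq_divide)
  moreover have "lin L" by (rule linI) (simp_all add: L_def lin_add[OF A] lin_scale[OF A] vec_eq_iff algebra_simps)
  ultimately show "\<exists>L. lin L \<and> ((\<lambda>z. (1 / (1 - hdot z b)) *s (c + A z)) has_derivative L) (at z within ball 0 1)" by blast
qed

lemma holomorphic_lin: "lin A \<Longrightarrow> holomorphic_map_on A (ball 0 1)"
  using holomorphic_quotient[of A 0 0] by simp

lemma holomorphic_compose:
  assumes "holomorphic_map_on f S" "holomorphic_map_on g T" "\<And>z. z \<in> S \<Longrightarrow> f z \<in> T"
  shows "holomorphic_map_on (\<lambda>z. g (f z)) S"
  unfolding holomorphic_map_on_def
proof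
  fix z assume z: "z \<in> S"
  obtain L where L: "lin L" "(f has_derivative L) (at z within S)" using assms(1) z unfolding holomorphic_map_on_def by blast
  obtain M where M: "lin M" "(g has_derivative M) (at (f z) within T)" using assms(2,3) z unfolding holomorphic_map_on_def by blast
  have "(g has_derivative M) (at (f z) within f ` S)" by (rule has_derivative_subset[OF M(2)]) (use assms(3) in auto)
  then have "((\<lambda>z. g (f z)) has_derivative (\<lambda>h. M (L h))) (at z within S)" by (rule has_derivative_in_compose[OF L(2)])
  moreover have "lin (\<lambda>h. M (L h))" by (rule linI) (simp_all add: lin_add[OF L(1)] lin_add[OF M(1)] lin_scale[OF L(1)] lin_scale[OF M(1)])
  ultimately show "\<exists>L. lin L \<and> ((\<lambda>z. g (f z)) has_derivative L) (at z within S)" by blast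
qed

text \<open>The inverse is carried as a second function, so that compositions need no reasoning
  about \<open>inv_into\<close>; \<open>aut_automorphism\<close> translates once.\<close>

definition aut :: "(complex^'a \<Rightarrow> complex^'a) \<Rightarrow> (complex^'a \<Rightarrow> complex^'a) \<Rightarrow> bool" where
  "aut f g \<longleftrightarrow> (\<forall>z\<in>ball 0 1. f z \<in> ball 0 1 \<and> g z \<in> ball 0 1 \<and> g (f z) = z \<and> f (g z) = z)
     \<and> holomorphic_map_on f (ball 0 1) \<and> holomorphic_map_on g (ball 0 1)"

lemma aut_automorphism: assumes "aut f g" shows "ball_automorphism f"
proof -
  have h: "\<And>z. z \<in> ball 0 1 \<Longrightarrow> f z \<in> ball 0 1 \<and> g z \<in> ball 0 1 \<and> g (f z) = z \<and> f (g z) = z"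
    "holomorphic_map_on f (ball 0 1)" "holomorphic_map_on g (ball 0 1)" using assms unfolding aut_def by blast+
  have b: "bij_betw f (ball 0 1) (ball 0 1)" by (rule bij_betw_byWitness[where f' = g]) (use h(1) in auto)
  have i: "inv_into (ball 0 1) f z = g z" if "z \<in> ball 0 1" for z
    using h(1)[OF that] b by (metis bij_betw_inv_into_left)
  have "holomorphic_map_on (inv_into (ball 0 1) f) (ball 0 1)"
    unfolding holomorphic_map_on_def
  proof
    fix z assume z: "z \<in> ball (0::complex^'a) 1"
    then obtain L where L: "lin L" "(g has_derivative L) (at z within ball 0 1)" using h(3) unfolding holomorphic_map_on_def by blast
    have "(inv_into (ball 0 1) f has_derivative L) (at z within ball 0 1)" by (rule has_derivative_transform[OF z i L(2)])
    then show "\<exists>L. lin L \<and> (inv_into (ball 0 1) f has_derivative L) (at z within ball 0 1)" using L(1) by blast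
  qed
  then show ?thesis using b h(2) unfolding ball_automorphism_def by blast
qed

lemma aut_comp: assumes "aut f g" "aut f' g'" shows "aut (\<lambda>z. f' (f z)) (\<lambda>z. g (g' z))"
proof -
  have "holomorphic_map_on (\<lambda>z. f' (f z)) (ball 0 1)"
    by (rule holomorphic_compose[where f = f and g = f' and T = "ball 0 1"]) (use assms in \<open>unfold aut_def, blast+\<close>)
  moreover have "holomorphic_map_on (\<lambda>z. g (g' z)) (ball 0 1)"
    by (rule holomorphic_compose[where f = g' and g = g and T = "ball 0 1"]) (use assms in \<open>unfold aut_def, blast+\<close>)
  ultimately show ?thesis using assms unfolding aut_def by auto
qed

section \<open>Unitary maps and Gram matrices\<close>

definition unitary :: "(complex^'n \<Rightarrow> complex^'n) \<Rightarrow> bool" where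
  "unitary U \<longleftrightarrow> lin U \<and> (\<forall>x y. hdot (U x) (U y) = hdot x y)"

lemma unitaryD: "unitary U \<Longrightarrow> lin U" "unitary U \<Longrightarrow> hdot (U x) (U y) = hdot x y"
  by (auto simp: unitary_def)

lemma unitary_comp: "unitary U \<Longrightarrow> unitary V \<Longrightarrow> unitary (\<lambda>x. V (U x))"
  unfolding unitary_def by (auto intro!: linI simp: lin_add lin_scale)

lemma unitary_surj: assumes "unitary U" shows "\<exists>x. U x = y"
  by (rule lin_inj_surj[OF unitaryD(1)[OF assms]]) (metis assms hdot_eq_0_iff unitaryD(2), simp)

lemma unitary_norm: "unitary U \<Longrightarrow> norm (U x) = norm x"
  using hdot_self_Re[of "U x"] hdot_self_Re[of x] by (simp add: unitaryD(2))

lemma unitary_aut: assumes U: "unitary U" shows "\<exists>V. aut U V"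
proof -
  obtain V where V: "\<And>y. U (V y) = y" using unitary_surj[OF U] by metis
  note l = unitaryD(1)[OF U]
  have VU: "V (U x) = x" for x
  proof -
    have "hdot (V (U x) - x) (V (U x) - x) = hdot (U (V (U x) - x)) (U (V (U x) - x))" by (simp only: unitaryD(2)[OF U])
    also have "\<dots> = 0" by (simp add: lin_diff[OF l] V)
    finally show ?thesis by (simp only: hdot_eq_0_iff right_minus_eq)
  qed
  have lV: "lin V"
  proof (rule linI)
    show "V (x + y) = V x + V y" for x y by (metis VU V lin_add[OF l])
    show "V (c *s x) = c *s V x" for c x by (metis VU V lin_scale[OF l])
  qed
  have "norm (V x) = norm x" for x using unitary_norm[OF U, of "V x"] by (simp add: V)
  then have "aut U V" unfolding aut_def using holomorphic_lin[OF l] holomorphic_lin[OF lV] by (simp add: V VU unitary_norm[OF U])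
  then show ?thesis by blast
qed

text \<open>A complex reflection along \<open>e = v - w\<close>. The factor
  \<open>c = hdot v e\<close> sends \<open>v\<close> to \<open>w\<close>, and
  \<open>hdot e e = c + cnj c\<close>, a consequence of the equal norms, makes the map
  unitary.\<close>

lemma unitary_reflection:
  assumes "norm v = norm w"
  shows "\<exists>R. unitary R \<and> R v = w \<and> (\<forall>x. hdot x (v - w) = 0 \<longrightarrow> R x = x)"
proof (cases "v = w")
  case False
  define e c where "e = v - w" and "c = hdot v e"
  have vv: "hdot w w = hdot v v" using assms by (simp add: hdot_self)
  have ee: "hdot e e = c + cnj c" by (simp add: e_def c_def cnj_hdot vv)
  have "hdot e e \<noteq> 0" using False by (simp only: hdot_eq_0_iff) (simp add: e_def)
  then have c0: "c \<noteq> 0" unfolding ee by auto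
  define R where "R x = x - (hdot x e / c) *s e" for x
  have "unitary R" unfolding unitary_def
  proof (intro conjI allI)
    show "lin R" by (rule linI) (simp_all add: R_def vec_eq_iff algebra_simps add_divide_distrib)
    fix x y
    have "hdot (R x) (R y) = hdot x y - hdot x e * hdot e y / cnj c - hdot x e / c * hdot e y + hdot x e / c * (hdot e y / cnj c) * hdot e e"
      by (simp add: R_def cnj_hdot algebra_simps)
    also have "\<dots> = hdot x y" unfolding ee using c0 by (simp add: field_simps)
    finally show "hdot (R x) (R y) = hdot x y" .
  qed
  moreover have "R v = w" using c0 by (simp add: R_def c_def[symmetric]) (simp add: e_def)
  moreover have "R x = x" if "hdot x (v - w) = 0" for x using that by (simp add: R_def e_def)
  ultimately show ?thesis by blast
next
  case True
  then show ?thesis by (intro exI[of _ "\<lambda>x. x"]) (auto simp: unitary_def intro: linI)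
qed

text \<open>Each new vector is corrected by a reflection. Equality of the Gram matrices makes the
  vectors already matched orthogonal to the defect, so the reflection fixes them.\<close>

lemma gram_finite:
  assumes "finite X" "\<And>x y. x \<in> X \<Longrightarrow> y \<in> X \<Longrightarrow> hdot (f x) (f y) = hdot (g x) (g y)"
  shows "\<exists>U. unitary U \<and> (\<forall>x\<in>X. U (g x) = f x)"
  using assms
proof (induction X)
  case empty
  show ?case by (intro exI[of _ "\<lambda>x. x"]) (auto simp: unitary_def intro: linI)
next
  case (insert a X)
  obtain U where U: "unitary U" "\<And>x. x \<in> X \<Longrightarrow> U (g x) = f x" using insert.IH insert.prems by blast
  have "(norm (U (g a)))\<^sup>2 = (norm (f a))\<^sup>2"
    using insert.prems[of a a] by (simp add: unitary_norm[OF U(1)] flip: hdot_self_Re)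
  then have "norm (U (g a)) = norm (f a)" by simp
  then obtain R where R: "unitary R" "R (U (g a)) = f a" "\<And>x. hdot x (U (g a) - f a) = 0 \<Longrightarrow> R x = x"
    using unitary_reflection by blast
  have "R (U (g x)) = f x" if x: "x \<in> X" for x
  proof -
    have "hdot (f x) (U (g a)) = hdot (g x) (g a)" using unitaryD(2)[OF U(1), of "g x" "g a"] U(2)[OF x] by simp
    then have "hdot (f x) (U (g a) - f a) = 0" using insert.prems[of x a] x by simp
    then show ?thesis using R(3) U(2)[OF x] by simp
  qed
  then show ?case using unitary_comp[OF U(1) R(1)] R(2) by (intro exI[of _ "\<lambda>x. R (U x)"]) auto
qed

text \<open>It suffices to match a basis of the span of \<open>g\<close>. For any other
  \<open>x\<close> the defect of the linear relation is orthogonal to every \<open>f y\<close>,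
  hence to itself.\<close>

lemma gram_unitary:
  fixes f g :: "'x \<Rightarrow> complex^'n"
  assumes h: "\<And>x y. x \<in> X \<Longrightarrow> y \<in> X \<Longrightarrow> hdot (f x) (f y) = hdot (g x) (g y)"
  shows "\<exists>U. unitary U \<and> (\<forall>x\<in>X. U (g x) = f x)"
proof -
  obtain B where B: "B \<subseteq> g ` X" "vec.independent B" "g ` X \<subseteq> vec.span B" by (rule vec.maximal_independent_subset)
  have fB: "finite B" using B(2) by (rule vec.finiteI_independent)
  obtain s where s: "\<And>b. b \<in> B \<Longrightarrow> s b \<in> X \<and> g (s b) = b" using B(1) by (metis image_iff subset_eq)
  obtain U where U: "unitary U" "\<And>b. b \<in> B \<Longrightarrow> U (g (s b)) = f (s b)"
    using gram_finite[of "s ` B" f g] fB s h by (metis (no_types, lifting) finite_imageI image_iff)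
  have "U (g x) = f x" if x: "x \<in> X" for x
  proof -
    obtain c where c: "g x = (\<Sum>b\<in>B. c b *s b)" using B(3) x vec.span_finite[OF fB] by fastforce
    have gb: "hdot (f (s b)) (f y) = hdot b (g y)" "hdot (f y) (f (s b)) = hdot (g y) b" if "b \<in> B" "y \<in> X" for b y
      using h[of "s b" y] h[of y "s b"] s[OF that(1)] that(2) by simp_all
    define e where "e = f x - (\<Sum>b\<in>B. c b *s f (s b))"
    have "hdot e (f y) = hdot (g x - (\<Sum>b\<in>B. c b *s b)) (g y)" if "y \<in> X" for y
      using h[OF x that] gb(1)[OF _ that] by (simp add: e_def hdot_sum cong: sum.cong)
    then have e: "hdot e (f y) = 0" if "y \<in> X" for y using that c by simp
    have "hdot e e = hdot e (f x) - (\<Sum>b\<in>B. cnj (c b) * hdot e (f (s b)))" by (simp add: e_def hdot_sum)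
    also have "\<dots> = 0" using e x s by simp
    finally have "f x = (\<Sum>b\<in>B. c b *s f (s b))" by (simp add: e_def del: hdot_diff)
    then show ?thesis using c U(2) s by (simp add: lin_sum[OF unitaryD(1)[OF U(1)]] lin_scale[OF unitaryD(1)[OF U(1)]])
  qed
  then show ?thesis using U(1) by blast
qed

text \<open>The involution of the ball exchanging \<open>0\<close> and \<open>a\<close>.\<close>

definition mobius :: "complex^'n \<Rightarrow> complex^'n \<Rightarrow> complex^'n" where
  "mobius a z = (1 / (1 - hdot z a)) *s (a + (- ((hdot z a / hdot a a) *s a) - of_real (sqrt (1 - (norm a)\<^sup>2)) *s prj a z))"

lemma mobius_parts:
  fixes a z :: "complex^'n"
  obtains l q where "z = l *s a + q" "hdot q a = 0" "hdot z a = l * hdot a a" "prj a z = q"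
    "mobius a z = (1 / (1 - l * hdot a a)) *s ((1 - l) *s a - of_real (sqrt (1 - (norm a)\<^sup>2)) *s q)"
proof -
  have "hdot z a = hdot z a / hdot a a * hdot a a" by (cases "a = 0") simp_all
  then have "mobius a z = (1 / (1 - hdot z a / hdot a a * hdot a a)) *s ((1 - hdot z a / hdot a a) *s a - of_real (sqrt (1 - (norm a)\<^sup>2)) *s prj a z)"
    unfolding mobius_def by (simp add: vec_eq_iff algebra_simps)
  then show ?thesis using that[OF prj_decomp] \<open>hdot z a = _\<close> by simp
qed

lemma sqrt_sq: fixes a :: "complex^'n" assumes "norm a < 1"
  shows "complex_of_real (sqrt (1 - (norm a)\<^sup>2)) * of_real (sqrt (1 - (norm a)\<^sup>2)) = 1 - hdot a a"
proof -
  have "sqrt (1 - (norm a)\<^sup>2) * sqrt (1 - (norm a)\<^sup>2) = 1 - (norm a)\<^sup>2" using assms by (simp add: power_le_one)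
  then show ?thesis unfolding of_real_mult[symmetric] by (simp add: hdot_self)
qed

text \<open>The right side has the form \<open>1 - hdot z w\<close> times
  \<open>h(z) cnj h(w)\<close>: this is the ambiguity up to which kernels are compared
  below.\<close>

lemma mobius_kernel:
  assumes a: "norm a < 1" and z: "norm z < 1" "norm w < 1"
  shows "1 - hdot (mobius a z) (mobius a w) = (1 - hdot a a) * (1 - hdot z w) / ((1 - hdot z a) * (1 - hdot a w))"
proof -
  define s where "s = complex_of_real (sqrt (1 - (norm a)\<^sup>2))"
  have s: "s * s = 1 - hdot a a" "cnj s = s" using sqrt_sq[OF a] by (simp_all add: s_def)
  obtain l q where 1: "z = l *s a + q" "hdot q a = 0" "hdot z a = l * hdot a a" "mobius a z = (1 / (1 - l * hdot a a)) *s ((1 - l) *s a - s *s q)"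
    using mobius_parts unfolding s_def by metis
  obtain k r where 2: "w = k *s a + r" "hdot r a = 0" "hdot w a = k * hdot a a" "mobius a w = (1 / (1 - k * hdot a a)) *s ((1 - k) *s a - s *s r)"
    using mobius_parts unfolding s_def by metis
  have ra: "hdot a r = 0" using 2(2) hdot_0_sym by blast
  define A Q where "A = hdot a a" and "Q = hdot q r"
  have cA: "cnj A = A" by (simp add: A_def cnj_hdot)
  have aw: "hdot a w = cnj k * A" by (simp add: 2(1) ra A_def)
  have ne: "1 - l * A \<noteq> 0" "1 - cnj k * A \<noteq> 0"
    using hdot_ne_1[of z a] hdot_ne_1[of w a] a z 1(3) aw by (auto simp: A_def)
  have zw: "hdot z w = l * cnj k * A + Q" unfolding 1(1) 2(1) by (simp add: 1(2) ra A_def Q_def)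
  have "hdot (mobius a z) (mobius a w) = ((1 - l) * cnj (1 - k) * A + (s * s) * Q) / ((1 - l * A) * (1 - cnj k * A))"
  proof -
    have "hdot ((1 - l) *s a - s *s q) ((1 - k) *s a - s *s r) = (1 - l) * cnj (1 - k) * A + (s * s) * Q"
      by (simp add: 1(2) ra s(2) A_def[symmetric] Q_def[symmetric] algebra_simps)
    then show ?thesis unfolding 1(4) 2(4) hdot_scale by (simp add: cA A_def[symmetric])
  qed
  then have "1 - hdot (mobius a z) (mobius a w) = ((1 - l * A) * (1 - cnj k * A) - ((1 - l) * cnj (1 - k) * A + (s * s) * Q)) / ((1 - l * A) * (1 - cnj k * A))"
    using ne by (simp add: diff_divide_distrib)
  also have "(1 - l * A) * (1 - cnj k * A) - ((1 - l) * cnj (1 - k) * A + (s * s) * Q) = (1 - A) * (1 - hdot z w)"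
    unfolding zw s(1) A_def[symmetric] by (simp add: algebra_simps)
  finally show ?thesis unfolding 1(3) aw A_def .
qed

lemma mobius_ball: assumes a: "norm a < 1" and z: "norm z < 1" shows "norm (mobius a z) < 1"
proof -
  have "1 - hdot (mobius a z) (mobius a z) = (1 - hdot a a) * (1 - hdot z z) / ((1 - hdot z a) * cnj (1 - hdot z a))"
    using mobius_kernel[OF a z z] by (simp add: cnj_hdot)
  also have "\<dots> = of_real ((1 - (norm a)\<^sup>2) * (1 - (norm z)\<^sup>2) / (cmod (1 - hdot z a))\<^sup>2)"
    unfolding hdot_self complex_norm_square[symmetric] by simp
  finally have "Re (1 - hdot (mobius a z) (mobius a z)) = (1 - (norm a)\<^sup>2) * (1 - (norm z)\<^sup>2) / (cmod (1 - hdot z a))\<^sup>2" by simp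
  moreover have "(norm a)\<^sup>2 < 1" "(norm z)\<^sup>2 < 1" "hdot z a \<noteq> 1" using a z hdot_ne_1(1)[of z a] by (simp_all add: power_less_one_iff)
  ultimately have "0 < Re (1 - hdot (mobius a z) (mobius a z))" by simp
  then have "(norm (mobius a z))\<^sup>2 < 1" by (simp add: hdot_self_Re)
  then show ?thesis by (simp add: power_less_one_iff)
qed

lemma mobius_involution: assumes a: "norm a < 1" and z: "norm z < 1" shows "mobius a (mobius a z) = z"
proof -
  define s where "s = complex_of_real (sqrt (1 - (norm a)\<^sup>2))"
  define A where "A = hdot a a"
  have s: "s * s = 1 - A" using sqrt_sq[OF a] by (simp add: s_def A_def)
  obtain l q where 1: "z = l *s a + q" "hdot q a = 0" "hdot z a = l * A" "mobius a z = (1 / (1 - l * A)) *s ((1 - l) *s a - s *s q)"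
    using mobius_parts unfolding s_def A_def by metis
  define d y where "d = 1 - l * A" and "y = mobius a z"
  have d: "d \<noteq> 0" using hdot_ne_1(1)[of z a] a z 1(3) by (auto simp: d_def)
  have A1: "1 - A \<noteq> 0" using hdot_ne_1(1)[of a a] a by (simp add: A_def)
  have ya: "hdot y a = (1 - l) * A / d" unfolding y_def 1(4) by (simp add: 1(2) A_def d_def left_diff_distrib diff_divide_distrib)
  have py: "prj a y = (- s / d) *s q"
  proof -
    have "y = ((1 - l) / d) *s a + (- s / d) *s q" unfolding y_def 1(4) d_def by (simp add: vec_eq_iff diff_divide_distrib left_diff_distrib)
    moreover have "prj a a = 0" by (cases "a = 0") (simp_all add: prj_def)
    ultimately show ?thesis using prj_id[OF 1(2)] by (simp only: prj_add prj_scale) simp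
  qed
  have pa: "(hdot y a / A) *s a = ((1 - l) / d) *s a" by (cases "a = 0") (simp_all add: ya A_def)
  have "1 - hdot y a = (1 - A) / d" unfolding ya using d by (simp add: field_simps d_def)
  then have "mobius a y = (d / (1 - A)) *s (a + (- (((1 - l) / d) *s a) - s *s ((- s / d) *s q)))"
    unfolding mobius_def A_def[symmetric] pa s_def[symmetric] py by simp
  also have "\<dots> = (d / (1 - A)) *s ((1 - (1 - l) / d) *s a) + (d / (1 - A)) *s (((s * s) / d) *s q)"
    by (simp add: vec_eq_iff algebra_simps)
  also have "(d / (1 - A)) *s ((1 - (1 - l) / d) *s a) = l *s a"
  proof -
    have "(1 - (1 - l) / d) = l * (1 - A) / d" using d by (simp add: field_simps d_def)
    then have "d / (1 - A) * (1 - (1 - l) / d) = l" using d A1 by simp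
    then show ?thesis by (simp only: vector_smult_assoc)
  qed
  also have "(d / (1 - A)) *s (((s * s) / d) *s q) = q" unfolding s using d A1 by simp
  finally show ?thesis using 1(1) by (simp add: y_def)
qed

lemma mobius_aut: assumes "norm a < 1" shows "aut (mobius a) (mobius a)"
proof -
  have "lin (\<lambda>z. - ((hdot z a / hdot a a) *s a) - of_real (sqrt (1 - (norm a)\<^sup>2)) *s prj a z)"
    by (rule linI) (simp_all add: prj_add prj_scale vec_eq_iff algebra_simps add_divide_distrib)
  then have "holomorphic_map_on (mobius a) (ball 0 1)"
    unfolding mobius_def[abs_def] by (rule holomorphic_quotient) (use assms in simp)
  then show ?thesis unfolding aut_def using mobius_ball[OF assms] mobius_involution[OF assms] by simp
qed

lemma mobius_self: "norm a < 1 \<Longrightarrow> mobius a a = 0"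
  unfolding mobius_def by (cases "a = 0") (simp_all add: prj_def)

text \<open>Two maps whose Hermitian kernels differ by a factor \<open>h(z) cnj h(w)\<close> differ by an automorphism: after moving
  the values at \<open>0\<close> to \<open>0\<close>, the factor is constant and the Gram matrices agree.\<close>

lemma equivalent_if_kernels_proportional:
  fixes F W :: "complex^'a \<Rightarrow> complex^'b"
  assumes F: "\<And>z. z \<in> ball 0 1 \<Longrightarrow> norm (F z) < 1" and W: "\<And>z. z \<in> ball 0 1 \<Longrightarrow> norm (W z) < 1"
    and h: "\<And>z w. z \<in> ball 0 1 \<Longrightarrow> w \<in> ball 0 1 \<Longrightarrow> 1 - hdot (F z) (F w) = (1 - hdot (W z) (W w)) * (h z * cnj (h w))"
  shows "\<exists>\<tau>. ball_automorphism \<tau> \<and> (\<forall>z\<in>ball 0 1. F z = \<tau> (W z))"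
proof -
  define B where "B = ball (0::complex^'a) 1"
  have 0: "0 \<in> B" by (simp add: B_def)
  define a b where "a = F 0" and "b = W 0"
  have ab: "norm a < 1" "norm b < 1" using F W by (simp_all add: a_def b_def)
  define F1 W1 where "F1 z = mobius a (F z)" and "W1 z = mobius b (W z)" for z
  have F1: "norm (F1 z) < 1" "F z = mobius a (F1 z)" if "z \<in> B" for z
    using mobius_ball[OF ab(1) F] mobius_involution[OF ab(1) F] that by (auto simp: F1_def B_def)
  define A u where "A = (1 - hdot a a) / (1 - hdot b b)" and "u z = h z * (1 - hdot (W z) b) / (1 - hdot (F z) a)" for z
  have nb: "1 - hdot b b \<noteq> 0" "1 - hdot a a \<noteq> 0" using hdot_ne_1(1)[OF ab(2)] hdot_ne_1(1)[OF ab(1)] ab by (metis less_imp_le right_minus_eq)+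
  have k: "1 - hdot (F1 z) (F1 w) = A * (1 - hdot (W1 z) (W1 w)) * (u z * cnj (u w))" if "z \<in> B" "w \<in> B" for z w
  proof -
    have n: "1 - hdot (F z) a \<noteq> 0" "1 - hdot a (F w) \<noteq> 0" "1 - hdot (W z) b \<noteq> 0" "1 - hdot b (W w) \<noteq> 0"
      using hdot_ne_1[OF F, of z a] hdot_ne_1[OF F, of w a] hdot_ne_1[OF W, of z b] hdot_ne_1[OF W, of w b] ab that by (auto simp: B_def)
    have 1: "1 - hdot (F1 z) (F1 w) = (1 - hdot a a) * ((1 - hdot (W z) (W w)) * (h z * cnj (h w))) / ((1 - hdot (F z) a) * (1 - hdot a (F w)))"
      using mobius_kernel[OF ab(1) F F, of z w] h[of z w] that by (simp add: F1_def B_def)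
    have 2: "1 - hdot (W1 z) (W1 w) = (1 - hdot b b) * (1 - hdot (W z) (W w)) / ((1 - hdot (W z) b) * (1 - hdot b (W w)))"
      using mobius_kernel[OF ab(2) W W, of z w] that by (simp add: W1_def B_def)
    have 3: "cnj (u w) = cnj (h w) * (1 - hdot b (W w)) / (1 - hdot a (F w))" by (simp add: u_def cnj_hdot)
    have "X * (K * (p * q)) / (r * t) = X / Y * (Y * K / (m * n)) * (p * m / r * (q * n / t))" if "Y \<noteq> 0" "m \<noteq> 0" "n \<noteq> 0"
      for X Y K p q r t m n :: complex using that by simp
    then show ?thesis unfolding 1 2 3 A_def u_def[of z] using n nb by blast
  qed
  have z0: "F1 0 = 0" "W1 0 = 0" using mobius_self ab by (simp_all add: F1_def W1_def a_def b_def)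
  \<comment> \<open>With one argument 0 both Hermitian products vanish, so the identity
    \<open>k\<close> shows that \<open>u\<close> is constant.\<close>
  have c: "A * (u z * cnj (u 0)) = 1" "A * (u 0 * cnj (u z)) = 1" if "z \<in> B" for z
    using k[OF that 0] k[OF 0 that] by (simp_all add: z0)
  have "hdot (F1 z) (F1 w) = hdot (W1 z) (W1 w)" if "z \<in> B" "w \<in> B" for z w
  proof -
    have "A * (u z * cnj (u w)) * (A * (u 0 * cnj (u 0))) = (A * (u z * cnj (u 0))) * (A * (u 0 * cnj (u w)))" by (simp add: mult_ac)
    then have "A * (u z * cnj (u w)) = 1" using c[OF that(1)] c[OF that(2)] c[OF 0] by simp
    moreover have "1 - hdot (F1 z) (F1 w) = (A * (u z * cnj (u w))) * (1 - hdot (W1 z) (W1 w))" using k[OF that] by (simp add: mult_ac)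
    ultimately show ?thesis by simp
  qed
  then obtain U where U: "unitary U" "\<And>z. z \<in> B \<Longrightarrow> U (W1 z) = F1 z" using gram_unitary[of B F1 W1] by blast
  obtain V where V: "aut U V" using unitary_aut[OF U(1)] by blast
  have "aut (\<lambda>z. mobius a (U (mobius b z))) (\<lambda>z. mobius b (V (mobius a z)))"
    using aut_comp[OF aut_comp[OF mobius_aut[OF ab(2)] V] mobius_aut[OF ab(1)]] .
  moreover have "F z = mobius a (U (mobius b (W z)))" if "z \<in> B" for z
    using F1(2)[OF that] U(2)[OF that] by (simp add: W1_def)
  ultimately show ?thesis using aut_automorphism unfolding B_def by blast
qed

section \<open>Kernels of rank at most two\<close>

lemma sum_UNIV_option: "(\<Sum>j\<in>(UNIV::'b::finite option set). f j) = f None + (\<Sum>k\<in>UNIV. f (Some k))"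
  by (simp add: UNIV_option_conv sum.reindex)

text \<open>The ambiguity absorbed by \<open>equivalent_if_kernels_proportional\<close>.\<close>

definition krel :: "(complex^'a \<Rightarrow> complex^'a \<Rightarrow> complex) \<Rightarrow> (complex^'a \<Rightarrow> complex^'a \<Rightarrow> complex) \<Rightarrow> bool" where
  "krel k k' \<longleftrightarrow> (\<exists>h. \<forall>z\<in>ball 0 1. \<forall>w\<in>ball 0 1. k z w = k' z w * (h z * cnj (h w)))"

lemma krelI: "(\<And>z w. z \<in> ball 0 1 \<Longrightarrow> w \<in> ball 0 1 \<Longrightarrow> k z w = k' z w * (h z * cnj (h w))) \<Longrightarrow> krel k k'"
  unfolding krel_def by blast

lemma krel_trans: assumes "krel k k'" "krel k' k''" shows "krel k k''"
proof -
  obtain h h' where "\<And>z w. z \<in> ball 0 1 \<Longrightarrow> w \<in> ball 0 1 \<Longrightarrow> k z w = k' z w * (h z * cnj (h w))"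
    "\<And>z w. z \<in> ball 0 1 \<Longrightarrow> w \<in> ball 0 1 \<Longrightarrow> k' z w = k'' z w * (h' z * cnj (h' w))" using assms unfolding krel_def by metis
  then show ?thesis by (intro krelI[of _ _ "\<lambda>z. h z * h' z"]) (simp add: mult_ac)
qed

lemma punctured_constant:
  fixes G :: "complex \<Rightarrow> complex"
  assumes "continuous_on (ball 0 1) G" "p \<in> ball 0 1" "\<And>t. t \<in> ball 0 1 \<Longrightarrow> t \<noteq> p \<Longrightarrow> G t = c"
  shows "G p = c"
proof -
  have "(G \<longlongrightarrow> G p) (at p)" using assms(1,2) by (simp add: continuous_on_eq_continuous_at isCont_def)
  moreover have "eventually (\<lambda>t. t \<in> ball 0 1) (at p)" using assms(2) by (intro eventually_at_in_open') auto
  then have "eventually (\<lambda>t. G t = c) (at p)" using assms(3)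
    by (smt (verit) eventually_at eventually_mono)
  then have "(G \<longlongrightarrow> c) (at p)" by (rule tendsto_eventually)
  ultimately show ?thesis by (rule tendsto_unique[OF trivial_limit_at])
qed

text \<open>On a line the Gram identity for \<open>(t g, F)\<close> and \<open>(t, g)\<close> yields \<open>(t - B) g = A t\<close> with \<open>|A|\<^sup>2 + |B|\<^sup>2 \<le> 1\<close>,
  which a continuous \<open>g\<close> with \<open>g(0) = 0\<close> satisfies only if \<open>g = 0\<close>.\<close>

lemma no_negative_square:
  fixes F :: "complex^'a \<Rightarrow> complex^'b"
  assumes k: "\<And>z w. z \<in> ball 0 1 \<Longrightarrow> w \<in> ball 0 1 \<Longrightarrow> 1 - hdot (F z) (F w) = (1 - hdot z w) * (1 - g z * cnj (g w))"
    and g: "continuous_on (ball 0 1) g" "g 0 = 0" and z0: "z0 \<in> ball 0 1"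
  shows "g z0 = 0"
proof (rule ccontr)
  assume ne: "g z0 \<noteq> 0"
  then have "z0 \<noteq> 0" using g(2) by auto
  define \<zeta> where "\<zeta> = (1 / of_real (norm z0)) *s z0"
  have \<zeta>: "norm \<zeta> = 1" "z0 = of_real (norm z0) *s \<zeta>" using \<open>z0 \<noteq> 0\<close> by (simp_all add: \<zeta>_def norm_smult norm_divide)
  define G where "G t = g (t *s \<zeta>)" for t
  have tb: "t *s \<zeta> \<in> ball 0 1" if "t \<in> ball 0 1" for t using that \<zeta> by (simp add: norm_smult)
  have cG: "continuous_on (ball 0 1) G" unfolding G_def
    by (rule continuous_on_compose2[OF g(1)]) (use tb in \<open>auto intro!: continuous_intros\<close>)
  \<comment> \<open>An index of the target at which \<open>G\<close> is stored; together with
    \<open>None\<close> it places the pair \<open>(t, G)\<close> in the same space as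
    \<open>(t G, F)\<close>.\<close>
  obtain k0 :: 'b where True by blast
  define X where "X t = (\<chi> i. case i of None \<Rightarrow> t * G t | Some k \<Rightarrow> F (t *s \<zeta>) $ k)" for t
  define Y where "Y t = (\<chi> i. case i of None \<Rightarrow> t | Some k \<Rightarrow> if k = k0 then G t else 0)" for t
  have ho: "hdot x y = x $ None * cnj (y $ None) + (\<Sum>k\<in>UNIV. x $ Some k * cnj (y $ Some k))" for x y :: "complex^'b option"
    by (simp add: hdot_def sum_UNIV_option)
  have hY: "hdot (Y t) y = t * cnj (y $ None) + G t * cnj (y $ Some k0)" for t y
    by (simp add: ho Y_def if_distrib[of "\<lambda>x. x * _"] cong: if_cong)
  have "hdot (X t) (X s) = hdot (Y t) (Y s)" if "t \<in> ball 0 1" "s \<in> ball 0 1" for t s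
  proof -
    have "hdot (X t) (X s) = t * G t * cnj (s * G s) + hdot (F (t *s \<zeta>)) (F (s *s \<zeta>))" by (simp add: ho X_def hdot_def)
    moreover have "hdot (F (t *s \<zeta>)) (F (s *s \<zeta>)) = 1 - (1 - t * cnj s) * (1 - G t * cnj (G s))"
      using k[OF tb[OF that(1)] tb[OF that(2)]] hdot_unit[OF \<zeta>(1)] by (simp add: G_def algebra_simps)
    moreover have "hdot (Y t) (Y s) = t * cnj s + G t * cnj (G s)" unfolding hY by (simp add: Y_def)
    ultimately show ?thesis by (simp add: algebra_simps)
  qed
  then obtain U where U: "unitary U" "\<And>t. t \<in> ball 0 1 \<Longrightarrow> U (Y t) = X t" using gram_unitary[of "ball 0 1" X Y] by blast
  obtain v where v: "U v = axis None 1" using unitary_surj[OF U(1)] by blast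
  define A B where "A = cnj (v $ None)" and "B = cnj (v $ Some k0)"
  have eq: "(t - B) * G t = t * A" if "t \<in> ball 0 1" for t
  proof -
    have "t * G t = hdot (U (Y t)) (U v)" unfolding v U(2)[OF that] by (simp add: X_def)
    also have "\<dots> = t * A + G t * B" unfolding unitaryD(2)[OF U(1)] hY A_def B_def ..
    finally show ?thesis by (simp add: algebra_simps)
  qed
  have nv: "(cmod A)\<^sup>2 + (cmod B)\<^sup>2 \<le> 1"
  proof -
    have "norm v = 1" using unitary_norm[OF U(1), of v] by (simp add: v norm_axis_1)
    then have "(\<Sum>i\<in>UNIV. (cmod (v $ i))\<^sup>2) = 1"
      by (simp add: norm_vec_def L2_set_def)
    moreover have "(\<Sum>i\<in>{None, Some k0}. (cmod (v $ i))\<^sup>2) \<le> (\<Sum>i\<in>UNIV. (cmod (v $ i))\<^sup>2)" by (rule sum_mono2) auto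
    ultimately show ?thesis by (simp add: A_def B_def)
  qed
  \<comment> \<open>Evaluation at \<open>t = B\<close> gives this when \<open>B\<close> is a nonzero
    point of the disc, and the bound \<open>nv\<close> gives it when \<open>cmod B\<close> is at
    least 1. For \<open>B = 0\<close> the factor \<open>t\<close> cancels off the origin, and
    continuity with \<open>G 0 = 0\<close> decides.\<close>
  have "A = 0"
  proof (cases "cmod B < 1")
    case True
    show ?thesis
    proof (cases "B = 0")
      case True
      have "G 0 = A" by (rule punctured_constant[OF cG]) (use eq True in auto)
      then show ?thesis using g(2) by (simp add: G_def)
    qed (use eq[of B] True in simp)
  next
    case False
    then have "1 \<le> (cmod B)\<^sup>2" by simp
    then show ?thesis using nv by (smt (verit) norm_eq_zero zero_le_power2 power2_eq_iff_nonneg zero_eq_power2)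
  qed
  have Gz: "G (of_real (norm z0)) \<noteq> 0" using ne \<zeta>(2) by (simp add: G_def)
  have zb: "complex_of_real (norm z0) \<in> ball 0 1" using z0 by simp
  have "B = of_real (norm z0)" using eq[OF zb] Gz \<open>A = 0\<close> by simp
  then have "G (of_real (norm z0)) = 0" by (intro punctured_constant[OF cG zb]) (use eq \<open>A = 0\<close> in auto)
  then show False using Gz by simp
qed

text \<open>By \<open>hdot_whitney\<close>, the kernel of the Whitney map composed with
  \<open>mobius a\<close>, with a vector \<open>b\<close> in place of the coordinate axis
  \<open>None\<close>.\<close>

definition whitney_kernel where
  "whitney_kernel a b z w = (1 - hdot (mobius a z) (mobius a w)) * (1 + hdot (mobius a z) b * hdot b (mobius a w))"

text \<open>A kernel \<open>1 + g(z) cnj g(w)\<close>: the Gram identity for \<open>(F, g)\<close> and \<open>(z, z g)\<close> gives \<open>g = A2 / A1\<close> with affine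
  \<open>A1 = 1 - \<langle>z, \<gamma>\<rangle>\<close>, \<open>A2 = \<langle>z, \<alpha>\<rangle>\<close>, whose Lorentz Gram matrix has trace zero; a rotation in the plane of
  \<open>A1, A2\<close> diagonalises it.\<close>

lemma positive_square:
  fixes F :: "complex^'a \<Rightarrow> complex^'b"
  assumes dim: "CARD('b) + 1 = 2 * CARD('a)"
    and k: "\<And>z w. z \<in> ball 0 1 \<Longrightarrow> w \<in> ball 0 1 \<Longrightarrow> 1 - hdot (F z) (F w) = (1 - hdot z w) * (1 + g z * cnj (g w))"
    and z0: "z0 \<in> ball 0 1" "g z0 \<noteq> 0"
  shows "\<exists>a b. norm a < 1 \<and> norm b = 1 \<and> krel (\<lambda>z w. 1 - hdot (F z) (F w)) (whitney_kernel a b)"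
proof -
  have "CARD('a + 'a) = CARD('b option)" using dim by simp
  \<comment> \<open>The two sides have equally many coordinates, so \<open>(F, g)\<close> can be
    arranged in the space of \<open>(z, g z)\<close> and \<open>gram_unitary\<close>
    applies.\<close>
  then obtain h :: "'a + 'a \<Rightarrow> 'b option" where h: "bij h" using finite_same_card_bij[of "UNIV :: ('a+'a) set" "UNIV :: 'b option set"] by auto
  define X where "X z = (\<chi> j. case h j of None \<Rightarrow> g z | Some k \<Rightarrow> F z $ k)" for z
  define Y where "Y z = prv z (g z *s z)" for z
  have "hdot (X z) (X w) = hdot (Y z) (Y w)" if "z \<in> ball 0 1" "w \<in> ball 0 1" for z w
  proof -
    have "hdot (X z) (X w) = (\<Sum>j\<in>UNIV. (\<lambda>i. (case i of None \<Rightarrow> g z | Some k \<Rightarrow> F z $ k) * cnj (case i of None \<Rightarrow> g w | Some k \<Rightarrow> F w $ k)) (h j))"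
      by (simp add: hdot_def X_def)
    also have "\<dots> = (\<Sum>i\<in>UNIV. (case i of None \<Rightarrow> g z | Some k \<Rightarrow> F z $ k) * cnj (case i of None \<Rightarrow> g w | Some k \<Rightarrow> F w $ k))"
      by (rule sum.reindex_bij_betw[OF h])
    also have "\<dots> = g z * cnj (g w) + hdot (F z) (F w)" by (simp add: sum_UNIV_option hdot_def)
    also have "\<dots> = hdot (Y z) (Y w)" using k[OF that] by (simp add: Y_def algebra_simps)
    finally show ?thesis .
  qed
  then obtain U where U: "unitary U" "\<And>z. z \<in> ball 0 1 \<Longrightarrow> U (Y z) = X z" using gram_unitary[of "ball 0 1" X Y] by blast
  obtain j0 where j0: "h j0 = None" using h by (metis bij_pointE)
  obtain v where v: "U v = axis j0 1" using unitary_surj[OF U(1)] by blast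
  define \<alpha> \<gamma> where "\<alpha> = fsv v" and "\<gamma> = snv v"
  have gv: "g z = hdot z \<alpha> + g z * hdot z \<gamma>" if "z \<in> ball 0 1" for z
  proof -
    have "g z = hdot (U (Y z)) (U v)" unfolding v U(2)[OF that] by (simp add: X_def j0)
    also have "\<dots> = hdot (Y z) (prv \<alpha> \<gamma>)" unfolding unitaryD(2)[OF U(1)] by (simp add: \<alpha>_def \<gamma>_def)
    finally show ?thesis by (simp add: Y_def)
  qed
  have one: "hdot \<gamma> \<gamma> = 1 - hdot \<alpha> \<alpha>"
  proof -
    have "hdot (prv \<alpha> \<gamma>) (prv \<alpha> \<gamma>) = hdot (axis j0 1) (axis j0 (1::complex))"
      using unitaryD(2)[OF U(1), of v v] v by (simp add: \<alpha>_def \<gamma>_def del: hdot_prv hdot_axis)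
    then show ?thesis by (simp add: algebra_simps)
  qed
  have n\<gamma>: "norm \<gamma> \<le> 1"
  proof -
    have "Re (hdot \<gamma> \<gamma>) \<le> 1" unfolding one by (simp add: hdot_self)
    then show ?thesis by (simp add: hdot_self_Re power_le_one_iff)
  qed
  have ne: "1 - hdot z \<gamma> \<noteq> 0" "1 - hdot \<gamma> z \<noteq> 0" if "z \<in> ball 0 1" for z using hdot_ne_1[of z \<gamma>] that n\<gamma> by auto
  have "\<alpha> \<noteq> 0" using gv[OF z0(1)] ne(1)[OF z0(1)] z0(2) by (auto simp: algebra_simps)
  define A where "A = (norm \<alpha>)\<^sup>2"
  have A: "A > 0" "hdot \<alpha> \<alpha> = of_real A" "hdot \<gamma> \<gamma> = 1 - of_real A" using \<open>\<alpha> \<noteq> 0\<close> one by (simp_all add: A_def hdot_self)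
  define b where "b = hdot \<gamma> \<alpha>"
  define \<beta> where "\<beta> = (if b = 0 then 1 else b / of_real (cmod b))"
  have \<beta>: "b = of_real (cmod b) * \<beta>" "\<beta> * cnj \<beta> = 1"
    by (auto simp: \<beta>_def complex_norm_square[symmetric] power2_eq_square norm_divide)
  \<comment> \<open>A trace-free Hermitian matrix with diagonal entry \<open>A\<close> and
    off-diagonal modulus \<open>cmod b\<close> is diagonalised by a rotation with
    \<open>tan (2 * \<theta>) = cmod b / A\<close>; the phase of \<open>b\<close> is taken up by
    \<open>\<beta>\<close>.\<close>
  define \<theta> where "\<theta> = arctan (cmod b / A) / 2"
  define x r where "x = cos \<theta>" and "r = sin \<theta>"
  have \<theta>: "0 \<le> \<theta>" "\<theta> < pi/2 / 2" using A arctan_ubound[of "cmod b / A"] by (simp_all add: \<theta>_def zero_le_arctan_iff)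
  have c2: "cos (2 * \<theta>) > 0" using \<theta> by (intro cos_gt_zero_pi) auto
  have x0: "x > 0" unfolding x_def using \<theta> pi_gt_zero by (intro cos_gt_zero_pi) auto
  have r0: "r \<ge> 0" unfolding r_def using \<theta> pi_gt_zero by (intro sin_ge_zero) auto
  have xr: "x\<^sup>2 + r\<^sup>2 = 1" "cos (2 * \<theta>) = x\<^sup>2 - r\<^sup>2" by (simp_all add: x_def r_def cos_double)
  have "tan (2 * \<theta>) = cmod b / A" by (simp add: \<theta>_def tan_arctan)
  then have t: "A * (2 * x * r) = cmod b * (x\<^sup>2 - r\<^sup>2)"
    using c2 A(1) unfolding tan_def sin_double xr(2)[symmetric] by (simp add: field_simps x_def r_def)
  define y where "y = of_real r * cnj \<beta>"
  define \<mu> where "\<mu> = A * (x\<^sup>2 - r\<^sup>2) + 2 * x * r * cmod b"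
  have \<mu>: "\<mu> > 0" unfolding \<mu>_def xr(2)[symmetric] using A c2 x0 r0 by (intro add_pos_nonneg) auto
  \<comment> \<open>The rotated pair is \<open>x * (1 - hdot z a)\<close> and
    \<open>hdot z u - cnj y\<close>. Below, \<open>au\<close> is Lorentz orthogonality, while
    \<open>laa\<close> and \<open>luu\<close> say that the Lorentz squares are \<open>\<mu>\<close>
    and \<open>- \<mu>\<close>; positivity of \<open>\<mu>\<close> puts \<open>a\<close> inside the
    ball.\<close>
  define a where "a = \<gamma> - (cnj y / of_real x) *s \<alpha>"
  define u where "u = y *s \<gamma> + of_real x *s \<alpha>"
  have cb: "hdot \<gamma> \<alpha> = b" "hdot \<alpha> \<gamma> = cnj b" by (simp_all add: b_def cnj_hdot)
  have yb: "y * b = of_real (r * cmod b)" "cnj y * cnj b = of_real (r * cmod b)" "cnj y * y = of_real (r\<^sup>2)"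
    using \<beta> by (simp_all add: y_def power2_eq_square mult_ac) (metis (no_types) complex_cnj_complex_of_real complex_cnj_mult mult.assoc mult.commute mult.left_neutral)+
  have X0: "complex_of_real x \<noteq> 0" using x0 by simp
  have xx: "of_real x * of_real x + cnj y * y = (1::complex)" unfolding yb using xr(1) by (simp add: power2_eq_square flip: of_real_mult of_real_add)
  have au: "hdot a u = cnj y"
  proof -
    have "of_real x * hdot a u = of_real x * cnj y * (1 - of_real A) + of_real x * of_real x * b - cnj y * (cnj y * cnj b) - cnj y * of_real x * of_real A"
      unfolding a_def u_def using X0 by (simp add: A cb algebra_simps)
    also have "\<dots> = of_real x * cnj y + (of_real (x\<^sup>2) * b - cnj y * of_real (r * cmod b) - 2 * of_real A * of_real x * cnj y)"
      unfolding yb by (simp add: algebra_simps power2_eq_square)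
    also have "of_real (x\<^sup>2) * b - cnj y * of_real (r * cmod b) - 2 * of_real A * of_real x * cnj y = \<beta> * of_real (cmod b * (x\<^sup>2 - r\<^sup>2) - A * (2 * x * r))"
      by (subst \<beta>(1)) (simp add: y_def power2_eq_square algebra_simps)
    also have "\<dots> = 0" using t by simp
    finally show ?thesis using X0 by simp
  qed
  have laa: "of_real (x\<^sup>2) * (1 - hdot a a) = of_real \<mu>"
  proof -
    have "of_real (x\<^sup>2) * (1 - hdot a a) = of_real x * of_real x * of_real A + of_real x * (y * b) + of_real x * (cnj y * cnj b) - cnj y * y * of_real A"
      unfolding a_def using X0 by (simp add: A cb power2_eq_square algebra_simps)
    also have "\<dots> = of_real \<mu>" unfolding yb by (simp add: \<mu>_def power2_eq_square algebra_simps)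
    finally show ?thesis .
  qed
  have luu: "hdot u u - cnj y * y = of_real \<mu>"
  proof -
    have "hdot u u - cnj y * y = - (cnj y * y * of_real A) + of_real x * (y * b) + of_real x * (cnj y * cnj b) + of_real x * of_real x * of_real A"
      unfolding u_def by (simp add: A cb algebra_simps)
    also have "\<dots> = of_real \<mu>" unfolding yb by (simp add: \<mu>_def power2_eq_square algebra_simps)
    finally show ?thesis .
  qed
  have na: "norm a < 1"
  proof -
    have "x\<^sup>2 * (1 - (norm a)\<^sup>2) = \<mu>" using arg_cong[OF laa, of Re] by (simp add: hdot_self)
    then have "0 < 1 - (norm a)\<^sup>2" using \<mu> x0 by (metis zero_less_mult_pos zero_less_power)
    then show ?thesis by (simp add: power_less_one_iff)
  qed
  define s where "s = complex_of_real (sqrt (1 - (norm a)\<^sup>2))"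
  have s: "s * s = 1 - hdot a a" "cnj s = s" "s \<noteq> 0" using sqrt_sq[OF na] hdot_ne_1(1)[OF na less_imp_le[OF na]] by (auto simp: s_def)
  obtain l2 q2 where u2: "u = l2 *s a + q2" "hdot q2 a = 0" using mobius_parts by metis
  have aq2: "hdot a q2 = 0" using u2(2) hdot_0_sym by blast
  \<comment> \<open>Chosen so that pairing \<open>mobius a z\<close> with \<open>bb\<close> gives
    the quotient of the two rotated functions, which is \<open>mb\<close>; its unit length comes
    from \<open>au\<close>, \<open>laa\<close> and \<open>luu\<close>.\<close>
  define bb where "bb = (- 1 / of_real x) *s (l2 *s a + (1 / s) *s q2)"
  have nb: "hdot bb bb = 1"
  proof -
    have "of_real (x\<^sup>2) * (s * s) * hdot bb bb = l2 * cnj l2 * hdot a a * (s * s) + hdot q2 q2"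
      unfolding bb_def using X0 s by (simp add: u2(2) aq2 power2_eq_square field_simps)
    also have "\<dots> = hdot u u - hdot a u * cnj (hdot a u)"
      unfolding u2(1) s(1) by (simp add: u2(2) aq2 cnj_hdot algebra_simps)
    also have "\<dots> = of_real (x\<^sup>2) * (s * s)" unfolding au s(1) laa using luu by (simp add: mult.commute)
    finally show ?thesis using X0 s(3) by simp
  qed
  have mb: "of_real x * (1 - hdot z a) * hdot (mobius a z) bb = hdot z u - cnj y" if z: "z \<in> ball 0 1" for z
  proof -
    obtain l q where 1: "z = l *s a + q" "hdot q a = 0" "hdot z a = l * hdot a a" "mobius a z = (1 / (1 - l * hdot a a)) *s ((1 - l) *s a - s *s q)"
      using mobius_parts unfolding s_def by metis
    have d: "1 - l * hdot a a \<noteq> 0" using hdot_ne_1(1)[of z a] z na 1(3) by auto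
    have "of_real x * (1 - hdot z a) * hdot (mobius a z) bb = of_real x * hdot ((1 - l) *s a - s *s q) bb"
      unfolding 1(3,4) hdot_scale using d by (simp del: hdot_diff)
    also have "\<dots> = - ((1 - l) * cnj l2 * hdot a a) + hdot q q2"
      unfolding bb_def using X0 s by (simp add: 1(2) aq2 algebra_simps)
    also have "\<dots> = hdot z u - hdot a u" unfolding 1(1) u2(1) by (simp add: 1(2) aq2 algebra_simps)
    finally show ?thesis unfolding au .
  qed
  have A1: "of_real x * (1 - hdot z \<gamma>) + y * hdot z \<alpha> = of_real x * (1 - hdot z a)" for z
    unfolding a_def using X0 by (simp add: algebra_simps)
  have A2: "- cnj y * (1 - hdot z \<gamma>) + of_real x * hdot z \<alpha> = hdot z u - cnj y" for z
    unfolding u_def by (simp add: algebra_simps)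
  define H where "H z = of_real x * (1 - hdot z a) * (1 - hdot z a) / (s * (1 - hdot z \<gamma>))" for z
  have "1 - hdot (F z) (F w) = (1 - hdot (mobius a z) (mobius a w)) * (1 + hdot (mobius a z) bb * hdot bb (mobius a w)) * (H z * cnj (H w))"
    if zw: "z \<in> ball 0 1" "w \<in> ball 0 1" for z w
  proof -
    define p q where "p z = 1 - hdot z \<gamma>" and "q z = hdot z \<alpha>" for z
    define M where "M z = hdot (mobius a z) bb" for z
    have gz: "g z = q z / p z" "p z \<noteq> 0" if "z \<in> ball 0 1" for z using gv[OF that] ne(1)[OF that] by (simp_all add: p_def q_def field_simps)
    have d: "1 - hdot z a \<noteq> 0" "1 - hdot w a \<noteq> 0" using hdot_ne_1(1)[of z a] hdot_ne_1(1)[of w a] zw na by auto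
    have "p z * cnj (p w) + q z * cnj (q w) = (of_real x * of_real x + cnj y * y) * (p z * cnj (p w) + q z * cnj (q w))" unfolding xx by simp
    also have "\<dots> = (of_real x * p z + y * q z) * cnj (of_real x * p w + y * q w) + (- cnj y * p z + of_real x * q z) * cnj (- cnj y * p w + of_real x * q w)"
      by (simp add: algebra_simps)
    also have "\<dots> = of_real x * (1 - hdot z a) * cnj (of_real x * (1 - hdot w a)) + of_real x * (1 - hdot z a) * M z * cnj (of_real x * (1 - hdot w a) * M w)"
      unfolding p_def q_def A1 A2 M_def mb[OF zw(1)] mb[OF zw(2)] ..
    finally have e: "p z * cnj (p w) + q z * cnj (q w) = of_real x * of_real x * (1 - hdot z a) * cnj (1 - hdot w a) * (1 + M z * cnj (M w))"
      by (simp add: algebra_simps)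
    have "1 + g z * cnj (g w) = (p z * cnj (p w) + q z * cnj (q w)) / (p z * cnj (p w))"
      using gz(2)[OF zw(1)] gz(2)[OF zw(2)] unfolding gz(1)[OF zw(1)] gz(1)[OF zw(2)] by (simp add: add_divide_distrib)
    moreover have "1 - hdot z w = (1 - hdot (mobius a z) (mobius a w)) * ((1 - hdot z a) * cnj (1 - hdot w a)) / (s * s)"
      using mobius_kernel[OF na, of z w] zw d s hdot_ne_1(2)[of w a] hdot_ne_1(1)[of a a] na by (simp add: cnj_hdot)
    ultimately have k2: "1 - hdot (F z) (F w) = (1 - hdot (mobius a z) (mobius a w)) * ((1 - hdot z a) * cnj (1 - hdot w a)) / (s * s)
       * ((of_real x * of_real x * (1 - hdot z a) * cnj (1 - hdot w a) * (1 + M z * cnj (M w))) / (p z * cnj (p w)))"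
      unfolding k[OF zw] e by simp
    have cH: "cnj (H w) = of_real x * cnj (1 - hdot w a) * cnj (1 - hdot w a) / (s * cnj (p w))" by (simp add: H_def p_def s(2))
    have "T * (p1 * p2) / (S * S) * ((X * X * p1 * p2 * N) / (P * Q)) = T * N * (X * p1 * p1 / (S * P) * (X * p2 * p2 / (S * Q)))"
      for T p1 p2 S X N P Q :: complex by (simp add: mult_ac)
    then show ?thesis unfolding k2 cH M_def cnj_hdot unfolding H_def p_def by blast
  qed
  then have "krel (\<lambda>z w. 1 - hdot (F z) (F w)) (whitney_kernel a bb)"
    unfolding whitney_kernel_def[abs_def] by (rule krelI)
  moreover have "norm bb = 1" using nb by (simp add: hdot_self) (metis abs_norm_cancel abs_square_eq_1 of_real_eq_1_iff of_real_power)
  ultimately show ?thesis using na by blast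
qed

lemma det3_scale: "det3 (\<lambda>z w. k z w * (v z * cnj (v w))) z1 z2 z3 w1 w2 w3 =
    det3 k z1 z2 z3 w1 w2 w3 * (v z1 * v z2 * v z3 * cnj (v w1 * v w2 * v w3))"
  unfolding det3_def by (simp add: algebra_simps)

lemma continuous_on_mobius:
  assumes "continuous_on S f" "\<And>x. x \<in> S \<Longrightarrow> hdot (f x) a \<noteq> 1"
  shows "continuous_on S (\<lambda>x. mobius a (f x))"
  unfolding mobius_def prj_def by (cases "a = 0") (use assms in \<open>auto intro!: continuous_intros\<close>)

text \<open>After \<open>F 0\<close> is moved to 0, subtracting 1 from the kernel lowers its rank to
  one. A Hermitian kernel of rank at most one is zero or plus or minus \<open>g(z) cnj g(w)\<close>,
  and the sign decides between the cases.\<close>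

lemma rank_two_classification:
  fixes F :: "complex^'a \<Rightarrow> complex^'b"
  assumes dim: "CARD('b) + 1 = 2 * CARD('a)"
    and F: "\<And>z. z \<in> ball 0 1 \<Longrightarrow> norm (F z) < 1" "continuous_on (ball 0 1) F"
    and det: "rank_le_two (kern F)"
  shows "krel (\<lambda>z w. 1 - hdot (F z) (F w)) (\<lambda>z w. 1 - hdot z w) \<or>
    (\<exists>a b. norm a < 1 \<and> norm b = 1 \<and> krel (\<lambda>z w. 1 - hdot (F z) (F w)) (whitney_kernel a b))"
proof -
  define B where "B = ball (0::complex^'a) 1"
  have 0: "0 \<in> B" by (simp add: B_def)
  define a F1 where "a = F 0" and "F1 z = mobius a (F z)" for z
  have na: "norm a < 1" using F(1) by (simp add: a_def)
  define s v where "s = complex_of_real (sqrt (1 - (norm a)\<^sup>2))" and "v z = s / (1 - hdot (F z) a)" for z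
  have s: "s * s = 1 - hdot a a" "cnj s = s" "s \<noteq> 0"
    using sqrt_sq[OF na] hdot_ne_1(1)[OF na less_imp_le[OF na]] by (auto simp: s_def)
  have ne: "hdot (F z) a \<noteq> 1" if "z \<in> B" for z using hdot_ne_1(1)[OF F(1), of z a] na that by (simp add: B_def)
  have v0: "v z \<noteq> 0" if "z \<in> B" for z using ne[OF that] s by (simp add: v_def)
  have kF: "1 - hdot (F1 z) (F1 w) = (1 - hdot (F z) (F w)) * (v z * cnj (v w))" if "z \<in> B" "w \<in> B" for z w
    using mobius_kernel[OF na F(1) F(1), of z w] that s by (simp add: F1_def B_def v_def cnj_hdot mult_ac)
  have rF: "krel (\<lambda>z w. 1 - hdot (F z) (F w)) (\<lambda>z w. 1 - hdot (F1 z) (F1 w))"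
    by (rule krelI[where h = "\<lambda>z. 1 / v z"]) (use kF v0 in \<open>simp add: B_def\<close>)
  have F1: "F1 0 = 0" "continuous_on B F1"
    using mobius_self[OF na] continuous_on_mobius[of B F a] F(2) ne by (auto simp: F1_def a_def B_def)
  define k where "k z w = kern F1 z w - 1" for z w
  have k0: "k z 0 = 0" "k 0 w = 0" for z w by (simp_all add: k_def kern_def F1)
  have cnj_k: "cnj (k z w) = k w z" for z w by (simp add: k_def kern_def cnj_hdot)
  \<comment> \<open>The kernel of \<open>F1\<close> is 1 as soon as one argument is 0, so a three by
    three minor with third row and column at 0 reduces to a two by two minor of
    \<open>k\<close>.\<close>
  have minor: "k z1 w1 * k z2 w2 = k z1 w2 * k z2 w1" if "z1 \<in> B" "z2 \<in> B" "w1 \<in> B" "w2 \<in> B" for z1 z2 w1 w2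
  proof -
    have e: "kern F1 z w = kern F z w * (v z * cnj (v w))" if "z \<in> B" "w \<in> B" for z w using kF[OF that] by (simp add: kern_def)
    have "det3 (kern F1) z1 z2 0 w1 w2 0 = det3 (\<lambda>z w. kern F z w * (v z * cnj (v w))) z1 z2 0 w1 w2 0"
      unfolding det3_def using e that 0 by simp
    also have "\<dots> = 0" unfolding det3_scale using det that 0 by (simp add: rank_le_two_def B_def)
    finally have d: "det3 (kern F1) z1 z2 0 w1 w2 0 = 0" .
    have kk: "kern F1 z w = k z w + 1" for z w by (simp add: k_def)
    show ?thesis using d unfolding det3_def kk k0 by (simp add: algebra_simps)
  qed
  have K: "1 - hdot (F1 z) (F1 w) = (1 - hdot z w) * (1 + k z w)" if "z \<in> B" "w \<in> B" for z w
    using hdot_ne_1(1)[of z w] that by (simp add: k_def kern_def B_def)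
  show ?thesis
  proof (cases "\<forall>z\<in>B. k z z = 0")
    case True
    have "k z w = 0" if "z \<in> B" "w \<in> B" for z w
    proof -
      have "k z w * cnj (k z w) = 0" using minor[OF that that] True that by (simp add: cnj_k)
      then show ?thesis by simp
    qed
    then have "krel (\<lambda>z w. 1 - hdot (F1 z) (F1 w)) (\<lambda>z w. 1 - hdot z w)"
      by (intro krelI[where h = "\<lambda>_. 1"]) (simp add: K B_def)
    then show ?thesis using krel_trans[OF rF] by blast
  next
    case False
    then obtain z0 where z0: "z0 \<in> B" "k z0 z0 \<noteq> 0" by blast
    define r where "r = Re (k z0 z0)"
    have r: "k z0 z0 = of_real r" using cnj_k[of z0 z0] by (simp add: r_def complex_eq_iff)
    have r0: "r \<noteq> 0" using z0 r by auto
    define g where "g z = k z z0 / of_real (sqrt \<bar>r\<bar>)" for z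
    have kg: "k z w = of_real (sgn r) * (g z * cnj (g w))" if "z \<in> B" "w \<in> B" for z w
    proof -
      have "complex_of_real (sqrt \<bar>r\<bar>) * of_real (sqrt \<bar>r\<bar>) = of_real \<bar>r\<bar>" unfolding of_real_mult[symmetric] by simp
      then have "g z * cnj (g w) = k z z0 * k z0 w / of_real \<bar>r\<bar>" by (simp add: g_def cnj_k)
      also have "k z z0 * k z0 w = k z w * of_real r" using minor[OF that(1) z0(1) that(2) z0(1)] r by simp
      finally show ?thesis using r0 by (simp add: sgn_if)
    qed
    have gz0: "g z0 \<noteq> 0" using z0 r0 by (simp add: g_def)
    show ?thesis
    proof (cases "r > 0")
      case True
      have "\<exists>a b. norm a < 1 \<and> norm b = 1 \<and> krel (\<lambda>z w. 1 - hdot (F1 z) (F1 w)) (whitney_kernel a b)"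
        by (rule positive_square[OF dim, where g = g and ?z0.0 = z0]) (use K kg z0 gz0 True in \<open>simp_all add: B_def\<close>)
      then show ?thesis using krel_trans[OF rF] by blast
    next
      case False
      have cg: "continuous_on B g" unfolding g_def k_def kern_def
        by (intro continuous_intros F1(2)) (use hdot_ne_1(1)[of _ z0] z0 r0 in \<open>auto simp: B_def\<close>)
      have "g z0 = 0"
        by (rule no_negative_square[where F = F1 and g = g, OF _ cg[unfolded B_def] _ z0(1)[unfolded B_def]])
          (use K kg False r0 in \<open>simp_all add: B_def\<close>, simp add: g_def k0)
      then show ?thesis using gz0 by simp
    qed
  qed
qed

section \<open>The two model maps\<close>

lemma hdot_standard_embedding: "hdot (standard_embedding z) (standard_embedding w) = hdot z w"
  by (simp add: hdot_def sum_UNIV_sum standard_embedding_def)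

lemma hdot_whitney: "1 - hdot (whitney_map z) (whitney_map w) = (1 - hdot z w) * (1 + z $ None * cnj (w $ None))"
  by (simp add: hdot_def sum_UNIV_sum sum_UNIV_option whitney_map_def power2_eq_square algebra_simps sum_distrib_left sum.distrib)

lemma norm_less_1_iff: "norm (x::complex^'n) < 1 \<longleftrightarrow> 0 < Re (1 - hdot x x)"
  by (simp add: hdot_self_Re power_less_one_iff)

lemma aut_id: "aut (\<lambda>x::complex^'n. x) (\<lambda>x. x)"
  by (simp add: aut_def holomorphic_lin linI)

text \<open>In the second case a unitary map takes the unit vector \<open>b\<close> to the axis
  \<open>None\<close>, so that the product with \<open>b\<close> becomes the coordinate squared by
  the Whitney map.\<close>

lemma linear_or_whitney:
  fixes F :: "complex ^ ('n::finite option) \<Rightarrow> complex ^ ('n option + 'n)"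
  assumes F: "\<And>z. z \<in> ball 0 1 \<Longrightarrow> norm (F z) < 1" "continuous_on (ball 0 1) F"
    and det: "rank_le_two (kern F)"
  shows "linear_ball_map F \<or> ball_equivalent F whitney_map"
proof -
  have dim: "CARD('n option + 'n) + 1 = 2 * CARD('n option)" by simp
  show ?thesis using rank_two_classification[OF dim F det]
  proof
    assume "krel (\<lambda>z w. 1 - hdot (F z) (F w)) (\<lambda>z w. 1 - hdot z w)"
    then obtain h where h: "\<And>z w. z \<in> ball 0 1 \<Longrightarrow> w \<in> ball 0 1 \<Longrightarrow> 1 - hdot (F z) (F w) = (1 - hdot z w) * (h z * cnj (h w))"
      unfolding krel_def by blast
    have E: "norm (standard_embedding z :: complex ^ ('n option + 'n)) < 1" if "z \<in> ball 0 1" for z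
      using that by (simp add: norm_less_1_iff hdot_standard_embedding)
    have "\<exists>\<tau>. ball_automorphism \<tau> \<and> (\<forall>z\<in>ball 0 1. F z = \<tau> (standard_embedding z))"
      by (rule equivalent_if_kernels_proportional[OF F(1) E, where h = h]) (simp_all add: h hdot_standard_embedding)
    then show ?thesis using aut_automorphism[OF aut_id] unfolding linear_ball_map_def ball_equivalent_def by blast
  next
    assume "\<exists>a b. norm a < 1 \<and> norm b = 1 \<and> krel (\<lambda>z w. 1 - hdot (F z) (F w)) (whitney_kernel a b)"
    then obtain a b h where ab: "norm a < 1" "norm b = 1" and h: "\<And>z w. z \<in> ball 0 1 \<Longrightarrow> w \<in> ball 0 1 \<Longrightarrow>
      1 - hdot (F z) (F w) = (1 - hdot (mobius a z) (mobius a w)) * (1 + hdot (mobius a z) b * hdot b (mobius a w)) * (h z * cnj (h w))"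
      unfolding krel_def whitney_kernel_def by blast
    have "norm b = norm (axis None 1 :: complex ^ ('n option))" using ab(2) by simp
    then obtain R where R: "unitary R" "R b = axis None 1" using unitary_reflection by blast
    obtain R' where R': "aut R R'" using unitary_aut[OF R(1)] by blast
    define \<sigma> where "\<sigma> z = R (mobius a z)" for z
    have au: "aut \<sigma> (\<lambda>z. mobius a (R' z))" unfolding \<sigma>_def[abs_def] by (rule aut_comp[OF mobius_aut[OF ab(1)] R'])
    have \<sigma>0: "\<sigma> z $ None = hdot (mobius a z) b" for z
      using unitaryD(2)[OF R(1), of "mobius a z" b] by (simp add: \<sigma>_def R(2))
    have \<sigma>\<sigma>: "hdot (\<sigma> z) (\<sigma> w) = hdot (mobius a z) (mobius a w)" for z w by (simp add: \<sigma>_def unitaryD(2)[OF R(1)])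
    have W: "norm (whitney_map (\<sigma> z)) < 1" if "z \<in> ball 0 1" for z
    proof -
      have "norm (\<sigma> z) < 1" using au that by (simp add: aut_def)
      then have "0 < Re ((1 - hdot (\<sigma> z) (\<sigma> z)) * (1 + \<sigma> z $ None * cnj (\<sigma> z $ None)))"
        unfolding norm_less_1_iff hdot_self complex_norm_square[symmetric] by (simp add: add_pos_nonneg)
      then show ?thesis unfolding norm_less_1_iff hdot_whitney .
    qed
    have "\<exists>\<tau>. ball_automorphism \<tau> \<and> (\<forall>z\<in>ball 0 1. F z = \<tau> (whitney_map (\<sigma> z)))"
      by (rule equivalent_if_kernels_proportional[OF F(1) W, where h = h]) (simp_all add: h hdot_whitney \<sigma>0 \<sigma>\<sigma> cnj_hdot)
    then show ?thesis using aut_automorphism[OF au] unfolding ball_equivalent_def by blast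
  qed
qed

section \<open>Regularity\<close>

lemma line_transform:
  fixes h h' :: "complex^'a \<Rightarrow> complex"
  assumes "((\<lambda>t. h (z + t *s d)) has_field_derivative D) (at 0)" "z \<in> ball 0 1" "\<And>z. z \<in> ball 0 1 \<Longrightarrow> h' z = h z"
  shows "((\<lambda>t. h' (z + t *s d)) has_field_derivative D) (at 0)"
  by (rule has_field_derivative_transform_within_open[OF assms(1) open_line[of z d]]) (use assms(2,3) in auto)

lemma cauchy_line:
  fixes h :: "complex^'a \<Rightarrow> complex"
  assumes h: "\<And>z. z \<in> ball 0 1 \<Longrightarrow> ((\<lambda>t. h (z + t *s e)) has_field_derivative D z) (at 0)"
    and r: "r > 0" "\<And>s. cmod s \<le> r \<Longrightarrow> y + s *s e \<in> ball 0 1"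
  shows "D y = integral {0..1} (\<lambda>x. h (y + circlepath 0 r x *s e) / circlepath 0 r x)"
proof -
  define f where "f s = h (y + s *s e)" for s
  have hol: "f holomorphic_on {s. y + s *s e \<in> ball 0 1}" unfolding f_def by (rule line_holomorphic[OF h])
  have sub: "cball 0 r \<subseteq> {s. y + s *s e \<in> ball 0 1}" using r by auto
  have "(f has_field_derivative (1 / (2 * of_real pi * \<i>) * contour_integral (circlepath 0 r) (\<lambda>u. f u / (u - 0)^2))) (at 0)"
    by (rule Cauchy_derivative_integral_circlepath(2))
      (use r holomorphic_on_subset[OF hol sub] in \<open>auto intro: holomorphic_on_imp_continuous_on holomorphic_on_subset\<close>)
  moreover have "(f has_field_derivative D y) (at 0)" unfolding f_def using h[of y] r(2)[of 0] r(1) by simp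
  ultimately have "D y = 1 / (2 * of_real pi * \<i>) * contour_integral (circlepath 0 r) (\<lambda>u. f u / u^2)"
    using DERIV_unique by fastforce
  also have "contour_integral (circlepath 0 r) (\<lambda>u. f u / u^2) = integral {0..1} (\<lambda>x. (2 * of_real pi * \<i>) * (f (circlepath 0 r x) / circlepath 0 r x))"
    unfolding contour_integral_integral
  proof (rule integral_cong)
    fix x :: real
    have "circlepath 0 r x \<noteq> 0" using circlepath_norm[OF r(1), of x] r(1) by auto
    moreover have "vector_derivative (circlepath 0 r) (at x) = 2 * of_real pi * \<i> * circlepath 0 r x"
      unfolding vector_derivative_circlepath by (simp add: circlepath)
    ultimately show "f (circlepath 0 r x) / (circlepath 0 r x)\<^sup>2 * vector_derivative (circlepath 0 r) (at x) =
        2 * of_real pi * \<i> * (f (circlepath 0 r x) / circlepath 0 r x)"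
      by (simp add: power2_eq_square)
  qed
  finally show ?thesis unfolding f_def integral_mult_right by simp
qed

text \<open>Partial derivatives of a function that is holomorphic on lines are again holomorphic on lines, and mixed
  derivatives commute: differentiate Cauchy's formula under the integral sign.\<close>

lemma partial_line_derivative:
  fixes h :: "complex^'a \<Rightarrow> complex" and p :: "'a \<Rightarrow> complex^'a \<Rightarrow> complex"
  assumes h: "\<And>z d. z \<in> ball 0 1 \<Longrightarrow> ((\<lambda>t. h (z + t *s d)) has_field_derivative (\<Sum>j\<in>UNIV. d $ j * p j z)) (at 0)"
    and p: "\<And>j. continuous_on (ball 0 1) (p j)" and z: "z \<in> ball 0 1"
  shows "\<exists>D. ((\<lambda>t. p i (z + t *s d)) has_field_derivative D) (at 0) \<and>
    (\<forall>q. (\<forall>j. \<forall>y\<in>ball 0 1. ((\<lambda>s. p j (y + s *s axis i 1)) has_field_derivative q j y) (at 0)) \<longrightarrow> D = (\<Sum>j\<in>UNIV. d $ j * q j z))"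
proof -
  define e :: "complex^'a" where "e = axis i 1"
  have ne: "norm e = 1" unfolding e_def by simp
  have he: "((\<lambda>t. h (y + t *s e)) has_field_derivative p i y) (at 0)" if "y \<in> ball 0 1" for y
    using h[OF that, of e] by (simp add: e_def axis_def if_distrib[of "\<lambda>a. a * _"] cong: if_cong)
  obtain \<epsilon> where \<epsilon>: "\<epsilon> > 0" "ball z \<epsilon> \<subseteq> ball 0 1" using z open_contains_ball[of "ball 0 1"] by blast
  define r \<delta> where "r = \<epsilon> / 2" and "\<delta> = \<epsilon> / (2 * (norm d + 1))"
  have pos: "r > 0" "\<delta> > 0" using \<epsilon> by (simp_all add: r_def \<delta>_def add_nonneg_pos)
  have inb: "z + t *s d + s *s e \<in> ball 0 1" if "t \<in> ball 0 \<delta>" "cmod s \<le> r" for t s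
  proof -
    have "norm (t *s d + s *s e) \<le> cmod t * norm d + cmod s"
      using norm_triangle_ineq[of "t *s d" "s *s e"] ne by (simp add: norm_smult)
    also have "cmod t * norm d \<le> cmod t * (norm d + 1)" by (intro mult_left_mono) auto
    also have "cmod t * (norm d + 1) < \<epsilon> / 2"
    proof -
      have dp: "norm d + 1 > 0" by (simp add: add_nonneg_pos)
      have "cmod t < \<epsilon> / 2 / (norm d + 1)" using that(1) by (simp add: \<delta>_def)
      then show ?thesis using dp by (simp only: pos_less_divide_eq)
    qed
    finally have "norm (t *s d + s *s e) < \<epsilon>" using that(2) by (simp add: r_def)
    then have "z + (t *s d + s *s e) \<in> ball z \<epsilon>" unfolding mem_ball dist_norm by (metis add_diff_cancel_left' norm_minus_commute)
    then show ?thesis using \<epsilon>(2) by (metis add.assoc subsetD)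
  qed
  define c where "c = circlepath 0 r"
  have nc: "cmod (c x) \<le> r" "c x \<noteq> 0" for x using circlepath_norm[OF pos(1), of x] pos(1) by (auto simp: c_def)
  have cc: "continuous_on S c" for S unfolding c_def circlepath_def part_circlepath_def by (intro continuous_intros)
  define f where "f t x = h (z + t *s d + c x *s e) / c x" for t x
  define fx where "fx t x = (\<Sum>j\<in>UNIV. d $ j * p j (z + t *s d + c x *s e)) / c x" for t x
  have formula: "p i (z + t *s d) = integral {0..1} (f t)" if "t \<in> ball 0 \<delta>" for t
    unfolding f_def c_def by (rule cauchy_line[OF he pos(1)]) (use inb[OF that] in auto)
  have der: "((\<lambda>t. f t x) has_field_derivative fx t x) (at t within ball 0 \<delta>)" if "t \<in> ball 0 \<delta>" for t x
  proof -
    have i: "(z + c x *s e) + t *s d \<in> ball 0 1" using inb[OF that nc(1)[of x]] by (simp add: add_ac)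
    have "((\<lambda>t. h ((z + c x *s e) + t *s d)) has_field_derivative (\<Sum>j\<in>UNIV. d $ j * p j ((z + c x *s e) + t *s d))) (at t)"
      by (rule line_deriv[where D = "\<lambda>z. \<Sum>j\<in>UNIV. d $ j * p j z", OF h i])
    then have "((\<lambda>t. h (z + t *s d + c x *s e)) has_field_derivative (\<Sum>j\<in>UNIV. d $ j * p j (z + t *s d + c x *s e))) (at t)"
      by (simp add: add_ac)
    then show ?thesis unfolding f_def fx_def by (rule has_field_derivative_at_within[OF DERIV_cdivide])
  qed
  have D: "((\<lambda>t. integral (cbox 0 1) (f t)) has_field_derivative integral (cbox 0 1) (fx 0)) (at 0 within ball 0 \<delta>)"
  proof (rule leibniz_rule_field_derivative[where U = "ball 0 \<delta>"])
    show "f t integrable_on cbox 0 1" if t: "t \<in> ball 0 \<delta>" for t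
    proof (rule integrable_continuous)
      have "continuous_on {s. z + t *s d + s *s e \<in> ball 0 1} (\<lambda>s. h (z + t *s d + s *s e))"
        by (rule holomorphic_on_imp_continuous_on[OF line_holomorphic[OF he]])
      then have "continuous_on (cbox 0 1) (\<lambda>x. h (z + t *s d + c x *s e))"
        by (rule continuous_on_compose2[OF _ cc]) (use inb[OF t nc(1)] in auto)
      then show "continuous_on (cbox 0 1) (f t)" unfolding f_def by (rule continuous_on_divide[OF _ cc]) (simp add: nc)
    qed
    have cs: "continuous_on (ball 0 \<delta> \<times> cbox 0 1) (\<lambda>u. c (snd u))"
      by (rule continuous_on_compose2[OF cc]) (auto intro: continuous_intros)
    then have g: "continuous_on (ball 0 \<delta> \<times> cbox 0 1) (\<lambda>u. z + fst u *s d + c (snd u) *s e)"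
      by (intro continuous_on_add continuous_on_const continuous_on_smult continuous_on_fst continuous_on_id)
    have "continuous_on (ball 0 \<delta> \<times> cbox 0 1) (\<lambda>u. p j (z + fst u *s d + c (snd u) *s e))" for j
      by (rule continuous_on_compose2[OF p g]) (use inb nc(1) in auto)
    then show "continuous_on (ball 0 \<delta> \<times> cbox 0 1) (\<lambda>(t, x). fx t x)"
      unfolding fx_def case_prod_beta
      by (intro continuous_on_divide continuous_on_mult continuous_on_sum continuous_on_const cs) (simp_all add: nc)
  qed (use der pos in auto)
  have "at 0 within ball 0 \<delta> = at (0::complex)" by (rule at_within_open) (use pos in auto)
  from D[unfolded this] have ex: "((\<lambda>t. p i (z + t *s d)) has_field_derivative integral (cbox 0 1) (fx 0)) (at 0)"
    by (rule has_field_derivative_transform_within_open[where S = "ball 0 \<delta>"]) (use pos formula in auto)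
  \<comment> \<open>The differentiated formula is also Cauchy's formula for the derivative of the
    sum of \<open>d $ j * p j\<close> along \<open>axis i 1\<close>, which takes the mixed
    derivatives in the other order.\<close>
  moreover have "integral (cbox 0 1) (fx 0) = (\<Sum>j\<in>UNIV. d $ j * q j z)"
    if q: "\<forall>j. \<forall>y\<in>ball 0 1. ((\<lambda>s. p j (y + s *s axis i 1)) has_field_derivative q j y) (at 0)" for q
  proof -
    have "(\<Sum>j\<in>UNIV. d $ j * q j z) = integral {0..1} (\<lambda>x. (\<Sum>j\<in>UNIV. d $ j * p j (z + circlepath 0 r x *s e)) / circlepath 0 r x)"
    proof (rule cauchy_line[OF _ pos(1)])
      show "((\<lambda>t. \<Sum>j\<in>UNIV. d $ j * p j (y + t *s e)) has_field_derivative (\<Sum>j\<in>UNIV. d $ j * q j y)) (at 0)" if "y \<in> ball 0 1" for y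
        using q that unfolding e_def by (intro DERIV_sum DERIV_cmult) blast
    qed (use inb[of 0] pos in auto)
    then show ?thesis by (simp add: fx_def[abs_def] c_def)
  qed
  ultimately show ?thesis by blast
qed

lemma line_derivative_eq_frechet:
  fixes f :: "complex^'a \<Rightarrow> complex^'b"
  assumes "f differentiable (at x)" "((\<lambda>t. f (x + t *s d) $ k) has_field_derivative D) (at 0)"
  shows "D = frechet_derivative f (at x) d $ k"
proof -
  have ch: "complex_of_real t *s d = t *\<^sub>R d" for t by (simp add: vec_eq_iff) (simp add: scaleR_conv_of_real)
  have fd: "(f has_derivative frechet_derivative f (at x)) (at (x + 0 *\<^sub>R d))"
    using assms(1) by (simp flip: frechet_derivative_works)
  have "((\<lambda>t. x + t *\<^sub>R d) has_derivative (\<lambda>t. t *\<^sub>R d)) (at 0)" by (auto intro!: derivative_eq_intros)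
  then have "((\<lambda>t. f (x + t *\<^sub>R d)) has_derivative (\<lambda>t. frechet_derivative f (at x) (t *\<^sub>R d))) (at 0)"
    by (rule has_derivative_compose[where f = "\<lambda>t. x + t *\<^sub>R d", OF _ fd])
  then have "((\<lambda>t. f (x + t *\<^sub>R d) $ k) has_derivative (\<lambda>t. frechet_derivative f (at x) (t *\<^sub>R d) $ k)) (at 0)"
    by (rule bounded_linear.has_derivative[OF bounded_linear_vec_nth])
  then have "((\<lambda>t. f (x + t *\<^sub>R d) $ k) has_vector_derivative frechet_derivative f (at x) d $ k) (at 0)"
    using linear_frechet_derivative[OF assms(1)] by (simp add: has_vector_derivative_def linear_scale)
  moreover have "((\<lambda>t. f (x + t *\<^sub>R d) $ k) has_vector_derivative D) (at 0)"
    using has_vector_derivative_real_field[of "\<lambda>t. f (x + t *s d) $ k" D 0 UNIV] assms(2) by (simp add: ch)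
  ultimately show ?thesis using vector_derivative_unique_at by blast
qed

text \<open>For a holomorphic map the real derivative in the direction \<open>axis i 1\<close> is
  the complex partial derivative in that coordinate.\<close>

abbreviation fd :: "(complex^'a \<Rightarrow> complex^'b) \<Rightarrow> 'a \<Rightarrow> complex^'a \<Rightarrow> complex^'b" where
  "fd f i x \<equiv> frechet_derivative f (at x) (axis i 1)"

text \<open>Smoothness up to the boundary gives real differentiability of the partials only. Complex
  differentiability comes from Cauchy's formula for \<open>h\<close>, and restricting to a real
  parameter identifies the derivative with the Frechet one.\<close>

lemma line_derivative_step:
  fixes h :: "complex^'a \<Rightarrow> complex" and f :: "'a \<Rightarrow> complex^'a \<Rightarrow> complex^'b"
  assumes h: "\<And>z d. z \<in> ball 0 1 \<Longrightarrow> ((\<lambda>t. h (z + t *s d)) has_field_derivative (\<Sum>j\<in>UNIV. d $ j * f j z $ k)) (at 0)"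
    and f: "\<And>j. f j differentiable_on ball 0 1" and z: "z \<in> ball 0 1"
  shows "((\<lambda>t. f i (z + t *s d) $ k) has_field_derivative (\<Sum>j\<in>UNIV. d $ j * fd (f i) j z $ k)) (at 0)"
    and "fd (f i) j z $ k = fd (f j) i z $ k"
proof -
  have diff: "f j differentiable (at y)" if "y \<in> ball 0 1" for j y
    using f[of j, unfolded differentiable_on_def] that at_within_open[OF that open_ball] by metis
  have cont: "continuous_on (ball 0 1) (\<lambda>z. f j z $ k)" for j
    using differentiable_imp_continuous_on[OF f[of j]] by (intro continuous_intros)
  note P = partial_line_derivative[where h = h and p = "\<lambda>j z. f j z $ k", OF h cont]
  have q: "\<forall>j. \<forall>y\<in>ball 0 1. ((\<lambda>s. f j (y + s *s axis i 1) $ k) has_field_derivative fd (f j) i y $ k) (at 0)" for i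
    using P line_derivative_eq_frechet[OF diff] by blast
  have der: "((\<lambda>t. f i (z + t *s d) $ k) has_field_derivative (\<Sum>j\<in>UNIV. d $ j * fd (f j) i z $ k)) (at 0)" for d i
  proof -
    obtain D where D: "((\<lambda>t. f i (z + t *s d) $ k) has_field_derivative D) (at 0)"
      "\<And>q. \<forall>j. \<forall>y\<in>ball 0 1. ((\<lambda>s. f j (y + s *s axis i 1) $ k) has_field_derivative q j y) (at 0) \<Longrightarrow> D = (\<Sum>j\<in>UNIV. d $ j * q j z)"
      using P[OF _ z, of i d] by blast
    show ?thesis using D(1) unfolding D(2)[OF q] .
  qed
  have "((\<lambda>t. f i (z + t *s axis j 1) $ k) has_field_derivative fd (f j) i z $ k) (at 0)" for i j
    using der[of i "axis j 1"] by (simp add: axis_def if_distrib[of "\<lambda>a. a * _"] cong: if_cong)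
  then have sym: "fd (f j) i z $ k = fd (f i) j z $ k" for i j
    using line_derivative_eq_frechet[OF diff[OF z]] by blast
  then show "fd (f i) j z $ k = fd (f j) i z $ k" .
  show "((\<lambda>t. f i (z + t *s d) $ k) has_field_derivative (\<Sum>j\<in>UNIV. d $ j * fd (f i) j z $ k)) (at 0)"
    using der[of i d] unfolding sym[of i] .
qed

section \<open>From the hypotheses on the map to its jets\<close>

lemma C_up_extension:
  fixes f :: "complex^'a \<Rightarrow> complex^'b"
  assumes "C_up_to_boundary m (ball 0 1) f"
  shows "\<exists>g. continuous_on (cball 0 1) g \<and> (\<forall>x\<in>ball 0 1. g x = f x)"
  using assms by (cases m) auto

lemma C_up_step:
  fixes f :: "complex^'a \<Rightarrow> complex^'b"
  assumes "C_up_to_boundary (Suc m) (ball 0 1) f"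
  shows "C_up_to_boundary m (ball 0 1) (fd f i)" "f differentiable_on ball 0 1"
proof -
  have "axis i (1::complex) \<in> Basis" by (simp add: axis_in_Basis_iff Basis_complex_def)
  then show "C_up_to_boundary m (ball 0 1) (fd f i)" "f differentiable_on ball 0 1" using assms by auto
qed

lemma holomorphic_map_line:
  fixes F :: "complex^'a \<Rightarrow> complex^'b"
  assumes "holomorphic_map_on F (ball 0 1)" and z: "z \<in> ball 0 1"
  shows "((\<lambda>t. F (z + t *s d) $ k) has_field_derivative (\<Sum>j\<in>UNIV. d $ j * fd F j z $ k)) (at 0)"
proof -
  obtain L where L: "Vector_Spaces.linear (*s) (*s) L" "(F has_derivative L) (at z)"
    using assms(1)[unfolded holomorphic_map_on_def] z at_within_open[OF z open_ball] by metis
  have LF: "frechet_derivative F (at z) = L" using frechet_derivative_at[OF L(2)] by simp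
  have Fd: "(F has_derivative L) (at (z + 0 *s d))" using L(2) by simp
  have Ld: "L d $ k = (\<Sum>j\<in>UNIV. d $ j * fd F j z $ k)" unfolding LF by (subst lin_expand[OF L(1)]) simp
  have bl: "bounded_linear (\<lambda>t. t *s d)"
    by (rule linear_conv_bounded_linear[THEN iffD1], rule linearI) (simp_all add: vec_eq_iff algebra_simps)
  have "((\<lambda>t. z + t *s d) has_derivative (\<lambda>t. t *s d)) (at 0)"
    using has_derivative_add[OF has_derivative_const bounded_linear_imp_has_derivative[OF bl]] by simp
  then have "((\<lambda>t. F (z + t *s d)) has_derivative (\<lambda>t. L (t *s d))) (at 0)" by (rule has_derivative_compose[where f = "\<lambda>t. z + t *s d", OF _ Fd])
  then have "((\<lambda>t. F (z + t *s d) $ k) has_derivative (\<lambda>t. L (t *s d) $ k)) (at 0)"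
    by (rule bounded_linear.has_derivative[OF bounded_linear_vec_nth])
  moreover have "(\<lambda>t. L (t *s d) $ k) = (*) (\<Sum>j\<in>UNIV. d $ j * fd F j z $ k)"
    using L(1) by (simp add: lin_scale fun_eq_iff mult.commute flip: Ld)
  ultimately show ?thesis by (simp add: has_field_derivative_def)
qed

text \<open>If the boundary value had norm below 1, a radial sequence tending to \<open>z\<close>
  would finally lie in the preimage of a compact ball. That preimage is compact in the open ball, so
  it cannot have \<open>z\<close> as a limit.\<close>

lemma proper_boundary:
  fixes F G :: "complex^'a \<Rightarrow> complex^'b"
  assumes F: "proper_map (top_of_set (ball 0 1)) (top_of_set (ball 0 1)) F"
    and G: "continuous_on (cball 0 1) G" "\<And>x. x \<in> ball 0 1 \<Longrightarrow> G x = F x"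
  shows "z \<in> ball 0 1 \<Longrightarrow> norm (G z) < 1" and "norm z = 1 \<Longrightarrow> norm (G z) = 1"
proof -
  show ins: "norm (G z) < 1" if "z \<in> ball 0 1" for z
    using proper_map_imp_subset_topspace[OF F] that G(2) by auto
  assume z: "norm z = 1"
  define x where "x n = (1 - 1 / real (Suc n)) *\<^sub>R z" for n
  have xb: "x n \<in> ball 0 1" for n using z by (simp add: x_def field_simps)
  have "(\<lambda>n. (1 - 1 / real (Suc n)) *\<^sub>R z) \<longlonglongrightarrow> (1 - 0) *\<^sub>R z"
    by (intro tendsto_intros LIMSEQ_Suc lim_1_over_n)
  then have xl: "x \<longlonglongrightarrow> z" by (simp add: x_def[abs_def])
  have Gl: "(\<lambda>n. G (x n)) \<longlonglongrightarrow> G z"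
    by (rule continuous_on_tendsto_compose[OF G(1) xl]) (use z xb in \<open>auto simp: less_imp_le\<close>)
  have "norm (G z) \<le> 1"
    by (rule Lim_norm_ubound[OF _ Gl]) (use ins[OF xb] in \<open>auto simp: less_imp_le\<close>)
  moreover have False if lt: "norm (G z) < 1"
  proof -
    obtain \<rho> where \<rho>: "norm (G z) < \<rho>" "\<rho> < 1" using dense[OF lt] by blast
    have "compactin (top_of_set (ball 0 1)) (cball (0::complex^'b) \<rho>)"
      using \<rho> by (auto simp: compactin_subtopology)
    then have "compactin (top_of_set (ball 0 1)) {x \<in> topspace (top_of_set (ball 0 1)). F x \<in> cball 0 \<rho>}"
      by (rule compactin_proper_map_preimage[OF F])
    then have K: "compact {x \<in> ball 0 1. F x \<in> cball 0 \<rho>}" by (simp add: compactin_subtopology)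
    have "eventually (\<lambda>n. norm (G (x n)) < \<rho>) sequentially"
      using tendsto_norm[OF Gl] \<rho>(1) by (rule order_tendstoD)
    then have "eventually (\<lambda>n. x n \<in> {x \<in> ball 0 1. F x \<in> cball 0 \<rho>}) sequentially"
      by eventually_elim (use xb G(2) in \<open>auto simp: less_imp_le\<close>)
    then have "z \<in> {x \<in> ball 0 1. F x \<in> cball 0 \<rho>}"
      by (rule Lim_in_closed_set[OF compact_imp_closed[OF K] _ _ xl]) simp
    then show False using z by simp
  qed
  ultimately show "norm (G z) = 1" by fastforce
qed

lemma proper_map_jets:
  fixes F :: "complex^'a \<Rightarrow> complex^'b"
  assumes hol: "holomorphic_map_on F (ball 0 1)"
    and pr: "proper_map (top_of_set (ball 0 1)) (top_of_set (ball 0 1)) F"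
    and C: "C_up_to_boundary (Suc (Suc (Suc m))) (ball 0 1) F"
  obtains G0 G1 G2 G3 where "jets G0 G1 G2 G3" "\<And>z. z \<in> ball 0 1 \<Longrightarrow> G0 z = F z"
proof -
  define f1 where "f1 = fd F"
  define f2 where "f2 i = fd (f1 i)" for i
  define f3 where "f3 i j = fd (f2 i j)" for i j
  have C1: "C_up_to_boundary (Suc (Suc m)) (ball 0 1) (f1 i)" for i unfolding f1_def by (rule C_up_step(1)[OF C])
  have C2: "C_up_to_boundary (Suc m) (ball 0 1) (f2 i j)" for i j unfolding f2_def by (rule C_up_step(1)[OF C1])
  have C3: "C_up_to_boundary m (ball 0 1) (f3 i j l)" for i j l unfolding f3_def by (rule C_up_step(1)[OF C2])
  obtain G0 where G0: "continuous_on (cball 0 1) G0" "\<And>z. z \<in> ball 0 1 \<Longrightarrow> G0 z = F z" using C_up_extension[OF C] by metis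
  obtain G1 where G1: "\<And>i. continuous_on (cball 0 1) (G1 i)" "\<And>i z. z \<in> ball 0 1 \<Longrightarrow> G1 i z = f1 i z"
    using C_up_extension[OF C1] by metis
  obtain G2 where G2: "\<And>i j. continuous_on (cball 0 1) (G2 i j)" "\<And>i j z. z \<in> ball 0 1 \<Longrightarrow> G2 i j z = f2 i j z"
    using C_up_extension[OF C2] by metis
  obtain G3 where G3: "\<And>i j l. continuous_on (cball 0 1) (G3 i j l)" "\<And>i j l z. z \<in> ball 0 1 \<Longrightarrow> G3 i j l z = f3 i j l z"
    using C_up_extension[OF C3] by metis
  have L0: "((\<lambda>t. F (z + t *s d) $ k) has_field_derivative (\<Sum>j\<in>UNIV. d $ j * f1 j z $ k)) (at 0)" if "z \<in> ball 0 1" for z d k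
    unfolding f1_def by (rule holomorphic_map_line[OF hol that])
  note S1 = line_derivative_step[OF L0 C_up_step(2)[OF C1]]
  have L1: "((\<lambda>t. f1 i (z + t *s d) $ k) has_field_derivative (\<Sum>j\<in>UNIV. d $ j * f2 i j z $ k)) (at 0)" if "z \<in> ball 0 1" for z d k i
    unfolding f2_def by (rule S1(1)[OF _ that])
  note S2 = line_derivative_step[OF L1 C_up_step(2)[OF C2]]
  have L2: "((\<lambda>t. f2 i j (z + t *s d) $ k) has_field_derivative (\<Sum>l\<in>UNIV. d $ l * f3 i j l z $ k)) (at 0)" if "z \<in> ball 0 1" for z d k i j
    unfolding f3_def by (rule S2(1)[OF _ that])
  have c3: "continuous_on (ball 0 1) (\<lambda>z. f3 i j l z $ k)" for i j l k
  proof -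
    have "continuous_on (ball 0 1) (\<lambda>z. G3 i j l z $ k)"
      by (intro continuous_on_component continuous_on_subset[OF G3(1)]) auto
    then show ?thesis by (rule continuous_on_eq) (simp add: G3(2))
  qed
  have "jets G0 G1 G2 G3"
  proof
    show "lhol (\<lambda>z. G3 i j l z $ k)" for i j l k
    proof (rule lholI)
      fix z d :: "complex^'a" assume z: "z \<in> ball 0 1"
      obtain D where "((\<lambda>t. f3 i j l (z + t *s d) $ k) has_field_derivative D) (at 0)"
        using partial_line_derivative[where h = "\<lambda>z. f2 i j z $ k" and p = "\<lambda>l z. f3 i j l z $ k", OF L2 c3 z] by blast
      then show "\<exists>D. ((\<lambda>t. G3 i j l (z + t *s d) $ k) has_field_derivative D) (at 0)"
        using line_transform[of "\<lambda>z. f3 i j l z $ k" z d D "\<lambda>z. G3 i j l z $ k"] z G3(2) by metis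
    qed
    show "((\<lambda>t. G0 (z + t *s d) $ k) has_field_derivative (\<Sum>i\<in>UNIV. d $ i * G1 i z $ k)) (at 0)" if z: "z \<in> ball 0 1" for z d k
      unfolding G1(2)[OF z] by (rule line_transform[where h = "\<lambda>z. F z $ k", OF L0[OF z] z]) (simp add: G0(2))
    show "((\<lambda>t. G1 i (z + t *s d) $ k) has_field_derivative (\<Sum>j\<in>UNIV. d $ j * G2 i j z $ k)) (at 0)" if z: "z \<in> ball 0 1" for z d k i
      unfolding G2(2)[OF z] by (rule line_transform[where h = "\<lambda>z. f1 i z $ k", OF L1[OF z] z]) (simp add: G1(2))
    show "((\<lambda>t. G2 i j (z + t *s d) $ k) has_field_derivative (\<Sum>l\<in>UNIV. d $ l * G3 i j l z $ k)) (at 0)" if z: "z \<in> ball 0 1" for z d k i j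
      unfolding G3(2)[OF z] by (rule line_transform[where h = "\<lambda>z. f2 i j z $ k", OF L2[OF z] z]) (simp add: G2(2))
    show "G2 i j z = G2 j i z" if z: "z \<in> ball 0 1" for z i j
      using S1(2)[OF _ z] by (simp add: G2(2)[OF z] f2_def vec_eq_iff)
    show "G3 i j l z = G3 i l j z" if z: "z \<in> ball 0 1" for z i j l
      using S2(2)[OF _ z] by (simp add: G3(2)[OF z] f3_def vec_eq_iff)
    show "norm (G0 z) < 1" if "z \<in> ball 0 1" for z by (rule proper_boundary(1)[OF pr G0 that])
    show "norm (G0 z) = 1" if "norm z = 1" for z by (rule proper_boundary(2)[OF pr G0 that])
  qed (rule G0(1) G1(1) G2(1) G3(1))+
  then show thesis using that G0(2) by blast
qed

theorem corollary5p1: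
  fixes F :: "complex ^ ('n::finite option) \<Rightarrow> complex ^ ('n option + 'n)"
  assumes "CARD('n) \<ge> 2"
    and "holomorphic_map_on F (ball 0 1)"
    and "proper_map (top_of_set (ball 0 1)) (top_of_set (ball 0 1)) F"
    and "C_up_to_boundary (CARD('n) + 1) (ball 0 1) F"
    and "\<not> linear_ball_map F"
  shows "ball_equivalent F whitney_map"
proof -
  \<comment> \<open>Since \<open>n\<close> is at least 2, three derivatives are available up to the
    boundary.\<close>
  have "CARD('n) + 1 = Suc (Suc (Suc (CARD('n) - 2)))" using assms(1) by simp
  then obtain G0 G1 G2 G3 where J: "jets G0 G1 G2 G3" and eq: "\<And>z. z \<in> ball 0 1 \<Longrightarrow> G0 z = F z"
    using proper_map_jets[OF assms(2,3)] assms(4) by metis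
  interpret jets G0 G1 G2 G3 by (rule J)
  have "rank_le_two (kern G0)" by (rule kernel_rank) (use assms(1) in simp_all)
  then have "linear_ball_map G0 \<or> ball_equivalent G0 whitney_map"
    by (rule linear_or_whitney[rotated 2]) (auto intro: inside continuous_on_subset[OF c0])
  then show ?thesis using assms(5) eq by (simp only: linear_ball_map_def ball_equivalent_def cong: ball_cong) blast
qed

end
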